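(* Let $n=2m+1$ be odd ($m\ge1$). Let $\beta_0\in O_K^\times$ satisfy $O_K=O[\beta_0]$ and $\beta_0^{\iota}=-\beta_0$, and let $\beta\in\mathfrak g(O)\subset\mathrm{End}_O(O_K\times O)$ be the element $(x,s)\mapsto(x\beta_0,0)$. Put $U_{K/F}=\{\gamma\in O_K^\times:\gamma\gamma^{\iota}\in O^\times\}$ and $$U_{K/F}\times_{\mathfrak p^r}O^\times=\{(\gamma,a)\in U_{K/F}\times O^\times:\gamma\gamma^\iota\equiv a^2\pmod{\mathfrak p^r}\}.$$ Then $\theta\mapsto\mathrm{Ind}_{G(O_r,\beta)}^{G(O_r)}\sigma_{\beta,\theta}$ is a bijection of the set of group homomorphisms $\theta:U_{K/F}\times_{\mathfrak p^r}O^\times\to\mathbb C^\times$ which factor through the image of $U_{K/F}\times_{\mathfrak p^r}O^\times$ in $(O_K/\mathfrak p_K^r)^\times\times O_r^\times$ and satisfy $$\theta(\gamma,a)=\tau(\varpi^{-l'}T_{K/F}(\beta_0x))\quad\text{for all }(\gamma,a)=(1+\varpi^lx,1+\varpi^ly)\in U_{K/F}\times_{\mathfrak p^r}O^\times\ (x\in O_K,\ y\in O)$$ onto $\mathrm{Irr}(G(O_r)\mid\psi_\beta)$, where $G=GO(S_{\varepsilon,\eta})$.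
   Context: Let $F$ be a non-archimedean local field with integer ring $O$, maximal ideal $\mathfrak p=\varpi O$ and finite residue field $\mathbb F=O/\mathfrak p$ of odd characteristic not dividing $n=2m+1$; $O_j=O/\mathfrak p^j$. Fix a continuous unitary character $\tau$ of the additive group $F$ with $\{x\in F:\tau(xO)=1\}=O$. For a finite abelian group $A$, $A^\wedge$ is its group of complex characters. A bar denotes reduction modulo $\mathfrak p$. $K/F$ is the unramified extension of degree $2m$, with integer ring $O_K$ and maximal ideal $\mathfrak p_K=\varpi O_K$; $\iota\in\mathrm{Gal}(K/F)$ is the unique element of order 2, and $T_{K/F}$ is the trace. Fix $\varepsilon\in O_K^\times$ with $\varepsilon^\iota=\varepsilon$ and $\eta\in O^\times$, and let $S_{\varepsilon,\eta}((x,s),(y,t))=T_{K/F}(\varepsilon xy^\iota)+\eta st$ on $K\times F$. $G=GO(S_{\varepsilon,\eta})$ is the $O$-group scheme with $G(L)=\{g\in GL_L((O_K\times O)\otimes_OL): S_{\varepsilon,\eta}(ug,vg)=\nu(g)S_{\varepsilon,\eta}(u,v)\ \forall u,v,\ \text{with }\nu(g)\in L^\times\}$ and its Lie algebra $\mathfrak g=\mathfrak{go}(S_{\varepsilon,\eta})$ is $\mathfrak g(L)=\{X\in\mathrm{End}_L((O_K\times O)\otimes_OL): S_{\varepsilon,\eta}(uX,v)+S_{\varepsilon,\eta}(u,vX)=\nu(X)S_{\varepsilon,\eta}(u,v)\ \forall u,v,\ \text{with }\nu(X)\in L\}$ for commutative $O$-algebras $L$ (endomorphisms act from the right). $B(X,Y)=\mathrm{tr}(XY)$,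 $K_j(O_r)=\ker(G(O_r)\to G(O_j))$ for $0<j<r$. Fix $r\ge2$ and write $r=l+l'$ with $l'=l$ if $r=2l$, $l'=l-1$ if $r=2l-1$. $\psi_\beta$ is the character of the abelian group $K_l(O_r)$ with $\psi_\beta(1+\varpi^lX\bmod\mathfrak p^r)=\tau(\varpi^{-l'}B(X,\beta))$, $X\in\mathfrak g(O)$; its stabilizer in $G(O_r)$ is $G(O_r,\beta)=\{g\bmod\mathfrak p^r:\mathrm{Ad}(g)\beta\equiv\beta\pmod{\mathfrak p^{l'}}\}$. $\mathrm{Irr}(G(O_r)\mid\psi_\beta)$ is the set of isomorphism classes of irreducible complex representations of $G(O_r)$ whose restriction to $K_l(O_r)$ contains $\psi_\beta$. $G_\beta$, $\mathfrak g_\beta$ are the centralizers of $\beta$ in $G$, $\mathfrak g$. Here $G_\beta(O_r)$ consists of the block-diagonal elements $\mathrm{diag}(\gamma\bmod\mathfrak p_K^r,\ a\bmod\mathfrak p^r)$ with $(\gamma,a)\in U_{K/F}\times_{\mathfrak p^r}O^\times$, so $\theta$ is regarded as a character of $G_\beta(O_r)$. Definition of $\sigma_{\beta,\theta}$, an irreducible representation of $G(O_r,\beta)=G_\beta(O_r)\cdot K_{l'}(O_r)$. If $r=2l$: $\sigma_{\beta,\theta}(gh)=\theta(g)\psi_\beta(h)$ for $g\in G_\beta(O_r)$, $h\in K_l(O_r)$. If $r=2l-1\ge3$: let $Z(O_r,\beta)\subset K_{l-1}(O_r)$ be the subgroup of the elements $1+\varpi^{l-1}X\bmod\mathfrak p^r$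 with $\overline X\in\mathfrak g_\beta(\mathbb F)$. For $\rho\in\mathfrak g_\beta(\mathbb F)^\wedge$ let $\psi_{\beta,\rho}$ be the character $1+\varpi^{l-1}X\mapsto\tau(\varpi^{-l}B(X,\beta)-(2\varpi)^{-1}B(X^2,\beta))\rho(\overline X)$ of $Z(O_r,\beta)$, and $\pi_{\beta,\rho}$ (on $V_{\beta,\rho}$) the unique irreducible representation of $K_{l-1}(O_r)$ whose restriction to $Z(O_r,\beta)$ contains $\psi_{\beta,\rho}$. Fix for each $\rho$ a group homomorphism $U_{\beta,\rho}:G_\beta(O_r)\to GL_{\mathbb C}(V_{\beta,\rho})$ (which exists here) such that $\pi_{\beta,\rho}(g^{-1}xg)=U_{\beta,\rho}(g)^{-1}\pi_{\beta,\rho}(x)U_{\beta,\rho}(g)$ for $g\in G_\beta(O_r)$, $x\in K_{l-1}(O_r)$, and $U_{\beta,\rho}=1$ on $G_\beta(O_r)\cap K_{l-1}(O_r)$. For $\theta\in G_\beta(O_r)^\wedge$ with $\theta=\psi_\beta$ on $G_\beta(O_r)\cap K_l(O_r)$ there is a unique $\rho$ with $\theta=\psi_{\beta,\rho}$ on $G_\beta(O_r)\cap K_{l-1}(O_r)$, and $\sigma_{\beta,\theta}(gh)=\theta(g)U_{\beta,\rho}(g)\pi_{\beta,\rho}(h)$ for $g\in G_\beta(O_r)$, $h\in K_{l-1}(O_r)$. *)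

theory Defs
  imports "HOL-Algebra.QuotRing" "Jordan_Normal_Form.VS_Connect"
begin

section \<open>Discretely valued fields\<close>

text \<open>A valuation is a function to the integers; its value at 0 is irrelevant (0 has valuation
  infinity), hence the explicit cases for 0 below.\<close>

locale discrete_valuation =
  fixes v :: "'a::field \<Rightarrow> int"
  assumes val_mult: "x \<noteq> 0 \<Longrightarrow> y \<noteq> 0 \<Longrightarrow> v (x * y) = v x + v y"
    and val_add: "x \<noteq> 0 \<Longrightarrow> y \<noteq> 0 \<Longrightarrow> x + y \<noteq> 0 \<Longrightarrow> min (v x) (v y) \<le> v (x + y)"
    and val_normalised: "\<exists>x. x \<noteq> 0 \<and> v x = 1"

definition val_ring :: "('a::field \<Rightarrow> int) \<Rightarrow> 'a ring" where
  "val_ring v = \<lparr>carrier = {x. x = 0 \<or> 0 \<le> v x}, mult = (*), one = 1, zero = 0, add = (+)\<rparr>"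

definition val_ideal :: "('a::field \<Rightarrow> int) \<Rightarrow> nat \<Rightarrow> 'a set" where
  "val_ideal v j = {x. x = 0 \<or> int j \<le> v x}"

definition res_ring :: "('a::field \<Rightarrow> int) \<Rightarrow> nat \<Rightarrow> 'a set ring" where
  "res_ring v j = val_ring v Quot val_ideal v j"

text \<open>A non-archimedean local field is a field that is complete for a discrete valuation with
  finite residue field.\<close>

locale nonarch_local_field = discrete_valuation v for v :: "'a::field \<Rightarrow> int" +
  assumes complete:
      "(\<And>j. \<exists>N. \<forall>a\<ge>N. \<forall>b\<ge>N. X a - X b \<in> val_ideal v j) \<Longrightarrow>
        \<exists>x. \<forall>j. \<exists>N. \<forall>a\<ge>N. (X :: nat \<Rightarrow> 'a) a - x \<in> val_ideal v j"
    and finite_residue: "finite (carrier (res_ring v 1))"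

definition residue_char :: "('a::field \<Rightarrow> int) \<Rightarrow> nat" where
  "residue_char v = (LEAST p. 0 < p \<and> of_nat p \<in> val_ideal v 1)"

text \<open>Continuity is with respect to the valuation topology.\<close>

definition unitary_char :: "('a::field \<Rightarrow> int) \<Rightarrow> ('a \<Rightarrow> complex) \<Rightarrow> bool" where
  "unitary_char v \<tau> \<longleftrightarrow>
     (\<forall>x y. \<tau> (x + y) = \<tau> x * \<tau> y) \<and> (\<forall>x. cmod (\<tau> x) = 1) \<and>
     (\<forall>x. \<forall>e>0. \<exists>j. \<forall>y. y - x \<in> val_ideal v j \<longrightarrow> cmod (\<tau> y - \<tau> x) < e)"


section \<open>Free modules, traces, similitudes\<close>

definition module_basis ::
  "('a, 'c) ring_scheme \<Rightarrow> ('a, 'b, 'd) module_scheme \<Rightarrow> nat \<Rightarrow> (nat \<Rightarrow> 'b) \<Rightarrow> bool" where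
  "module_basis L N n b \<longleftrightarrow>
     b \<in> {..<n} \<rightarrow> carrier N \<and>
     (\<forall>u \<in> carrier N. \<exists>!c. c \<in> {..<n} \<rightarrow>\<^sub>E carrier L \<and>
        u = (\<Oplus>\<^bsub>N\<^esub>i\<in>{..<n}. c i \<odot>\<^bsub>N\<^esub> b i))"

text \<open>The trace of an endomorphism of a finite free module; it does not depend on the basis.\<close>

definition module_trace ::
  "('a, 'c) ring_scheme \<Rightarrow> ('a, 'b, 'd) module_scheme \<Rightarrow> ('b \<Rightarrow> 'b) \<Rightarrow> 'a" where
  "module_trace L N f = (THE t. \<exists>n b C.
     module_basis L N n b \<and>
     (\<forall>i<n. \<forall>j<n. C i j \<in> carrier L) \<and>
     (\<forall>j<n. f (b j) = (\<Oplus>\<^bsub>N\<^esub>i\<in>{..<n}. C i j \<odot>\<^bsub>N\<^esub> b i)) \<and>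
     t = (\<Oplus>\<^bsub>L\<^esub>i\<in>{..<n}. C i i))"

definition module_end ::
  "('a, 'c) ring_scheme \<Rightarrow> ('a, 'b, 'd) module_scheme \<Rightarrow> ('b \<Rightarrow> 'b) set" where
  "module_end L N = LinearCombinations.module_hom L N N \<inter> extensional (carrier N)"

text \<open>Endomorphisms act from the right, so the product X Y means: first X, then Y.\<close>

definition rcomp :: "('a, 'b, 'd) module_scheme \<Rightarrow> ('b \<Rightarrow> 'b) \<Rightarrow> ('b \<Rightarrow> 'b) \<Rightarrow> 'b \<Rightarrow> 'b" where
  "rcomp N X Y = compose (carrier N) Y X"

definition similitude_group ::
  "('a, 'c) ring_scheme \<Rightarrow> ('a, 'b, 'd) module_scheme \<Rightarrow> ('b \<Rightarrow> 'b \<Rightarrow> 'a) \<Rightarrow> ('b \<Rightarrow> 'b) monoid" where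
  "similitude_group L N S =
     \<lparr>carrier = {g \<in> module_end L N. bij_betw g (carrier N) (carrier N) \<and>
        (\<exists>\<nu> \<in> Units L. \<forall>u \<in> carrier N. \<forall>w \<in> carrier N. S (g u) (g w) = \<nu> \<otimes>\<^bsub>L\<^esub> S u w)},
      mult = rcomp N, one = (\<lambda>u \<in> carrier N. u)\<rparr>"

definition similitude_lie ::
  "('a, 'c) ring_scheme \<Rightarrow> ('a, 'b, 'd) module_scheme \<Rightarrow> ('b \<Rightarrow> 'b \<Rightarrow> 'a) \<Rightarrow> ('b \<Rightarrow> 'b) set" where
  "similitude_lie L N S =
     {X \<in> module_end L N. \<exists>\<nu> \<in> carrier L. \<forall>u \<in> carrier N. \<forall>w \<in> carrier N.
        S (X u) w \<oplus>\<^bsub>L\<^esub> S u (X w) = \<nu> \<otimes>\<^bsub>L\<^esub> S u w}"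


section \<open>Unramified extensions\<close>

definition ext_module :: "('f::field \<Rightarrow> 'k::field) \<Rightarrow> ('f, 'k) module" where
  "ext_module e = \<lparr>carrier = UNIV, mult = undefined, one = undefined, zero = 0, add = (+),
     smult = (\<lambda>a x. e a * x)\<rparr>"

definition field_ext_of_degree :: "('f::field \<Rightarrow> 'k::field) \<Rightarrow> nat \<Rightarrow> bool" where
  "field_ext_of_degree e d \<longleftrightarrow>
     e 1 = 1 \<and> (\<forall>a b. e (a + b) = e a + e b) \<and> (\<forall>a b. e (a * b) = e a * e b) \<and>
     (\<exists>b. module_basis class_ring (ext_module e) d b)"

text \<open>Unramified means ramification index 1 (residue fields of local fields are perfect): the
  normalised valuation of the extension field restricts to the normalised valuation of the
  base field.\<close>

definition unramified_ext ::
  "('f::field \<Rightarrow> int) \<Rightarrow> ('k::field \<Rightarrow> int) \<Rightarrow> ('f \<Rightarrow> 'k) \<Rightarrow> nat \<Rightarrow> bool" where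
  "unramified_ext v w e d \<longleftrightarrow>
     field_ext_of_degree e d \<and> discrete_valuation w \<and> (\<forall>x. x \<noteq> 0 \<longrightarrow> w (e x) = v x)"

definition ext_trace :: "('f::field \<Rightarrow> 'k::field) \<Rightarrow> 'k \<Rightarrow> 'f" where
  "ext_trace e x = module_trace class_ring (ext_module e) (\<lambda>y. x * y)"

definition galois_set :: "('f::field \<Rightarrow> 'k::field) \<Rightarrow> ('k \<Rightarrow> 'k) set" where
  "galois_set e = {s. bij s \<and> (\<forall>x y. s (x + y) = s x + s y) \<and> (\<forall>x y. s (x * y) = s x * s y) \<and>
     (\<forall>a. s (e a) = e a)}"


section \<open>Complex representations of finite groups\<close>

text \<open>A representation of degree \<open>d\<close> is a homomorphism to the group of invertible complex
  \<open>d \<times> d\<close> matrices; only its values on the carrier of the group matter.\<close>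

abbreviation GL :: "nat \<Rightarrow> complex mat monoid" where
  "GL d \<equiv> units_of (ring_mat TYPE(complex) d ())"

definition char_set :: "('g, 'c) monoid_scheme \<Rightarrow> ('g \<Rightarrow> complex) set" where
  "char_set A = hom A (units_of (class_ring :: complex ring)) \<inter> extensional (carrier A)"

definition irreducible_rep ::
  "('g, 'c) monoid_scheme \<Rightarrow> nat \<Rightarrow> ('g \<Rightarrow> complex mat) \<Rightarrow> bool" where
  "irreducible_rep G d R \<longleftrightarrow> R \<in> hom G (GL d) \<and> 0 < d \<and>
     (\<forall>W. VectorSpace.subspace class_ring W (module_vec TYPE(complex) d) \<longrightarrow>
        (\<forall>g \<in> carrier G. \<forall>x \<in> W. R g *\<^sub>v x \<in> W) \<longrightarrow> W = {0\<^sub>v d} \<or> W = carrier_vec d)"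

definition contains_char ::
  "'g set \<Rightarrow> nat \<Rightarrow> ('g \<Rightarrow> complex mat) \<Rightarrow> ('g \<Rightarrow> complex) \<Rightarrow> bool" where
  "contains_char H d R \<chi> \<longleftrightarrow>
     (\<exists>x \<in> carrier_vec d. x \<noteq> 0\<^sub>v d \<and> (\<forall>h \<in> H. R h *\<^sub>v x = \<chi> h \<cdot>\<^sub>v x))"

definition rep_iso ::
  "('g, 'c) monoid_scheme \<Rightarrow> ((nat \<times> ('g \<Rightarrow> complex mat)) \<times> (nat \<times> ('g \<Rightarrow> complex mat))) set" where
  "rep_iso G = {((d, R), (d', R')). R \<in> hom G (GL d) \<and> R' \<in> hom G (GL d') \<and> d = d' \<and>
     (\<exists>P \<in> carrier (GL d). \<forall>g \<in> carrier G. P * R g = R' g * P)}"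

definition Irr_over ::
  "('g, 'c) monoid_scheme \<Rightarrow> 'g set \<Rightarrow> ('g \<Rightarrow> complex) \<Rightarrow> (nat \<times> ('g \<Rightarrow> complex mat)) set set" where
  "Irr_over G H \<chi> = {(d, R). irreducible_rep G d R \<and> contains_char H d R \<chi>} // rep_iso G"

definition induced_space ::
  "('g, 'c) monoid_scheme \<Rightarrow> 'g set \<Rightarrow> nat \<Rightarrow> ('g \<Rightarrow> complex mat) \<Rightarrow> ('g \<Rightarrow> complex vec) set" where
  "induced_space G H d \<sigma> = {f \<in> carrier G \<rightarrow>\<^sub>E carrier_vec d.
     \<forall>h \<in> H. \<forall>x \<in> carrier G. f (h \<otimes>\<^bsub>G\<^esub> x) = \<sigma> h *\<^sub>v f x}"

text \<open>The isomorphism class of the induced representation: all matrix representations isomorphic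
  to the induced space with the group acting by right translation.\<close>

definition induced_class ::
  "('g, 'c) monoid_scheme \<Rightarrow> 'g set \<Rightarrow> nat \<Rightarrow> ('g \<Rightarrow> complex mat) \<Rightarrow>
    (nat \<times> ('g \<Rightarrow> complex mat)) set" where
  "induced_class G H d \<sigma> = {(D, R). R \<in> hom G (GL D) \<and>
     (\<exists>T. bij_betw T (carrier_vec D) (induced_space G H d \<sigma>) \<and>
       (\<forall>x \<in> carrier_vec D. \<forall>y \<in> carrier_vec D. T (x + y) = (\<lambda>z \<in> carrier G. T x z + T y z)) \<and>
       (\<forall>c. \<forall>x \<in> carrier_vec D. T (c \<cdot>\<^sub>v x) = (\<lambda>z \<in> carrier G. c \<cdot>\<^sub>v T x z)) \<and>
       (\<forall>g \<in> carrier G. \<forall>x \<in> carrier_vec D.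
          T (R g *\<^sub>v x) = (\<lambda>z \<in> carrier G. T x (z \<otimes>\<^bsub>G\<^esub> g))))}"


section \<open>The group GO and its reductions\<close>

text \<open>The base field \<open>F\<close> is the type \<open>'f\<close>, the extension \<open>K\<close> is the type \<open>'k\<close>, and \<open>F\<close> is
  regarded as a subfield of \<open>K\<close> via \<open>emb\<close>.  The record only packages the parameters; all
  conditions on them are hypotheses of the theorem.\<close>

record ('f, 'k) go_data =
  vF :: "'f \<Rightarrow> int"
  vK :: "'k \<Rightarrow> int"
  emb :: "'f \<Rightarrow> 'k"
  iot :: "'k \<Rightarrow> 'k"
  eps :: 'k
  eta :: 'f
  varpi :: 'f
  tau :: "'f \<Rightarrow> complex"
  beta0 :: 'k

type_synonym ('f, 'k) lat_map = "('k \<times> 'f) \<Rightarrow> ('k \<times> 'f)"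
type_synonym ('f, 'k) res_map = "('k \<times> 'f) set \<Rightarrow> ('k \<times> 'f) set"

abbreviation O_F :: "('f::field, 'k::field) go_data \<Rightarrow> 'f ring" where
  "O_F D \<equiv> val_ring (vF D)"

abbreviation O_K :: "('f::field, 'k::field) go_data \<Rightarrow> 'k ring" where
  "O_K D \<equiv> val_ring (vK D)"

abbreviation TrK :: "('f::field, 'k::field) go_data \<Rightarrow> 'k \<Rightarrow> 'f" where
  "TrK D \<equiv> ext_trace (emb D)"

definition lattice :: "('f::field, 'k::field) go_data \<Rightarrow> ('f, 'k \<times> 'f) module" where
  "lattice D = \<lparr>carrier = carrier (O_K D) \<times> carrier (O_F D), mult = undefined, one = undefined,
     zero = (0, 0), add = (\<lambda>(x, s) (y, t). (x + y, s + t)),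
     smult = (\<lambda>a (x, s). (emb D a * x, a * s))\<rparr>"

fun form :: "('f::field, 'k::field) go_data \<Rightarrow> 'k \<times> 'f \<Rightarrow> 'k \<times> 'f \<Rightarrow> 'f" where
  "form D (x, s) (y, t) = TrK D (eps D * x * iot D y) + eta D * s * t"

text \<open>For \<open>L = O / \<pp>\<^sup>j\<close> and \<open>M = O\<^sub>K \<times> O\<close>, the module \<open>M \<otimes> L\<close> is realised as
  \<open>M / \<pp>\<^sup>j M\<close>, with \<open>\<pp>\<^sup>j M = \<pp>\<^sub>K\<^sup>j \<times> \<pp>\<^sup>j\<close>; operations on cosets follow the pattern of
  \<open>rcoset_mult\<close>.\<close>

definition sublattice :: "('f::field, 'k::field) go_data \<Rightarrow> nat \<Rightarrow> ('k \<times> 'f) set" where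
  "sublattice D j = val_ideal (vK D) j \<times> val_ideal (vF D) j"

definition res_lattice ::
  "('f::field, 'k::field) go_data \<Rightarrow> nat \<Rightarrow> ('f set, ('k \<times> 'f) set) module" where
  "res_lattice D j = \<lparr>carrier = a_rcosets\<^bsub>lattice D\<^esub> (sublattice D j),
     mult = undefined, one = undefined, zero = sublattice D j, add = set_add (lattice D),
     smult = (\<lambda>A C. \<Union>a\<in>A. \<Union>u\<in>C. sublattice D j +>\<^bsub>lattice D\<^esub> (a \<odot>\<^bsub>lattice D\<^esub> u))\<rparr>"

definition res_form ::
  "('f::field, 'k::field) go_data \<Rightarrow> nat \<Rightarrow> ('k \<times> 'f) set \<Rightarrow> ('k \<times> 'f) set \<Rightarrow> 'f set" where
  "res_form D j A B = (\<Union>u\<in>A. \<Union>w\<in>B. val_ideal (vF D) j +>\<^bsub>O_F D\<^esub> form D u w)"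

definition GO :: "('f::field, 'k::field) go_data \<Rightarrow> nat \<Rightarrow> ('f, 'k) res_map monoid" where
  "GO D j = similitude_group (res_ring (vF D) j) (res_lattice D j) (res_form D j)"

definition go_int :: "('f::field, 'k::field) go_data \<Rightarrow> ('f, 'k) lat_map set" where
  "go_int D = similitude_lie (O_F D) (lattice D) (form D)"

definition go_res :: "('f::field, 'k::field) go_data \<Rightarrow> nat \<Rightarrow> ('f, 'k) res_map set" where
  "go_res D j = similitude_lie (res_ring (vF D) j) (res_lattice D j) (res_form D j)"

text \<open>\<open>red_int D j\<close> is reduction of endomorphisms from \<open>O\<close> to \<open>O\<^sub>j\<close>, and \<open>red D r j\<close> is
  reduction from \<open>O\<^sub>r\<close> to \<open>O\<^sub>j\<close> for \<open>j \<le> r\<close>.  The unions are over representatives, all of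
  which give the same coset.\<close>

definition red_int ::
  "('f::field, 'k::field) go_data \<Rightarrow> nat \<Rightarrow> ('f, 'k) lat_map \<Rightarrow> ('f, 'k) res_map" where
  "red_int D j X = (\<lambda>C \<in> carrier (res_lattice D j). \<Union>u\<in>C. sublattice D j +>\<^bsub>lattice D\<^esub> X u)"

definition red ::
  "('f::field, 'k::field) go_data \<Rightarrow> nat \<Rightarrow> nat \<Rightarrow> ('f, 'k) res_map \<Rightarrow> ('f, 'k) res_map" where
  "red D r j g = (\<lambda>C \<in> carrier (res_lattice D j).
     \<Union>E\<in>{E \<in> carrier (res_lattice D r). E \<subseteq> C}. sublattice D j <+>\<^bsub>lattice D\<^esub> g E)"

definition congr_subgroup ::
  "('f::field, 'k::field) go_data \<Rightarrow> nat \<Rightarrow> nat \<Rightarrow> ('f, 'k) res_map set" where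
  "congr_subgroup D r j = {g \<in> carrier (GO D r). red D r j g = \<one>\<^bsub>GO D j\<^esub>}"

definition one_plus ::
  "('f::field, 'k::field) go_data \<Rightarrow> nat \<Rightarrow> ('f, 'k) lat_map \<Rightarrow> ('f, 'k) lat_map" where
  "one_plus D j X =
     (\<lambda>u \<in> carrier (lattice D). u \<oplus>\<^bsub>lattice D\<^esub> (varpi D ^ j \<odot>\<^bsub>lattice D\<^esub> X u))"

definition trace_form ::
  "('f::field, 'k::field) go_data \<Rightarrow> ('f, 'k) lat_map \<Rightarrow> ('f, 'k) lat_map \<Rightarrow> 'f" where
  "trace_form D X Y = module_trace (O_F D) (lattice D) (rcomp (lattice D) X Y)"


section \<open>The element beta and its centralizers\<close>

definition diag :: "('f::field, 'k::field) go_data \<Rightarrow> 'k \<Rightarrow> 'f \<Rightarrow> ('f, 'k) lat_map" where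
  "diag D \<gamma> a = (\<lambda>(x, s) \<in> carrier (lattice D). (x * \<gamma>, s * a))"

definition beta :: "('f::field, 'k::field) go_data \<Rightarrow> ('f, 'k) lat_map" where
  "beta D = (\<lambda>(x, s) \<in> carrier (lattice D). (x * beta0 D, 0))"

text \<open>Where the mathematics says that a value is determined by any choice of representative or
  factorization, the value is written with a definite description.\<close>

definition psi_beta ::
  "('f::field, 'k::field) go_data \<Rightarrow> nat \<Rightarrow> nat \<Rightarrow> nat \<Rightarrow> ('f, 'k) res_map \<Rightarrow> complex" where
  "psi_beta D r l l' k = (THE z. \<exists>X \<in> go_int D. k = red_int D r (one_plus D l X) \<and>
     z = tau D (trace_form D X (beta D) / varpi D ^ l'))"

definition stabilizer_beta ::
  "('f::field, 'k::field) go_data \<Rightarrow> nat \<Rightarrow> nat \<Rightarrow> ('f, 'k) res_map set" where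
  "stabilizer_beta D r l' = {g \<in> carrier (GO D r).
     red D r l' (rcomp (res_lattice D r) (rcomp (res_lattice D r) g (red_int D r (beta D)))
       (inv\<^bsub>GO D r\<^esub> g)) = red_int D l' (beta D)}"

definition G_beta :: "('f::field, 'k::field) go_data \<Rightarrow> nat \<Rightarrow> ('f, 'k) res_map set" where
  "G_beta D r = {g \<in> carrier (GO D r).
     rcomp (res_lattice D r) g (red_int D r (beta D)) =
     rcomp (res_lattice D r) (red_int D r (beta D)) g}"

definition lie_beta_res :: "('f::field, 'k::field) go_data \<Rightarrow> ('f, 'k) res_map set" where
  "lie_beta_res D = {Y \<in> go_res D 1.
     rcomp (res_lattice D 1) Y (red_int D 1 (beta D)) =
     rcomp (res_lattice D 1) (red_int D 1 (beta D)) Y}"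

definition lie_beta_add :: "('f::field, 'k::field) go_data \<Rightarrow> ('f, 'k) res_map monoid" where
  "lie_beta_add D = \<lparr>carrier = lie_beta_res D,
     mult = (\<lambda>X Y. \<lambda>u \<in> carrier (res_lattice D 1). X u \<oplus>\<^bsub>res_lattice D 1\<^esub> Y u),
     one = (\<lambda>u \<in> carrier (res_lattice D 1). \<zero>\<^bsub>res_lattice D 1\<^esub>)\<rparr>"


section \<open>The characters theta\<close>

definition U_KF :: "('f::field, 'k::field) go_data \<Rightarrow> 'k set" where
  "U_KF D = {\<gamma> \<in> Units (O_K D). \<gamma> * iot D \<gamma> \<in> emb D ` Units (O_F D)}"

definition U_fiber :: "('f::field, 'k::field) go_data \<Rightarrow> nat \<Rightarrow> ('k \<times> 'f) monoid" where
  "U_fiber D r = \<lparr>carrier = {(\<gamma>, a). \<gamma> \<in> U_KF D \<and> a \<in> Units (O_F D) \<and>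
        \<gamma> * iot D \<gamma> - emb D (a ^ 2) \<in> emb D ` val_ideal (vF D) r},
     mult = (\<lambda>(\<gamma>, a) (\<delta>, b). (\<gamma> * \<delta>, a * b)), one = (1, 1)\<rparr>"

definition theta_set ::
  "('f::field, 'k::field) go_data \<Rightarrow> nat \<Rightarrow> nat \<Rightarrow> nat \<Rightarrow> ('k \<times> 'f \<Rightarrow> complex) set" where
  "theta_set D r l l' = {\<theta> \<in> char_set (U_fiber D r).
     (\<forall>\<gamma> a \<delta> b. (\<gamma>, a) \<in> carrier (U_fiber D r) \<longrightarrow> (\<delta>, b) \<in> carrier (U_fiber D r) \<longrightarrow>
        \<gamma> - \<delta> \<in> val_ideal (vK D) r \<longrightarrow> a - b \<in> val_ideal (vF D) r \<longrightarrow> \<theta> (\<gamma>, a) = \<theta> (\<delta>, b)) \<and>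
     (\<forall>x \<in> carrier (O_K D). \<forall>y \<in> carrier (O_F D).
        (1 + emb D (varpi D) ^ l * x, 1 + varpi D ^ l * y) \<in> carrier (U_fiber D r) \<longrightarrow>
        \<theta> (1 + emb D (varpi D) ^ l * x, 1 + varpi D ^ l * y) =
          tau D (TrK D (beta0 D * x) / varpi D ^ l'))}"

text \<open>\<open>\<theta>\<close> as a character of the centralizer \<open>G_beta D r\<close>, whose elements are the block-diagonal
  \<open>diag(\<gamma> mod \<pp>\<^sub>K\<^sup>r, a mod \<pp>\<^sup>r)\<close>.\<close>

definition theta_on_G_beta ::
  "('f::field, 'k::field) go_data \<Rightarrow> nat \<Rightarrow> ('k \<times> 'f \<Rightarrow> complex) \<Rightarrow> ('f, 'k) res_map \<Rightarrow> complex" where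
  "theta_on_G_beta D r \<theta> g = (THE z. \<exists>(\<gamma>, a) \<in> carrier (U_fiber D r).
     g = red_int D r (diag D \<gamma> a) \<and> z = \<theta> (\<gamma>, a))"


section \<open>The representations sigma\<close>

text \<open>For \<open>r = 2 l - 1\<close> and \<open>1 + \<varpi>\<^bsup>l-1\<^esup> X mod \<pp>\<^sup>r\<close> in \<open>K\<^bsub>l-1\<^esub>(O\<^sub>r)\<close>, the endomorphism \<open>X\<close> need
  not lie in the Lie algebra (only its reduction modulo \<open>\<pp>\<^bsup>l-1\<^esup>\<close> does), so \<open>X\<close> ranges over all
  endomorphisms.  The quadratic term of \<open>psi_beta_rho\<close> accounts for this.\<close>

definition Z_beta ::
  "('f::field, 'k::field) go_data \<Rightarrow> nat \<Rightarrow> nat \<Rightarrow> ('f, 'k) res_map set" where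
  "Z_beta D r l = {k \<in> congr_subgroup D r (l - 1). \<exists>X \<in> module_end (O_F D) (lattice D).
     k = red_int D r (one_plus D (l - 1) X) \<and> red_int D 1 X \<in> lie_beta_res D}"

definition psi_beta_rho ::
  "('f::field, 'k::field) go_data \<Rightarrow> nat \<Rightarrow> nat \<Rightarrow> (('f, 'k) res_map \<Rightarrow> complex) \<Rightarrow>
    ('f, 'k) res_map \<Rightarrow> complex" where
  "psi_beta_rho D r l \<rho> k = (THE z. \<exists>X \<in> module_end (O_F D) (lattice D).
     k = red_int D r (one_plus D (l - 1) X) \<and> red_int D 1 X \<in> lie_beta_res D \<and>
     z = tau D (trace_form D X (beta D) / varpi D ^ l
           - trace_form D (rcomp (lattice D) X X) (beta D) / (2 * varpi D)) * \<rho> (red_int D 1 X))"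

text \<open>A choice, for each \<open>\<rho>\<close>, of the irreducible representation \<open>\<pi>\<^bsub>\<beta>,\<rho>\<^esub>\<close> of \<open>K\<^bsub>l-1\<^esub>(O\<^sub>r)\<close> over
  \<open>\<psi>\<^bsub>\<beta>,\<rho>\<^esub>\<close> (of degree \<open>d \<rho>\<close>) and of the homomorphism \<open>U\<^bsub>\<beta>,\<rho>\<^esub>\<close> on the same space.  The inverse of
  \<open>U \<rho> g\<close> is \<open>U \<rho> (inv g)\<close>.\<close>

definition odd_choice ::
  "('f::field, 'k::field) go_data \<Rightarrow> nat \<Rightarrow> nat \<Rightarrow> ((('f, 'k) res_map \<Rightarrow> complex) \<Rightarrow> nat) \<Rightarrow>
    ((('f, 'k) res_map \<Rightarrow> complex) \<Rightarrow> ('f, 'k) res_map \<Rightarrow> complex mat) \<Rightarrow>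
    ((('f, 'k) res_map \<Rightarrow> complex) \<Rightarrow> ('f, 'k) res_map \<Rightarrow> complex mat) \<Rightarrow> bool" where
  "odd_choice D r l d \<pi> U \<longleftrightarrow> (\<forall>\<rho> \<in> char_set (lie_beta_add D).
     irreducible_rep ((GO D r)\<lparr>carrier := congr_subgroup D r (l - 1)\<rparr>) (d \<rho>) (\<pi> \<rho>) \<and>
     contains_char (Z_beta D r l) (d \<rho>) (\<pi> \<rho>) (psi_beta_rho D r l \<rho>) \<and>
     U \<rho> \<in> hom ((GO D r)\<lparr>carrier := G_beta D r\<rparr>) (GL (d \<rho>)) \<and>
     (\<forall>g \<in> G_beta D r. \<forall>x \<in> congr_subgroup D r (l - 1).
        \<pi> \<rho> (inv\<^bsub>GO D r\<^esub> g \<otimes>\<^bsub>GO D r\<^esub> x \<otimes>\<^bsub>GO D r\<^esub> g) = U \<rho> (inv\<^bsub>GO D r\<^esub> g) * \<pi> \<rho> x * U \<rho> g) \<and>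
     (\<forall>g \<in> G_beta D r \<inter> congr_subgroup D r (l - 1). U \<rho> g = 1\<^sub>m (d \<rho>)))"

definition rho_of ::
  "('f::field, 'k::field) go_data \<Rightarrow> nat \<Rightarrow> nat \<Rightarrow> ('k \<times> 'f \<Rightarrow> complex) \<Rightarrow>
    ('f, 'k) res_map \<Rightarrow> complex" where
  "rho_of D r l \<theta> = (THE \<rho>. \<rho> \<in> char_set (lie_beta_add D) \<and>
     (\<forall>k \<in> G_beta D r \<inter> congr_subgroup D r (l - 1).
        theta_on_G_beta D r \<theta> k = psi_beta_rho D r l \<rho> k))"

definition sigma_even ::
  "('f::field, 'k::field) go_data \<Rightarrow> nat \<Rightarrow> nat \<Rightarrow> nat \<Rightarrow> ('k \<times> 'f \<Rightarrow> complex) \<Rightarrow>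
    ('f, 'k) res_map \<Rightarrow> complex mat" where
  "sigma_even D r l l' \<theta> x = (THE A. \<exists>g \<in> G_beta D r. \<exists>h \<in> congr_subgroup D r l.
     x = g \<otimes>\<^bsub>GO D r\<^esub> h \<and> A = (theta_on_G_beta D r \<theta> g * psi_beta D r l l' h) \<cdot>\<^sub>m 1\<^sub>m 1)"

definition sigma_odd ::
  "('f::field, 'k::field) go_data \<Rightarrow> nat \<Rightarrow> nat \<Rightarrow>
    ((('f, 'k) res_map \<Rightarrow> complex) \<Rightarrow> ('f, 'k) res_map \<Rightarrow> complex mat) \<Rightarrow>
    ((('f, 'k) res_map \<Rightarrow> complex) \<Rightarrow> ('f, 'k) res_map \<Rightarrow> complex mat) \<Rightarrow>
    ('k \<times> 'f \<Rightarrow> complex) \<Rightarrow> ('f, 'k) res_map \<Rightarrow> complex mat" where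
  "sigma_odd D r l \<pi> U \<theta> x = (THE A. \<exists>g \<in> G_beta D r. \<exists>h \<in> congr_subgroup D r (l - 1).
     x = g \<otimes>\<^bsub>GO D r\<^esub> h \<and>
     A = theta_on_G_beta D r \<theta> g \<cdot>\<^sub>m (U (rho_of D r l \<theta>) g * \<pi> (rho_of D r l \<theta>) h))"

definition Ind_sigma ::
  "('f::field, 'k::field) go_data \<Rightarrow> nat \<Rightarrow> nat \<Rightarrow> nat \<Rightarrow>
    ((('f, 'k) res_map \<Rightarrow> complex) \<Rightarrow> nat) \<Rightarrow>
    ((('f, 'k) res_map \<Rightarrow> complex) \<Rightarrow> ('f, 'k) res_map \<Rightarrow> complex mat) \<Rightarrow>
    ((('f, 'k) res_map \<Rightarrow> complex) \<Rightarrow> ('f, 'k) res_map \<Rightarrow> complex mat) \<Rightarrow>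
    ('k \<times> 'f \<Rightarrow> complex) \<Rightarrow> (nat \<times> (('f, 'k) res_map \<Rightarrow> complex mat)) set" where
  "Ind_sigma D r l l' d \<pi> U \<theta> =
     (if r = 2 * l then induced_class (GO D r) (stabilizer_beta D r l') 1 (sigma_even D r l l' \<theta>)
      else induced_class (GO D r) (stabilizer_beta D r l') (d (rho_of D r l \<theta>))
             (sigma_odd D r l \<pi> U \<theta>))"

end

theory Submission
  imports Defs "Jordan_Normal_Form.Char_Poly" "HOL-Computational_Algebra.Fundamental_Theorem_Algebra" "HOL-Library.Product_Plus"
begin

text \<open>The stabilizer of \<open>\<psi> = psi_beta\<close> is \<open>H = A N\<^sub>1\<close> with \<open>A = G_beta\<close> abelian and \<open>N\<^sub>1 = K\<^bsub>l'\<^esub>(O\<^sub>r)\<close>,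
  because a similitude that centralizes \<open>\<beta>\<close> modulo \<open>\<pp>\<^sup>j\<close> is congruent to a block-diagonal one.  By Clifford theory it
  suffices to describe the irreducible representations of \<open>H\<close> over \<open>\<psi>\<close>.  Let \<open>Z\<close> consist of the elements of \<open>N\<^sub>1\<close>
  that commute with \<open>\<beta>\<close> modulo \<open>\<pp>\<^sup>l\<close>.  The commutator pairing on \<open>N\<^sub>1/Z\<close> is the trace pairing with
  \<open>[X, \<beta>]\<close>, which is nondegenerate since the trace form is perfect on skew endomorphisms.  So the character of an
  irreducible \<open>\<pi>\<close> of \<open>N\<^sub>1\<close> over an extension of \<open>\<psi>\<close> to \<open>Z\<close> vanishes off \<open>Z\<close>, and averaging gives an
  \<open>N\<^sub>1\<close>-intertwiner from any representation over that extension to \<open>\<pi>\<close>.  The group \<open>A\<close> acts on the space of these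
  intertwiners, and a common eigenvector yields \<open>\<theta>\<close>.

  In the even case \<open>Z = N\<^sub>1 = K\<^bsub>l\<^esub>(O\<^sub>r)\<close>.  In the odd case the extensions of \<open>\<psi>\<close> to \<open>Z\<close> correspond to the
  characters \<open>\<rho>\<close> of the centralizer in the residual Lie algebra, and \<open>\<theta>\<close> determines \<open>\<rho>\<close> because \<open>A \<inter> N\<^sub>1\<close>
  maps onto that centralizer.\<close>

section \<open>Matrix representations\<close>

text \<open>Group elements over \<open>O\<close> modulo \<open>\<pp>^r\<close> are handled through
  lifts to linear maps of the ambient space \<open>K \<times> F\<close> that preserve the lattice.
  These maps form a ring in which congruences are membership in the two-sided ideals
  \<open>\<I> j\<close>; a lift satisfies the similitude equation only up to such an ideal.
  Perfectness of the trace form on skew endomorphisms rests on that of the trace of \<open>K\<close>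
  over \<open>F\<close>. For the latter, the derivative of the minimal polynomial of \<beta> is
  shown to be a unit at \<beta>, and Euler's formula gives an explicit dual basis. The
  block-diagonal element congruent to a similitude comes from a square root that corrects the norm
  of its first entry. The levels satisfy \<open>l \<le> 2 * l'\<close>, which sends commutators of
  level \<open>l'\<close> into level \<open>l\<close>, and \<open>r \<le> 3 * l'\<close>, which
  kills triple products, so that a quadratic logarithm suffices. No degree of \<pi> is ever
  computed: the vanishing of its character off \<open>Z\<close> takes the place of a count.\<close>

definition rep_on :: "('g, 'c) monoid_scheme \<Rightarrow> 'g set \<Rightarrow> nat \<Rightarrow> ('g \<Rightarrow> complex mat) \<Rightarrow> bool" where
  "rep_on G H d R \<longleftrightarrow> (\<forall>g\<in>H. R g \<in> carrier_mat d d) \<and>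
     (\<forall>g\<in>H. \<forall>h\<in>H. R (g \<otimes>\<^bsub>G\<^esub> h) = R g * R h) \<and> R \<one>\<^bsub>G\<^esub> = 1\<^sub>m d"

definition vsub :: "nat \<Rightarrow> complex vec set \<Rightarrow> bool" where
  "vsub d W \<longleftrightarrow> W \<subseteq> carrier_vec d \<and> 0\<^sub>v d \<in> W \<and> (\<forall>x\<in>W. \<forall>y\<in>W. x + y \<in> W) \<and>
     (\<forall>c. \<forall>x\<in>W. c \<cdot>\<^sub>v x \<in> W)"

definition irr_on :: "'g set \<Rightarrow> nat \<Rightarrow> ('g \<Rightarrow> complex mat) \<Rightarrow> bool" where
  "irr_on H d R \<longleftrightarrow> 0 < d \<and>
     (\<forall>W. vsub d W \<longrightarrow> (\<forall>g\<in>H. \<forall>x\<in>W. R g *\<^sub>v x \<in> W) \<longrightarrow> W = {0\<^sub>v d} \<or> W = carrier_vec d)"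

lemma GL_carrier: "A \<in> carrier (GL d) \<longleftrightarrow>
    A \<in> carrier_mat d d \<and> (\<exists>B\<in>carrier_mat d d. A * B = 1\<^sub>m d \<and> B * A = 1\<^sub>m d)"
  by (auto simp: units_of_def Units_def ring_mat_simps)

lemma GL_simps: "A \<otimes>\<^bsub>GL d\<^esub> B = A * B" "\<one>\<^bsub>GL d\<^esub> = 1\<^sub>m d"
  by (auto simp: units_of_def ring_mat_simps)

text \<open>An idempotent of \<open>GL d\<close> is the identity, so a homomorphism respects the
  unit. Conversely, multiplicativity and the value at the unit make \<open>R (inv g)\<close> an
  inverse of \<open>R g\<close>.\<close>

lemma hom_GL_iff:
  assumes "group G" "subgroup H G"
  shows "R \<in> hom (G\<lparr>carrier := H\<rparr>) (GL d) \<longleftrightarrow> rep_on G H d R"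
proof
  interpret group G by fact
  interpret H: subgroup H G by fact
  assume R: "R \<in> hom (G\<lparr>carrier := H\<rparr>) (GL d)"
  have c: "g \<in> H \<Longrightarrow> R g \<in> carrier (GL d)" for g
    using R by (auto simp: hom_def)
  have m: "g \<in> H \<Longrightarrow> h \<in> H \<Longrightarrow> R (g \<otimes>\<^bsub>G\<^esub> h) = R g * R h" for g h
    using R by (auto simp: hom_def GL_simps)
  have "R \<one>\<^bsub>G\<^esub> * R \<one>\<^bsub>G\<^esub> = R \<one>\<^bsub>G\<^esub>"
    using m[of "\<one>\<^bsub>G\<^esub>" "\<one>\<^bsub>G\<^esub>"] by auto
  moreover obtain B where B: "B \<in> carrier_mat d d" "R \<one>\<^bsub>G\<^esub> * B = 1\<^sub>m d" "B * R \<one>\<^bsub>G\<^esub> = 1\<^sub>m d"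
    using c[of "\<one>\<^bsub>G\<^esub>"] unfolding GL_carrier by auto
  moreover have "R \<one>\<^bsub>G\<^esub> \<in> carrier_mat d d"
    using c[of "\<one>\<^bsub>G\<^esub>"] unfolding GL_carrier by auto
  ultimately have "R \<one>\<^bsub>G\<^esub> = 1\<^sub>m d"
    by (metis assoc_mult_mat right_mult_one_mat)
  then show "rep_on G H d R"
    using c m by (auto simp: rep_on_def GL_carrier)
next
  interpret group G by fact
  interpret H: subgroup H G by fact
  assume R: "rep_on G H d R"
  have "R g \<in> carrier (GL d)" if g: "g \<in> H" for g
  proof -
    have mult: "R x * R y = R (x \<otimes>\<^bsub>G\<^esub> y)" if "x \<in> H" "y \<in> H" for x y
      using R that by (simp add: rep_on_def)
    have "R g * R (inv\<^bsub>G\<^esub> g) = R (g \<otimes>\<^bsub>G\<^esub> inv\<^bsub>G\<^esub> g)" "R (inv\<^bsub>G\<^esub> g) * R g = R (inv\<^bsub>G\<^esub> g \<otimes>\<^bsub>G\<^esub> g)"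
      using g by (intro mult; simp)+
    moreover have "R (inv\<^bsub>G\<^esub> g) \<in> carrier_mat d d" "R g \<in> carrier_mat d d" "R \<one>\<^bsub>G\<^esub> = 1\<^sub>m d"
      using R g by (auto simp: rep_on_def)
    ultimately show ?thesis using g
      unfolding GL_carrier using r_inv[OF H.mem_carrier[OF g]] l_inv[OF H.mem_carrier[OF g]] by auto
  qed
  then show "R \<in> hom (G\<lparr>carrier := H\<rparr>) (GL d)"
    using R by (auto simp: hom_def GL_simps rep_on_def)
qed

lemma hom_GL_iff':
  assumes "group G"
  shows "R \<in> hom G (GL d) \<longleftrightarrow> rep_on G (carrier G) d R"
  using hom_GL_iff[OF assms group.subgroup_self[OF assms]] by simp

lemma rep_on_mult: "rep_on G H d R \<Longrightarrow> g \<in> H \<Longrightarrow> h \<in> H \<Longrightarrow> R (g \<otimes>\<^bsub>G\<^esub> h) = R g * R h"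
  and rep_on_closed: "rep_on G H d R \<Longrightarrow> g \<in> H \<Longrightarrow> R g \<in> carrier_mat d d"
  and rep_on_one: "rep_on G H d R \<Longrightarrow> R \<one>\<^bsub>G\<^esub> = 1\<^sub>m d"
  by (auto simp: rep_on_def)

lemma irreducible_rep_iff:
  assumes "group G" "subgroup H G"
  shows "irreducible_rep (G\<lparr>carrier := H\<rparr>) d R \<longleftrightarrow> rep_on G H d R \<and> irr_on H d R"
proof -
  have "VectorSpace.subspace class_ring W (module_vec TYPE(complex) d) = vsub d W" for W
    unfolding VectorSpace.subspace_def LinearCombinations.submodule_def module_vec_simps vsub_def
    by (auto simp: vec_vs vec_module class_ring_simps)
  then show ?thesis
    unfolding irreducible_rep_def hom_GL_iff[OF assms] irr_on_def by simp
qed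

lemma irreducible_rep_iff':
  assumes "group G"
  shows "irreducible_rep G d R \<longleftrightarrow> rep_on G (carrier G) d R \<and> irr_on (carrier G) d R"
  using irreducible_rep_iff[OF assms group.subgroup_self[OF assms]] by simp

lemma irr_onD:
  assumes "irr_on H d R" "W \<subseteq> carrier_vec d" "0\<^sub>v d \<in> W" "\<And>x y. x \<in> W \<Longrightarrow> y \<in> W \<Longrightarrow> x + y \<in> W"
    "\<And>c x. x \<in> W \<Longrightarrow> c \<cdot>\<^sub>v x \<in> W" "\<And>g x. g \<in> H \<Longrightarrow> x \<in> W \<Longrightarrow> R g *\<^sub>v x \<in> W"
    "w \<in> W" "w \<noteq> 0\<^sub>v d"
  shows "W = carrier_vec d"
proof -
  have "vsub d W" using assms(2-5) by (simp add: vsub_def)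
  then have "W = {0\<^sub>v d} \<or> W = carrier_vec d"
    using assms(1,6) unfolding irr_on_def by simp
  then show ?thesis using assms(7,8) by auto
qed

lemma irr_on_mono: "irr_on H d R \<Longrightarrow> H \<subseteq> H' \<Longrightarrow> irr_on H' d R"
  unfolding irr_on_def by (auto dest: subsetD)

lemma irr_on_cong: "(\<And>h. h \<in> H \<Longrightarrow> R h = R' h) \<Longrightarrow> irr_on H d R \<longleftrightarrow> irr_on H d R'"
  unfolding irr_on_def by simp

lemma irr_on_1: "irr_on H 1 R"
  unfolding irr_on_def
proof (intro conjI allI impI)
  fix W :: "complex vec set"
  assume "vsub 1 W"
  then have W: "W \<subseteq> carrier_vec 1" "0\<^sub>v 1 \<in> W" "\<And>c x. x \<in> W \<Longrightarrow> c \<cdot>\<^sub>v x \<in> W"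
    by (auto simp: vsub_def)
  show "W = {0\<^sub>v 1} \<or> W = carrier_vec 1"
  proof (cases "W = {0\<^sub>v 1}")
    case False
    then obtain w where w: "w \<in> W" "w \<noteq> 0\<^sub>v 1" using W by auto
    then have wc: "w \<in> carrier_vec 1" using W by auto
    then have w0: "w $ 0 \<noteq> 0" using w(2) by (metis carrier_vecD eq_vecI index_zero_vec less_one)
    have "x \<in> W" if x: "x \<in> carrier_vec 1" for x
    proof -
      have "x = (x $ 0 / w $ 0) \<cdot>\<^sub>v w"
        using x wc w0 by (intro eq_vecI) auto
      then show ?thesis using W w by metis
    qed
    then show ?thesis using W by auto
  qed simp
qed simp

lemma linear_mat:
  fixes L :: "'a::comm_ring_1 vec \<Rightarrow> 'a vec"
  assumes c: "\<And>x. x \<in> carrier_vec n \<Longrightarrow> L x \<in> carrier_vec m"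
    and a: "\<And>x y. x \<in> carrier_vec n \<Longrightarrow> y \<in> carrier_vec n \<Longrightarrow> L (x + y) = L x + L y"
    and s: "\<And>c x. x \<in> carrier_vec n \<Longrightarrow> L (c \<cdot>\<^sub>v x) = c \<cdot>\<^sub>v L x"
  obtains A where "A \<in> carrier_mat m n" "\<And>x. x \<in> carrier_vec n \<Longrightarrow> A *\<^sub>v x = L x"
proof -
  define A where "A = mat m n (\<lambda>(i, j). L (unit_vec n j) $ i)"
  have "A *\<^sub>v x = L x" if x: "x \<in> carrier_vec n" for x
  proof -
    \<comment> \<open>\<open>?x k\<close> keeps the first \<open>k\<close> coordinates of
      \<open>x\<close>; the induction adds one multiple of a unit vector at a time.\<close>
    let ?x = "\<lambda>k. vec n (\<lambda>i. if i < k then x $ i else 0)"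
    have "k \<le> n \<Longrightarrow> L (?x k) = vec m (\<lambda>i. \<Sum>j<k. L (unit_vec n j) $ i * x $ j)" for k
    proof (induction k)
      case 0
      have "vec n (\<lambda>i. 0) = 0 \<cdot>\<^sub>v vec n (\<lambda>i. 0 :: 'a)" by auto
      then have *: "L (vec n (\<lambda>i. 0)) = 0 \<cdot>\<^sub>v L (vec n (\<lambda>i. 0))" using s[of "vec n (\<lambda>i. 0)" 0] by auto
      moreover have "L (vec n (\<lambda>i. 0)) \<in> carrier_vec m" using c by auto
      then have "0 \<cdot>\<^sub>v L (vec n (\<lambda>i. 0)) = vec m (\<lambda>i. 0)" by (intro eq_vecI) auto
      ultimately show ?case by simp
    next
      case (Suc k)
      have "?x (Suc k) = ?x k + x $ k \<cdot>\<^sub>v unit_vec n k"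
        using Suc.prems by (intro eq_vecI) (auto simp: less_Suc_eq)
      moreover have "L (?x k + x $ k \<cdot>\<^sub>v unit_vec n k) = L (?x k) + x $ k \<cdot>\<^sub>v L (unit_vec n k)"
        using a s by simp
      moreover have "L (unit_vec n k) \<in> carrier_vec m" using c by auto
      ultimately show ?case using Suc by (intro eq_vecI) auto
    qed
    from this[of n] have "L x = vec m (\<lambda>i. \<Sum>j<n. L (unit_vec n j) $ i * x $ j)"
    proof -
      have "?x n = x" using x by (intro eq_vecI) auto
      then show ?thesis using \<open>\<And>k. k \<le> n \<Longrightarrow> _ k\<close>[of n] by simp
    qed
    then show ?thesis
      using x by (intro eq_vecI) (auto simp: A_def mult_mat_vec_def scalar_prod_def lessThan_atLeast0 row_def)
  qed
  then show thesis using that[of A] by (auto simp: A_def)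
qed

lemma mat_eq_by_vec:
  fixes A B :: "'a::comm_ring_1 mat"
  assumes "A \<in> carrier_mat m n" "B \<in> carrier_mat m n" "\<And>x. x \<in> carrier_vec n \<Longrightarrow> A *\<^sub>v x = B *\<^sub>v x"
  shows "A = B"
proof (rule eq_matI)
  fix i j assume ij: "i < dim_row B" "j < dim_col B"
  have "(A *\<^sub>v unit_vec n j) $ i = (B *\<^sub>v unit_vec n j) $ i" using assms by simp
  then show "A $$ (i, j) = B $$ (i, j)" using ij assms(1,2) by (simp add: scalar_prod_right_unit)
qed (use assms in auto)

text \<open>The complex matrix \<open>P\<close> has an eigenvalue because its characteristic
  polynomial is not constant, and the eigenspace is invariant under the representation, hence the
  whole space.\<close>

lemma Schur_scalar:
  assumes irr: "irr_on H d R" and R: "\<And>h. h \<in> H \<Longrightarrow> R h \<in> carrier_mat d d"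
    and P: "P \<in> carrier_mat d d" and c: "\<And>h. h \<in> H \<Longrightarrow> P * R h = R h * P"
  obtains c where "P = c \<cdot>\<^sub>m 1\<^sub>m d"
proof -
  have d: "0 < d" using irr by (auto simp: irr_on_def)
  have "degree (char_poly P) = d" using degree_monic_char_poly[OF P] by auto
  then have "\<not> constant (poly (char_poly P))" using d by (simp add: constant_degree)
  then obtain e where "poly (char_poly P) e = 0" using fundamental_theorem_of_algebra by blast
  then have "eigenvalue P e" using eigenvalue_root_char_poly[OF P] by auto
  then obtain v where v: "v \<in> carrier_vec d" "v \<noteq> 0\<^sub>v d" "P *\<^sub>v v = e \<cdot>\<^sub>v v"
    using P by (auto simp: eigenvalue_def eigenvector_def)
  let ?W = "{v \<in> carrier_vec d. P *\<^sub>v v = e \<cdot>\<^sub>v v}"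
  have "?W = carrier_vec d"
  proof (rule irr_onD[OF irr, of _ v])
    fix g x assume g: "g \<in> H" and x: "x \<in> ?W"
    have "P *\<^sub>v (R g *\<^sub>v x) = (P * R g) *\<^sub>v x" using P R[OF g] x by auto
    also have "\<dots> = R g *\<^sub>v (P *\<^sub>v x)" using P R[OF g] x c[OF g] by auto
    also have "\<dots> = e \<cdot>\<^sub>v (R g *\<^sub>v x)" using R[OF g] x by (auto simp: mult_mat_vec)
    finally show "R g *\<^sub>v x \<in> ?W" using R[OF g] x by auto
  qed (use v P in \<open>auto simp: mult_add_distrib_mat_vec smult_add_distrib_vec mult_mat_vec smult_smult_assoc mult.commute\<close>)
  then have "P *\<^sub>v v = (e \<cdot>\<^sub>m 1\<^sub>m d) *\<^sub>v v" if "v \<in> carrier_vec d" for v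
  proof -
    have "P *\<^sub>v v = e \<cdot>\<^sub>v v" using that \<open>?W = carrier_vec d\<close> by blast
    also have "\<dots> = (e \<cdot>\<^sub>m 1\<^sub>m d) *\<^sub>v v" using that
      by (intro eq_vecI) (auto simp: smult_scalar_prod_distrib[of _ d])
    finally show ?thesis .
  qed
  then have "P = e \<cdot>\<^sub>m 1\<^sub>m d" using P by (intro mat_eq_by_vec[of _ d d]) auto
  then show thesis using that by blast
qed

text \<open>A nontrivial \<open>n\<close>-th root of unity has geometric sum zero. This
  orthogonality is what makes the Fourier sums in \<open>common_eigen_mat\<close> add up to a
  multiple of the original matrix.\<close>

lemma geometric_root_unity:
  fixes n i :: nat
  assumes "0 < i" "i < n"
  shows "(\<Sum>k<n. cis (2 * pi / n) ^ (k * i)) = 0"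
proof -
  let ?w = "cis (2 * pi / n)"
  have n: "0 < n" using assms by simp
  have e: "?w ^ i = cis (2 * pi * real i / real n)" by (simp add: DeMoivre field_simps)
  have "cis (2 * pi * real i / real n) \<noteq> cis (2 * pi * real 0 / real n)"
    using bij_betw_roots_unity[OF n] assms n unfolding bij_betw_def inj_on_def by (metis lessThan_iff nat_neq_iff)
  then have "?w ^ i \<noteq> 1" unfolding e by simp
  moreover have "?w ^ n = 1" using n by (simp add: DeMoivre)
  then have "(?w ^ i) ^ n = 1" by (metis mult.commute power_mult power_one)
  ultimately have "(\<Sum>k<n. (?w ^ i) ^ k) = 0" by (simp add: geometric_sum)
  then show ?thesis by (simp add: power_mult[symmetric] mult.commute)
qed

lemma trace_mult_swap:
  fixes A B :: "complex mat"
  assumes "A \<in> carrier_mat n m" "B \<in> carrier_mat m n"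
  shows "(\<Sum>i<n. (A * B) $$ (i, i)) = (\<Sum>j<m. (B * A) $$ (j, j))"
proof -
  have "(\<Sum>i<n. (A * B) $$ (i, i)) = (\<Sum>i<n. \<Sum>j<m. A $$ (i, j) * B $$ (j, i))"
    using assms by (auto simp: scalar_prod_def lessThan_atLeast0)
  also have "\<dots> = (\<Sum>j<m. (B * A) $$ (j, j))"
    using assms by (subst sum.swap) (auto simp: scalar_prod_def lessThan_atLeast0 mult.commute)
  finally show ?thesis .
qed

lemma smult_mat_cancel:
  fixes Q :: "complex mat"
  assumes "Q \<in> carrier_mat a b" "Q \<noteq> 0\<^sub>m a b" "c \<cdot>\<^sub>m Q = e \<cdot>\<^sub>m Q"
  shows "c = e"
proof -
  obtain i j where ij: "i < a" "j < b" "Q $$ (i, j) \<noteq> 0"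
    using assms(1,2) by (metis carrier_matD eq_matI index_zero_mat)
  then have "(c \<cdot>\<^sub>m Q) $$ (i, j) = (e \<cdot>\<^sub>m Q) $$ (i, j)" using assms by simp
  then show ?thesis using ij assms(1) by simp
qed

lemma (in group) finite_pow_one:
  assumes fin: "finite (carrier G)" and g: "g \<in> carrier G"
  shows "\<exists>n::nat. 0 < n \<and> g [^] n = \<one>"
proof -
  have "range (\<lambda>n::nat. g [^] n) \<subseteq> carrier G" using g by auto
  then have "finite (range (\<lambda>n::nat. g [^] n))" using fin by (rule finite_subset)
  then have "\<not> inj (\<lambda>n::nat. g [^] n)" using finite_imageD by blast
  then obtain a b :: nat where ab: "g [^] a = g [^] b" "a < b"
    unfolding inj_def by (metis linorder_neqE_nat)
  have "g [^] a \<otimes> g [^] (b - a) = g [^] a \<otimes> \<one>"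
    using ab g nat_pow_mult[OF g, of a "b - a"] by simp
  then have "g [^] (b - a) = \<one>" by (metis g nat_pow_closed Units_eq Units_l_cancel one_closed)
  then show ?thesis using ab by (intro exI[of _ "b - a"]) auto
qed

text \<open>The eigenspace projections of an operator \<open>F t\<close> of order \<open>n\<close> are the finite Fourier sums over its
  powers; one of them does not annihilate \<open>Q\<close>.\<close>

lemma (in group) common_eigen_mat:
  fixes W :: "complex mat set" and F :: "'a \<Rightarrow> complex mat \<Rightarrow> complex mat"
  assumes fin: "finite (carrier G)" and A: "subgroup S G"
    and Q: "Q \<in> W" "Q \<noteq> 0\<^sub>m a b" and W: "W \<subseteq> carrier_mat a b"
    and add: "\<And>X Y. X \<in> W \<Longrightarrow> Y \<in> W \<Longrightarrow> X + Y \<in> W"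
    and smult: "\<And>X c. X \<in> W \<Longrightarrow> c \<cdot>\<^sub>m X \<in> W"
    and maps: "\<And>s X. s \<in> S \<Longrightarrow> X \<in> W \<Longrightarrow> F s X \<in> W"
    and Fadd: "\<And>s X Y. s \<in> S \<Longrightarrow> X \<in> W \<Longrightarrow> Y \<in> W \<Longrightarrow> F s (X + Y) = F s X + F s Y"
    and Fsmult: "\<And>s X c. s \<in> S \<Longrightarrow> X \<in> W \<Longrightarrow> F s (c \<cdot>\<^sub>m X) = c \<cdot>\<^sub>m F s X"
    and comm: "\<And>s t X. s \<in> S \<Longrightarrow> t \<in> S \<Longrightarrow> X \<in> W \<Longrightarrow> F s (F t X) = F t (F s X)"
    and one: "\<And>X. X \<in> W \<Longrightarrow> F \<one> X = X"
    and act: "\<And>s t X. s \<in> S \<Longrightarrow> t \<in> S \<Longrightarrow> X \<in> W \<Longrightarrow> F (s \<otimes> t) X = F s (F t X)"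
  obtains Q lam where "Q \<in> W" "Q \<noteq> 0\<^sub>m a b" "\<And>s. s \<in> S \<Longrightarrow> F s Q = lam s \<cdot>\<^sub>m Q"
    "\<And>s t. s \<in> S \<Longrightarrow> t \<in> S \<Longrightarrow> lam (s \<otimes> t) = lam s * lam t"
proof -
  interpret S: subgroup S G by (rule A)
  have S: "finite S" using fin S.subset by (rule finite_subset[rotated])
  have ord: "\<exists>n>0. \<forall>X\<in>W. (F s ^^ n) X = X" if s: "s \<in> S" for s
  proof -
    obtain k :: nat where k: "0 < k" "s [^] k = \<one>" using finite_pow_one[OF fin, of s] s by auto
    have "s [^] j \<in> S \<and> (F s ^^ j) X = F (s [^] j) X" if "X \<in> W" for j :: nat and X
    proof (induction j)
      case (Suc j)
      then have "(F s ^^ Suc j) X = F (s \<otimes> s [^] j) X" using s that by (simp add: act)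
      also have "s \<otimes> s [^] j = s [^] Suc j" by (rule nat_pow_Suc2[symmetric]) (use s in simp)
      finally show ?case using Suc s by simp
    qed (simp add: one that)
    then show ?thesis using k one by (intro exI[of _ k]) simp
  qed
  \<comment> \<open>Linear combinations are formed entrywise, because the dimensions of a matrix are
    not part of its type. The fact \<open>sums\<close> says that they stay in \<open>W\<close> and
    are compatible with every \<open>F s\<close>.\<close>
  define lc where "lc c h n = mat a b (\<lambda>ij. \<Sum>i<n. c i * h i $$ ij)" for c and h :: "nat \<Rightarrow> complex mat" and n :: nat
  have Wc: "X \<in> carrier_mat a b" if "X \<in> W" for X using W that by blast
  have sums: "lc c h n \<in> W \<and> (\<forall>s\<in>S. F s (lc c h n) = lc c (\<lambda>i. F s (h i)) n)" if h: "\<And>i. h i \<in> W" for c h n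
  proof (induction n)
    case 0
    have z: "0 \<cdot>\<^sub>m X = lc c h' 0" if "X \<in> W" for X h' using Wc[OF that] by (auto simp: lc_def intro!: eq_matI)
    have "F s (lc c h 0) = lc c (\<lambda>i. F s (h i)) 0" if "s \<in> S" for s
      using Fsmult[OF that Q(1), of 0] unfolding z[OF Q(1), of h] z[OF maps[OF that Q(1)], of "\<lambda>i. F s (h i)"] .
    then show ?case using smult[OF Q(1), of 0] unfolding z[OF Q(1), of h] by blast
  next
    case (Suc n)
    have "lc c h' (Suc n) = lc c h' n + c n \<cdot>\<^sub>m h' n" if "\<And>i. h' i \<in> W" for h'
      using Wc[OF that[of n]] by (intro eq_matI) (auto simp: lc_def)
    then show ?case using Suc h maps by (simp add: add smult Fadd Fsmult)
  qed
  \<comment> \<open>Induction over the elements of \<open>S\<close>: an eigenvector common to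
    \<open>T\<close> is replaced by its projection to an eigenspace of \<open>F t\<close>. Since the
    operators commute, it keeps its eigenvalues for \<open>T\<close>.\<close>
  have "\<exists>Q\<in>W. Q \<noteq> 0\<^sub>m a b \<and> (\<forall>s\<in>S. \<exists>c. F s Q = c \<cdot>\<^sub>m Q)"
    using S order_refl
  proof (induction S rule: finite_subset_induct')
    case empty
    then show ?case using Q by auto
  next
    case (insert t T)
    then obtain Q where Q: "Q \<in> W" "Q \<noteq> 0\<^sub>m a b" "\<And>s. s \<in> T \<Longrightarrow> \<exists>c. F s Q = c \<cdot>\<^sub>m Q" by auto
    obtain n where n: "0 < n" "\<forall>X\<in>W. (F t ^^ n) X = X" using ord[OF \<open>t \<in> S\<close>] by auto
    define w where "w = cis (2 * pi / n)"
    have wn: "w ^ n = 1" using n by (simp add: w_def DeMoivre)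
    have w0: "w \<noteq> 0" by (simp add: w_def)
    define h where "h i = (F t ^^ i) Q" for i
    have hW: "h i \<in> W" for i unfolding h_def by (induction i) (auto simp: Q maps \<open>t \<in> S\<close>)
    have hS: "F t (h i) = h (Suc i)" for i by (simp add: h_def)
    define P where "P k = lc (\<lambda>i. w ^ (k * i)) h n" for k :: nat
    have PW: "P k \<in> W" for k unfolding P_def using sums[of h "\<lambda>i. w ^ (k * i)" n] hW by simp
    have FP: "F s (P k) = lc (\<lambda>i. w ^ (k * i)) (\<lambda>i. F s (h i)) n" if "s \<in> S" for k s
      unfolding P_def using sums[of h "\<lambda>i. w ^ (k * i)" n] hW that by simp
    \<comment> \<open>The \<open>P k\<close> add up to \<open>n\<close> times \<open>Q\<close> by
      orthogonality, so they cannot all vanish.\<close>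
    have "\<exists>k. P k \<noteq> 0\<^sub>m a b"
    proof (rule ccontr)
      assume "\<not> (\<exists>k. P k \<noteq> 0\<^sub>m a b)"
      then have z: "P k $$ x = 0" if "fst x < a" "snd x < b" for k x using that by (cases x) auto
      have "Q $$ x = 0" if x: "fst x < a" "snd x < b" for x
      proof -
        have "0 = (\<Sum>k<n. P k $$ x)" using z[OF x] by simp
        also have "\<dots> = (\<Sum>k<n. \<Sum>i<n. w ^ (k * i) * h i $$ x)" using x by (cases x) (simp add: P_def lc_def)
        also have "\<dots> = (\<Sum>i<n. (\<Sum>k<n. w ^ (k * i)) * h i $$ x)"
          unfolding sum_distrib_right by (rule sum.swap)
        also have "\<dots> = (\<Sum>i<n. if i = 0 then of_nat n * Q $$ x else 0)"
          by (intro sum.cong refl) (auto simp: geometric_root_unity w_def h_def)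
        also have "\<dots> = of_nat n * Q $$ x" using n by (simp add: sum.delta)
        finally show ?thesis using n by simp
      qed
      then show False using Q(2) Wc[OF Q(1)] by (metis carrier_matD eq_matI fst_conv index_zero_mat snd_conv)
    qed
    then obtain k where k: "P k \<noteq> 0\<^sub>m a b" by auto
    have "F t (P k) = inverse (w ^ k) \<cdot>\<^sub>m P k"
    proof (rule eq_matI)
      fix i j assume "i < dim_row (inverse (w ^ k) \<cdot>\<^sub>m P k)" "j < dim_col (inverse (w ^ k) \<cdot>\<^sub>m P k)"
      then have x: "i < a" "j < b" using Wc[OF PW[of k]] by auto
      let ?x = "(i, j)"
      \<comment> \<open>\<open>F t\<close> shifts the index by one; the two boundary terms agree
        because \<open>w ^ n = 1\<close> and \<open>n\<close> applications of \<open>F t\<close>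
        give the identity.\<close>
      have "w ^ k * F t (P k) $$ ?x = (\<Sum>i<n. w ^ (k * Suc i) * h (Suc i) $$ ?x)"
        using x by (simp add: FP[OF \<open>t \<in> S\<close>] lc_def hS sum_distrib_left algebra_simps power_add)
      also have "\<dots> = (\<Sum>i<Suc n. w ^ (k * i) * h i $$ ?x) - w ^ (k * 0) * h 0 $$ ?x"
        unfolding sum.lessThan_Suc_shift by simp
      also have "\<dots> = P k $$ ?x"
        using n(2) Q(1) wn x by (simp add: P_def lc_def h_def mult.commute[of k] power_mult)
      finally show "F t (P k) $$ ?x = (inverse (w ^ k) \<cdot>\<^sub>m P k) $$ ?x"
        using w0 x Wc[OF PW[of k]] by (simp add: field_simps)
    qed (use Wc[OF PW[of k]] Wc[OF maps[OF \<open>t \<in> S\<close> PW[of k]]] in auto)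
    moreover have "\<exists>c. F s (P k) = c \<cdot>\<^sub>m P k" if s: "s \<in> T" for s
    proof -
      obtain c where c: "F s Q = c \<cdot>\<^sub>m Q" using Q(3)[OF s] by auto
      have sS: "s \<in> S" using s insert by auto
      have Fh: "F s (h i) = c \<cdot>\<^sub>m h i" for i
      proof (induction i)
        case 0
        then show ?case using c by (simp add: h_def)
      next
        case (Suc i)
        have "F s (h (Suc i)) = F t (F s (h i))" unfolding hS[symmetric] using comm[OF sS \<open>t \<in> S\<close> hW] .
        then show ?case using Suc Fsmult[OF \<open>t \<in> S\<close> hW] by (simp add: hS)
      qed
      have "F s (P k) = lc (\<lambda>i. w ^ (k * i)) (\<lambda>i. c \<cdot>\<^sub>m h i) n" unfolding FP[OF sS] Fh ..
      also have "\<dots> = c \<cdot>\<^sub>m P k"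
        using carrier_matD[OF Wc[OF hW]] by (intro eq_matI) (auto simp: P_def lc_def sum_distrib_left algebra_simps)
      finally have "F s (P k) = c \<cdot>\<^sub>m P k" .
      then show ?thesis ..
    qed
    ultimately show ?case using PW k by blast
  qed
  then obtain Q lam where Q: "Q \<in> W" "Q \<noteq> 0\<^sub>m a b" and lam: "\<And>s. s \<in> S \<Longrightarrow> F s Q = lam s \<cdot>\<^sub>m Q" by metis
  have "lam (s \<otimes> t) = lam s * lam t" if "s \<in> S" "t \<in> S" for s t
  proof (rule smult_mat_cancel[OF Wc[OF Q(1)] Q(2)])
    have "lam (s \<otimes> t) \<cdot>\<^sub>m Q = lam t \<cdot>\<^sub>m (lam s \<cdot>\<^sub>m Q)"
      using lam[of "s \<otimes> t"] lam[OF that(1)] lam[OF that(2)] act[OF that Q(1)] Fsmult[OF that(1) Q(1)] that by simp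
    also have "\<dots> = (lam s * lam t) \<cdot>\<^sub>m Q" by (auto intro!: eq_matI)
    finally show "lam (s \<otimes> t) \<cdot>\<^sub>m Q = (lam s * lam t) \<cdot>\<^sub>m Q" .
  qed
  then show thesis using that Q lam by blast
qed

text \<open>\<open>Q i j\<close> is the sum over \<open>K\<close> of
  \<open>\<pi> x * E * R (inv x)\<close> with \<open>E\<close> the matrix unit at
  \<open>(i, j)\<close>. If all of them vanished, so would the sum over \<open>i\<close> of the
  entries \<open>Q i j $$ (i, l)\<close>. It contains the traces of \<open>\<pi> x\<close>, of which
  only those on \<open>Z\<close> survive, and applied to \<open>v\<close> it gives a nonzero
  multiple of \<open>v $ j\<close>.\<close>

lemma averaged_intertwiner:
  fixes R \<pi> :: "'g \<Rightarrow> complex mat" and G (structure)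
  assumes "group G" and K: "subgroup K G" "finite K"
    and \<pi>: "rep_on G K d \<pi>" "0 < d" and R: "rep_on G K D R"
    and Z: "subgroup Z G" "Z \<subseteq> K"
    and tr: "\<And>x. x \<in> K \<Longrightarrow> x \<notin> Z \<Longrightarrow> (\<Sum>i<d. \<pi> x $$ (i, i)) = 0"
    and \<psi>: "\<And>z. z \<in> Z \<Longrightarrow> \<pi> z = \<psi> z \<cdot>\<^sub>m 1\<^sub>m d"
    and v: "v \<in> carrier_vec D" "v \<noteq> 0\<^sub>v D" "\<And>z. z \<in> Z \<Longrightarrow> R z *\<^sub>v v = \<psi> z \<cdot>\<^sub>v v"
  obtains Q where "Q \<in> carrier_mat d D" "Q \<noteq> 0\<^sub>m d D" "\<And>y. y \<in> K \<Longrightarrow> Q * R y = \<pi> y * Q"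
proof -
  interpret group G by fact
  interpret K: subgroup K G by fact
  interpret Z: subgroup Z G by fact
  have \<pi>c: "x \<in> K \<Longrightarrow> \<pi> x \<in> carrier_mat d d" and Rc: "x \<in> K \<Longrightarrow> R x \<in> carrier_mat D D" for x
    using \<pi> R by (auto simp: rep_on_def)
  define Q where "Q i j = mat d D (\<lambda>(k, l). \<Sum>x\<in>K. \<pi> x $$ (k, i) * R (inv x) $$ (j, l))" for i j
  have Q: "Q i j \<in> carrier_mat d D" for i j by (simp add: Q_def)
  have int: "Q i j * R y = \<pi> y * Q i j" if y: "y \<in> K" and i: "i < d" and j: "j < D" for i j y
  proof (rule eq_matI)
    fix k l assume "k < dim_row (\<pi> y * Q i j)" "l < dim_col (\<pi> y * Q i j)"
    then have kl: "k < d" "l < D" using \<pi>c[OF y] by (auto simp: Q_def)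
    have 1: "R (inv x \<otimes> y) $$ (j, l) = (\<Sum>m<D. R (inv x) $$ (j, m) * R y $$ (m, l))" if x: "x \<in> K" for x
    proof -
      have "R (inv x \<otimes> y) = R (inv x) * R y" using R x y by (auto simp: rep_on_def)
      then show ?thesis using Rc[of "inv x"] Rc[OF y] x kl j
        by (auto simp: scalar_prod_def lessThan_atLeast0)
    qed
    have 2: "\<pi> (y \<otimes> x) $$ (k, i) = (\<Sum>m<d. \<pi> y $$ (k, m) * \<pi> x $$ (m, i))" if x: "x \<in> K" for x
    proof -
      have "\<pi> (y \<otimes> x) = \<pi> y * \<pi> x" using \<pi> x y by (auto simp: rep_on_def)
      then show ?thesis using \<pi>c[of x] \<pi>c[OF y] x kl i
        by (auto simp: scalar_prod_def lessThan_atLeast0)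
    qed
    have "(Q i j * R y) $$ (k, l) = (\<Sum>m<D. (\<Sum>x\<in>K. \<pi> x $$ (k, i) * R (inv x) $$ (j, m)) * R y $$ (m, l))"
      using kl Rc[OF y] by (auto simp: Q_def scalar_prod_def lessThan_atLeast0)
    also have "\<dots> = (\<Sum>x\<in>K. \<pi> x $$ (k, i) * (\<Sum>m<D. R (inv x) $$ (j, m) * R y $$ (m, l)))"
      unfolding sum_distrib_right sum_distrib_left by (subst sum.swap) (simp add: mult.assoc)
    also have "\<dots> = (\<Sum>x\<in>K. \<pi> x $$ (k, i) * R (inv x \<otimes> y) $$ (j, l))"
      by (intro sum.cong refl) (simp add: 1)
    also have "\<dots> = (\<Sum>x\<in>K. \<pi> (y \<otimes> x) $$ (k, i) * R (inv x) $$ (j, l))"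
      by (rule sum.reindex_bij_witness[of _ "\<lambda>x. y \<otimes> x" "\<lambda>x. inv y \<otimes> x"])
        (use y in \<open>auto simp: m_assoc[symmetric] inv_mult_group\<close>)
    also have "\<dots> = (\<Sum>x\<in>K. (\<Sum>m<d. \<pi> y $$ (k, m) * \<pi> x $$ (m, i)) * R (inv x) $$ (j, l))"
      by (intro sum.cong refl) (simp add: 2)
    also have "\<dots> = (\<Sum>m<d. \<pi> y $$ (k, m) * (\<Sum>x\<in>K. \<pi> x $$ (m, i) * R (inv x) $$ (j, l)))"
      unfolding sum_distrib_right sum_distrib_left by (subst sum.swap) (simp add: mult.assoc)
    also have "\<dots> = (\<pi> y * Q i j) $$ (k, l)"
      using kl \<pi>c[OF y] by (auto simp: Q_def scalar_prod_def lessThan_atLeast0)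
    finally show "(Q i j * R y) $$ (k, l) = (\<pi> y * Q i j) $$ (k, l)" .
  qed (use \<pi>c[OF y] Rc[OF y] in \<open>auto simp: Q_def\<close>)
  have "\<exists>i<d. \<exists>j<D. Q i j \<noteq> 0\<^sub>m d D"
  proof (rule ccontr)
    assume "\<not> (\<exists>i<d. \<exists>j<D. Q i j \<noteq> 0\<^sub>m d D)"
    then have 0: "Q i j = 0\<^sub>m d D" if "i < d" "j < D" for i j using that by auto
    have "v $ j = 0" if j: "j < D" for j
    proof -
      have \<psi>\<psi>: "\<psi> z * \<psi> (inv z) = 1" if z: "z \<in> Z" for z
      proof -
        have "\<pi> z * \<pi> (inv z) = \<pi> (z \<otimes> inv z)" using z Z(2) by (intro rep_on_mult[OF \<pi>(1), symmetric]) auto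
        also have "\<dots> = 1\<^sub>m d" using rep_on_one[OF \<pi>(1)] z by simp
        finally have "\<psi> z \<cdot>\<^sub>m 1\<^sub>m d * \<pi> (inv z) = 1\<^sub>m d" using \<psi>[OF z] by simp
        then have "\<psi> z \<cdot>\<^sub>m (\<psi> (inv z) \<cdot>\<^sub>m 1\<^sub>m d) = 1\<^sub>m d"
          using mult_smult_assoc_mat[of "1\<^sub>m d" d d "\<pi> (inv z)" d "\<psi> z"] \<psi>[of "inv z"] z by simp
        then have "(\<psi> z \<cdot>\<^sub>m (\<psi> (inv z) \<cdot>\<^sub>m 1\<^sub>m d)) $$ (0, 0) = (1\<^sub>m d :: complex mat) $$ (0, 0)" by simp
        then show ?thesis using \<pi>(2) by simp
      qed
      have "(\<Sum>z\<in>Z. of_nat d * \<psi> z * R (inv z) $$ (j, l)) = 0" if l: "l < D" for l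
      proof -
        have "0 = (\<Sum>i<d. Q i j $$ (i, l))" using 0 j l by simp
        also have "\<dots> = (\<Sum>i<d. \<Sum>x\<in>K. \<pi> x $$ (i, i) * R (inv x) $$ (j, l))"
          by (intro sum.cong refl) (use l in \<open>auto simp: Q_def\<close>)
        also have "\<dots> = (\<Sum>x\<in>K. (\<Sum>i<d. \<pi> x $$ (i, i)) * R (inv x) $$ (j, l))"
          unfolding sum_distrib_right by (rule sum.swap)
        also have "\<dots> = (\<Sum>x\<in>Z. (\<Sum>i<d. \<pi> x $$ (i, i)) * R (inv x) $$ (j, l))"
          using K Z tr by (intro sum.mono_neutral_right) auto
        also have "\<dots> = (\<Sum>z\<in>Z. of_nat d * \<psi> z * R (inv z) $$ (j, l))"
          by (intro sum.cong refl) (simp add: \<psi>)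
        finally show ?thesis by simp
      qed
      then have "0 = (\<Sum>l<D. (\<Sum>z\<in>Z. of_nat d * \<psi> z * R (inv z) $$ (j, l)) * v $ l)" by simp
      also have "\<dots> = (\<Sum>z\<in>Z. of_nat d * \<psi> z * (\<Sum>l<D. R (inv z) $$ (j, l) * v $ l))"
        unfolding sum_distrib_right sum_distrib_left by (subst sum.swap) (simp add: mult.assoc)
      also have "\<dots> = (\<Sum>z\<in>Z. of_nat d * \<psi> z * (R (inv z) *\<^sub>v v) $ j)"
      proof (intro sum.cong refl)
        fix z assume "z \<in> Z"
        then have "R (inv z) \<in> carrier_mat D D" using Rc Z by blast
        then show "of_nat d * \<psi> z * (\<Sum>l<D. R (inv z) $$ (j, l) * v $ l) = of_nat d * \<psi> z * (R (inv z) *\<^sub>v v) $ j"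
          using j v by (auto simp: scalar_prod_def lessThan_atLeast0)
      qed
      also have "\<dots> = (\<Sum>z\<in>Z. of_nat d * (\<psi> z * \<psi> (inv z)) * v $ j)"
        by (intro sum.cong refl) (use v j in auto)
      also have "\<dots> = (\<Sum>z\<in>Z. of_nat d * v $ j)"
        by (intro sum.cong refl) (simp add: \<psi>\<psi>)
      also have "\<dots> = of_nat (card Z * d) * v $ j" by simp
      finally have "of_nat (card Z * d) * v $ j = 0" by simp
      moreover have "card Z \<noteq> 0"
        using finite_subset[OF Z(2) K(2)] Z.one_closed by (metis card_eq_0_iff empty_iff)
      ultimately show ?thesis using \<pi>(2) by simp
    qed
    then have "v = 0\<^sub>v D" using v by (intro eq_vecI) auto
    then show False using v by simp
  qed
  then show thesis using that Q int by blast
qed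

section \<open>Clifford theory\<close>

text \<open>The equations required in \<open>induced_class\<close>, evaluated at the points of the
  group. The functions compared there are extensional, so that \<open>induced_class_iff\<close> can
  pass between the two forms.\<close>

definition ind_map ::
  "('g, 'c) monoid_scheme \<Rightarrow> 'g set \<Rightarrow> nat \<Rightarrow> ('g \<Rightarrow> complex mat) \<Rightarrow>
    nat \<Rightarrow> ('g \<Rightarrow> complex mat) \<Rightarrow> (complex vec \<Rightarrow> 'g \<Rightarrow> complex vec) \<Rightarrow> bool" where
  "ind_map G H d \<sigma> D R T \<longleftrightarrow> bij_betw T (carrier_vec D) (induced_space G H d \<sigma>) \<and>
       (\<forall>x \<in> carrier_vec D. \<forall>y \<in> carrier_vec D. \<forall>z\<in>carrier G. T (x + y) z = T x z + T y z) \<and>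
       (\<forall>c. \<forall>x \<in> carrier_vec D. \<forall>z\<in>carrier G. T (c \<cdot>\<^sub>v x) z = c \<cdot>\<^sub>v T x z) \<and>
       (\<forall>g \<in> carrier G. \<forall>x \<in> carrier_vec D. \<forall>z\<in>carrier G.
          T (R g *\<^sub>v x) z = T x (z \<otimes>\<^bsub>G\<^esub> g))"

lemma induced_space_eqI:
  assumes "f \<in> induced_space G H d \<sigma>" "f' \<in> induced_space G H d \<sigma>" "\<And>z. z \<in> carrier G \<Longrightarrow> f z = f' z"
  shows "f = f'"
  using assms unfolding induced_space_def by (auto intro: PiE_ext)

lemma induced_class_iff:
  assumes "group G"
  shows "(D, R) \<in> induced_class G H d \<sigma> \<longleftrightarrow>
    rep_on G (carrier G) D R \<and> (\<exists>T. ind_map G H d \<sigma> D R T)"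
proof -
  have ext: "f = restrict f' (carrier G) \<longleftrightarrow> (\<forall>z\<in>carrier G. f z = f' z)"
    if "f \<in> induced_space G H d \<sigma>" for f f'
    using that by (auto simp: induced_space_def fun_eq_iff PiE_def extensional_def)
  have "(bij_betw T (carrier_vec D) (induced_space G H d \<sigma>) \<and>
       (\<forall>x \<in> carrier_vec D. \<forall>y \<in> carrier_vec D. T (x + y) = (\<lambda>z \<in> carrier G. T x z + T y z)) \<and>
       (\<forall>c. \<forall>x \<in> carrier_vec D. T (c \<cdot>\<^sub>v x) = (\<lambda>z \<in> carrier G. c \<cdot>\<^sub>v T x z)) \<and>
       (\<forall>g \<in> carrier G. \<forall>x \<in> carrier_vec D.
          T (R g *\<^sub>v x) = (\<lambda>z \<in> carrier G. T x (z \<otimes>\<^bsub>G\<^esub> g)))) = ind_map G H d \<sigma> D R T"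
    if R: "rep_on G (carrier G) D R" for T
  proof (cases "bij_betw T (carrier_vec D) (induced_space G H d \<sigma>)")
    case True
    then have T: "T x \<in> induced_space G H d \<sigma>" if "x \<in> carrier_vec D" for x
      using that by (auto simp: bij_betw_def)
    have "R g *\<^sub>v x \<in> carrier_vec D" if "g \<in> carrier G" "x \<in> carrier_vec D" for g x
      using rep_on_closed[OF R that(1)] that(2) by simp
    then show ?thesis using True by (simp add: ind_map_def ext T)
  qed (simp add: ind_map_def)
  then show ?thesis
    unfolding induced_class_def hom_GL_iff'[OF assms] by auto
qed

lemma ind_mapD:
  assumes "ind_map G H d \<sigma> D R T"
  shows "bij_betw T (carrier_vec D) (induced_space G H d \<sigma>)"
    and "x \<in> carrier_vec D \<Longrightarrow> y \<in> carrier_vec D \<Longrightarrow> z \<in> carrier G \<Longrightarrow> T (x + y) z = T x z + T y z"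
    and "x \<in> carrier_vec D \<Longrightarrow> z \<in> carrier G \<Longrightarrow> T (c \<cdot>\<^sub>v x) z = c \<cdot>\<^sub>v T x z"
    and "x \<in> carrier_vec D \<Longrightarrow> g \<in> carrier G \<Longrightarrow> z \<in> carrier G \<Longrightarrow> T (R g *\<^sub>v x) z = T x (z \<otimes>\<^bsub>G\<^esub> g)"
    and "x \<in> carrier_vec D \<Longrightarrow> T x \<in> induced_space G H d \<sigma>"
  using assms by (auto simp: ind_map_def bij_betw_def)

lemma induced_spaceD:
  assumes "f \<in> induced_space G H d \<sigma>"
  shows "x \<in> carrier G \<Longrightarrow> f x \<in> carrier_vec d"
    and "h \<in> H \<Longrightarrow> x \<in> carrier G \<Longrightarrow> f (h \<otimes>\<^bsub>G\<^esub> x) = \<sigma> h *\<^sub>v f x"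
  using assms by (auto simp: induced_space_def)

lemma induced_inj:
  assumes "bij_betw T (carrier_vec D) (induced_space G H d \<sigma>)"
    and xy: "x \<in> carrier_vec D" "y \<in> carrier_vec D" "\<And>z. z \<in> carrier G \<Longrightarrow> T x z = T y z"
  shows "x = y"
proof -
  have "T x = T y" using assms by (intro induced_space_eqI) (auto simp: bij_betw_def)
  then show ?thesis using bij_betw_imp_inj_on[OF assms(1)] xy by (auto dest: inj_onD)
qed

text \<open>Composing with the inverse of \<open>T\<close> turns a linear map into the induced space
  into a matrix. In this way both the group action and the intertwiners between two models become
  matrices.\<close>

lemma induced_linear:
  assumes T: "bij_betw T (carrier_vec D) (induced_space G H d \<sigma>)"
      "\<And>x y z. x \<in> carrier_vec D \<Longrightarrow> y \<in> carrier_vec D \<Longrightarrow> z \<in> carrier G \<Longrightarrow> T (x + y) z = T x z + T y z"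
      "\<And>c x z. x \<in> carrier_vec D \<Longrightarrow> z \<in> carrier G \<Longrightarrow> T (c \<cdot>\<^sub>v x) z = c \<cdot>\<^sub>v T x z"
    and W: "\<And>x. x \<in> carrier_vec n \<Longrightarrow> A x \<in> induced_space G H d \<sigma>"
    and add: "\<And>x y z. x \<in> carrier_vec n \<Longrightarrow> y \<in> carrier_vec n \<Longrightarrow> z \<in> carrier G \<Longrightarrow> A (x + y) z = A x z + A y z"
    and smult: "\<And>c x z. x \<in> carrier_vec n \<Longrightarrow> z \<in> carrier G \<Longrightarrow> A (c \<cdot>\<^sub>v x) z = c \<cdot>\<^sub>v A x z"
  obtains P where "P \<in> carrier_mat D n" "\<And>x. x \<in> carrier_vec n \<Longrightarrow> T (P *\<^sub>v x) = A x"
proof -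
  define L where "L x = inv_into (carrier_vec D) T (A x)" for x
  have L: "L x \<in> carrier_vec D" "T (L x) = A x" if "x \<in> carrier_vec n" for x
    using W[OF that] bij_betw_imp_surj_on[OF T(1)] inv_into_into[of "A x" T "carrier_vec D"]
      f_inv_into_f[of "A x" T "carrier_vec D"] unfolding L_def by simp_all
  obtain P where "P \<in> carrier_mat D n" "\<And>x. x \<in> carrier_vec n \<Longrightarrow> P *\<^sub>v x = L x"
  proof (rule linear_mat[of n L D])
    show "L (x + y) = L x + L y" if "x \<in> carrier_vec n" "y \<in> carrier_vec n" for x y
      by (rule induced_inj[OF T(1)]) (use that in \<open>auto simp: L T add\<close>)
    show "L (c \<cdot>\<^sub>v x) = c \<cdot>\<^sub>v L x" if "x \<in> carrier_vec n" for c x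
      by (rule induced_inj[OF T(1)]) (use that in \<open>auto simp: L T smult\<close>)
  qed (auto simp: L)
  then show thesis using that L by auto
qed

text \<open>\<open>A * B\<close> and \<open>B * A\<close> have the same trace, and the traces of the
  two identity matrices are \<open>n\<close> and \<open>m\<close>.\<close>

lemma left_inverse_square:
  fixes A B :: "complex mat"
  assumes "A \<in> carrier_mat n m" "B \<in> carrier_mat m n" "A * B = 1\<^sub>m n" "B * A = 1\<^sub>m m"
  shows "n = m"
  using trace_mult_swap[OF assms(1,2)] assms(3,4) by simp

text \<open>\<open>H\<close> is the full stabilizer of \<psi> under conjugation. For
  \<open>x\<close> outside \<open>H\<close>, some \<open>n\<close> and its conjugate by
  \<open>x\<close> have different values, and this separates the cosets of \<open>H\<close> in the
  induced space.\<close>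

locale clifford = group G for G (structure) +
  fixes N H :: "'a set" and \<psi> :: "'a \<Rightarrow> complex"
  assumes finG: "finite (carrier G)"
    and N: "subgroup N G" "\<And>x n. x \<in> carrier G \<Longrightarrow> n \<in> N \<Longrightarrow> x \<otimes> n \<otimes> inv x \<in> N"
    and H: "subgroup H G" "N \<subseteq> H"
    and Hst: "\<And>g. g \<in> H \<longleftrightarrow> g \<in> carrier G \<and> (\<forall>n\<in>N. \<psi> (g \<otimes> n \<otimes> inv g) = \<psi> n)"

locale clifford_rep = clifford +
  fixes d :: nat and \<sigma> :: "'a \<Rightarrow> complex mat"
  assumes \<sigma>: "rep_on G H d \<sigma>" "irr_on H d \<sigma>" "\<And>n. n \<in> N \<Longrightarrow> \<sigma> n = \<psi> n \<cdot>\<^sub>m 1\<^sub>m d"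
begin

sublocale N: subgroup N G by (rule N)
sublocale H: subgroup H G by (rule H)

abbreviation "W \<equiv> induced_space G H d \<sigma>"

lemma \<sigma>_closed: "h \<in> H \<Longrightarrow> \<sigma> h \<in> carrier_mat d d" using \<sigma>(1) by (rule rep_on_closed)
lemma \<sigma>_mult: "g \<in> H \<Longrightarrow> h \<in> H \<Longrightarrow> \<sigma> (g \<otimes> h) = \<sigma> g * \<sigma> h" using \<sigma>(1) by (rule rep_on_mult)
lemma \<sigma>_one: "\<sigma> \<one> = 1\<^sub>m d" using \<sigma>(1) by (rule rep_on_one)
lemma d_pos: "0 < d" using \<sigma>(2) by (auto simp: irr_on_def)

lemma \<sigma>_inj:
  assumes "h \<in> H" "v \<in> carrier_vec d" "\<sigma> h *\<^sub>v v = 0\<^sub>v d"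
  shows "v = 0\<^sub>v d"
proof -
  have "v = \<sigma> (inv h \<otimes> h) *\<^sub>v v" using assms by (simp add: \<sigma>_one)
  also have "\<dots> = \<sigma> (inv h) *\<^sub>v (\<sigma> h *\<^sub>v v)"
    using assms \<sigma>_closed[of h] \<sigma>_closed[of "inv h"] by (subst \<sigma>_mult) auto
  also have "\<dots> = 0\<^sub>v d" using assms \<sigma>_closed[of "inv h"] by auto
  finally show ?thesis .
qed

text \<open>Moving \<open>n\<close> to the left of \<open>x\<close> conjugates it by
  \<open>x\<close>, and \<sigma> is scalar on \<open>N\<close>. So the values on different cosets of
  \<open>H\<close> belong to different conjugates of \<psi>.\<close>

lemma W_N:
  assumes "f \<in> W" "x \<in> carrier G" "n \<in> N"
  shows "f (x \<otimes> n) = \<psi> (x \<otimes> n \<otimes> inv x) \<cdot>\<^sub>v f x"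
proof -
  have "f (x \<otimes> n) = f ((x \<otimes> n \<otimes> inv x) \<otimes> x)"
    using assms by (simp add: m_assoc)
  also have "\<dots> = \<sigma> (x \<otimes> n \<otimes> inv x) *\<^sub>v f x"
    using assms N H(2) by (intro induced_spaceD(2)[OF assms(1)]) auto
  also have "\<dots> = \<psi> (x \<otimes> n \<otimes> inv x) \<cdot>\<^sub>v f x"
    using assms induced_spaceD(1)[OF assms(1,2)]
    by (subst \<sigma>(3)) (auto simp: N intro!: eq_vecI simp: smult_scalar_prod_distrib[of _ d])
  finally show ?thesis .
qed

text \<open>The function supported on the coset \<open>H y\<close> with value \<open>v\<close> at
  \<open>y\<close>; such functions span the induced space.\<close>

definition point :: "'a \<Rightarrow> complex vec \<Rightarrow> 'a \<Rightarrow> complex vec" where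
  "point y v = (\<lambda>x\<in>carrier G. if x \<otimes> inv y \<in> H then \<sigma> (x \<otimes> inv y) *\<^sub>v v else 0\<^sub>v d)"

lemma point_W: "v \<in> carrier_vec d \<Longrightarrow> y \<in> carrier G \<Longrightarrow> point y v \<in> W"
  unfolding induced_space_def
proof (intro CollectI conjI ballI)
  assume v: "v \<in> carrier_vec d" and y: "y \<in> carrier G"
  show "point y v \<in> carrier G \<rightarrow>\<^sub>E carrier_vec d"
    using v \<sigma>_closed by (auto simp: point_def) (metis mult_mat_vec_carrier)
  fix h x assume h: "h \<in> H" and x: "x \<in> carrier G"
  have *: "h \<otimes> x \<otimes> inv y = h \<otimes> (x \<otimes> inv y)" using h x y by (simp add: m_assoc)
  have "h \<otimes> (x \<otimes> inv y) \<in> H \<longleftrightarrow> x \<otimes> inv y \<in> H"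
  proof
    assume "h \<otimes> (x \<otimes> inv y) \<in> H"
    then have "inv h \<otimes> (h \<otimes> (x \<otimes> inv y)) \<in> H" using h by auto
    then show "x \<otimes> inv y \<in> H" using h x y by (simp add: m_assoc[symmetric])
  qed (use h in auto)
  then show "point y v (h \<otimes> x) = \<sigma> h *\<^sub>v point y v x"
    using h x y v \<sigma>_closed[OF h] \<sigma>_closed[of "x \<otimes> inv y"]
    by (auto simp: point_def * \<sigma>_mult)
qed

lemma point_self: "v \<in> carrier_vec d \<Longrightarrow> y \<in> carrier G \<Longrightarrow> point y v y = v"
  by (simp add: point_def \<sigma>_one)

lemma point_coset:
  assumes "f \<in> W" "y \<in> carrier G" "z \<in> carrier G"
  shows "point y (f y) z = (if z \<otimes> inv y \<in> H then f z else 0\<^sub>v d)"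
  using assms induced_spaceD(2)[OF assms(1), of "z \<otimes> inv y" y]
  by (auto simp: point_def m_assoc)

text \<open>Representatives \<open>t i\<close> of the cosets identify the induced space with
  \<open>k\<close> blocks of length \<open>d\<close>: a function is determined by its values at the
  representatives, and these can be prescribed.\<close>

lemma induced_exists: "\<exists>D R T. rep_on G (carrier G) D R \<and> ind_map G H d \<sigma> D R T"
proof -
  have fin: "finite (rcosets H)" using finG by (simp add: RCOSETS_def)
  obtain c where c: "bij_betw c {0..<card (rcosets H)} (rcosets H)" using ex_bij_betw_nat_finite[OF fin] ..
  define k where "k = card (rcosets H)"
  define t where "t i = (SOME x. x \<in> carrier G \<and> H #> x = c i)" for i
  have t: "t i \<in> carrier G" "H #> t i = c i" if "i < k" for i
  proof -
    have "c i \<in> rcosets H" using c that by (auto simp: bij_betw_def k_def)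
    then have "\<exists>x. x \<in> carrier G \<and> H #> x = c i" by (auto simp: RCOSETS_def)
    then show "t i \<in> carrier G" "H #> t i = c i" unfolding t_def by (metis (mono_tags, lifting) someI_ex)+
  qed
  define idx where "idx x = inv_into {0..<k} c (H #> x)" for x
  have idx: "idx x < k" "c (idx x) = H #> x" if "x \<in> carrier G" for x
  proof -
    have "H #> x \<in> c ` {0..<k}" using that c by (auto simp: bij_betw_def k_def RCOSETS_def)
    then show "idx x < k" "c (idx x) = H #> x"
      unfolding idx_def using inv_into_into[of "H #> x" c "{0..<k}"] by (auto simp: f_inv_into_f)
  qed
  have idx_t: "idx (t i) = i" if "i < k" for i
    using c that t[OF that] inv_into_f_f[of c "{0..<k}" i] by (auto simp: idx_def bij_betw_def k_def)
  have xt: "x \<otimes> inv (t (idx x)) \<in> H" if x: "x \<in> carrier G" for x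
  proof -
    have "x \<in> H #> t (idx x)" using rcos_self[OF x H(1)] idx[OF x] t by simp
    then obtain h where "h \<in> H" "x = h \<otimes> t (idx x)" by (auto simp: r_coset_def)
    then have "h \<in> H" "x \<otimes> inv (t (idx x)) = h"
      using t[OF idx(1)[OF x]] H.mem_carrier by (metis inv_solve_right' m_closed x)+
    then show ?thesis by simp
  qed
  have idx_H: "idx (h \<otimes> x) = idx x" if "h \<in> H" "x \<in> carrier G" for h x
  proof -
    have "h \<otimes> x \<in> H #> x" using that by (auto simp: r_coset_def)
    then have "H #> x = H #> (h \<otimes> x)" using repr_independence that(2) H(1) by blast
    then show ?thesis by (simp add: idx_def)
  qed
  \<comment> \<open>The \<open>i\<close>-th block of length \<open>d\<close> of \<open>v\<close>
    becomes the value at \<open>t i\<close>.\<close>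
  define blk where "blk i v = vec d (\<lambda>j. v $ (i * d + j))" for i and v :: "complex vec"
  define T where "T v = (\<lambda>x\<in>carrier G. \<sigma> (x \<otimes> inv (t (idx x))) *\<^sub>v blk (idx x) v)" for v
  have blk: "blk i v \<in> carrier_vec d" for i v by (simp add: blk_def)
  have lt: "i * d + j < k * d" if "i < k" "j < d" for i j
  proof -
    have "i * d + j < (i + 1) * d" using that by simp
    also have "\<dots> \<le> k * d" using that by (intro mult_le_mono1) simp
    finally show ?thesis .
  qed
  have TW: "T v \<in> W" for v
    unfolding induced_space_def
  proof (intro CollectI conjI ballI)
    show "T v \<in> carrier G \<rightarrow>\<^sub>E carrier_vec d"
      using \<sigma>_closed[OF xt] blk by (auto simp: T_def) (metis mult_mat_vec_carrier)
    fix h x assume h: "h \<in> H" and x: "x \<in> carrier G"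
    have "h \<otimes> x \<otimes> inv (t (idx x)) = h \<otimes> (x \<otimes> inv (t (idx x)))"
      using h x t[OF idx(1)[OF x]] by (simp add: m_assoc)
    then show "T v (h \<otimes> x) = \<sigma> h *\<^sub>v T v x"
      using h x \<sigma>_closed[OF h] \<sigma>_closed[OF xt[OF x]] blk xt[OF x] by (simp add: T_def idx_H \<sigma>_mult)
  qed
  have Tt: "T v (t i) = blk i v" if "i < k" for i v
    using t[OF that] blk by (simp add: T_def idx_t[OF that] \<sigma>_one)
  have bij: "bij_betw T (carrier_vec (k * d)) W"
  proof (rule bij_betw_imageI, rule inj_onI)
    fix u v assume uv: "u \<in> carrier_vec (k * d)" "v \<in> carrier_vec (k * d)" "T u = T v"
    show "u = v"
    proof (rule eq_vecI)
      fix a assume "a < dim_vec v"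
      then have a: "a < k * d" using uv by simp
      then have i: "a div d < k" and j: "a mod d < d" using d_pos by (auto simp: less_mult_imp_div_less)
      have "blk (a div d) u $ (a mod d) = blk (a div d) v $ (a mod d)"
        using uv(3) Tt[OF i] by metis
      then show "u $ a = v $ a" using j by (simp add: blk_def)
    qed (use uv in auto)
  next
    have "f \<in> T ` carrier_vec (k * d)" if f: "f \<in> W" for f
    proof -
    define v where "v = vec (k * d) (\<lambda>a. f (t (a div d)) $ (a mod d))"
    have b: "blk i v = f (t i)" if "i < k" for i
      using induced_spaceD(1)[OF f t(1)[OF that]] lt[OF that] d_pos
      by (intro eq_vecI) (auto simp: blk_def v_def)
    have "f = T v"
    proof (rule induced_space_eqI[OF f TW])
      fix z assume z: "z \<in> carrier G"
      have "f z = f ((z \<otimes> inv (t (idx z))) \<otimes> t (idx z))"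
        using z t[OF idx(1)[OF z]] by (simp add: m_assoc)
      also have "\<dots> = \<sigma> (z \<otimes> inv (t (idx z))) *\<^sub>v f (t (idx z))"
        using induced_spaceD(2)[OF f xt[OF z] t(1)[OF idx(1)[OF z]]] .
      finally show "f z = T v z" using z b[OF idx(1)[OF z]] by (simp add: T_def)
    qed
    then show ?thesis by (auto simp: v_def)
    qed
    then show "T ` carrier_vec (k * d) = W" using TW by auto
  qed
  have Tadd: "T (x + y) z = T x z + T y z"
    if "x \<in> carrier_vec (k * d)" "y \<in> carrier_vec (k * d)" "z \<in> carrier G" for x y z
  proof -
    have "blk (idx z) (x + y) = blk (idx z) x + blk (idx z) y"
      using that lt[OF idx(1)[OF that(3)]] by (intro eq_vecI) (auto simp: blk_def)
    then show ?thesis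
      using that mult_add_distrib_mat_vec[OF \<sigma>_closed[OF xt[OF that(3)]] blk blk] by (simp add: T_def)
  qed
  have Tsm: "T (e \<cdot>\<^sub>v x) z = e \<cdot>\<^sub>v T x z"
    if "x \<in> carrier_vec (k * d)" "z \<in> carrier G" for x z e
  proof -
    have "blk (idx z) (e \<cdot>\<^sub>v x) = e \<cdot>\<^sub>v blk (idx z) x"
      using that lt[OF idx(1)[OF that(2)]] by (intro eq_vecI) (auto simp: blk_def)
    then show ?thesis
      using that mult_mat_vec[OF \<sigma>_closed[OF xt[OF that(2)]] blk] by (simp add: T_def)
  qed
  have I: "ind_map G H d \<sigma> (k * d) R T \<longleftrightarrow>
    (\<forall>g \<in> carrier G. \<forall>x \<in> carrier_vec (k * d). \<forall>z\<in>carrier G. T (R g *\<^sub>v x) z = T x (z \<otimes> g))" for R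
    using bij Tadd Tsm by (auto simp: ind_map_def)
  note inj = induced_inj[OF bij]
  have tr: "(\<lambda>z\<in>carrier G. f (z \<otimes> g)) \<in> W" if "f \<in> W" "g \<in> carrier G" for f g
    using that by (auto simp: induced_space_def m_assoc)
  have "\<exists>P. P \<in> carrier_mat (k * d) (k * d) \<and> (\<forall>x\<in>carrier_vec (k * d). \<forall>z\<in>carrier G. T (P *\<^sub>v x) z = T x (z \<otimes> g))"
    if g: "g \<in> carrier G" for g
  proof -
    have W: "(\<lambda>z\<in>carrier G. T x (z \<otimes> g)) \<in> W" if "x \<in> carrier_vec (k * d)" for x by (rule tr[OF TW g])
    show ?thesis
      by (rule induced_linear[OF bij Tadd Tsm W]) (use g in \<open>auto simp: Tadd Tsm fun_eq_iff\<close>)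
  qed
  then obtain R where R: "\<And>g. g \<in> carrier G \<Longrightarrow> R g \<in> carrier_mat (k * d) (k * d)"
    "\<And>g x z. g \<in> carrier G \<Longrightarrow> x \<in> carrier_vec (k * d) \<Longrightarrow> z \<in> carrier G \<Longrightarrow> T (R g *\<^sub>v x) z = T x (z \<otimes> g)"
    by metis
  have "rep_on G (carrier G) (k * d) R"
    unfolding rep_on_def
  proof (intro conjI ballI)
    fix g h assume g: "g \<in> carrier G" and h: "h \<in> carrier G"
    show "R (g \<otimes> h) = R g * R h"
    proof (rule mat_eq_by_vec[of _ "k * d" "k * d"])
      fix x :: "complex vec" assume x: "x \<in> carrier_vec (k * d)"
      have "R (g \<otimes> h) *\<^sub>v x = R g *\<^sub>v (R h *\<^sub>v x)"
        by (rule inj) (use R(1)[of "g \<otimes> h"] R(1)[OF g] R(1)[OF h] g h x in \<open>auto simp: R(2) m_assoc\<close>)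
      then show "R (g \<otimes> h) *\<^sub>v x = (R g * R h) *\<^sub>v x" using R(1)[OF g] R(1)[OF h] x by auto
    qed (use R(1)[OF g] R(1)[OF h] R(1)[of "g \<otimes> h"] g h in auto)
  next
    show "R \<one> = 1\<^sub>m (k * d)"
    proof (rule mat_eq_by_vec[of _ "k * d" "k * d"])
      fix x :: "complex vec" assume x: "x \<in> carrier_vec (k * d)"
      show "R \<one> *\<^sub>v x = 1\<^sub>m (k * d) *\<^sub>v x"
        by (rule inj) (use R(1)[of \<one>] x in \<open>auto simp: R(2)\<close>)
    qed (use R(1) in auto)
  qed (use R in auto)
  then show ?thesis using I R by blast
qed

end

section \<open>Irreducibility of the induced representation\<close>

locale clifford_ind = clifford_rep +
  fixes D :: nat and R :: "'a \<Rightarrow> complex mat" and T :: "complex vec \<Rightarrow> 'a \<Rightarrow> complex vec"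
  assumes R: "rep_on G (carrier G) D R" and T: "ind_map G H d \<sigma> D R T"
begin

lemmas Tb = ind_mapD(1)[OF T] and T_add = ind_mapD(2)[OF T] and T_smult = ind_mapD(3)[OF T]
  and T_R = ind_mapD(4)[OF T] and T_W = ind_mapD(5)[OF T]

lemma R_closed: "g \<in> carrier G \<Longrightarrow> R g \<in> carrier_mat D D" using R by (rule rep_on_closed)

lemmas T_eqI = induced_inj[OF Tb]

lemma T_zero: "z \<in> carrier G \<Longrightarrow> T (0\<^sub>v D) z = 0\<^sub>v d"
proof -
  assume z: "z \<in> carrier G"
  have "0 \<cdot>\<^sub>v 0\<^sub>v D = (0\<^sub>v D :: complex vec)" by (auto intro!: eq_vecI)
  then have "T (0\<^sub>v D) z = T (0 \<cdot>\<^sub>v 0\<^sub>v D) z" by simp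
  also have "\<dots> = 0 \<cdot>\<^sub>v T (0\<^sub>v D) z" using z by (intro T_smult) auto
  also have "\<dots> = 0\<^sub>v d" using induced_spaceD(1)[OF T_W[of "0\<^sub>v D"] z] by (auto intro!: eq_vecI)
  finally show ?thesis .
qed

lemma T_nonzero:
  assumes "x \<in> carrier_vec D" "x \<noteq> 0\<^sub>v D"
  obtains z where "z \<in> carrier G" "T x z \<noteq> 0\<^sub>v d"
  using assms T_eqI[of x "0\<^sub>v D"] T_zero by auto

definition pt :: "'a \<Rightarrow> complex vec \<Rightarrow> complex vec" where
  "pt y v = inv_into (carrier_vec D) T (point y v)"

lemma pt:
  assumes "y \<in> carrier G" "v \<in> carrier_vec d"
  shows "pt y v \<in> carrier_vec D" "T (pt y v) = point y v"
  using point_W[OF assms(2,1)] bij_betw_imp_surj_on[OF Tb] f_inv_into_f[of "point y v" T "carrier_vec D"]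
    inv_into_into[of "point y v" T "carrier_vec D"] unfolding pt_def by simp_all

lemma pt_add:
  assumes "u \<in> carrier_vec d" "v \<in> carrier_vec d"
  shows "pt \<one> (u + v) = pt \<one> u + pt \<one> v"
proof (rule T_eqI)
  fix z assume z: "z \<in> carrier G"
  show "T (pt \<one> (u + v)) z = T (pt \<one> u + pt \<one> v) z"
    using z assms pt[of \<one>] mult_add_distrib_mat_vec[OF \<sigma>_closed assms]
    by (simp add: T_add point_def)
qed (use assms pt in auto)

lemma pt_smult:
  assumes "u \<in> carrier_vec d"
  shows "pt \<one> (c \<cdot>\<^sub>v u) = c \<cdot>\<^sub>v pt \<one> u"
proof (rule T_eqI)
  fix z assume z: "z \<in> carrier G"
  show "T (pt \<one> (c \<cdot>\<^sub>v u)) z = T (c \<cdot>\<^sub>v pt \<one> u) z"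
    using z assms pt[of \<one>] mult_mat_vec[OF \<sigma>_closed assms]
    by (auto simp add: T_smult point_def)
qed (use assms pt in auto)

lemma pt_H:
  assumes "u \<in> carrier_vec d" "h \<in> H"
  shows "pt \<one> (\<sigma> h *\<^sub>v u) = R h *\<^sub>v pt \<one> u"
proof (rule T_eqI)
  have c: "\<sigma> h *\<^sub>v u \<in> carrier_vec d" using \<sigma>_closed[OF assms(2)] assms by simp
  show "pt \<one> (\<sigma> h *\<^sub>v u) \<in> carrier_vec D" using c pt by simp
  show "R h *\<^sub>v pt \<one> u \<in> carrier_vec D" using assms pt[of \<one> u] R_closed[of h] by simp
  fix z assume z: "z \<in> carrier G"
  have iff: "z \<otimes> h \<in> H \<longleftrightarrow> z \<in> H"
  proof
    assume "z \<otimes> h \<in> H"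
    then have "z \<otimes> h \<otimes> inv h \<in> H" using assms by auto
    then show "z \<in> H" using z assms by (simp add: m_assoc)
  qed (use assms in auto)
  have "T (R h *\<^sub>v pt \<one> u) z = point \<one> u (z \<otimes> h)"
    using z assms pt[of \<one> u] by (simp add: T_R)
  also have "\<dots> = point \<one> (\<sigma> h *\<^sub>v u) z"
    using z assms iff \<sigma>_closed[of z] \<sigma>_closed[of h] by (auto simp: point_def \<sigma>_mult)
  finally show "T (pt \<one> (\<sigma> h *\<^sub>v u)) z = T (R h *\<^sub>v pt \<one> u) z" using c pt by simp
qed

text \<open>Right translation by \<open>inv y\<close> moves the support from \<open>H\<close> to the
  coset \<open>H y\<close>.\<close>

lemma pt_translate:
  assumes "u \<in> carrier_vec d" "y \<in> carrier G"
  shows "R (inv y) *\<^sub>v pt \<one> u = pt y u"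
  by (rule T_eqI)
    (use assms pt[of \<one> u] pt[of y u] R_closed[of "inv y"] in \<open>auto simp: T_R point_def\<close>)

lemma pt_nonzero:
  assumes "u \<in> carrier_vec d" "u \<noteq> 0\<^sub>v d"
  shows "pt \<one> u \<noteq> 0\<^sub>v D"
proof
  assume "pt \<one> u = 0\<^sub>v D"
  then have "T (pt \<one> u) \<one> = 0\<^sub>v d" using T_zero by simp
  then show False using assms pt[of \<one> u] point_self[of u \<one>] by simp
qed

lemma pt_N:
  assumes "u \<in> carrier_vec d" "n \<in> N"
  shows "R n *\<^sub>v pt \<one> u = \<psi> n \<cdot>\<^sub>v pt \<one> u"
proof -
  have "R n *\<^sub>v pt \<one> u = pt \<one> (\<sigma> n *\<^sub>v u)" using pt_H assms H by auto
  also have "\<sigma> n *\<^sub>v u = \<psi> n \<cdot>\<^sub>v u"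
    using assms by (subst \<sigma>(3)) (auto intro!: eq_vecI simp: smult_scalar_prod_distrib[of _ d])
  finally show ?thesis using assms pt_smult by simp
qed

lemma nonzero_vec_exists: "\<exists>u\<in>carrier_vec d. u \<noteq> (0\<^sub>v d :: complex vec)"
  using d_pos by (intro bexI[of _ "unit_vec d 0"]) auto

lemma D_pos: "0 < D"
proof -
  obtain u :: "complex vec" where "u \<in> carrier_vec d" "u \<noteq> 0\<^sub>v d" using nonzero_vec_exists by auto
  then have "pt \<one> u \<in> carrier_vec D" "pt \<one> u \<noteq> 0\<^sub>v D" using pt pt_nonzero by auto
  then show ?thesis by (metis carrier_vecD eq_vecI gr0I index_zero_vec(2) less_nat_zero_code)
qed

lemma contains: "contains_char N D R \<psi>"
proof -
  obtain u :: "complex vec" where "u \<in> carrier_vec d" "u \<noteq> 0\<^sub>v d" using nonzero_vec_exists by auto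
  then show ?thesis unfolding contains_char_def using pt[of \<one> u] pt_nonzero pt_N by blast
qed

definition supp :: "complex vec \<Rightarrow> 'a set" where
  "supp x = {z \<in> carrier G. T x z \<noteq> 0\<^sub>v d}"

lemma supp_finite: "finite (supp x)" using finG by (simp add: supp_def)

text \<open>An argument with minimal supports. A nonzero vector of \<open>S\<close> with smallest
  support, translated so that it does not vanish at the unit, is supported on \<open>H\<close>.
  Irreducibility of \<sigma> then puts every function supported on \<open>H\<close> into
  \<open>S\<close>, and the translates of these span the induced space.\<close>

lemma irr: "irr_on (carrier G) D R"
  unfolding irr_on_def
proof (intro conjI allI impI)
  fix S assume S: "vsub D S" and inv: "\<forall>g\<in>carrier G. \<forall>x\<in>S. R g *\<^sub>v x \<in> S"
  have Sc: "x \<in> S \<Longrightarrow> x \<in> carrier_vec D" and S0: "0\<^sub>v D \<in> S" and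
    Sa: "x \<in> S \<Longrightarrow> y \<in> S \<Longrightarrow> x + y \<in> S" and Sm: "x \<in> S \<Longrightarrow> c \<cdot>\<^sub>v x \<in> S" for x y c
    using S by (auto simp: vsub_def)
  have SR: "g \<in> carrier G \<Longrightarrow> x \<in> S \<Longrightarrow> R g *\<^sub>v x \<in> S" for g x using inv by auto
  show "S = {0\<^sub>v D} \<or> S = carrier_vec D"
  proof (cases "S = {0\<^sub>v D}")
    case False
    let ?P = "\<lambda>w. w \<in> S \<and> w \<noteq> 0\<^sub>v D"
    have "\<exists>w. ?P w" using False S0 by auto
    then obtain w0 where w0: "?P w0" "\<And>w. ?P w \<Longrightarrow> card (supp w0) \<le> card (supp w)"
      using ex_has_least_nat[of ?P _ "\<lambda>w. card (supp w)"] by blast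
    have w0c: "w0 \<in> carrier_vec D" using w0 Sc by auto
    obtain y where y: "y \<in> carrier G" "T w0 y \<noteq> 0\<^sub>v d" using T_nonzero w0(1) Sc by blast
    define w where "w = R y *\<^sub>v w0"
    have wS: "w \<in> S" using w0 SR y w_def by simp
    have wc: "w \<in> carrier_vec D" using wS Sc by auto
    have Tw: "T w z = T w0 (z \<otimes> y)" if "z \<in> carrier G" for z
      using that y w0c by (simp add: w_def T_R)
    have w1: "T w \<one> \<noteq> 0\<^sub>v d" using Tw[of \<one>] y by simp
    have "card (supp w) = card (supp w0)"
    proof (rule bij_betw_same_card)
      show "bij_betw (\<lambda>z. z \<otimes> y) (supp w) (supp w0)"
        by (rule bij_betw_byWitness[where f' = "\<lambda>z. z \<otimes> inv y"])
          (use y in \<open>auto simp: supp_def Tw m_assoc\<close>)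
    qed
    then have min: "card (supp w) \<le> card (supp w')" if "w' \<in> S" "w' \<noteq> 0\<^sub>v D" for w'
      using w0(2) that by simp
    have supp_H: "T w x = 0\<^sub>v d" if x: "x \<in> carrier G" "x \<notin> H" for x
    proof (rule ccontr)
      assume nz: "T w x \<noteq> 0\<^sub>v d"
      obtain n where n: "n \<in> N" "\<psi> (x \<otimes> n \<otimes> inv x) \<noteq> \<psi> n" using x Hst by blast
      define c where "c = \<psi> (x \<otimes> n \<otimes> inv x)"
      \<comment> \<open>By \<open>W_N\<close> the value at \<open>z\<close> is multiplied by
        \<open>\<psi> (z \<otimes> n \<otimes> inv z) - c\<close>. This kills the value at
        \<open>x\<close> and keeps a nonzero one at the unit, so the support shrinks.\<close>
      define w' where "w' = R n *\<^sub>v w + (- c) \<cdot>\<^sub>v w"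
      have nG: "n \<in> carrier G" using n by auto
      have w'S: "w' \<in> S" using wS n SR Sm Sa nG by (simp add: w'_def)
      have Tw': "T w' z = (\<psi> (z \<otimes> n \<otimes> inv z) - c) \<cdot>\<^sub>v T w z" if z: "z \<in> carrier G" for z
      proof -
        have "T w' z = T (R n *\<^sub>v w) z + (- c) \<cdot>\<^sub>v T w z"
          unfolding w'_def using wc R_closed[OF nG] z by (simp add: T_add T_smult)
        also have "T (R n *\<^sub>v w) z = \<psi> (z \<otimes> n \<otimes> inv z) \<cdot>\<^sub>v T w z"
          using W_N[OF T_W[OF wc] z n(1)] wc nG z by (simp add: T_R)
        finally show ?thesis
          using induced_spaceD(1)[OF T_W[OF wc] z] by (auto intro!: eq_vecI simp: algebra_simps)
      qed
      have "T w' \<one> \<noteq> 0\<^sub>v d"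
      proof
        assume "T w' \<one> = 0\<^sub>v d"
        then have "(\<psi> n - c) \<cdot>\<^sub>v T w \<one> = 0\<^sub>v d" using Tw'[of \<one>] nG by simp
        moreover have "T w \<one> = inverse (\<psi> n - c) \<cdot>\<^sub>v ((\<psi> n - c) \<cdot>\<^sub>v T w \<one>)"
          using n by (simp add: smult_smult_assoc c_def)
        ultimately have "T w \<one> = inverse (\<psi> n - c) \<cdot>\<^sub>v 0\<^sub>v d" by simp
        also have "\<dots> = 0\<^sub>v d" by (auto intro!: eq_vecI)
        finally show False using w1 by simp
      qed
      then have "w' \<noteq> 0\<^sub>v D" using T_zero by auto
      moreover have "supp w' \<subset> supp w"
      proof
        show "supp w' \<subseteq> supp w"
        proof
          fix z assume z: "z \<in> supp w'"
          then have zG: "z \<in> carrier G" by (simp add: supp_def)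
          have "(\<psi> (z \<otimes> n \<otimes> inv z) - c) \<cdot>\<^sub>v 0\<^sub>v d = 0\<^sub>v d" by (auto intro!: eq_vecI)
          then show "z \<in> supp w" using z Tw'[OF zG] by (auto simp: supp_def)
        qed
        have "T w' x = 0\<^sub>v d"
          using Tw'[OF x(1)] induced_spaceD(1)[OF T_W[OF wc] x(1)] by (auto simp: c_def intro!: eq_vecI)
        then show "supp w' \<noteq> supp w" using nz x by (auto simp: supp_def)
      qed
      ultimately show False using min[OF w'S] psubset_card_mono[OF supp_finite] by (metis not_le)
    qed
    define V where "V = {v \<in> carrier_vec d. pt \<one> v \<in> S}"
    define v1 where "v1 = T w \<one>"
    have v1: "v1 \<in> carrier_vec d" "v1 \<noteq> 0\<^sub>v d"
      using w1 induced_spaceD(1)[OF T_W[OF wc], of \<one>] by (auto simp: v1_def)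
    have "pt \<one> v1 = w"
    proof (rule T_eqI)
      fix z assume z: "z \<in> carrier G"
      show "T (pt \<one> v1) z = T w z"
        using pt[of \<one> v1] v1 point_coset[OF T_W[OF wc], of \<one> z] z supp_H[of z] by (auto simp: v1_def)
    qed (use pt v1 wc in auto)
    then have "v1 \<in> V" using wS v1 by (simp add: V_def)
    have "V = carrier_vec d"
    proof (rule irr_onD[OF \<sigma>(2), of V v1])
      have "pt \<one> (0\<^sub>v d) = 0\<^sub>v D"
      proof -
        have "0 \<cdot>\<^sub>v 0\<^sub>v d = (0\<^sub>v d :: complex vec)" by (auto intro!: eq_vecI)
        then have "pt \<one> (0\<^sub>v d) = pt \<one> (0 \<cdot>\<^sub>v 0\<^sub>v d)" by simp
        also have "\<dots> = 0 \<cdot>\<^sub>v pt \<one> (0\<^sub>v d)" by (rule pt_smult) simp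
        also have "\<dots> = 0\<^sub>v D" using pt[of \<one> "0\<^sub>v d"] by (auto intro!: eq_vecI)
        finally show ?thesis .
      qed
      then show "0\<^sub>v d \<in> V" using S0 by (simp add: V_def)
      show "\<sigma> g *\<^sub>v x \<in> V" if "g \<in> H" "x \<in> V" for g x
        using that SR[of g "pt \<one> x"] \<sigma>_closed[of g] by (auto simp: V_def pt_H)
    qed (use \<open>v1 \<in> V\<close> v1 Sa Sm in \<open>auto simp: V_def pt_add pt_smult\<close>)
    then have ptS: "pt y v \<in> S" if "v \<in> carrier_vec d" "y \<in> carrier G" for v y
      using that SR[of "inv y" "pt \<one> v"] pt_translate[of v y] by (auto simp: V_def)
    have "u \<in> S" if "u \<in> carrier_vec D" for u
      using that
    \<comment> \<open>Removing the part of \<open>u\<close> on the coset of \<open>x\<close> shrinks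
      the support, and the removed vector \<open>pt x v\<close> lies in \<open>S\<close> by
      \<open>ptS\<close>.\<close>
    proof (induction "card (supp u)" arbitrary: u rule: less_induct)
      case less
      show ?case
      proof (cases "u = 0\<^sub>v D")
        case False
        obtain x where x: "x \<in> carrier G" "T u x \<noteq> 0\<^sub>v d" using T_nonzero[OF less.prems False] by auto
        define v where "v = T u x"
        have v: "v \<in> carrier_vec d" using induced_spaceD(1)[OF T_W[OF less.prems] x(1)] by (simp add: v_def)
        define u' where "u' = u + (- 1) \<cdot>\<^sub>v pt x v"
        have u'c: "u' \<in> carrier_vec D" using less.prems pt[OF x(1) v] by (simp add: u'_def)
        have Tu': "T u' z = (if z \<otimes> inv x \<in> H then 0\<^sub>v d else T u z)" if z: "z \<in> carrier G" for z
        proof -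
          have "T u' z = T u z + (- 1) \<cdot>\<^sub>v point x v z"
            using z less.prems pt[OF x(1) v] by (simp add: u'_def T_add T_smult)
          then show ?thesis
            using point_coset[OF T_W[OF less.prems] x(1) z] induced_spaceD(1)[OF T_W[OF less.prems] z]
            by (auto simp: v_def intro!: eq_vecI)
        qed
        have "supp u' \<subset> supp u"
        proof
          show "supp u' \<subseteq> supp u"
          proof
            fix z assume "z \<in> supp u'"
            then show "z \<in> supp u" using Tu'[of z] by (simp add: supp_def split: if_splits)
          qed
          have "x \<in> supp u" "x \<notin> supp u'" using Tu'[OF x(1)] x by (simp_all add: supp_def)
          then show "supp u' \<noteq> supp u" by blast
        qed
        then have "card (supp u') < card (supp u)" by (rule psubset_card_mono[OF supp_finite])
        then have "u' \<in> S" using less.hyps u'c by auto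
        then have "u' + pt x v \<in> S" using ptS v x Sa by auto
        moreover have "u' + pt x v = u"
          using less.prems pt[OF x(1) v] by (auto simp: u'_def intro!: eq_vecI)
        ultimately show ?thesis by simp
      qed (use S0 in auto)
    qed
    then show ?thesis using Sc by auto
  qed simp
qed (rule D_pos)

end

text \<open>Schur's lemma: the kernel and the image of the intertwiner are invariant
  subspaces.\<close>

lemma irr_intertwiner_bij:
  fixes P :: "complex mat"
  assumes irr: "irr_on H D R" "irr_on H D' R'"
    and c: "\<And>h. h \<in> H \<Longrightarrow> R h \<in> carrier_mat D D" "\<And>h. h \<in> H \<Longrightarrow> R' h \<in> carrier_mat D' D'"
    and P: "P \<in> carrier_mat D' D" "P \<noteq> 0\<^sub>m D' D" and PR: "\<And>h. h \<in> H \<Longrightarrow> P * R h = R' h * P"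
  shows "bij_betw (\<lambda>x. P *\<^sub>v x) (carrier_vec D) (carrier_vec D')"
proof -
  have PRv: "P *\<^sub>v (R h *\<^sub>v x) = R' h *\<^sub>v (P *\<^sub>v x)" if "h \<in> H" "x \<in> carrier_vec D" for h x
    using PR[OF that(1)] c(1)[OF that(1)] c(2)[OF that(1)] P that(2) by (metis assoc_mult_mat_vec)
  have P0: "P *\<^sub>v 0\<^sub>v D = 0\<^sub>v D'" using P by (auto intro!: eq_vecI)
  have "\<exists>w\<in>carrier_vec D. P *\<^sub>v w \<noteq> 0\<^sub>v D'"
  proof (rule ccontr)
    assume "\<not> ?thesis"
    then have z: "P *\<^sub>v x = 0\<^sub>v D'" if "x \<in> carrier_vec D" for x using that by blast
    have "P = 0\<^sub>m D' D" using P z by (intro mat_eq_by_vec[of _ D' D]) (auto intro!: eq_vecI)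
    then show False using P by simp
  qed
  then obtain w where w: "w \<in> carrier_vec D" "P *\<^sub>v w \<noteq> 0\<^sub>v D'" by blast
  have ker: "x = 0\<^sub>v D" if x: "x \<in> carrier_vec D" "P *\<^sub>v x = 0\<^sub>v D'" for x
  proof (rule ccontr)
    assume x0: "x \<noteq> 0\<^sub>v D"
    have "{x \<in> carrier_vec D. P *\<^sub>v x = 0\<^sub>v D'} = carrier_vec D"
    proof (rule irr_onD[OF irr(1), of _ x])
      show "R g *\<^sub>v y \<in> {x \<in> carrier_vec D. P *\<^sub>v x = 0\<^sub>v D'}"
        if "g \<in> H" "y \<in> {x \<in> carrier_vec D. P *\<^sub>v x = 0\<^sub>v D'}" for g y
        using that c(1)[OF that(1)] c(2)[OF that(1)] PRv by (auto intro!: eq_vecI)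
    qed (use x x0 P P0 in \<open>auto simp: mult_add_distrib_mat_vec[OF P(1)] mult_mat_vec[OF P(1)]\<close>)
    then show False using w by auto
  qed
  have "(\<lambda>x. P *\<^sub>v x) ` carrier_vec D = carrier_vec D'"
  proof (rule irr_onD[OF irr(2), of _ "P *\<^sub>v w"])
    show "0\<^sub>v D' \<in> (\<lambda>x. P *\<^sub>v x) ` carrier_vec D" using P0 by (metis image_eqI zero_carrier_vec)
    show "x + y \<in> (\<lambda>x. P *\<^sub>v x) ` carrier_vec D"
      if "x \<in> (\<lambda>x. P *\<^sub>v x) ` carrier_vec D" "y \<in> (\<lambda>x. P *\<^sub>v x) ` carrier_vec D" for x y
    proof -
      obtain a b where "a \<in> carrier_vec D" "b \<in> carrier_vec D" "x = P *\<^sub>v a" "y = P *\<^sub>v b" using \<open>x \<in> _\<close> \<open>y \<in> _\<close> by auto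
      then show ?thesis
        using mult_add_distrib_mat_vec[OF P(1), of a b] by (intro image_eqI[of _ _ "a + b"]) auto
    qed
    show "e \<cdot>\<^sub>v x \<in> (\<lambda>x. P *\<^sub>v x) ` carrier_vec D" if "x \<in> (\<lambda>x. P *\<^sub>v x) ` carrier_vec D" for x e
    proof -
      obtain a where "a \<in> carrier_vec D" "x = P *\<^sub>v a" using \<open>x \<in> _\<close> by auto
      then show ?thesis
        using mult_mat_vec[OF P(1), of a e] by (intro image_eqI[of _ _ "e \<cdot>\<^sub>v a"]) auto
    qed
    show "R' g *\<^sub>v x \<in> (\<lambda>x. P *\<^sub>v x) ` carrier_vec D" if g: "g \<in> H" "x \<in> (\<lambda>x. P *\<^sub>v x) ` carrier_vec D" for g x
    proof -
      obtain a where "a \<in> carrier_vec D" "x = P *\<^sub>v a" using \<open>x \<in> _\<close> by auto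
      then show ?thesis
        using PRv[OF g(1)] c(1)[OF g(1)] by (intro image_eqI[of _ _ "R g *\<^sub>v a"]) auto
    qed
  qed (use w P in auto)
  moreover have "inj_on (\<lambda>x. P *\<^sub>v x) (carrier_vec D)"
  proof (rule inj_onI)
    fix x y assume xy: "x \<in> carrier_vec D" "y \<in> carrier_vec D" "P *\<^sub>v x = P *\<^sub>v y"
    have "P *\<^sub>v (x - y) = 0\<^sub>v D'" using mult_minus_distrib_mat_vec[OF P(1) xy(1,2)] xy P by auto
    then have "x - y = 0\<^sub>v D" using ker xy by auto
    then have "(x - y) $ i = 0" if "i < D" for i using that by simp
    then show "x = y" using xy by (intro eq_vecI) auto
  qed
  ultimately show ?thesis by (simp add: bij_betw_def)
qed

section \<open>Frobenius reciprocity and the Clifford correspondence\<close>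

context clifford
begin

lemma clifford_indI:
  assumes "clifford_rep G N H \<psi> d \<sigma>" "(D, R) \<in> induced_class G H d \<sigma>"
  obtains T where "clifford_ind G N H \<psi> d \<sigma> D R T"
  using assms induced_class_iff[OF is_group]
  by (auto simp: clifford_ind_def clifford_ind_axioms_def)

text \<open>Two models of the induced space are compared through their maps \<open>T\<close> and
  \<open>T'\<close>; conversely, composing \<open>T\<close> with an isomorphism of representations
  gives another model.\<close>

lemma induced_class_eq:
  assumes \<sigma>: "clifford_rep G N H \<psi> d \<sigma>" and R: "(D, R) \<in> induced_class G H d \<sigma>"
  shows "induced_class G H d \<sigma> = rep_iso G `` {(D, R)}"
proof -
  obtain T where "clifford_ind G N H \<psi> d \<sigma> D R T" using clifford_indI[OF \<sigma> R] .
  then interpret I: clifford_ind G N H \<psi> d \<sigma> D R T .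
  have hom: "R \<in> hom G (GL D)" using I.R hom_GL_iff'[OF is_group] by simp
  have "(D', R') \<in> rep_iso G `` {(D, R)}" if R': "(D', R') \<in> induced_class G H d \<sigma>" for D' R'
  proof -
    obtain T' where "clifford_ind G N H \<psi> d \<sigma> D' R' T'" using clifford_indI[OF \<sigma> R'] .
    then interpret J: clifford_ind G N H \<psi> d \<sigma> D' R' T' .
    have "\<exists>P\<in>carrier_mat D' D. \<forall>x\<in>carrier_vec D. T' (P *\<^sub>v x) = T x"
      by (rule induced_linear[OF J.Tb J.T_add J.T_smult, of D T]) (auto simp: I.T_W I.T_add I.T_smult)
    then obtain P where P: "P \<in> carrier_mat D' D" "\<And>x. x \<in> carrier_vec D \<Longrightarrow> T' (P *\<^sub>v x) = T x"
      by auto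
    have "\<exists>Q\<in>carrier_mat D D'. \<forall>x\<in>carrier_vec D'. T (Q *\<^sub>v x) = T' x"
      by (rule induced_linear[OF I.Tb I.T_add I.T_smult, of D' T']) (auto simp: J.T_W J.T_add J.T_smult)
    then obtain Q where Q: "Q \<in> carrier_mat D D'" "\<And>x. x \<in> carrier_vec D' \<Longrightarrow> T (Q *\<^sub>v x) = T' x" by auto
    have PQ: "P * Q = 1\<^sub>m D'"
    proof (rule mat_eq_by_vec[of _ D' D'])
      fix x :: "complex vec" assume x: "x \<in> carrier_vec D'"
      show "(P * Q) *\<^sub>v x = 1\<^sub>m D' *\<^sub>v x" by (rule J.T_eqI) (use P Q x in auto)
    qed (use P Q in auto)
    have QP: "Q * P = 1\<^sub>m D"
    proof (rule mat_eq_by_vec[of _ D D])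
      fix x :: "complex vec" assume x: "x \<in> carrier_vec D"
      show "(Q * P) *\<^sub>v x = 1\<^sub>m D *\<^sub>v x" by (rule I.T_eqI) (use P Q x in auto)
    qed (use P Q in auto)
    note Q = Q(1) PQ QP left_inverse_square[OF Q(1) P(1) QP PQ, symmetric]
    have PR: "P * R g = R' g * P" if g: "g \<in> carrier G" for g
    proof (rule mat_eq_by_vec[of _ D' D])
      fix x :: "complex vec" assume x: "x \<in> carrier_vec D"
      have "P *\<^sub>v (R g *\<^sub>v x) = R' g *\<^sub>v (P *\<^sub>v x)"
        by (rule J.T_eqI) (use g x P I.R_closed[OF g] J.R_closed[OF g] in \<open>auto simp: J.T_R I.T_R\<close>)
      then show "(P * R g) *\<^sub>v x = (R' g * P) *\<^sub>v x"
        using P I.R_closed[OF g] J.R_closed[OF g] x by auto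
    qed (use P I.R_closed[OF g] J.R_closed[OF g] in auto)
    have "R' \<in> hom G (GL D')" using J.R hom_GL_iff'[OF is_group] by simp
    moreover have "P \<in> carrier (GL D)" unfolding GL_carrier using P Q by auto
    ultimately show ?thesis using PR hom Q by (auto simp: rep_iso_def)
  qed
  moreover have "(D', R') \<in> induced_class G H d \<sigma>" if R': "(D', R') \<in> rep_iso G `` {(D, R)}" for D' R'
  proof -
    from R' obtain P where P: "D' = D" "R' \<in> hom G (GL D)" "P \<in> carrier (GL D)"
      "\<And>g. g \<in> carrier G \<Longrightarrow> P * R g = R' g * P" by (auto simp: rep_iso_def)
    obtain Q where Q: "P \<in> carrier_mat D D" "Q \<in> carrier_mat D D" "P * Q = 1\<^sub>m D" "Q * P = 1\<^sub>m D"
      using P(3) unfolding GL_carrier by auto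
    have R'r: "rep_on G (carrier G) D R'" using P(2) hom_GL_iff'[OF is_group] by simp
    have QR: "Q * R' g = R g * Q" if g: "g \<in> carrier G" for g
    proof -
      note c = I.R_closed[OF g] rep_on_closed[OF R'r g] Q(1,2)
      have "Q * R' g = Q * (R' g * (P * Q))" using c Q by simp
      also have "\<dots> = Q * ((R' g * P) * Q)" using c by (simp add: assoc_mult_mat[of _ D D _ D _ D])
      also have "\<dots> = Q * ((P * R g) * Q)" using P(4)[OF g] by simp
      also have "\<dots> = (Q * P) * (R g * Q)" using c by (simp add: assoc_mult_mat[of _ D D _ D _ D])
      finally show ?thesis using c Q by simp
    qed
    have QPv: "P *\<^sub>v (Q *\<^sub>v x) = x" "Q *\<^sub>v (P *\<^sub>v x) = x" if "x \<in> carrier_vec D" for x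
      using Q that by (metis assoc_mult_mat_vec one_mult_mat_vec)+
    have b: "bij_betw (\<lambda>y. Q *\<^sub>v y) (carrier_vec D) (carrier_vec D)"
      by (rule bij_betw_byWitness[where f' = "\<lambda>y. P *\<^sub>v y"]) (use Q QPv in auto)
    have "ind_map G H d \<sigma> D R' (\<lambda>y. T (Q *\<^sub>v y))"
      unfolding ind_map_def
    proof (intro conjI ballI allI)
      show "bij_betw (\<lambda>y. T (Q *\<^sub>v y)) (carrier_vec D) (induced_space G H d \<sigma>)"
        using bij_betw_trans[OF b I.Tb] by (simp add: o_def)
      fix x y :: "complex vec" and z assume x: "x \<in> carrier_vec D" and y: "y \<in> carrier_vec D" and z: "z \<in> carrier G"
      then show "T (Q *\<^sub>v (x + y)) z = T (Q *\<^sub>v x) z + T (Q *\<^sub>v y) z"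
        using Q(2) by (simp add: mult_add_distrib_mat_vec[OF Q(2)] I.T_add)
    next
      fix x :: "complex vec" and z c assume x: "x \<in> carrier_vec D" and z: "z \<in> carrier G"
      then show "T (Q *\<^sub>v (c \<cdot>\<^sub>v x)) z = c \<cdot>\<^sub>v T (Q *\<^sub>v x) z"
        using Q(2) by (simp add: mult_mat_vec[OF Q(2)] I.T_smult)
    next
      fix x :: "complex vec" and z g assume g: "g \<in> carrier G" and x: "x \<in> carrier_vec D" and z: "z \<in> carrier G"
      note c = I.R_closed[OF g] rep_on_closed[OF R'r g]
      have "Q *\<^sub>v (R' g *\<^sub>v x) = (Q * R' g) *\<^sub>v x" using c Q x by simp
      also have "\<dots> = R g *\<^sub>v (Q *\<^sub>v x)" unfolding QR[OF g] using c Q x by simp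
      finally show "T (Q *\<^sub>v (R' g *\<^sub>v x)) z = T (Q *\<^sub>v x) (z \<otimes> g)"
        using Q x g z by (simp add: I.T_R)
    qed
    then show ?thesis using R'r P(1) induced_class_iff[OF is_group] by blast
  qed
  ultimately show ?thesis by auto
qed

text \<open>Embed the first representation as the functions supported on \<open>H\<close> and
  evaluate at the unit in the second model. The result is not zero: the embedded vectors are
  \<psi>-eigenvectors of \<open>N\<close>, and in the second model such functions live on
  \<open>H\<close>, where the value at the unit determines them.\<close>

lemma induced_intertwiner:
  assumes "clifford_rep G N H \<psi> d \<sigma>" "clifford_rep G N H \<psi> d' \<sigma>'"
    and "(D, R) \<in> induced_class G H d \<sigma>" "(D, R) \<in> induced_class G H d' \<sigma>'"
  obtains P where "P \<in> carrier_mat d' d" "P \<noteq> 0\<^sub>m d' d" "\<And>h. h \<in> H \<Longrightarrow> P * \<sigma> h = \<sigma>' h * P"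
proof -
  obtain T where "clifford_ind G N H \<psi> d \<sigma> D R T" using clifford_indI assms by metis
  then interpret I: clifford_ind G N H \<psi> d \<sigma> D R T .
  obtain T' where "clifford_ind G N H \<psi> d' \<sigma>' D R T'" using clifford_indI assms by metis
  then interpret J: clifford_ind G N H \<psi> d' \<sigma>' D R T' .
  define q where "q v = T' (I.pt \<one> v) \<one>" for v
  have qc: "q v \<in> carrier_vec d'" if "v \<in> carrier_vec d" for v
    using induced_spaceD(1)[OF J.T_W] I.pt[OF one_closed that] by (auto simp: q_def)
  obtain P where P: "P \<in> carrier_mat d' d" "\<And>x. x \<in> carrier_vec d \<Longrightarrow> P *\<^sub>v x = q x"
  proof (rule linear_mat[of d q d'])
    show "q (x + y) = q x + q y" if "x \<in> carrier_vec d" "y \<in> carrier_vec d" for x y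
      using that I.pt by (simp add: q_def I.pt_add J.T_add)
    show "q (c \<cdot>\<^sub>v x) = c \<cdot>\<^sub>v q x" if "x \<in> carrier_vec d" for x c
      using that I.pt by (simp add: q_def I.pt_smult J.T_smult)
  qed (use qc in auto)
  have "P * \<sigma> h = \<sigma>' h * P" if h: "h \<in> H" for h
  proof (rule mat_eq_by_vec[of _ d' d])
    fix x :: "complex vec" assume x: "x \<in> carrier_vec d"
    have hG: "h \<in> carrier G" using h by auto
    have "P *\<^sub>v (\<sigma> h *\<^sub>v x) = q (\<sigma> h *\<^sub>v x)" using P x I.\<sigma>_closed[OF h] by simp
    also have "\<dots> = T' (I.pt \<one> x) h"
      using x h hG I.pt[OF one_closed x] by (simp add: q_def I.pt_H J.T_R)
    also have "\<dots> = T' (I.pt \<one> x) (h \<otimes> \<one>)" using hG by simp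
    also have "\<dots> = \<sigma>' h *\<^sub>v q x"
      unfolding q_def using induced_spaceD(2)[OF J.T_W h one_closed] I.pt[OF one_closed x] by simp
    finally show "(P * \<sigma> h) *\<^sub>v x = (\<sigma>' h * P) *\<^sub>v x"
      using x P I.\<sigma>_closed[OF h] J.\<sigma>_closed[OF h] by simp
  qed (use P I.\<sigma>_closed[OF h] J.\<sigma>_closed[OF h] in auto)
  moreover have "P \<noteq> 0\<^sub>m d' d"
  proof
    assume P0: "P = 0\<^sub>m d' d"
    obtain u :: "complex vec" where u: "u \<in> carrier_vec d" "u \<noteq> 0\<^sub>v d" using I.nonzero_vec_exists by auto
    let ?x = "I.pt \<one> u"
    have x: "?x \<in> carrier_vec D" "?x \<noteq> 0\<^sub>v D" using I.pt u I.pt_nonzero by auto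
    obtain z where z: "z \<in> carrier G" "T' ?x z \<noteq> 0\<^sub>v d'" using J.T_nonzero[OF x] by auto
    \<comment> \<open>At a point \<open>z\<close> of the support, \<open>n\<close> acts both by its
      own value and by that of its conjugate, so \<open>z\<close> stabilizes \<psi>.\<close>
    have "\<psi> (z \<otimes> n \<otimes> inv z) = \<psi> n" if n: "n \<in> N" for n
    proof -
      have nG: "n \<in> carrier G" using n by auto
      have Tz: "T' ?x z \<in> carrier_vec d'" using induced_spaceD(1)[OF J.T_W[OF x(1)] z(1)] .
      have "\<psi> (z \<otimes> n \<otimes> inv z) \<cdot>\<^sub>v T' ?x z = T' ?x (z \<otimes> n)"
        using J.W_N[OF J.T_W[OF x(1)] z(1) n] by simp
      also have "\<dots> = T' (R n *\<^sub>v ?x) z" using x z nG by (simp add: J.T_R)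
      also have "\<dots> = \<psi> n \<cdot>\<^sub>v T' ?x z" using x z u n by (simp add: I.pt_N J.T_smult)
      finally have e: "\<psi> (z \<otimes> n \<otimes> inv z) * T' ?x z $ i = \<psi> n * T' ?x z $ i" if "i < d'" for i
        using that Tz by (metis carrier_vecD index_smult_vec(1))
      obtain i where "i < d'" "T' ?x z $ i \<noteq> 0"
        using z(2) Tz by (metis carrier_vecD eq_vecI index_zero_vec)
      then show ?thesis using e[of i] by simp
    qed
    then have zH: "z \<in> H" using Hst z by blast
    have "T' ?x z = T' ?x (z \<otimes> \<one>)" using z by simp
    also have "\<dots> = \<sigma>' z *\<^sub>v q u" unfolding q_def using induced_spaceD(2)[OF J.T_W[OF x(1)] zH one_closed] by simp
    also have "q u = 0\<^sub>v d'" using P(2)[OF u(1), symmetric] u P0 by (auto intro!: eq_vecI)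
    also have "\<sigma>' z *\<^sub>v 0\<^sub>v d' = 0\<^sub>v d'" using J.\<sigma>_closed[OF zH] by auto
    finally show False using z by simp
  qed
  ultimately show thesis using that P by blast
qed

text \<open>Frobenius reciprocity: \<open>v\<close> is sent to the function with value
  \<open>Q *\<^sub>v (R x *\<^sub>v v)\<close> at \<open>x\<close>. This is a nonzero intertwiner
  between irreducible representations, hence bijective.\<close>

lemma induced_class_memI:
  assumes \<sigma>: "clifford_rep G N H \<psi> d \<sigma>"
    and R: "rep_on G (carrier G) D R" "irr_on (carrier G) D R"
    and Q: "Q \<in> carrier_mat d D" "Q \<noteq> 0\<^sub>m d D" "\<And>h. h \<in> H \<Longrightarrow> Q * R h = \<sigma> h * Q"
  shows "(D, R) \<in> induced_class G H d \<sigma>"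
proof -
  interpret S: clifford_rep G N H \<psi> d \<sigma> by fact
  obtain D' R' T' where "rep_on G (carrier G) D' R'" "ind_map G H d \<sigma> D' R' T'"
    using S.induced_exists by auto
  then interpret J: clifford_ind G N H \<psi> d \<sigma> D' R' T' by unfold_locales
  note Rc = rep_on_closed[OF R(1)]
  define t where "t v = (\<lambda>x\<in>carrier G. Q *\<^sub>v (R x *\<^sub>v v))" for v
  have tW: "t v \<in> induced_space G H d \<sigma>" if v: "v \<in> carrier_vec D" for v
    unfolding induced_space_def
  proof (intro CollectI conjI ballI)
    show "t v \<in> carrier G \<rightarrow>\<^sub>E carrier_vec d"
    proof -
      have "Q *\<^sub>v (R x *\<^sub>v v) \<in> carrier_vec d" if "x \<in> carrier G" for x
        using Q(1) Rc[OF that] v by simp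
      then show ?thesis by (auto simp: t_def)
    qed
    fix h x assume h: "h \<in> H" and x: "x \<in> carrier G"
    have hG: "h \<in> carrier G" using h by auto
    have "Q *\<^sub>v (R (h \<otimes> x) *\<^sub>v v) = Q *\<^sub>v (R h *\<^sub>v (R x *\<^sub>v v))"
      using rep_on_mult[OF R(1) hG x] Rc[OF hG] Rc[OF x] v by simp
    also have "\<dots> = (Q * R h) *\<^sub>v (R x *\<^sub>v v)" using Q Rc[OF hG] Rc[OF x] v by simp
    also have "\<dots> = \<sigma> h *\<^sub>v (Q *\<^sub>v (R x *\<^sub>v v))"
      unfolding Q(3)[OF h] using Q Rc[OF x] v S.\<sigma>_closed[OF h] by simp
    finally show "t v (h \<otimes> x) = \<sigma> h *\<^sub>v t v x" using hG x by (simp add: t_def)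
  qed
  have tadd: "t (x + y) z = t x z + t y z" if "x \<in> carrier_vec D" "y \<in> carrier_vec D" "z \<in> carrier G" for x y z
    using that Rc[OF that(3)] Q(1) mult_add_distrib_mat_vec[OF Rc[OF that(3)] that(1,2)]
      mult_add_distrib_mat_vec[OF Q(1), of "R z *\<^sub>v x" "R z *\<^sub>v y"] by (simp add: t_def)
  have tsm: "t (c \<cdot>\<^sub>v x) z = c \<cdot>\<^sub>v t x z" if "x \<in> carrier_vec D" "z \<in> carrier G" for c x z
    using that Rc[OF that(2)] mult_mat_vec[OF Rc[OF that(2)] that(1)] mult_mat_vec[OF Q(1), of "R z *\<^sub>v x"]
    by (simp add: t_def)
  have "\<exists>P\<in>carrier_mat D' D. \<forall>x\<in>carrier_vec D. T' (P *\<^sub>v x) = t x"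
    by (rule induced_linear[OF J.Tb J.T_add J.T_smult, of D t]) (auto simp: tW tadd tsm)
  then obtain P where P: "P \<in> carrier_mat D' D" "\<And>x. x \<in> carrier_vec D \<Longrightarrow> T' (P *\<^sub>v x) = t x"
    by auto
  have tR: "t (R g *\<^sub>v x) z = t x (z \<otimes> g)" if "g \<in> carrier G" "x \<in> carrier_vec D" "z \<in> carrier G" for g x z
    using that rep_on_mult[OF R(1), of z g] Rc[of z] Rc[of g] by (simp add: t_def)
  have PR: "P * R g = R' g * P" if g: "g \<in> carrier G" for g
  proof (rule mat_eq_by_vec[of _ D' D])
    fix x :: "complex vec" assume x: "x \<in> carrier_vec D"
    have "P *\<^sub>v (R g *\<^sub>v x) = R' g *\<^sub>v (P *\<^sub>v x)"
      by (rule J.T_eqI) (use g x P Rc[OF g] J.R_closed[OF g] in \<open>auto simp: J.T_R tR\<close>)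
    then show "(P * R g) *\<^sub>v x = (R' g * P) *\<^sub>v x"
      using P Rc[OF g] J.R_closed[OF g] x by auto
  qed (use P Rc[OF g] J.R_closed[OF g] in auto)
  have "P \<noteq> 0\<^sub>m D' D"
  proof
    assume P0: "P = 0\<^sub>m D' D"
    have "Q = 0\<^sub>m d D"
    proof (rule mat_eq_by_vec[of _ d D])
      fix x :: "complex vec" assume x: "x \<in> carrier_vec D"
      have "P *\<^sub>v x = 0\<^sub>v D'" using P0 x by (auto intro!: eq_vecI)
      then have "t x \<one> = T' (0\<^sub>v D') \<one>" using P(2)[OF x] by simp
      then have "Q *\<^sub>v x = 0\<^sub>v d" using J.T_zero rep_on_one[OF R(1)] x by (simp add: t_def)
      then show "Q *\<^sub>v x = 0\<^sub>m d D *\<^sub>v x" using x by (auto intro!: eq_vecI)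
    qed (use Q in auto)
    then show False using Q by simp
  qed
  then have b: "bij_betw (\<lambda>x. P *\<^sub>v x) (carrier_vec D) (carrier_vec D')"
    using irr_intertwiner_bij[OF R(2) J.irr Rc J.R_closed P(1) _ PR] by simp
  have "ind_map G H d \<sigma> D R t"
    unfolding ind_map_def
  proof (intro conjI ballI allI)
    have "bij_betw (\<lambda>x. T' (P *\<^sub>v x)) (carrier_vec D) (induced_space G H d \<sigma>)"
      using bij_betw_trans[OF b J.Tb] by (simp add: o_def)
    then show "bij_betw t (carrier_vec D) (induced_space G H d \<sigma>)"
      by (subst (asm) bij_betw_cong[of _ _ t]) (use P in auto)
  qed (use tadd tsm tR in auto)
  then show ?thesis using R(1) induced_class_iff[OF is_group] by blast
qed

text \<open>Everything about \<open>G\<close> is reduced to intertwiners over \<open>H\<close>: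
  \<open>inj\<close> is applied to the intertwiner between two inducing representations of the same
  class, and \<open>complete\<close> supplies the map for Frobenius reciprocity.\<close>

theorem clifford_bij:
  fixes \<Theta> :: "'t set"
  assumes rep: "\<And>t. t \<in> \<Theta> \<Longrightarrow> clifford_rep G N H \<psi> (d t) (\<sigma> t)"
    and inj: "\<And>t t' P. t \<in> \<Theta> \<Longrightarrow> t' \<in> \<Theta> \<Longrightarrow> P \<in> carrier_mat (d t') (d t) \<Longrightarrow> P \<noteq> 0\<^sub>m (d t') (d t) \<Longrightarrow>
      (\<And>h. h \<in> H \<Longrightarrow> P * \<sigma> t h = \<sigma> t' h * P) \<Longrightarrow> t = t'"
    and complete: "\<And>D R. rep_on G (carrier G) D R \<Longrightarrow> contains_char N D R \<psi> \<Longrightarrow>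
      \<exists>t\<in>\<Theta>. \<exists>Q\<in>carrier_mat (d t) D. Q \<noteq> 0\<^sub>m (d t) D \<and> (\<forall>h\<in>H. Q * R h = \<sigma> t h * Q)"
  shows "bij_betw (\<lambda>t. induced_class G H (d t) (\<sigma> t)) \<Theta> (Irr_over G N \<psi>)"
proof (rule bij_betw_imageI)
  show "inj_on (\<lambda>t. induced_class G H (d t) (\<sigma> t)) \<Theta>"
  proof (rule inj_onI)
    fix t t' assume t: "t \<in> \<Theta>" "t' \<in> \<Theta>" and e: "induced_class G H (d t) (\<sigma> t) = induced_class G H (d t') (\<sigma> t')"
    interpret S: clifford_rep G N H \<psi> "d t" "\<sigma> t" using rep t by simp
    obtain D R where R: "(D, R) \<in> induced_class G H (d t) (\<sigma> t)"
      using S.induced_exists induced_class_iff[OF is_group] by blast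
    obtain P where "P \<in> carrier_mat (d t') (d t)" "P \<noteq> 0\<^sub>m (d t') (d t)" "\<And>h. h \<in> H \<Longrightarrow> P * \<sigma> t h = \<sigma> t' h * P"
      using induced_intertwiner[OF rep[OF t(1)] rep[OF t(2)] R] R e by auto
    then show "t = t'" using inj t by blast
  qed
  let ?X = "{(D, R). irreducible_rep G D R \<and> contains_char N D R \<psi>}"
  show "(\<lambda>t. induced_class G H (d t) (\<sigma> t)) ` \<Theta> = Irr_over G N \<psi>"
  proof (intro equalityI subsetI)
    fix C assume "C \<in> (\<lambda>t. induced_class G H (d t) (\<sigma> t)) ` \<Theta>"
    then obtain t where t: "t \<in> \<Theta>" "C = induced_class G H (d t) (\<sigma> t)" by auto
    interpret S: clifford_rep G N H \<psi> "d t" "\<sigma> t" using rep t by simp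
    obtain D R where R: "(D, R) \<in> induced_class G H (d t) (\<sigma> t)"
      using S.induced_exists induced_class_iff[OF is_group] by blast
    obtain T where "clifford_ind G N H \<psi> (d t) (\<sigma> t) D R T" using clifford_indI rep[OF t(1)] R by metis
    then interpret I: clifford_ind G N H \<psi> "d t" "\<sigma> t" D R T .
    have "(D, R) \<in> ?X" using I.irr I.contains I.R by (simp add: irreducible_rep_iff'[OF is_group])
    moreover have "C = rep_iso G `` {(D, R)}" using t induced_class_eq[OF rep[OF t(1)] R] by simp
    ultimately show "C \<in> Irr_over G N \<psi>" unfolding Irr_over_def by (auto intro!: quotientI)
  next
    fix C assume "C \<in> Irr_over G N \<psi>"
    then obtain D R where R: "(D, R) \<in> ?X" and C: "C = rep_iso G `` {(D, R)}"
      unfolding Irr_over_def by (auto elim!: quotientE)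
    have R': "rep_on G (carrier G) D R" "irr_on (carrier G) D R" "contains_char N D R \<psi>"
      using R by (auto simp: irreducible_rep_iff'[OF is_group])
    obtain t Q where t: "t \<in> \<Theta>" and Q: "Q \<in> carrier_mat (d t) D" "Q \<noteq> 0\<^sub>m (d t) D"
      "\<And>h. h \<in> H \<Longrightarrow> Q * R h = \<sigma> t h * Q"
      using complete[OF R'(1,3)] by auto
    have "(D, R) \<in> induced_class G H (d t) (\<sigma> t)"
      by (rule induced_class_memI[OF rep[OF t] R'(1,2) Q])
    then show "C \<in> (\<lambda>t. induced_class G H (d t) (\<sigma> t)) ` \<Theta>"
      using induced_class_eq[OF rep[OF t]] C t by blast
  qed
qed

end

section \<open>Extensions of Heisenberg type\<close>



lemma scalar_mat_vec: "x \<in> carrier_vec d \<Longrightarrow> (c \<cdot>\<^sub>m 1\<^sub>m d) *\<^sub>v x = c \<cdot>\<^sub>v (x :: complex vec)"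
  by (auto intro!: eq_vecI simp: smult_scalar_prod_distrib[of _ d])

lemma scalar_mat_mult: "A \<in> carrier_mat d d \<Longrightarrow> (c \<cdot>\<^sub>m 1\<^sub>m d) * A = c \<cdot>\<^sub>m (A :: complex mat)"
  by (subst mult_smult_assoc_mat[of _ d d _ d]) auto

lemma smult_smult_times: "a \<cdot>\<^sub>m (b \<cdot>\<^sub>m A) = (a * b) \<cdot>\<^sub>m (A :: complex mat)"
  and one_smult_mat: "1 \<cdot>\<^sub>m A = (A :: complex mat)"
  by (auto intro!: eq_matI)

lemma char_setI:
  assumes "\<And>x. x \<in> carrier A \<Longrightarrow> f x \<noteq> 0" "\<And>x y. x \<in> carrier A \<Longrightarrow> y \<in> carrier A \<Longrightarrow> f (x \<otimes>\<^bsub>A\<^esub> y) = f x * f y"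
    "f \<in> extensional (carrier A)"
  shows "f \<in> char_set A"
proof -
  have "\<exists>y. y * f x = 1" if "x \<in> carrier A" for x
    using assms(1)[OF that] by (intro exI[of _ "inverse (f x)"]) simp
  then show ?thesis
    using assms by (auto simp: char_set_def hom_def units_of_def Units_def class_ring_simps mult.commute)
qed

lemma char_setD:
  assumes "f \<in> char_set A"
  shows "x \<in> carrier A \<Longrightarrow> f x \<noteq> 0" "x \<in> carrier A \<Longrightarrow> y \<in> carrier A \<Longrightarrow> f (x \<otimes>\<^bsub>A\<^esub> y) = f x * f y"
    "f \<in> extensional (carrier A)"
  using assms by (auto simp: char_set_def hom_def units_of_def Units_def class_ring_simps Pi_iff)

lemma char_set_eqI:
  assumes "f \<in> char_set A" "g \<in> char_set A" "\<And>x. x \<in> carrier A \<Longrightarrow> f x = g x"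
  shows "f = g"
  using char_setD(3)[OF assms(1)] char_setD(3)[OF assms(2)] assms(3) by (rule extensionalityI)

context group
begin

text \<open>Two factorizations of an element differ by an element \<open>k\<close> of
  \<open>A \<inter> B\<close>, and \<open>F\<close> is balanced under such \<open>k\<close>.\<close>

lemma the_factorization:
  assumes A: "subgroup A G" and B: "subgroup B G"
    and F: "\<And>g k x. g \<in> A \<Longrightarrow> k \<in> A \<inter> B \<Longrightarrow> x \<in> B \<Longrightarrow> F (g \<otimes> k) x = F g (k \<otimes> x)"
    and gx: "g \<in> A" "x \<in> B"
  shows "(THE M. \<exists>g'\<in>A. \<exists>x'\<in>B. g \<otimes> x = g' \<otimes> x' \<and> M = F g' x') = F g x"
proof (rule the_equality)
  fix M assume "\<exists>g'\<in>A. \<exists>x'\<in>B. g \<otimes> x = g' \<otimes> x' \<and> M = F g' x'"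
  then obtain g' x' where *: "g' \<in> A" "x' \<in> B" "g \<otimes> x = g' \<otimes> x'" "M = F g' x'" by blast
  interpret A: subgroup A G by fact
  interpret B: subgroup B G by fact
  define k where "k = inv g \<otimes> g'"
  have "k \<otimes> x' = inv g \<otimes> (g' \<otimes> x')" unfolding k_def using gx * by (simp add: m_assoc)
  also have "\<dots> = x" unfolding *(3)[symmetric] using gx by (simp add: m_assoc[symmetric])
  finally have kx: "k \<otimes> x' = x" .
  have kA: "k \<in> A" unfolding k_def using gx * by simp
  have "k = x \<otimes> inv x'" unfolding kx[symmetric] using kA * by (simp add: m_assoc)
  then have "k \<in> B" using gx * by simp
  moreover have "g \<otimes> k = g'" unfolding k_def using gx * by (simp add: m_assoc[symmetric])
  ultimately show "M = F g x" using F[of g k x'] kA gx * kx by simp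
qed (use gx in blast)

text \<open>The \<psi>-eigenspace of \<open>Z\<close> is nonzero, and it is stable under
  \<open>N1\<close> because conjugation by \<open>N1\<close> fixes \<psi>; so it is the whole
  space.\<close>

lemma irreducible_scalar:
  assumes sub: "subgroup N1 G" "subgroup Z G" "Z \<subseteq> N1"
    and \<pi>: "rep_on G N1 d \<pi>" "irr_on N1 d \<pi>" "contains_char Z d \<pi> \<psi>"
    and Z_norm: "\<And>y z. y \<in> N1 \<Longrightarrow> z \<in> Z \<Longrightarrow> y \<otimes> z \<otimes> inv y \<in> Z"
    and inv: "\<And>y z. y \<in> N1 \<Longrightarrow> z \<in> Z \<Longrightarrow> \<psi> (y \<otimes> z \<otimes> inv y) = \<psi> z"
    and z: "z \<in> Z"
  shows "\<pi> z = \<psi> z \<cdot>\<^sub>m 1\<^sub>m d"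
proof -
  interpret N1: subgroup N1 G by (rule sub)
  interpret Z: subgroup Z G by (rule sub)
  have ZN1: "z \<in> N1" if "z \<in> Z" for z using sub that by auto
  note \<pi>_mult = rep_on_mult[OF \<pi>(1)] and \<pi>_closed = rep_on_closed[OF \<pi>(1)]
  obtain v where v: "v \<in> carrier_vec d" "v \<noteq> 0\<^sub>v d" "\<And>z. z \<in> Z \<Longrightarrow> \<pi> z *\<^sub>v v = \<psi> z \<cdot>\<^sub>v v"
    using \<pi>(3) unfolding contains_char_def by auto
  let ?W = "{v \<in> carrier_vec d. \<forall>z\<in>Z. \<pi> z *\<^sub>v v = \<psi> z \<cdot>\<^sub>v v}"
  have W: "?W = carrier_vec d"
  proof (rule irr_onD[OF \<pi>(2), of _ v])
    have "\<pi> z *\<^sub>v 0\<^sub>v d = \<psi> z \<cdot>\<^sub>v 0\<^sub>v d" if "z \<in> Z" for z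
      using \<pi>_closed[OF ZN1[OF that]] by (auto intro!: eq_vecI)
    then show "0\<^sub>v d \<in> ?W" by simp
    show "x + y \<in> ?W" if "x \<in> ?W" "y \<in> ?W" for x y
    proof -
      have xy: "x \<in> carrier_vec d" "y \<in> carrier_vec d" using that by auto
      then show ?thesis using that mult_add_distrib_mat_vec[OF \<pi>_closed[OF ZN1] xy] smult_add_distrib_vec[OF xy]
        by simp
    qed
    show "c \<cdot>\<^sub>v x \<in> ?W" if "x \<in> ?W" for c x
      using that mult_mat_vec[OF \<pi>_closed[OF ZN1]] by (auto simp: smult_smult_assoc mult.commute)
    show "\<pi> y *\<^sub>v x \<in> ?W" if y: "y \<in> N1" and x: "x \<in> ?W" for y x
    proof -
      have xc: "x \<in> carrier_vec d" using x by auto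
      have "\<pi> z *\<^sub>v (\<pi> y *\<^sub>v x) = \<psi> z \<cdot>\<^sub>v (\<pi> y *\<^sub>v x)" if z: "z \<in> Z" for z
      proof -
        let ?z = "inv y \<otimes> z \<otimes> y"
        have zc: "?z \<in> Z" using Z_norm[of "inv y" z] y z by simp
        have "\<psi> ?z = \<psi> z" using inv[OF _ z, of "inv y"] y by simp
        have "\<pi> z *\<^sub>v (\<pi> y *\<^sub>v x) = \<pi> (z \<otimes> y) *\<^sub>v x"
          using \<pi>_mult[OF ZN1[OF z] y] \<pi>_closed[OF y] \<pi>_closed[OF ZN1[OF z]] xc by simp
        also have "z \<otimes> y = y \<otimes> ?z" using y z by (simp add: m_assoc[symmetric])
        also have "\<pi> (y \<otimes> ?z) *\<^sub>v x = \<pi> y *\<^sub>v (\<pi> ?z *\<^sub>v x)"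
          using \<pi>_mult[OF y ZN1[OF zc]] \<pi>_closed[OF y] \<pi>_closed[OF ZN1[OF zc]] xc by simp
        also have "\<pi> ?z *\<^sub>v x = \<psi> z \<cdot>\<^sub>v x" using x zc \<open>\<psi> ?z = \<psi> z\<close> by auto
        finally show ?thesis using mult_mat_vec[OF \<pi>_closed[OF y] xc] by simp
      qed
      then show ?thesis using xc \<pi>_closed[OF y] by auto
    qed
  qed (use v in auto)
  show ?thesis
  proof (rule mat_eq_by_vec[of _ d d])
    fix x :: "complex vec" assume x: "x \<in> carrier_vec d"
    then have "x \<in> ?W" using W by simp
    then show "\<pi> z *\<^sub>v x = (\<psi> z \<cdot>\<^sub>m 1\<^sub>m d) *\<^sub>v x" using z x by (simp add: scalar_mat_vec)
  qed (use \<pi>_closed[OF ZN1[OF z]] in auto)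
qed

text \<open>On the \<psi>-eigenspace of \<open>N\<close> the operators from \<open>Z\<close>
  commute, since commutators of \<open>Z\<close> lie in \<open>N\<close> and \<psi> is 1 on them. A
  common eigenvector therefore exists, and its eigenvalues extend \<psi> to
  \<open>Z\<close>.\<close>

lemma eigenchar_extension:
  assumes fin: "finite (carrier G)" and sub: "subgroup N G" "subgroup Z G" "N \<subseteq> Z"
    and norm: "\<And>z n. z \<in> Z \<Longrightarrow> n \<in> N \<Longrightarrow> inv z \<otimes> n \<otimes> z \<in> N \<and> \<psi> (inv z \<otimes> n \<otimes> z) = \<psi> n"
    and comm: "\<And>z w. z \<in> Z \<Longrightarrow> w \<in> Z \<Longrightarrow> z \<otimes> w \<otimes> inv z \<otimes> inv w \<in> N \<and> \<psi> (z \<otimes> w \<otimes> inv z \<otimes> inv w) = 1"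
    and R: "rep_on G (carrier G) D R" and cont: "contains_char N D R \<psi>"
  obtains lam where "contains_char Z D R lam" "\<And>z w. z \<in> Z \<Longrightarrow> w \<in> Z \<Longrightarrow> lam (z \<otimes> w) = lam z * lam w"
    "\<And>n. n \<in> N \<Longrightarrow> lam n = \<psi> n"
proof -
  interpret N: subgroup N G by (rule sub)
  interpret Z: subgroup Z G by (rule sub)
  note Rc = rep_on_closed[OF R] and Rm = rep_on_mult[OF R]
  define W where "W = {X \<in> carrier_mat D 1. \<forall>n\<in>N. R n * X = \<psi> n \<cdot>\<^sub>m X}"
  have Wc: "X \<in> carrier_mat D 1" if "X \<in> W" for X using that by (simp add: W_def)
  have Rmm: "R (g \<otimes> h) * X = R g * (R h * X)" if "g \<in> carrier G" "h \<in> carrier G" "X \<in> carrier_mat D 1" for g h X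
    using that by (simp add: Rm assoc_mult_mat[OF Rc Rc])
  obtain v where v: "v \<in> carrier_vec D" "v \<noteq> 0\<^sub>v D" "\<And>n. n \<in> N \<Longrightarrow> R n *\<^sub>v v = \<psi> n \<cdot>\<^sub>v v"
    using cont unfolding contains_char_def by auto
  \<comment> \<open>Vectors are written as matrices with one column, so that
    \<open>common_eigen_mat\<close> applies.\<close>
  let ?Q = "mat_of_cols D [v]"
  have Qc: "?Q \<in> carrier_mat D 1" using mat_of_cols_carrier(1)[of D "[v]"] by simp
  have "R n * ?Q = \<psi> n \<cdot>\<^sub>m ?Q" if n: "n \<in> N" for n
  proof (rule mat_col_eqI)
    fix i assume "i < dim_col (\<psi> n \<cdot>\<^sub>m ?Q)"
    then show "col (R n * ?Q) i = col (\<psi> n \<cdot>\<^sub>m ?Q) i"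
      using v n col_mult2[OF Rc[OF N.mem_carrier[OF n]] Qc, of 0] by simp
  qed (use Rc[OF N.mem_carrier[OF n]] in auto)
  then have QW: "?Q \<in> W" unfolding W_def using Qc by blast
  have Q0: "?Q \<noteq> 0\<^sub>m D 1"
  proof
    assume "?Q = 0\<^sub>m D 1"
    then have "col ?Q 0 = col (0\<^sub>m D 1) 0" by simp
    then show False using v by simp
  qed
  have maps: "R z * X \<in> W" if z: "z \<in> Z" and X: "X \<in> W" for z X
  proof -
    have "R n * (R z * X) = \<psi> n \<cdot>\<^sub>m (R z * X)" if n: "n \<in> N" for n
    proof -
      let ?n = "inv z \<otimes> n \<otimes> z"
      have n': "?n \<in> N" "\<psi> ?n = \<psi> n" using norm[OF z n] by auto
      have "R n * (R z * X) = R (n \<otimes> z) * X" using n z Wc[OF X] by (simp add: Rmm)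
      also have "n \<otimes> z = z \<otimes> ?n" using n z by (simp add: m_assoc[symmetric])
      also have "R (z \<otimes> ?n) * X = R z * (R ?n * X)" using n z Wc[OF X] by (simp add: Rmm)
      also have "R ?n * X = \<psi> n \<cdot>\<^sub>m X" using X n' by (simp add: W_def)
      also have "R z * (\<psi> n \<cdot>\<^sub>m X) = \<psi> n \<cdot>\<^sub>m (R z * X)" using mult_smult_distrib[OF Rc Wc[OF X]] z by simp
      finally show ?thesis .
    qed
    then show ?thesis using mult_carrier_mat[OF Rc Wc[OF X]] z by (simp add: W_def)
  qed
  have RR: "R z * (R w * X) = R w * (R z * X)" if z: "z \<in> Z" and w: "w \<in> Z" and X: "X \<in> W" for z w X
  proof -
    let ?c = "z \<otimes> w \<otimes> inv z \<otimes> inv w"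
    have c: "?c \<in> N" "\<psi> ?c = 1" using comm[OF z w] by auto
    have zw: "z \<otimes> w = ?c \<otimes> (w \<otimes> z)"
    proof -
      have "inv w \<otimes> (w \<otimes> z) = z" using z w by (simp add: m_assoc[symmetric])
      then show ?thesis using z w by (simp add: m_assoc)
    qed
    have "R z * (R w * X) = R (z \<otimes> w) * X" using z w Wc[OF X] by (simp add: Rmm)
    also have "\<dots> = R ?c * (R (w \<otimes> z) * X)" using z w Wc[OF X] by (subst zw) (simp add: Rmm)
    also have "\<dots> = R (w \<otimes> z) * X" using maps[OF _ X, of "w \<otimes> z"] z w c by (simp add: W_def one_smult_mat)
    also have "\<dots> = R w * (R z * X)" using z w Wc[OF X] by (simp add: Rmm)
    finally show ?thesis .
  qed
  obtain Q lam where Q: "Q \<in> W" "Q \<noteq> 0\<^sub>m D 1" and lam: "\<And>z. z \<in> Z \<Longrightarrow> R z * Q = lam z \<cdot>\<^sub>m Q"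
    and 2: "\<And>z w. z \<in> Z \<Longrightarrow> w \<in> Z \<Longrightarrow> lam (z \<otimes> w) = lam z * lam w"
  proof (rule common_eigen_mat[OF fin sub(2), of ?Q W D 1 "\<lambda>z X. R z * X"])
    show "X + Y \<in> W" if "X \<in> W" "Y \<in> W" for X Y
      using that mult_add_distrib_mat[OF Rc Wc[OF that(1)] Wc[OF that(2)]] add_smult_distrib_left_mat[OF Wc[OF that(1)] Wc[OF that(2)]]
      by (simp add: W_def)
    show "c \<cdot>\<^sub>m X \<in> W" if "X \<in> W" for X c
      using that mult_smult_distrib[OF Rc Wc[OF that]] by (simp add: W_def smult_smult_times mult.commute)
    show "R s * (X + Y) = R s * X + R s * Y" if "s \<in> Z" "X \<in> W" "Y \<in> W" for s X Y
      using mult_add_distrib_mat[OF Rc Wc[OF that(2)] Wc[OF that(3)]] that(1) by simp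
    show "R s * (c \<cdot>\<^sub>m X) = c \<cdot>\<^sub>m (R s * X)" if "s \<in> Z" "X \<in> W" for s X c
      using mult_smult_distrib[OF Rc Wc[OF that(2)]] that(1) by simp
    show "R \<one> * X = X" if "X \<in> W" for X using left_mult_one_mat[OF Wc[OF that]] by (simp add: rep_on_one[OF R])
    show "R (z \<otimes> w) * X = R z * (R w * X)" if "z \<in> Z" "w \<in> Z" "X \<in> W" for z w X
      using that Wc by (simp add: Rmm)
  qed (use QW Q0 maps Wc RR in auto)
  have "col Q 0 \<noteq> 0\<^sub>v D"
  proof
    assume a: "col Q 0 = 0\<^sub>v D"
    have "Q = 0\<^sub>m D 1" by (rule mat_col_eqI) (use a Wc[OF Q(1)] in auto)
    then show False using Q(2) by simp
  qed
  moreover have "R z *\<^sub>v col Q 0 = lam z \<cdot>\<^sub>v col Q 0" if z: "z \<in> Z" for z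
  proof -
    have "col (R z * Q) 0 = R z *\<^sub>v col Q 0" using col_mult2[OF Rc Wc[OF Q(1)], of z 0] z by simp
    then show ?thesis using lam[OF z] Wc[OF Q(1)] by simp
  qed
  ultimately have 1: "contains_char Z D R lam"
    unfolding contains_char_def using Wc[OF Q(1)] by (intro bexI[of _ "col Q 0"]) auto
  have 3: "lam n = \<psi> n" if n: "n \<in> N" for n
  proof (rule smult_mat_cancel[OF Wc[OF Q(1)] Q(2)])
    show "lam n \<cdot>\<^sub>m Q = \<psi> n \<cdot>\<^sub>m Q" using lam[of n] Q(1) n sub(3) by (auto simp: W_def)
  qed
  show thesis using that[OF 1 2 3] .
qed

end

text \<open>\<open>P\<close> indexes the extensions \<open>\<psi>p\<close> of \<open>\<psi>\<close> to \<open>Z\<close>, and \<open>\<Theta>\<close> the characters \<open>\<chi>\<close> of \<open>A\<close> that agree with \<open>\<psi>\<close>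
  on \<open>N\<close>; such a character selects the extension \<open>rr\<close> with which it agrees on \<open>A \<inter> N1\<close>.\<close>

locale heisenberg_clifford = clifford +
  fixes N1 Z A :: "'a set" and P :: "'p set" and e :: "'p \<Rightarrow> nat"
    and \<pi> U :: "'p \<Rightarrow> 'a \<Rightarrow> complex mat" and \<psi>p :: "'p \<Rightarrow> 'a \<Rightarrow> complex"
    and \<Theta> :: "'t set" and \<chi> :: "'t \<Rightarrow> 'a \<Rightarrow> complex" and rr :: "'t \<Rightarrow> 'p"
    and \<sigma> :: "'t \<Rightarrow> 'a \<Rightarrow> complex mat"
  assumes sub: "subgroup N1 G" "subgroup Z G" "subgroup A G" "N \<subseteq> Z" "Z \<subseteq> N1" "N1 \<subseteq> H" "A \<subseteq> H"
    and A_comm: "\<And>g h. g \<in> A \<Longrightarrow> h \<in> A \<Longrightarrow> g \<otimes> h = h \<otimes> g"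
    and H_prod: "\<And>h. h \<in> H \<Longrightarrow> \<exists>g\<in>A. \<exists>x\<in>N1. h = g \<otimes> x"
    and AN1: "A \<inter> N1 \<subseteq> Z"
    and A_norm: "\<And>g x. g \<in> A \<Longrightarrow> x \<in> N1 \<Longrightarrow> inv g \<otimes> x \<otimes> g \<in> N1"
    and Z_norm: "\<And>y z. y \<in> N1 \<Longrightarrow> z \<in> Z \<Longrightarrow> y \<otimes> z \<otimes> inv y \<in> Z"
    and \<pi>: "\<And>p. p \<in> P \<Longrightarrow> rep_on G N1 (e p) (\<pi> p)" "\<And>p. p \<in> P \<Longrightarrow> irr_on N1 (e p) (\<pi> p)"
      "\<And>p. p \<in> P \<Longrightarrow> contains_char Z (e p) (\<pi> p) (\<psi>p p)"
    and \<psi>p_inv: "\<And>p y z. p \<in> P \<Longrightarrow> y \<in> N1 \<Longrightarrow> z \<in> Z \<Longrightarrow> \<psi>p p (y \<otimes> z \<otimes> inv y) = \<psi>p p z"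
    and \<psi>p_N: "\<And>p n. p \<in> P \<Longrightarrow> n \<in> N \<Longrightarrow> \<psi>p p n = \<psi> n"
    and U: "\<And>p. p \<in> P \<Longrightarrow> rep_on G A (e p) (U p)"
      "\<And>p g x. p \<in> P \<Longrightarrow> g \<in> A \<Longrightarrow> x \<in> N1 \<Longrightarrow> \<pi> p (inv g \<otimes> x \<otimes> g) = U p (inv g) * \<pi> p x * U p g"
      "\<And>p g. p \<in> P \<Longrightarrow> g \<in> A \<inter> N1 \<Longrightarrow> U p g = 1\<^sub>m (e p)"
    and nondeg: "\<And>p x. p \<in> P \<Longrightarrow> x \<in> N1 \<Longrightarrow> x \<notin> Z \<Longrightarrow>
      \<exists>y\<in>N1. y \<otimes> x \<otimes> inv y \<otimes> inv x \<in> Z \<and> \<psi>p p (y \<otimes> x \<otimes> inv y \<otimes> inv x) \<noteq> 1"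
    and sep: "\<And>p p'. p \<in> P \<Longrightarrow> p' \<in> P \<Longrightarrow> (\<And>z. z \<in> Z \<Longrightarrow> \<psi>p p z = \<psi>p p' z) \<Longrightarrow> p = p'"
    and complP: "\<And>D R. rep_on G (carrier G) D R \<Longrightarrow> contains_char N D R \<psi> \<Longrightarrow>
      \<exists>p\<in>P. contains_char Z D R (\<psi>p p)"
    and rr: "\<And>t. t \<in> \<Theta> \<Longrightarrow> rr t \<in> P"
    and \<chi>_mult: "\<And>t g h. t \<in> \<Theta> \<Longrightarrow> g \<in> A \<Longrightarrow> h \<in> A \<Longrightarrow> \<chi> t (g \<otimes> h) = \<chi> t g * \<chi> t h"
    and \<chi>_N1: "\<And>t k. t \<in> \<Theta> \<Longrightarrow> k \<in> A \<inter> N1 \<Longrightarrow> \<chi> t k = \<psi>p (rr t) k"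
    and \<Theta>_ex: "\<And>p \<chi>0. p \<in> P \<Longrightarrow> (\<And>g h. g \<in> A \<Longrightarrow> h \<in> A \<Longrightarrow> \<chi>0 (g \<otimes> h) = \<chi>0 g * \<chi>0 h) \<Longrightarrow>
      (\<And>k. k \<in> A \<inter> N1 \<Longrightarrow> \<chi>0 k = \<psi>p p k) \<Longrightarrow> \<exists>t\<in>\<Theta>. rr t = p \<and> (\<forall>g\<in>A. \<chi> t g = \<chi>0 g)"
    and \<chi>_inj: "\<And>t t'. t \<in> \<Theta> \<Longrightarrow> t' \<in> \<Theta> \<Longrightarrow> (\<And>g. g \<in> A \<Longrightarrow> \<chi> t g = \<chi> t' g) \<Longrightarrow> t = t'"
    and \<sigma>: "\<And>t g x. t \<in> \<Theta> \<Longrightarrow> g \<in> A \<Longrightarrow> x \<in> N1 \<Longrightarrow>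
      \<sigma> t (g \<otimes> x) = \<chi> t g \<cdot>\<^sub>m (U (rr t) g * \<pi> (rr t) x)"
begin

sublocale N1: subgroup N1 G by (rule sub)
sublocale Z: subgroup Z G by (rule sub)
sublocale A: subgroup A G by (rule sub)
sublocale N: subgroup N G by (rule N)
sublocale H: subgroup H G by (rule H)

lemma ZN1: "z \<in> Z \<Longrightarrow> z \<in> N1" using sub by auto

lemma \<pi>_closed: "p \<in> P \<Longrightarrow> x \<in> N1 \<Longrightarrow> \<pi> p x \<in> carrier_mat (e p) (e p)" using \<pi>(1) by (rule rep_on_closed)
lemma \<pi>_mult: "p \<in> P \<Longrightarrow> x \<in> N1 \<Longrightarrow> y \<in> N1 \<Longrightarrow> \<pi> p (x \<otimes> y) = \<pi> p x * \<pi> p y" using \<pi>(1) by (rule rep_on_mult)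
lemma \<pi>_one: "p \<in> P \<Longrightarrow> \<pi> p \<one> = 1\<^sub>m (e p)" using \<pi>(1) by (rule rep_on_one)
lemma U_closed: "p \<in> P \<Longrightarrow> x \<in> A \<Longrightarrow> U p x \<in> carrier_mat (e p) (e p)" using U(1) by (rule rep_on_closed)
lemma U_mult: "p \<in> P \<Longrightarrow> x \<in> A \<Longrightarrow> y \<in> A \<Longrightarrow> U p (x \<otimes> y) = U p x * U p y" using U(1) by (rule rep_on_mult)
lemma U_one: "p \<in> P \<Longrightarrow> U p \<one> = 1\<^sub>m (e p)" using U(1) by (rule rep_on_one)
lemma e_pos: "p \<in> P \<Longrightarrow> 0 < e p" using \<pi>(2) by (auto simp: irr_on_def)

lemma \<pi>_Z: "p \<in> P \<Longrightarrow> z \<in> Z \<Longrightarrow> \<pi> p z = \<psi>p p z \<cdot>\<^sub>m 1\<^sub>m (e p)"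
  by (rule irreducible_scalar[where Z = Z and \<psi> = "\<psi>p p", OF sub(1,2,5) \<pi> Z_norm \<psi>p_inv])

lemma \<psi>p_one: "p \<in> P \<Longrightarrow> \<psi>p p \<one> = 1"
proof -
  assume p: "p \<in> P"
  have "(\<psi>p p \<one> \<cdot>\<^sub>m 1\<^sub>m (e p)) $$ (0, 0) = (1\<^sub>m (e p) :: complex mat) $$ (0, 0)"
    using \<pi>_Z[OF p Z.one_closed] \<pi>_one[OF p] by simp
  then show ?thesis using e_pos[OF p] by simp
qed

lemma \<chi>_one: "t \<in> \<Theta> \<Longrightarrow> \<chi> t \<one> = 1"
  using \<chi>_N1[of t \<one>] \<psi>p_one[OF rr] by simp

lemma \<sigma>_N1: "t \<in> \<Theta> \<Longrightarrow> x \<in> N1 \<Longrightarrow> \<sigma> t x = \<pi> (rr t) x"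
  using \<sigma>[of t \<one> x] \<chi>_one[of t] U_one[OF rr, of t] \<pi>_closed[OF rr, of t x] by (auto intro!: eq_matI)

lemma \<sigma>_A: "t \<in> \<Theta> \<Longrightarrow> g \<in> A \<Longrightarrow> \<sigma> t g = \<chi> t g \<cdot>\<^sub>m U (rr t) g"
  using \<sigma>[of t g \<one>] \<pi>_one[OF rr, of t] U_closed[OF rr, of t g] by simp

lemma U_inv: "p \<in> P \<Longrightarrow> g \<in> A \<Longrightarrow> U p g * U p (inv g) = 1\<^sub>m (e p)"
  using U_mult[of p g "inv g"] U_one by simp

text \<open>Moving \<open>x\<close> to the right of \<open>f\<close> conjugates it to
  \<open>inv f \<otimes> x \<otimes> f\<close>, whose image under \<pi> is the conjugate by
  \<open>U f\<close>. So a product of two defining expressions is again of that form.\<close>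

lemma rep_H:
  assumes t: "t \<in> \<Theta>"
  shows "rep_on G H (e (rr t)) (\<sigma> t)"
proof -
  let ?p = "rr t" and ?e = "e (rr t)"
  note p = rr[OF t]
  have c: "\<sigma> t h \<in> carrier_mat ?e ?e" if h: "h \<in> H" for h
  proof -
    obtain g x where gx: "g \<in> A" "x \<in> N1" "h = g \<otimes> x" using H_prod[OF h] by auto
    then show ?thesis using \<sigma>[OF t gx(1,2)] U_closed[OF p gx(1)] \<pi>_closed[OF p gx(2)] by simp
  qed
  have m: "\<sigma> t (h \<otimes> k) = \<sigma> t h * \<sigma> t k" if h: "h \<in> H" and k: "k \<in> H" for h k
  proof -
    obtain g x where gx: "g \<in> A" "x \<in> N1" "h = g \<otimes> x" using H_prod[OF h] by auto
    obtain f y where fy: "f \<in> A" "y \<in> N1" "k = f \<otimes> y" using H_prod[OF k] by auto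
    let ?x = "inv f \<otimes> x \<otimes> f"
    have x: "?x \<in> N1" using A_norm[OF fy(1) gx(2)] .
    have hk: "h \<otimes> k = (g \<otimes> f) \<otimes> (?x \<otimes> y)"
    proof -
      have "(g \<otimes> f) \<otimes> (?x \<otimes> y) = g \<otimes> (f \<otimes> (inv f \<otimes> (x \<otimes> (f \<otimes> y))))"
        using gx fy by (simp add: m_assoc)
      also have "\<dots> = g \<otimes> (x \<otimes> (f \<otimes> y))" using gx fy by (simp add: m_assoc[symmetric])
      finally show ?thesis using gx fy by (simp add: m_assoc)
    qed
    note cc = U_closed[OF p gx(1)] U_closed[OF p fy(1)] \<pi>_closed[OF p gx(2)] \<pi>_closed[OF p fy(2)]
      U_closed[OF p A.m_inv_closed[OF fy(1)]]
    have "U ?p (g \<otimes> f) * \<pi> ?p (?x \<otimes> y) =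
        (U ?p g * U ?p f) * ((U ?p (inv f) * \<pi> ?p x * U ?p f) * \<pi> ?p y)"
      using U_mult[OF p gx(1) fy(1)] \<pi>_mult[OF p x fy(2)] U(2)[OF p fy(1) gx(2)] by simp
    also have "\<dots> = U ?p g * ((U ?p f * U ?p (inv f)) * (\<pi> ?p x * (U ?p f * \<pi> ?p y)))"
      using cc by (simp add: assoc_mult_mat[of _ ?e ?e _ ?e _ ?e])
    also have "\<dots> = (U ?p g * \<pi> ?p x) * (U ?p f * \<pi> ?p y)"
      unfolding U_inv[OF p fy(1)] using cc by (simp add: assoc_mult_mat[of _ ?e ?e _ ?e _ ?e])
    finally have 1: "U ?p (g \<otimes> f) * \<pi> ?p (?x \<otimes> y) = (U ?p g * \<pi> ?p x) * (U ?p f * \<pi> ?p y)" .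
    have "\<sigma> t (h \<otimes> k) = (\<chi> t g * \<chi> t f) \<cdot>\<^sub>m ((U ?p g * \<pi> ?p x) * (U ?p f * \<pi> ?p y))"
      unfolding hk using \<sigma>[OF t, of "g \<otimes> f" "?x \<otimes> y"] gx fy x 1 \<chi>_mult[OF t gx(1) fy(1)] by simp
    also have "\<dots> = \<sigma> t h * \<sigma> t k"
      unfolding gx(3) fy(3) \<sigma>[OF t gx(1,2)] \<sigma>[OF t fy(1,2)]
      using cc by (intro eq_matI) auto
    finally show ?thesis .
  qed
  have "\<sigma> t \<one> = 1\<^sub>m ?e" using \<sigma>_N1[OF t, of \<one>] \<pi>_one[OF p] by simp
  then show ?thesis using c m by (simp add: rep_on_def)
qed

lemma clifford_rep_\<sigma>:
  assumes t: "t \<in> \<Theta>"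
  shows "clifford_rep G N H \<psi> (e (rr t)) (\<sigma> t)"
proof unfold_locales
  note p = rr[OF t]
  show "rep_on G H (e (rr t)) (\<sigma> t)" by (rule rep_H[OF t])
  have "irr_on N1 (e (rr t)) (\<sigma> t)"
    using \<pi>(2)[OF p] irr_on_cong[of N1 "\<sigma> t" "\<pi> (rr t)"] \<sigma>_N1[OF t] by simp
  then show "irr_on H (e (rr t)) (\<sigma> t)" using irr_on_mono sub(6) by metis
  show "\<sigma> t n = \<psi> n \<cdot>\<^sub>m 1\<^sub>m (e (rr t))" if "n \<in> N" for n
  proof -
    have "n \<in> Z" using sub(4) that by auto
    then show ?thesis using \<sigma>_N1[OF t ZN1] \<pi>_Z[OF p] \<psi>p_N[OF p that] by simp
  qed
qed

text \<open>On \<open>Z\<close> a nonzero intertwiner equates the two characters, so both parameters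
  select the same extension. On \<open>N1\<close> it is then scalar by Schur's lemma, and on
  \<open>A\<close> the nonzero scalar cancels and leaves \<chi>.\<close>

lemma \<sigma>_inj:
  assumes t: "t \<in> \<Theta>" "t' \<in> \<Theta>" and Q: "Q \<in> carrier_mat (e (rr t')) (e (rr t))" "Q \<noteq> 0\<^sub>m (e (rr t')) (e (rr t))"
    and c: "\<And>h. h \<in> H \<Longrightarrow> Q * \<sigma> t h = \<sigma> t' h * Q"
  shows "t = t'"
proof -
  note p = rr[OF t(1)] rr[OF t(2)]
  have "\<psi>p (rr t) z = \<psi>p (rr t') z" if z: "z \<in> Z" for z
  proof -
    have "Q * \<sigma> t z = \<sigma> t' z * Q" using c z ZN1 sub(6) by blast
    then have "Q * (\<psi>p (rr t) z \<cdot>\<^sub>m 1\<^sub>m (e (rr t))) = (\<psi>p (rr t') z \<cdot>\<^sub>m 1\<^sub>m (e (rr t'))) * Q"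
      using \<sigma>_N1[OF t(1) ZN1[OF z]] \<sigma>_N1[OF t(2) ZN1[OF z]] \<pi>_Z[OF p(1) z] \<pi>_Z[OF p(2) z] by simp
    then have "\<psi>p (rr t) z \<cdot>\<^sub>m Q = \<psi>p (rr t') z \<cdot>\<^sub>m Q"
      using Q(1) mult_smult_distrib[OF Q(1) one_carrier_mat] mult_smult_assoc_mat[OF one_carrier_mat Q(1)] by simp
    then show ?thesis using smult_mat_cancel Q by blast
  qed
  then have pp: "rr t = rr t'" using sep p by blast
  let ?e = "e (rr t)"
  have Qc: "Q \<in> carrier_mat ?e ?e" using Q pp by simp
  have "Q * \<pi> (rr t) x = \<pi> (rr t) x * Q" if "x \<in> N1" for x
    using c[of x] sub(6) that \<sigma>_N1[OF t(1) that] \<sigma>_N1[OF t(2) that] pp by auto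
  then obtain s where s: "Q = s \<cdot>\<^sub>m 1\<^sub>m ?e"
    using Schur_scalar[OF \<pi>(2)[OF p(1)] \<pi>_closed[OF p(1)] Qc] by metis
  have s0: "s \<noteq> 0"
  proof
    assume "s = 0"
    then have "Q = 0\<^sub>m ?e ?e" using s by (auto intro!: eq_matI)
    then show False using Q pp by simp
  qed
  have "\<chi> t g = \<chi> t' g" if g: "g \<in> A" for g
  proof -
    note u = U_closed[OF p(1) g]
    have "Q * \<sigma> t g = \<sigma> t' g * Q" using c g sub(7) by blast
    then have "Q * (\<chi> t g \<cdot>\<^sub>m U (rr t) g) = (\<chi> t' g \<cdot>\<^sub>m U (rr t) g) * Q"
      using \<sigma>_A[OF t(1) g] \<sigma>_A[OF t(2) g] pp by simp
    then have "s \<cdot>\<^sub>m (\<chi> t g \<cdot>\<^sub>m U (rr t) g) = s \<cdot>\<^sub>m (\<chi> t' g \<cdot>\<^sub>m U (rr t) g)"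
      using u mult_smult_assoc_mat[OF one_carrier_mat, of "\<chi> t g \<cdot>\<^sub>m U (rr t) g" ?e ?e s]
        mult_smult_distrib[OF _ one_carrier_mat, of "\<chi> t' g \<cdot>\<^sub>m U (rr t) g" ?e ?e s]
      unfolding s by simp
    moreover have "(s * c) \<cdot>\<^sub>m M = s \<cdot>\<^sub>m (c \<cdot>\<^sub>m M)" for c and M :: "complex mat" by (intro eq_matI) auto
    ultimately have "(s * \<chi> t g) \<cdot>\<^sub>m U (rr t) g = (s * \<chi> t' g) \<cdot>\<^sub>m U (rr t) g" by simp
    moreover have "U (rr t) g \<noteq> 0\<^sub>m ?e ?e"
    proof
      assume "U (rr t) g = 0\<^sub>m ?e ?e"
      then have "0\<^sub>m ?e ?e = (1\<^sub>m ?e :: complex mat)"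
        using U_inv[OF p(1) g] U_closed[OF p(1) A.m_inv_closed[OF g]] by simp
      then have "(0\<^sub>m ?e ?e :: complex mat) $$ (0, 0) = 1\<^sub>m ?e $$ (0, 0)" by simp
      then show False using e_pos[OF p(1)] by simp
    qed
    ultimately have "s * \<chi> t g = s * \<chi> t' g" using smult_mat_cancel u by blast
    then show ?thesis using s0 by simp
  qed
  then show ?thesis using \<chi>_inj t by blast
qed

text \<open>For a suitable \<open>y\<close> the conjugate of \<open>\<pi> p x\<close> by
  \<open>\<pi> p y\<close> is its multiple by a scalar different from 1, whereas the trace is
  invariant under conjugation.\<close>

lemma trace_off_Z:
  assumes p: "p \<in> P" and x: "x \<in> N1" "x \<notin> Z"
  shows "(\<Sum>i<e p. \<pi> p x $$ (i, i)) = 0"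
proof -
  obtain y where y: "y \<in> N1" "y \<otimes> x \<otimes> inv y \<otimes> inv x \<in> Z" "\<psi>p p (y \<otimes> x \<otimes> inv y \<otimes> inv x) \<noteq> 1"
    using nondeg[OF p x] by auto
  define k where "k = y \<otimes> x \<otimes> inv y \<otimes> inv x"
  have yi: "inv y \<in> N1" using y by simp
  have kx: "k \<otimes> x \<otimes> y = y \<otimes> x"
    unfolding k_def using x y by (simp add: m_assoc)
  have "\<psi>p p k \<cdot>\<^sub>m (\<pi> p x * \<pi> p y) = \<pi> p y * \<pi> p x"
  proof -
    have "\<pi> p (k \<otimes> x \<otimes> y) = (\<psi>p p k \<cdot>\<^sub>m 1\<^sub>m (e p)) * \<pi> p x * \<pi> p y"
      using \<pi>_mult[OF p] ZN1 y x \<pi>_Z[OF p] by (simp add: k_def[symmetric])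
    then show ?thesis
      using kx \<pi>_mult[OF p y(1) x(1)] \<pi>_closed[OF p x(1)] \<pi>_closed[OF p y(1)]
        mult_smult_assoc_mat[OF one_carrier_mat \<pi>_closed[OF p x(1)]]
        mult_smult_assoc_mat[OF \<pi>_closed[OF p x(1)] \<pi>_closed[OF p y(1)]] by simp
  qed
  then have "\<psi>p p k \<cdot>\<^sub>m (\<pi> p x * \<pi> p y) * \<pi> p (inv y) = \<pi> p y * \<pi> p x * \<pi> p (inv y)" by simp
  moreover have "\<pi> p y * \<pi> p (inv y) = 1\<^sub>m (e p)" "\<pi> p (inv y) * \<pi> p y = 1\<^sub>m (e p)"
    using \<pi>_mult[OF p y(1) yi] \<pi>_mult[OF p yi y(1)] \<pi>_one[OF p] y by auto
  ultimately have eq: "\<psi>p p k \<cdot>\<^sub>m \<pi> p x = \<pi> p y * (\<pi> p x * \<pi> p (inv y))"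
    using \<pi>_closed[OF p x(1)] \<pi>_closed[OF p y(1)] \<pi>_closed[OF p yi]
    by (simp add: mult_smult_assoc_mat[of _ "e p" "e p" _ "e p"] assoc_mult_mat[of _ "e p" "e p" _ "e p" _ "e p"])
  have "\<psi>p p k * (\<Sum>i<e p. \<pi> p x $$ (i, i)) = (\<Sum>i<e p. (\<psi>p p k \<cdot>\<^sub>m \<pi> p x) $$ (i, i))"
    unfolding sum_distrib_left using \<pi>_closed[OF p x(1)] by (intro sum.cong) auto
  also have "\<dots> = (\<Sum>i<e p. (\<pi> p x * \<pi> p (inv y) * \<pi> p y) $$ (i, i))"
    unfolding eq using \<pi>_closed[OF p x(1)] \<pi>_closed[OF p y(1)] \<pi>_closed[OF p yi] by (intro trace_mult_swap) auto
  also have "\<pi> p x * \<pi> p (inv y) * \<pi> p y = \<pi> p x"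
    using \<open>\<pi> p (inv y) * \<pi> p y = _\<close> \<pi>_closed[OF p x(1)] \<pi>_closed[OF p y(1)] \<pi>_closed[OF p yi]
    by (simp add: assoc_mult_mat[of _ "e p" "e p" _ "e p" _ "e p"])
  finally have "(\<psi>p p k - 1) * (\<Sum>i<e p. \<pi> p x $$ (i, i)) = 0" by (simp add: algebra_simps)
  then show ?thesis using y(3) by (simp add: k_def)
qed

text \<open>An element \<open>g\<close> of \<open>A\<close> sends an intertwiner \<open>Q\<close> to
  \<open>U p (inv g) * Q * R g\<close>; these operators commute because \<open>A\<close> is
  commutative. The eigenvalues on \<open>A \<inter> N1\<close> are those of
  \<open>\<psi>p p\<close>, because \<open>U\<close> is trivial there and \<pi> is scalar on
  \<open>Z\<close>.\<close>

lemma \<sigma>_complete: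
  assumes R: "rep_on G (carrier G) D R" and cont: "contains_char N D R \<psi>"
  shows "\<exists>t\<in>\<Theta>. \<exists>Q\<in>carrier_mat (e (rr t)) D. Q \<noteq> 0\<^sub>m (e (rr t)) D \<and> (\<forall>h\<in>H. Q * R h = \<sigma> t h * Q)"
proof -
  obtain p where p: "p \<in> P" and "contains_char Z D R (\<psi>p p)" using complP[OF R cont] by auto
  then obtain v where v: "v \<in> carrier_vec D" "v \<noteq> 0\<^sub>v D" "\<And>z. z \<in> Z \<Longrightarrow> R z *\<^sub>v v = \<psi>p p z \<cdot>\<^sub>v v"
    unfolding contains_char_def by auto
  have Rc: "R g \<in> carrier_mat D D" if "g \<in> carrier G" for g using rep_on_closed[OF R that] .
  have Rm: "R (g \<otimes> h) = R g * R h" if "g \<in> carrier G" "h \<in> carrier G" for g h using rep_on_mult[OF R that] .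
  have R1: "rep_on G N1 D R" using R unfolding rep_on_def by auto
  let ?e = "e p"
  obtain Q0 where Q0: "Q0 \<in> carrier_mat ?e D" "Q0 \<noteq> 0\<^sub>m ?e D" "\<And>y. y \<in> N1 \<Longrightarrow> Q0 * R y = \<pi> p y * Q0"
    using averaged_intertwiner[OF is_group sub(1) finite_subset[OF N1.subset finG] \<pi>(1)[OF p] e_pos[OF p] R1
        sub(2,5) trace_off_Z[OF p] \<pi>_Z[OF p] v] by metis
  define W where "W = {Q \<in> carrier_mat ?e D. \<forall>y\<in>N1. Q * R y = \<pi> p y * Q}"
  define F where "F g Q = U p (inv g) * Q * R g" for g Q
  have F_mult: "F (g \<otimes> h) Q = F h (F g Q)" if "g \<in> A" "h \<in> A" "Q \<in> carrier_mat ?e D" for g h Q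
  proof -
    note cc = U_closed[OF p A.m_inv_closed[OF that(1)]] U_closed[OF p A.m_inv_closed[OF that(2)]]
      Rc[OF A.mem_carrier[OF that(1)]] Rc[OF A.mem_carrier[OF that(2)]] that(3)
    have "inv (g \<otimes> h) = inv h \<otimes> inv g" using that by (simp add: inv_mult_group)
    then have "F (g \<otimes> h) Q = (U p (inv h) * U p (inv g)) * Q * (R g * R h)"
      using that U_mult[OF p, of "inv h" "inv g"] Rm[of g h] by (simp add: F_def)
    also have "\<dots> = F h (F g Q)"
      unfolding F_def using cc
      by (simp add: assoc_mult_mat[of _ ?e ?e _ ?e _ D] assoc_mult_mat[of _ ?e ?e _ D _ D] assoc_mult_mat[of _ ?e D _ D _ D])
    finally show ?thesis .
  qed
  have FW: "F g Q \<in> W" if g: "g \<in> A" and Q: "Q \<in> W" for g Q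
  proof -
    have gi: "inv g \<in> A" and gG: "g \<in> carrier G" using g by auto
    note cc = U_closed[OF p gi] U_closed[OF p g] Rc[OF gG]
    have Qc: "Q \<in> carrier_mat ?e D" using Q by (simp add: W_def)
    have "F g Q * R y = \<pi> p y * F g Q" if y: "y \<in> N1" for y
    proof -
      have yG: "y \<in> carrier G" using y by auto
      let ?y = "g \<otimes> y \<otimes> inv g"
      have y': "?y \<in> N1" using A_norm[OF gi y] g by simp
      note cy = Rc[OF yG] \<pi>_closed[OF p y] \<pi>_closed[OF p y'] Rc[OF N1.mem_carrier[OF y']]
      have "R g * R y = R (?y \<otimes> g)" using g y by (simp add: m_assoc Rm[symmetric])
      also have "\<dots> = R ?y * R g" using y' g by (intro Rm) auto
      finally have 1: "R g * R y = R ?y * R g" .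
      have 2: "\<pi> p ?y = U p g * \<pi> p y * U p (inv g)" using U(2)[OF p gi y] g by simp
      have 3: "U p (inv g) * U p g = 1\<^sub>m ?e" using U_inv[OF p gi] g by simp
      have "F g Q * R y = U p (inv g) * (Q * (R g * R y))"
        unfolding F_def using cc cy Qc
        by (simp add: assoc_mult_mat[of _ ?e ?e _ D _ D] assoc_mult_mat[of _ ?e D _ D _ D])
      also have "\<dots> = U p (inv g) * ((Q * R ?y) * R g)"
        unfolding 1 using cc cy Qc by (simp add: assoc_mult_mat[of _ ?e D _ D _ D])
      also have "Q * R ?y = \<pi> p ?y * Q" using Q y' by (simp add: W_def)
      also have "U p (inv g) * (\<pi> p ?y * Q * R g) = (U p (inv g) * U p g) * (\<pi> p y * (U p (inv g) * Q * R g))"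
        unfolding 2 using cc cy Qc
        by (simp add: assoc_mult_mat[of _ ?e ?e _ D _ D] assoc_mult_mat[of _ ?e ?e _ ?e _ D]
            assoc_mult_mat[of _ ?e ?e _ ?e _ ?e])
      also have "\<dots> = \<pi> p y * F g Q"
        unfolding 3 F_def using cc cy Qc left_mult_one_mat[of "\<pi> p y * (U p (inv g) * Q * R g)" ?e D] by simp
      finally show ?thesis .
    qed
    then show ?thesis using cc Qc by (simp add: W_def F_def)
  qed
  have F1: "F \<one> Q = Q" if "Q \<in> W" for Q
    using that U_one[OF p] rep_on_one[OF R] by (auto simp: F_def W_def)
  have Wadd: "X + Y \<in> W" if "X \<in> W" "Y \<in> W" for X Y
  proof -
    have "X \<in> carrier_mat ?e D" "Y \<in> carrier_mat ?e D" using that by (auto simp: W_def)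
    then show ?thesis using that unfolding W_def
      by (auto simp: add_mult_distrib_mat[OF _ _ Rc] mult_add_distrib_mat[OF \<pi>_closed[OF p]])
  qed
  have Wsm: "c \<cdot>\<^sub>m X \<in> W" if "X \<in> W" for X c
  proof -
    have "X \<in> carrier_mat ?e D" using that by (auto simp: W_def)
    then show ?thesis using that unfolding W_def
      by (auto simp: mult_smult_assoc_mat[OF _ Rc] mult_smult_distrib[OF \<pi>_closed[OF p]])
  qed
  have FF: "F g (F h X) = F h (F g X)" if "g \<in> A" "h \<in> A" "X \<in> W" for g h X
    using F_mult[of g h X] F_mult[of h g X] A_comm[of g h] that by (simp add: W_def)
  obtain Q \<chi>0 where Q: "Q \<in> W" "Q \<noteq> 0\<^sub>m ?e D" and FQ: "\<And>g. g \<in> A \<Longrightarrow> F g Q = \<chi>0 g \<cdot>\<^sub>m Q"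
    and \<chi>0_mult: "\<And>g h. g \<in> A \<Longrightarrow> h \<in> A \<Longrightarrow> \<chi>0 (g \<otimes> h) = \<chi>0 g * \<chi>0 h"
  proof (rule common_eigen_mat[OF finG A.subgroup_axioms, of Q0 W ?e D F])
    show "Q0 \<in> W" "Q0 \<noteq> 0\<^sub>m ?e D" using Q0 by (auto simp: W_def)
    show "W \<subseteq> carrier_mat ?e D" by (auto simp: W_def)
    show "F g (X + Y) = F g X + F g Y" if g: "g \<in> A" and X: "X \<in> W" and Y: "Y \<in> W" for g X Y
    proof -
      have XY: "X \<in> carrier_mat ?e D" "Y \<in> carrier_mat ?e D" using X Y by (auto simp: W_def)
      note u = U_closed[OF p A.m_inv_closed[OF g]] and r = Rc[OF A.mem_carrier[OF g]]
      show ?thesis unfolding F_def mult_add_distrib_mat[OF u XY]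
        using add_mult_distrib_mat[OF _ _ r, of "U p (inv g) * X" ?e "U p (inv g) * Y"] u XY by simp
    qed
    show "F g (c \<cdot>\<^sub>m X) = c \<cdot>\<^sub>m F g X" if g: "g \<in> A" and X: "X \<in> W" for g X c
    proof -
      have X: "X \<in> carrier_mat ?e D" using X by (auto simp: W_def)
      note u = U_closed[OF p A.m_inv_closed[OF g]] and r = Rc[OF A.mem_carrier[OF g]]
      show ?thesis unfolding F_def mult_smult_distrib[OF u X]
        using mult_smult_assoc_mat[OF _ r, of "U p (inv g) * X" ?e c] u X by simp
    qed
    show "F (g \<otimes> h) X = F g (F h X)" if "g \<in> A" "h \<in> A" "X \<in> W" for g h X
      using F_mult[of g h X] FF[OF that] that by (simp add: W_def)
  qed (use Wadd Wsm FW FF F1 in auto)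
  have Qc: "Q \<in> carrier_mat ?e D" using Q by (simp add: W_def)
  \<comment> \<open>Cancelling \<open>U p (inv g)\<close> turns the eigenvector equation into the
    intertwining relation on \<open>A\<close>.\<close>
  have QR: "Q * R g = \<chi>0 g \<cdot>\<^sub>m (U p g * Q)" if g: "g \<in> A" for g
  proof -
    note u = U_closed[OF p A.m_inv_closed[OF g]] U_closed[OF p g] and r = Rc[OF A.mem_carrier[OF g]]
    have "Q * R g = (U p g * U p (inv g)) * (Q * R g)" using U_inv[OF p g] Qc r by simp
    also have "\<dots> = U p g * F g Q" unfolding F_def using u r Qc
      by (simp add: assoc_mult_mat[of _ ?e ?e _ ?e _ D] assoc_mult_mat[of _ ?e ?e _ D _ D])
    finally show ?thesis unfolding FQ[OF g] using mult_smult_distrib[OF u(2) Qc] by simp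
  qed
  have \<chi>0_N1: "\<chi>0 k = \<psi>p p k" if k: "k \<in> A \<inter> N1" for k
  proof -
    have "\<chi>0 k \<cdot>\<^sub>m Q = Q * R k" using QR[of k] U(3)[OF p k] k Qc by simp
    also have "\<dots> = \<pi> p k * Q" using Q(1) k by (simp add: W_def)
    also have "\<dots> = \<psi>p p k \<cdot>\<^sub>m Q"
      using \<pi>_Z[OF p, of k] k AN1 mult_smult_assoc_mat[OF one_carrier_mat Qc] Qc by (auto simp: subset_iff)
    finally show ?thesis using smult_mat_cancel[OF Qc Q(2)] by simp
  qed
  obtain t where t: "t \<in> \<Theta>" "rr t = p" "\<forall>g\<in>A. \<chi> t g = \<chi>0 g"
    using \<Theta>_ex[OF p, of \<chi>0] \<chi>0_mult \<chi>0_N1 by blast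
  have "Q * R h = \<sigma> t h * Q" if h: "h \<in> H" for h
  proof -
    obtain g x where gx: "g \<in> A" "x \<in> N1" "h = g \<otimes> x" using H_prod[OF h] by auto
    have gG: "g \<in> carrier G" "x \<in> carrier G" using gx by auto
    note cc = U_closed[OF p gx(1)] \<pi>_closed[OF p gx(2)] Rc[OF gG(1)] Rc[OF gG(2)] Qc
    have "Q * R h = (Q * R g) * R x"
      using Rm[OF gG] cc unfolding gx(3) by (simp add: assoc_mult_mat[of _ ?e D _ D _ D])
    also have "\<dots> = \<chi>0 g \<cdot>\<^sub>m (U p g * (Q * R x))"
      unfolding QR[OF gx(1)] using cc mult_smult_assoc_mat[of "U p g * Q" ?e D "R x" D "\<chi>0 g"]
      by (simp add: assoc_mult_mat[of _ ?e ?e _ D _ D])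
    also have "Q * R x = \<pi> p x * Q" using Q(1) gx(2) by (simp add: W_def)
    also have "\<chi>0 g \<cdot>\<^sub>m (U p g * (\<pi> p x * Q)) = (\<chi>0 g \<cdot>\<^sub>m (U p g * \<pi> p x)) * Q"
      using cc mult_smult_assoc_mat[of "U p g * \<pi> p x" ?e ?e Q D "\<chi>0 g"]
      by (simp add: assoc_mult_mat[of _ ?e ?e _ ?e _ D])
    finally show ?thesis using \<sigma>[OF t(1) gx(1,2)] t gx by simp
  qed
  then show ?thesis using t Q Qc by blast
qed

theorem heisenberg_clifford_bij:
  "bij_betw (\<lambda>t. induced_class G H (e (rr t)) (\<sigma> t)) \<Theta> (Irr_over G N \<psi>)"
  by (rule clifford_bij[where d = "\<lambda>t. e (rr t)"])
    (auto intro: clifford_rep_\<sigma> \<sigma>_inj \<sigma>_complete)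

end

section \<open>Unramified extensions generated by a single element\<close>

context discrete_valuation
begin

abbreviation "I \<equiv> val_ideal v"

lemma val_one [simp]: "v 1 = 0"
  using val_mult[of 1 1] by simp

lemma val_uminus [simp]: "v (- x) = v x"
proof (cases "x = 0")
  case False
  have "v (- 1) + v (- 1) = v 1" using val_mult[of "- 1" "- 1"] by simp
  then have "v (- 1) = 0" by simp
  then show ?thesis using val_mult[of "- 1" x] False by simp
qed simp

lemma val_power: "x \<noteq> 0 \<Longrightarrow> v (x ^ n) = int n * v x"
  by (induction n) (auto simp: val_mult algebra_simps)

lemma val_inverse: "x \<noteq> 0 \<Longrightarrow> v (inverse x) = - v x"
  using val_mult[of x "inverse x"] by simp

lemma ideal_zero [simp]: "0 \<in> I j"
  by (simp add: val_ideal_def)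

lemma ideal_add [intro]: "x \<in> I j \<Longrightarrow> y \<in> I j \<Longrightarrow> x + y \<in> I j"
  using val_add[of x y] by (cases "x = 0"; cases "y = 0"; cases "x + y = 0") (auto simp: val_ideal_def)

lemma ideal_uminus [simp]: "- x \<in> I j \<longleftrightarrow> x \<in> I j"
  by (auto simp: val_ideal_def)

lemma ideal_diff [intro]: "x \<in> I j \<Longrightarrow> y \<in> I j \<Longrightarrow> x - y \<in> I j"
  using ideal_add[of x j "- y"] by simp

lemma ideal_sum [intro]: "(\<And>i. i \<in> A \<Longrightarrow> f i \<in> I j) \<Longrightarrow> sum f A \<in> I j"
  by (induction A rule: infinite_finite_induct) auto

lemma ideal_mult: "x \<in> I j \<Longrightarrow> y \<in> I k \<Longrightarrow> x * y \<in> I (j + k)"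
  using val_mult[of x y] by (cases "x = 0"; cases "y = 0") (auto simp: val_ideal_def)

lemma ideal_multL: "x \<in> I 0 \<Longrightarrow> y \<in> I j \<Longrightarrow> x * y \<in> I j"
  using ideal_mult[of x 0 y j] by simp

lemma ideal_multR: "x \<in> I j \<Longrightarrow> y \<in> I 0 \<Longrightarrow> x * y \<in> I j"
  using ideal_mult[of x j y 0] by simp

lemma ideal_mono: "x \<in> I j \<Longrightarrow> k \<le> j \<Longrightarrow> x \<in> I k"
  by (auto simp: val_ideal_def)

lemma ideal_one [simp]: "1 \<in> I 0"
  by (simp add: val_ideal_def)

lemma ideal_power [intro]: "x \<in> I 0 \<Longrightarrow> x ^ n \<in> I 0"
  by (induction n) (auto intro: ideal_multL)

lemma ideal_cancel: "x - y \<in> I j \<Longrightarrow> x \<in> I j \<longleftrightarrow> y \<in> I j"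
  using ideal_diff[of x j "x - y"] ideal_add[of "x - y" j y] by auto

lemma ideal_of_nat [simp]: "of_nat n \<in> I 0"
  by (induction n) auto

lemma ideal_all: "(\<And>j. x \<in> I j) \<Longrightarrow> x = 0"
proof (rule ccontr)
  assume a: "\<And>j. x \<in> I j" and "x \<noteq> 0"
  then have "int (nat (v x) + 1) \<le> v x" using a[of "nat (v x) + 1"] unfolding val_ideal_def by blast
  then show False by linarith
qed

lemma carrier_val_ring: "carrier (val_ring v) = I 0"
  by (auto simp: val_ring_def val_ideal_def)

lemma Units_val_ring: "Units (val_ring v) = {x. x \<noteq> 0 \<and> v x = 0}"
proof -
  have "x \<noteq> 0 \<and> v x = 0" if "y * x = 1" "x = 0 \<or> 0 \<le> v x" "y = 0 \<or> 0 \<le> v y" for x y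
  proof -
    have "y \<noteq> 0" "x \<noteq> 0" using that by auto
    then have "v y + v x = 0" using val_mult[of y x] that by simp
    then show ?thesis using that \<open>x \<noteq> 0\<close> \<open>y \<noteq> 0\<close> by auto
  qed
  moreover have "\<exists>y. (y = 0 \<or> 0 \<le> v y) \<and> y * x = 1 \<and> x * y = 1" if "x \<noteq> 0" "v x = 0" for x
    using that val_inverse[of x] by (intro exI[of _ "inverse x"]) auto
  ultimately show ?thesis by (auto simp: Units_def val_ring_def)
qed

lemma unit_iff: "x \<in> Units (val_ring v) \<longleftrightarrow> x \<in> I 0 \<and> x \<notin> I 1"
  unfolding Units_val_ring by (auto simp: val_ideal_def)

lemma unit_nonzero: "x \<in> Units (val_ring v) \<Longrightarrow> x \<noteq> 0"
  unfolding Units_val_ring by auto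

lemma unit_inverse: "x \<in> Units (val_ring v) \<Longrightarrow> inverse x \<in> Units (val_ring v)"
  unfolding Units_val_ring by (auto simp: val_inverse)

lemma unit_mult: "x \<in> Units (val_ring v) \<Longrightarrow> y \<in> Units (val_ring v) \<Longrightarrow> x * y \<in> Units (val_ring v)"
  unfolding Units_val_ring by (auto simp: val_mult)

lemma unit_integral: "x \<in> Units (val_ring v) \<Longrightarrow> x \<in> I 0"
  unfolding unit_iff by simp

lemma unit_mult_iff: "x \<in> Units (val_ring v) \<Longrightarrow> x * y \<in> I j \<longleftrightarrow> y \<in> I j"
  unfolding Units_val_ring by (cases "y = 0") (auto simp: val_ideal_def val_mult)

lemma unit_divide: "x \<in> I j \<Longrightarrow> y \<in> Units (val_ring v) \<Longrightarrow> x / y \<in> I j"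
  using ideal_multR[OF _ unit_integral[OF unit_inverse], of x j y] by (simp add: divide_inverse)

lemma unit_cong: "x \<in> Units (val_ring v) \<Longrightarrow> x - y \<in> I 1 \<Longrightarrow> y \<in> Units (val_ring v)"
  unfolding unit_iff
  using ideal_cancel[of x y 1] ideal_cancel[OF ideal_mono, of x y 1 0] by auto

lemma unit_one [simp]: "1 \<in> Units (val_ring v)"
  unfolding Units_val_ring by simp

lemma prime_ideal: "x \<in> I 0 \<Longrightarrow> y \<in> I 0 \<Longrightarrow> x * y \<in> I 1 \<Longrightarrow>
    x \<in> I 1 \<or> y \<in> I 1"
  using unit_mult[of x y] unfolding unit_iff by auto

lemma prime_ideal_power: "x \<in> I 0 \<Longrightarrow> x ^ n \<in> I 1 \<Longrightarrow> x \<in> I 1"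
proof (induction n)
  case (Suc n)
  then show ?case using prime_ideal[of x "x ^ n"] by auto
qed (auto simp: val_ideal_def)

end

locale uniformized = discrete_valuation v for v :: "'a::field \<Rightarrow> int" +
  fixes \<pi> :: 'a
  assumes \<pi>: "\<pi> \<noteq> 0" "v \<pi> = 1"
begin

lemma \<pi>_power_nz [simp]: "\<pi> ^ n \<noteq> 0" using \<pi> by simp

lemma \<pi>_power_mem: "\<pi> ^ j \<in> I j"
  using \<pi> by (simp add: val_ideal_def val_power)

lemma ideal_shift: "\<pi> ^ j * x \<in> I (j + k) \<longleftrightarrow> x \<in> I k"
  using \<pi> by (cases "x = 0") (auto simp: val_ideal_def val_mult val_power)

lemma ideal_shift0: "\<pi> ^ j * x \<in> I j \<longleftrightarrow> x \<in> I 0"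
  using ideal_shift[of j x 0] by simp

lemma idealE:
  assumes "x \<in> I j"
  obtains y where "y \<in> I 0" "x = \<pi> ^ j * y"
  using that[of "x / \<pi> ^ j"] assms ideal_shift0[of j "x / \<pi> ^ j"] \<pi> by simp

lemma clear_denominator: "\<exists>k. \<pi> ^ k * x \<in> I 0"
  using \<pi> by (intro exI[of _ "nat (- v x)"]) (cases "x = 0"; auto simp: val_ideal_def val_mult val_power)

lemma clear_denominators: "finite A \<Longrightarrow> \<exists>k. \<forall>x\<in>A. \<pi> ^ k * f x \<in> I 0"
proof (induction A rule: finite_induct)
  case (insert a A)
  then obtain k where k: "\<forall>x\<in>A. \<pi> ^ k * f x \<in> I 0" by auto
  obtain j where j: "\<pi> ^ j * f a \<in> I 0" using clear_denominator by auto
  have p: "\<pi> ^ i \<in> I 0" for i using \<pi>_power_mem by (rule ideal_mono) simp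
  have "\<pi> ^ (j + k) * f x = \<pi> ^ j * (\<pi> ^ k * f x)" "\<pi> ^ (j + k) * f x = \<pi> ^ k * (\<pi> ^ j * f x)" for x
    by (simp_all add: power_add mult.assoc mult.left_commute)
  then show ?case using k j ideal_multL[OF p] by (intro exI[of _ "j + k"]) (metis insertE)
qed auto

end

locale complete_uniformized = uniformized v \<pi> + nonarch_local_field v for v :: "'a::field \<Rightarrow> int" and \<pi>
begin

text \<open>All uses of completeness pass through this form, in which the partial sums approximate
  the limit at a prescribed rate.\<close>

lemma series_limit:
  assumes c: "\<And>k. c k \<in> I 0"
  obtains L where "\<And>n. L - (\<Sum>k<n. \<pi> ^ k * c k) \<in> I n"
proof -
  define X where "X n = (\<Sum>k<n. \<pi> ^ k * c k)" for n
  have X: "X a - X b \<in> I j" if "j \<le> b" "b \<le> a" for a b j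
  proof -
    have "X a - X b = (\<Sum>k\<in>{b..<a}. \<pi> ^ k * c k)"
      unfolding X_def lessThan_atLeast0 using sum.atLeastLessThan_concat[of 0 b a "\<lambda>k. \<pi> ^ k * c k"] that
      by (simp add: algebra_simps)
    also have "\<dots> \<in> I j"
      using that c by (intro ideal_sum ideal_multR) (auto intro: ideal_mono[OF \<pi>_power_mem])
    finally show ?thesis .
  qed
  have "\<exists>N. \<forall>a\<ge>N. \<forall>b\<ge>N. X a - X b \<in> I j" for j
  proof (intro exI[of _ j] allI impI)
    fix a b assume ab: "j \<le> a" "j \<le> b"
    show "X a - X b \<in> I j"
    proof (cases "b \<le> a")
      case False
      then have "- (X b - X a) \<in> I j" using X[of j a b] ab by (subst ideal_uminus) auto
      then show ?thesis by simp
    qed (use X ab in auto)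
  qed
  then obtain L where L: "\<forall>j. \<exists>N. \<forall>a\<ge>N. X a - L \<in> I j" using complete by blast
  have "L - X n \<in> I n" for n
  proof -
    obtain N where N: "\<forall>a\<ge>N. X a - L \<in> I n" using L by auto
    have "(X (max N n) - X n) - (X (max N n) - L) \<in> I n"
      by (rule ideal_diff) (use X[of n n "max N n"] N in auto)
    then show ?thesis by simp
  qed
  then show thesis by (intro that[of L]) (simp add: X_def)
qed

end

text \<open>Preservation of the normalised valuations means that \<open>e \<pi>\<close> remains a
  uniformizer, so that expansions in powers of \<pi> can be made in both fields at once.\<close>

locale unramified_gen =
  F: complete_uniformized v \<pi> + K: discrete_valuation w
  for v :: "'f::field \<Rightarrow> int" and \<pi> and w :: "'k::field \<Rightarrow> int" +
  fixes e :: "'f \<Rightarrow> 'k" and \<beta> :: 'k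
  assumes e_hom: "e 1 = 1" "e (a + b) = e a + e b" "e (a * b) = e a * e b"
    and e_val: "x \<noteq> 0 \<Longrightarrow> w (e x) = v x"
    and \<beta>_unit: "\<beta> \<in> Units (val_ring w)"
    and OK_gen: "carrier (val_ring w) = {poly (map_poly e p) \<beta> | p. \<forall>i. coeff p i \<in> carrier (val_ring v)}"
begin

lemma e_zero [simp]: "e 0 = 0" using e_hom(2)[of 0 0] by (metis add_cancel_right_right add_0)
lemma e_one [simp]: "e 1 = 1" by (rule e_hom)
lemma e_add: "e (a + b) = e a + e b" by (rule e_hom)
lemma e_mult: "e (a * b) = e a * e b" by (rule e_hom)
lemma e_uminus: "e (- a) = - e a" using e_add[of a "- a"] by (simp add: eq_neg_iff_add_eq_0 add.commute)
lemma e_diff: "e (a - b) = e a - e b" using e_add[of a "- b"] by (simp add: e_uminus)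
lemma e_power: "e (a ^ n) = e a ^ n" by (induction n) (simp_all add: e_mult)
lemma e_sum: "e (sum f A) = (\<Sum>i\<in>A. e (f i))" by (induction A rule: infinite_finite_induct) (simp_all add: e_add)
lemma e_eq_0 [simp]: "e a = 0 \<longleftrightarrow> a = 0"
  using e_mult[of a "inverse a"] by (cases "a = 0") auto
lemma e_inj: "e a = e b \<longleftrightarrow> a = b" using e_eq_0[of "a - b"] by (auto simp: e_diff)
lemma e_inverse: "e (inverse a) = inverse (e a)"
proof (cases "a = 0")
  case False
  then show ?thesis using e_mult[of a "inverse a"] by (simp add: inverse_unique)
qed simp
lemma e_of_nat: "e (of_nat n) = of_nat n" by (induction n) (simp_all add: e_add)
lemma e_ideal [simp]: "e x \<in> K.I j \<longleftrightarrow> x \<in> F.I j"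
  by (cases "x = 0") (auto simp: val_ideal_def e_val)
lemma e_unit [simp]: "e x \<in> Units (val_ring w) \<longleftrightarrow> x \<in> Units (val_ring v)"
  by (auto simp: F.Units_val_ring K.Units_val_ring e_val)

sublocale K: uniformized w "e \<pi>"
  by unfold_locales (use F.\<pi> in \<open>auto simp: e_val\<close>)

lemma \<beta>_integral: "\<beta> ^ i \<in> K.I 0"
  using K.unit_integral[OF \<beta>_unit] by auto

definition ev :: "nat \<Rightarrow> (nat \<Rightarrow> 'f) \<Rightarrow> 'k" where
  "ev n c = (\<Sum>i<n. e (c i) * \<beta> ^ i)"

lemma ev_ideal: "(\<And>i. i < n \<Longrightarrow> c i \<in> F.I j) \<Longrightarrow> ev n c \<in> K.I j"
  unfolding ev_def using \<beta>_integral by (intro K.ideal_sum K.ideal_multR) auto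

lemma ev_add: "ev n (\<lambda>i. c i + c' i) = ev n c + ev n c'"
  by (simp add: ev_def e_add sum.distrib algebra_simps)
lemma ev_diff: "ev n (\<lambda>i. c i - c' i) = ev n c - ev n c'"
  by (simp add: ev_def e_diff sum_subtractf algebra_simps)
lemma ev_smult: "ev n (\<lambda>i. a * c i) = e a * ev n c"
  by (simp add: ev_def e_mult sum_distrib_left algebra_simps)
lemma ev_cong: "(\<And>i. i < n \<Longrightarrow> c i = c' i) \<Longrightarrow> ev n c = ev n c'"
  by (simp add: ev_def)
lemma ev_sum: "ev n (\<lambda>i. \<Sum>k\<in>A. c k i) = (\<Sum>k\<in>A. ev n (c k))"
  unfolding ev_def e_sum sum_distrib_right by (rule sum.swap)

lemma OK_ev:
  assumes "y \<in> K.I 0"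
  obtains n c where "\<And>i. c i \<in> F.I 0" "y = ev n c"
proof -
  obtain p where p: "y = poly (map_poly e p) \<beta>" "\<And>i. coeff p i \<in> F.I 0"
    using assms OK_gen by (auto simp: F.carrier_val_ring K.carrier_val_ring)
  have "y = (\<Sum>i\<le>degree p. e (coeff p i) * \<beta> ^ i)"
    unfolding p(1) poly_altdef
    by (rule sum.mono_neutral_cong_left) (auto simp: coeff_map_poly degree_map_poly_le coeff_eq_0 not_le le_degree intro: le_trans)
  then have "y = ev (Suc (degree p)) (coeff p)" by (simp add: ev_def lessThan_Suc_atMost)
  then show thesis using p that by blast
qed

text \<open>The least degree of a monic relation modulo the maximal ideal is the residue degree.\<close>

definition monic_rel :: "nat \<Rightarrow> bool" where
  "monic_rel j \<longleftrightarrow> (\<exists>c. (\<forall>i. c i \<in> F.I 0) \<and> \<beta> ^ j + ev j c \<in> K.I 1)"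

text \<open>Leading coefficients in the maximal ideal are dropped until one is a unit, by which the
  relation is divided.\<close>

lemma strip_relation:
  assumes c: "\<And>i. c i \<in> F.I 0" and r: "ev n c \<in> K.I 1" and u: "i0 < n" "c i0 \<notin> F.I 1"
  shows "\<exists>j<n. monic_rel j"
  using r u
proof (induction n)
  case (Suc n)
  show ?case
  proof (cases "c n \<in> F.I 1")
    case True
    then have "e (c n) * \<beta> ^ n \<in> K.I 1" using \<beta>_integral by (intro K.ideal_multR) auto
    then have "ev n c \<in> K.I 1"
      using Suc.prems(1) K.ideal_diff[of "ev (Suc n) c" 1 "e (c n) * \<beta> ^ n"] by (simp add: ev_def)
    moreover have "i0 < n" using True Suc.prems by (auto simp: less_Suc_eq)
    ultimately show ?thesis using Suc by (meson less_SucI)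
  next
    case False
    then have U: "c n \<in> Units (val_ring v)" using c by (simp add: F.unit_iff)
    then have n0: "c n \<noteq> 0" by (rule F.unit_nonzero)
    have i: "inverse (c n) \<in> F.I 0" using F.unit_inverse[OF U] by (rule F.unit_integral)
    have "e (inverse (c n)) * ev (Suc n) c \<in> K.I 1"
      using i Suc.prems(1) by (intro K.ideal_multL) auto
    also have "e (inverse (c n)) * ev (Suc n) c = \<beta> ^ n + ev n (\<lambda>i. inverse (c n) * c i)"
      using n0 by (simp add: ev_smult) (simp add: ev_def algebra_simps e_inverse)
    finally have "monic_rel n" unfolding monic_rel_def
      using i c by (intro exI[of _ "\<lambda>i. inverse (c n) * c i"]) (auto intro: F.ideal_multL)
    then show ?thesis by auto
  qed
qed auto

text \<open>The inverse of \<beta> is integral, hence a polynomial in \<beta>. Multiplied by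
  \<beta>, this becomes a relation with constant coefficient \<open>- 1\<close>, which is a
  unit.\<close>

lemma monic_rel_exists: "\<exists>j. monic_rel j"
proof -
  have "inverse \<beta> \<in> K.I 0" using K.unit_inverse[OF \<beta>_unit] by (rule K.unit_integral)
  then obtain n c where c: "\<And>i. c i \<in> F.I 0" "inverse \<beta> = ev n c" using OK_ev by metis
  define c' where "c' i = (if i = 0 then - 1 else c (i - 1))" for i
  have "ev (Suc n) c' = - 1 + \<beta> * ev n c"
    unfolding ev_def sum.lessThan_Suc_shift
    by (simp add: c'_def e_uminus sum_distrib_left algebra_simps)
  also have "\<dots> = 0" using c(2) K.unit_nonzero[OF \<beta>_unit] by (simp add: field_simps flip: c(2))
  finally have "ev (Suc n) c' \<in> K.I 1" by simp
  moreover have "c' 0 \<notin> F.I 1" by (simp add: c'_def val_ideal_def)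
  moreover have "c' i \<in> F.I 0" for i using c by (auto simp: c'_def)
  ultimately show ?thesis using strip_relation[of c' "Suc n" 0] by auto
qed

definition s :: nat where "s = (LEAST j. monic_rel j)"

lemma monic_rel_s: "monic_rel s" unfolding s_def using monic_rel_exists by (rule LeastI_ex)

lemma indep_mod:
  assumes c: "\<And>i. i < s \<Longrightarrow> c i \<in> F.I 0" and r: "ev s c \<in> K.I 1" and i: "i < s"
  shows "c i \<in> F.I 1"
proof (rule ccontr)
  assume "c i \<notin> F.I 1"
  then have "\<exists>j<s. monic_rel j"
    using strip_relation[of "\<lambda>i. if i < s then c i else 0" s i] c r i
    by (simp add: ev_cong[of s "\<lambda>i. if i < s then c i else 0" c])
  then show False unfolding s_def using not_less_Least by blast
qed

text \<open>Independence modulo the maximal ideal makes all coefficients divisible by \<pi>;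
  dividing the relation by \<pi> lowers \<open>j\<close> by one.\<close>

lemma indep_mod_power:
  assumes c: "\<And>i. i < s \<Longrightarrow> c i \<in> F.I 0" and r: "ev s c \<in> K.I j" and i: "i < s"
  shows "c i \<in> F.I j"
  using c r i
proof (induction j arbitrary: c)
  case (Suc j)
  have "ev s c \<in> K.I 1" using Suc.prems(2) by (rule K.ideal_mono) simp
  then have c1: "c k \<in> F.I 1" if "k < s" for k using indep_mod[of c k] Suc.prems(1) that by blast
  have "\<exists>y. y \<in> F.I 0 \<and> c k = \<pi> * y" if "k < s" for k
    using F.idealE[OF c1[OF that]] by (metis power_one_right)
  then obtain y where y: "\<And>k. k < s \<Longrightarrow> y k \<in> F.I 0 \<and> c k = \<pi> * y k" by metis
  have "ev s c = e \<pi> ^ 1 * ev s y" using y by (simp add: ev_smult[symmetric] cong: ev_cong)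
  then have "ev s y \<in> K.I j" using Suc.prems(2) K.ideal_shift[of 1 "ev s y" j] by simp
  then have "y i \<in> F.I j" using Suc.IH[of y] y Suc.prems(3) by blast
  then show ?case using F.ideal_shift[of 1 "y i" j] y Suc.prems(3) by simp
qed auto

text \<open>Multiplication by a power of \<pi> makes the coefficients integral and shifts both sides
  equally.\<close>

lemma coeff_ideal:
  assumes r: "ev s c \<in> K.I j" and i: "i < s"
  shows "c i \<in> F.I j"
proof -
  obtain k where k: "\<forall>i\<in>{..<s}. \<pi> ^ k * c i \<in> F.I 0" using F.clear_denominators[of "{..<s}" c] by auto
  have "ev s (\<lambda>i. \<pi> ^ k * c i) \<in> K.I (k + j)"
    unfolding ev_smult e_power using r by (simp add: K.ideal_shift)
  then have "\<pi> ^ k * c i \<in> F.I (k + j)" using indep_mod_power[of "\<lambda>i. \<pi> ^ k * c i"] k i by simp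
  then show ?thesis by (simp add: F.ideal_shift)
qed

lemma ev_inj:
  assumes "ev s c = ev s c'" "i < s"
  shows "c i = c' i"
proof -
  have "ev s (\<lambda>i. c i - c' i) \<in> K.I j" for j using assms by (simp add: ev_diff)
  then have "c i - c' i \<in> F.I j" for j using coeff_ideal assms(2) by blast
  then show ?thesis using F.ideal_all by force
qed

lemma s_pos: "0 < s"
proof (rule ccontr)
  assume "\<not> 0 < s"
  then have "1 \<in> K.I 1" using monic_rel_s by (auto simp: monic_rel_def ev_def)
  then show False by (simp add: val_ideal_def)
qed

lemma power_mod: "\<exists>c. (\<forall>i. c i \<in> F.I 0) \<and> \<beta> ^ n - ev s c \<in> K.I 1"
proof (induction n)
  case 0
  have "ev s (\<lambda>i. if i = 0 then 1 else 0) = 1"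
    using s_pos unfolding ev_def by (subst sum.remove[of _ 0]) auto
  then show ?case by (intro exI[of _ "\<lambda>i. if i = 0 then 1 else 0"]) auto
next
  case (Suc n)
  then obtain c where c: "\<And>i. c i \<in> F.I 0" "\<beta> ^ n - ev s c \<in> K.I 1" by auto
  obtain f where f: "\<And>i. f i \<in> F.I 0" "\<beta> ^ s + ev s f \<in> K.I 1"
    using monic_rel_s by (auto simp: monic_rel_def)
  obtain t where t: "s = Suc t" using s_pos by (cases s) auto
  \<comment> \<open>Multiplication by \<beta> shifts the coefficients by one, and the overflow at
    \<open>\<beta> ^ s\<close> is replaced by means of the monic relation.\<close>
  define c' where "c' i = (if i = 0 then 0 else c (i - 1)) - c t * f i" for i
  have "\<beta> * ev s c = ev s (\<lambda>i. if i = 0 then 0 else c (i - 1)) + e (c t) * \<beta> ^ s"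
    unfolding t ev_def by (subst sum.lessThan_Suc, subst sum.lessThan_Suc_shift)
      (simp add: algebra_simps sum_distrib_left)
  then have "\<beta> ^ Suc n - ev s c' = \<beta> * (\<beta> ^ n - ev s c) + e (c t) * (\<beta> ^ s + ev s f)"
    unfolding c'_def ev_diff ev_smult by (simp add: algebra_simps)
  also have "\<dots> \<in> K.I 1"
    by (rule K.ideal_add; rule K.ideal_multL) (use c f \<beta>_integral[of 1] in auto)
  finally have "\<beta> ^ Suc n - ev s c' \<in> K.I 1" .
  moreover have "c' i \<in> F.I 0" for i unfolding c'_def
    by (rule F.ideal_diff, use c in simp) (rule F.ideal_multL, use c f in auto)
  ultimately show ?case by blast
qed

lemma integral_mod: 
  assumes "y \<in> K.I 0"
  shows "\<exists>c y'. (\<forall>i. c i \<in> F.I 0) \<and> y' \<in> K.I 0 \<and> y = ev s c + e \<pi> * y'"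
proof -
  obtain n a where a: "\<And>i. a i \<in> F.I 0" "y = ev n a" using OK_ev[OF assms] by metis
  obtain c where c: "\<And>k i. c k i \<in> F.I 0" "\<And>k. \<beta> ^ k - ev s (c k) \<in> K.I 1"
    using power_mod by metis
  define c' where "c' i = (\<Sum>k<n. a k * c k i)" for i
  have "ev s c' = (\<Sum>k<n. e (a k) * ev s (c k))"
    unfolding c'_def ev_sum by (simp add: ev_smult)
  then have "y - ev s c' = (\<Sum>k<n. e (a k) * (\<beta> ^ k - ev s (c k)))"
    unfolding a(2) by (simp add: ev_def sum_subtractf algebra_simps)
  also have "\<dots> \<in> K.I 1" using a c by (intro K.ideal_sum K.ideal_multL) auto
  finally obtain y' where "y' \<in> K.I 0" "y - ev s c' = e \<pi> ^ 1 * y'" by (rule K.idealE)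
  moreover have "c' i \<in> F.I 0" for i unfolding c'_def using a c by (intro F.ideal_sum F.ideal_multL) auto
  ultimately show ?thesis by (intro exI[of _ c'] exI[of _ y']) (auto simp: algebra_simps)
qed

lemma ev_series:
  assumes "\<And>k i. c k i \<in> F.I 0"
  obtains L where "\<And>n. ev s L - (\<Sum>k<n. e \<pi> ^ k * ev s (c k)) \<in> K.I n" "\<And>i. L i \<in> F.I 0"
proof -
  have "\<exists>L. \<forall>n. L - (\<Sum>k<n. \<pi> ^ k * c k i) \<in> F.I n" for i
    using F.series_limit[of "\<lambda>k. c k i"] assms by metis
  then obtain L where L: "\<And>i n. L i - (\<Sum>k<n. \<pi> ^ k * c k i) \<in> F.I n" by metis
  have "ev s L - (\<Sum>k<n. e \<pi> ^ k * ev s (c k)) = ev s (\<lambda>i. L i - (\<Sum>k<n. \<pi> ^ k * c k i))" for n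
    unfolding ev_diff ev_sum by (simp add: ev_smult e_power)
  moreover have "ev s (\<lambda>i. L i - (\<Sum>k<n. \<pi> ^ k * c k i)) \<in> K.I n" for n using L by (intro ev_ideal)
  moreover have "L i \<in> F.I 0" for i using L[of i 0] by simp
  ultimately show thesis by (intro that[of L]) simp_all
qed

text \<open>Successive approximation: each step splits off a combination of the powers of \<beta>
  below \<open>s\<close>, and the \<pi>-adic series of the coefficients converge. So these powers
  span the integers of \<open>K\<close> over those of \<open>F\<close>.\<close>

lemma integral_ev:
  assumes "y \<in> K.I 0"
  obtains c where "y = ev s c" "\<And>i. c i \<in> F.I 0"
proof -
  define step where "step y = (SOME cy. (\<forall>i. fst cy i \<in> F.I 0) \<and> snd cy \<in> K.I 0 \<and>
    y = ev s (fst cy) + e \<pi> * snd cy)" for y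
  have step: "(\<forall>i. fst (step y) i \<in> F.I 0) \<and> snd (step y) \<in> K.I 0 \<and>
    y = ev s (fst (step y)) + e \<pi> * snd (step y)" if y: "y \<in> K.I 0" for y
  proof -
    have "\<exists>cy. (\<forall>i. fst cy i \<in> F.I 0) \<and> snd cy \<in> K.I 0 \<and> y = ev s (fst cy) + e \<pi> * snd cy"
      using integral_mod[OF y] by auto
    then show ?thesis unfolding step_def by (rule someI_ex)
  qed
  define Y where "Y n = ((\<lambda>y. snd (step y)) ^^ n) y" for n
  have Y: "Y n \<in> K.I 0" for n by (induction n) (use assms step in \<open>auto simp: Y_def\<close>)
  define c where "c n = fst (step (Y n))" for n
  have YS: "Y n = ev s (c n) + e \<pi> * Y (Suc n)" for n using step[OF Y[of n]] by (simp add: c_def Y_def)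
  have yn: "y = (\<Sum>k<n. e \<pi> ^ k * ev s (c k)) + e \<pi> ^ n * Y n" for n
  proof (induction n)
    case (Suc n)
    then show ?case using YS[of n] by (simp add: algebra_simps)
  qed (simp add: Y_def)
  have cI: "c k i \<in> F.I 0" for k i using step[OF Y[of k]] by (simp add: c_def)
  obtain L where L: "\<And>n. ev s L - (\<Sum>k<n. e \<pi> ^ k * ev s (c k)) \<in> K.I n" "\<And>i. L i \<in> F.I 0"
    using ev_series[of c, OF cI] by blast
  have "y - ev s L \<in> K.I n" for n
  proof -
    have "e \<pi> ^ n * Y n \<in> K.I n" using Y K.ideal_shift0 by simp
    then have "e \<pi> ^ n * Y n - (ev s L - (\<Sum>k<n. e \<pi> ^ k * ev s (c k))) \<in> K.I n" by (rule K.ideal_diff[OF _ L(1)])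
    then show ?thesis using yn[of n] by (simp add: algebra_simps)
  qed
  then have "y = ev s L" using K.ideal_all by force
  then show thesis using that L by blast
qed

text \<open>The value 0 for indices from \<open>s\<close> on makes linearity valid for all
  indices.\<close>

definition coord :: "nat \<Rightarrow> 'k \<Rightarrow> 'f" where
  "coord i x = (if i < s then (SOME c. x = ev s c) i else 0)"

lemma coord_ev: "ev s (\<lambda>i. coord i x) = x"
proof -
  obtain k where k: "e \<pi> ^ k * x \<in> K.I 0" using K.clear_denominator by auto
  obtain c where "e \<pi> ^ k * x = ev s c" using integral_ev[OF k] by metis
  then have "e (inverse (\<pi> ^ k)) * (e \<pi> ^ k * x) = ev s (\<lambda>i. inverse (\<pi> ^ k) * c i)" by (simp add: ev_smult)
  moreover have "e (inverse (\<pi> ^ k)) * (e \<pi> ^ k * x) = x" using F.\<pi> by (simp add: e_inverse e_power)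
  ultimately have "\<exists>c. x = ev s c" by metis
  then have "x = ev s (SOME c. x = ev s c)" by (rule someI_ex)
  also have "\<dots> = ev s (\<lambda>i. coord i x)" by (rule ev_cong) (simp add: coord_def)
  finally show ?thesis by simp
qed

lemma coord_unique: "x = ev s c \<Longrightarrow> i < s \<Longrightarrow> coord i x = c i"
  using ev_inj[of "\<lambda>i. coord i x" c i] coord_ev by simp

lemma coord_ge: "\<not> i < s \<Longrightarrow> coord i x = 0" by (simp add: coord_def)

lemma coord_add: "coord i (x + y) = coord i x + coord i y"
  using coord_unique[of "x + y" "\<lambda>i. coord i x + coord i y" i] coord_ev[of x] coord_ev[of y]
  by (cases "i < s") (auto simp: ev_add coord_ge)

lemma coord_smult: "coord i (e a * x) = a * coord i x"
  using coord_unique[of "e a * x" "\<lambda>i. a * coord i x" i] coord_ev[of x]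
  by (cases "i < s") (auto simp: ev_smult coord_ge)

lemma coord_zero [simp]: "coord i 0 = 0" using coord_add[of i 0 0] by (metis add_cancel_right_right add_0)
lemma coord_uminus: "coord i (- x) = - coord i x" using coord_add[of i x "- x"] by (simp add: eq_neg_iff_add_eq_0 add.commute)
lemma coord_diff: "coord i (x - y) = coord i x - coord i y" using coord_add[of i x "- y"] by (simp add: coord_uminus)
lemma coord_sum: "coord i (sum f A) = (\<Sum>j\<in>A. coord i (f j))"
  by (induction A rule: infinite_finite_induct) (simp_all add: coord_add)

lemma coord_ideal: "x \<in> K.I j \<Longrightarrow> coord i x \<in> F.I j"
  using coeff_ideal[of "\<lambda>i. coord i x" j i] coord_ev by (cases "i < s") (auto simp: coord_ge)

lemma ideal_coord: "(\<And>i. i < s \<Longrightarrow> coord i x \<in> F.I j) \<Longrightarrow> x \<in> K.I j"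
  using ev_ideal[of s "\<lambda>i. coord i x" j] coord_ev by simp

lemma coord_power: "j < s \<Longrightarrow> coord i (\<beta> ^ j) = (if i = j then 1 else 0)"
proof -
  assume j: "j < s"
  have "ev s (\<lambda>i. if i = j then 1 else 0) = \<beta> ^ j"
    using j unfolding ev_def by (subst sum.remove[of _ j]) auto
  then show ?thesis using coord_unique[of "\<beta> ^ j" "\<lambda>i. if i = j then 1 else 0" i] j by (cases "i < s") (auto simp: coord_ge)
qed

text \<open>Completeness of \<open>K\<close> is inherited coordinatewise from
  \<open>F\<close>.\<close>

lemma K_series:
  assumes "\<And>k. y k \<in> K.I 0"
  obtains Y where "\<And>n. Y - (\<Sum>k<n. e \<pi> ^ k * y k) \<in> K.I n"
proof -
  have "coord i (y k) \<in> F.I 0" for k i using coord_ideal assms by blast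
  then obtain L where "\<And>n. ev s L - (\<Sum>k<n. e \<pi> ^ k * ev s (\<lambda>i. coord i (y k))) \<in> K.I n"
    using ev_series[of "\<lambda>k i. coord i (y k)"] by blast
  then show thesis by (intro that[of "ev s L"]) (simp add: coord_ev)
qed

end

section \<open>Residue rings and the Frobenius map\<close>

lemma (in discrete_valuation) coset_eq:
  "I j +>\<^bsub>val_ring v\<^esub> x = {y. y - x \<in> I j}"
proof -
  have "I j +>\<^bsub>val_ring v\<^esub> x = (\<Union>h\<in>I j. {h + x})"
    by (simp add: a_r_coset_def' val_ring_def)
  also have "\<dots> = {y. y - x \<in> I j}"
  proof (intro Set.set_eqI iffI)
    fix y assume "y \<in> {y. y - x \<in> I j}"
    then show "y \<in> (\<Union>h\<in>I j. {h + x})" by (intro UN_I[of "y - x"]) auto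
  qed auto
  finally show ?thesis .
qed

lemma (in discrete_valuation) coset_eq_iff:
  "I j +>\<^bsub>val_ring v\<^esub> x = I j +>\<^bsub>val_ring v\<^esub> y \<longleftrightarrow> x - y \<in> I j"
proof
  assume *: "I j +>\<^bsub>val_ring v\<^esub> x = I j +>\<^bsub>val_ring v\<^esub> y"
  have "x \<in> I j +>\<^bsub>val_ring v\<^esub> x" by (simp add: coset_eq)
  then have "x \<in> I j +>\<^bsub>val_ring v\<^esub> y" by (simp only: *)
  then show "x - y \<in> I j" by (simp add: coset_eq)
next
  assume *: "x - y \<in> I j"
  have "z - x \<in> I j \<longleftrightarrow> z - y \<in> I j" for z
    using ideal_cancel[of "z - y" "z - x" j] * by simp
  then show "I j +>\<^bsub>val_ring v\<^esub> x = I j +>\<^bsub>val_ring v\<^esub> y"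
    by (simp add: coset_eq)
qed

lemma (in discrete_valuation) carrier_res_ring:
  "carrier (res_ring v j) = (\<lambda>x. I j +>\<^bsub>val_ring v\<^esub> x) ` I 0"
  by (auto simp: res_ring_def FactRing_def A_RCOSETS_def' carrier_val_ring)

text \<open>The inner binomial coefficients are divisible by \<open>p\<close>, which lies in the
  maximal ideal.\<close>

lemma (in discrete_valuation) freshman:
  assumes p: "prime p" "of_nat p \<in> I 1" and xy: "x \<in> I 0" "y \<in> I 0"
  shows "(x + y) ^ p - (x ^ p + y ^ p) \<in> I 1"
proof -
  have p0: "0 < p" using p(1) by (rule prime_gt_0_nat)
  have "(x + y) ^ p = (\<Sum>k\<le>p. of_nat (p choose k) * x ^ k * y ^ (p - k))" by (rule binomial_ring)
  also have "\<dots> = (\<Sum>k\<in>{0, p}. of_nat (p choose k) * x ^ k * y ^ (p - k)) +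
      (\<Sum>k\<in>{..p} - {0, p}. of_nat (p choose k) * x ^ k * y ^ (p - k))"
    by (subst sum.union_disjoint[symmetric]) (auto intro: sum.cong)
  also have "(\<Sum>k\<in>{0, p}. of_nat (p choose k) * x ^ k * y ^ (p - k)) = x ^ p + y ^ p" using p0 by simp
  finally have "(x + y) ^ p - (x ^ p + y ^ p) = (\<Sum>k\<in>{..p} - {0, p}. of_nat (p choose k) * x ^ k * y ^ (p - k))" by simp
  also have "\<dots> \<in> I 1"
  proof (intro ideal_sum ideal_multR)
    fix k assume "k \<in> {..p} - {0, p}"
    then have "p dvd (p choose k)" using p(1) by (intro dvd_choose_prime) auto
    then obtain q where "p choose k = p * q" by (rule dvdE)
    then show "of_nat (p choose k) \<in> I 1" using p(2) by (auto intro!: ideal_multR)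
  qed (use xy in auto)
  finally show ?thesis .
qed

lemma (in discrete_valuation) freshman_sum:
  assumes p: "prime p" "of_nat p \<in> I 1" and f: "\<And>i. i \<in> A \<Longrightarrow> f i \<in> I 0"
  shows "(sum f A) ^ p - (\<Sum>i\<in>A. f i ^ p) \<in> I 1"
  using f
proof (induction A rule: infinite_finite_induct)
  case (insert a A)
  have "(f a + sum f A) ^ p - (f a ^ p + sum f A ^ p) \<in> I 1"
    using insert by (intro freshman p) auto
  moreover have "sum f A ^ p - (\<Sum>i\<in>A. f i ^ p) \<in> I 1" using insert by auto
  ultimately have "((f a + sum f A) ^ p - (f a ^ p + sum f A ^ p)) + (sum f A ^ p - (\<Sum>i\<in>A. f i ^ p)) \<in> I 1"
    by (rule ideal_add)
  then show ?case using insert by (simp add: algebra_simps)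
qed (use prime_gt_0_nat[OF p(1)] in \<open>auto simp: zero_power\<close>)

context nonarch_local_field
begin

definition p where "p = residue_char v"

text \<open>The residue field is finite, so two natural numbers have the same residue; their
  difference shows that the set minimised in \<open>residue_char\<close> is not empty.\<close>

lemma p: "0 < p" "of_nat p \<in> I 1"
  and p_least: "0 < n \<Longrightarrow> of_nat n \<in> I 1 \<Longrightarrow> p \<le> n"
proof -
  have fin: "finite ((\<lambda>x. I 1 +>\<^bsub>val_ring v\<^esub> x) ` I 0)"
    using finite_residue by (simp add: carrier_res_ring)
  have "(\<lambda>n::nat. I 1 +>\<^bsub>val_ring v\<^esub> (of_nat n)) ` UNIV \<subseteq> (\<lambda>x. I 1 +>\<^bsub>val_ring v\<^esub> x) ` I 0"
    by auto
  then have "finite ((\<lambda>n::nat. I 1 +>\<^bsub>val_ring v\<^esub> (of_nat n)) ` UNIV)" using fin by (rule finite_subset)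
  then have "\<not> inj (\<lambda>n::nat. I 1 +>\<^bsub>val_ring v\<^esub> (of_nat n))" using finite_imageD by blast
  then have "\<exists>a b::nat. a < b \<and> of_nat a - of_nat b \<in> I 1"
    unfolding inj_def coset_eq_iff by (metis linorder_neqE_nat coset_eq_iff)
  then obtain a b :: nat where ab: "a < b" "of_nat a - of_nat b \<in> I 1" by auto
  have "(of_nat (b - a) :: 'a) = - (of_nat a - of_nat b)" using of_nat_diff[OF less_imp_le[OF ab(1)]] by simp
  also have "\<dots> \<in> I 1" unfolding ideal_uminus by (rule ab)
  finally have ex: "0 < b - a \<and> of_nat (b - a) \<in> I 1" using ab by simp
  show "0 < p" "of_nat p \<in> I 1"
    using LeastI[of "\<lambda>p. 0 < p \<and> of_nat p \<in> I 1", OF ex] by (auto simp: p_def residue_char_def)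
  show "p \<le> n" if "0 < n" "of_nat n \<in> I 1"
    unfolding p_def residue_char_def using that by (intro Least_le) simp
qed

lemma p_prime: "prime p"
proof -
  have "p \<noteq> 1" using p by (auto simp: val_ideal_def)
  moreover have "a = 1 \<or> b = 1" if ab: "p = a * b" for a b
  proof -
    have pos: "0 < a" "0 < b" using ab p by auto
    have "of_nat a * of_nat b \<in> I 1" using p ab by simp
    then have "of_nat a \<in> I 1 \<or> of_nat b \<in> I 1"
      using prime_ideal[OF ideal_of_nat ideal_of_nat] by blast
    then have "p \<le> a \<or> p \<le> b" using p_least[OF pos(1)] p_least[OF pos(2)] by blast
    then show ?thesis using ab pos by (auto simp: mult_le_cancel1 mult_le_cancel2)
  qed
  ultimately show ?thesis using p(1) by (metis One_nat_def dvdE prime_nat_iff nat_mult_1_right less_one nat_neq_iff)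
qed

lemma of_nat_unit: "\<not> p dvd n \<Longrightarrow> of_nat n \<in> Units (val_ring v)"
proof (rule ccontr)
  assume n: "\<not> p dvd n" and "of_nat n \<notin> Units (val_ring v)"
  then have 1: "of_nat n \<in> I 1" by (simp add: unit_iff)
  have "of_nat n = of_nat p * of_nat (n div p) + (of_nat (n mod p) :: 'a)"
    by (metis mult_div_mod_eq of_nat_add of_nat_mult)
  then have "of_nat (n mod p) = of_nat n - (of_nat p * of_nat (n div p) :: 'a)" by simp
  also have "\<dots> \<in> I 1" using 1 p by (intro ideal_diff ideal_multR) auto
  finally have "n mod p = 0 \<or> p \<le> n mod p" using p_least by blast
  then show False using n mod_less_divisor[OF p(1), of n] by (auto simp: dvd_eq_mod_eq_0)
qed

text \<open>The Frobenius map of the residue field is injective, since a field has no nilpotent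
  elements, and finiteness makes it surjective.\<close>

lemma p_root:
  assumes a: "a \<in> I 0"
  obtains b where "b \<in> I 0" "a - b ^ p \<in> I 1"
proof -
  let ?c = "\<lambda>x. I 1 +>\<^bsub>val_ring v\<^esub> x"
  let ?R = "?c ` I 0"
  let ?i = "inv_into (I 0) ?c"
  let ?f = "\<lambda>C. ?c (?i C ^ p)"
  have i: "?i C \<in> I 0" "?c (?i C) = C" if "C \<in> ?R" for C
    using inv_into_into[OF that] f_inv_into_f[OF that] by auto
  have "inj_on ?f ?R"
  proof (rule inj_onI)
    fix C E assume C: "C \<in> ?R" and E: "E \<in> ?R" and "?f C = ?f E"
    then have 1: "?i C ^ p - ?i E ^ p \<in> I 1" by (simp only: coset_eq_iff)
    have "((?i C - ?i E) + ?i E) ^ p - ((?i C - ?i E) ^ p + ?i E ^ p) \<in> I 1"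
      by (rule freshman[OF p_prime p(2)]) (use i C E in auto)
    then have "?i C ^ p - ((?i C - ?i E) ^ p + ?i E ^ p) \<in> I 1"
      by (simp only: diff_add_cancel)
    from ideal_diff[OF 1 this] have "(?i C - ?i E) ^ p \<in> I 1" by (simp add: algebra_simps)
    then have "?i C - ?i E \<in> I 1" by (rule prime_ideal_power[rotated]) (use i C E in auto)
    then have "?c (?i C) = ?c (?i E)" by (simp only: coset_eq_iff)
    then show "C = E" using i C E by simp
  qed
  moreover have "?f ` ?R \<subseteq> ?R" using i by auto
  moreover have "finite ?R" using finite_residue by (simp add: carrier_res_ring)
  ultimately have "?f ` ?R = ?R" by (intro endo_inj_surj)
  moreover have "?c a \<in> ?R" using a by auto
  ultimately obtain C where "C \<in> ?R" "?c a = ?f C" by (metis (no_types, lifting) imageE)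
  then show thesis using that[of "?i C"] i by (auto simp: coset_eq_iff)
qed

end

section \<open>The derivative of the minimal polynomial and the dual basis\<close>

context unramified_gen
begin

text \<open>Coefficients of the minimal polynomial \<open>f\<close> of \<beta> over
  \<open>F\<close>, monic of degree \<open>s\<close>.\<close>

definition a :: "nat \<Rightarrow> 'f" where
  "a i = (if i = s then 1 else - coord i (\<beta> ^ s))"

lemma a_integral: "a i \<in> F.I 0"
  by (auto simp: a_def coord_ideal[OF \<beta>_integral])

lemma minpoly: "(\<Sum>i\<le>s. e (a i) * \<beta> ^ i) = 0"
proof -
  have "(\<Sum>i<s. e (a i) * \<beta> ^ i) = - ev s (\<lambda>i. coord i (\<beta> ^ s))"
    unfolding ev_def sum_negf[symmetric] by (intro sum.cong) (auto simp: a_def e_uminus)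
  then show ?thesis by (simp add: lessThan_Suc_atMost[symmetric] a_def coord_ev)
qed

text \<open>The value at \<beta> of the derivative of \<open>f\<close>, which generates the
  different.\<close>

definition fd :: 'k where
  "fd = (\<Sum>i<s. e (of_nat (Suc i) * a (Suc i)) * \<beta> ^ i)"

lemma e_p: "of_nat F.p \<in> K.I 1"
  using F.p e_ideal[of "of_nat F.p" 1] by (simp add: e_of_nat)

text \<open>Separability of the residue extension. If the derivative vanished at \<beta> modulo the
  maximal ideal, only the coefficients of \<open>f\<close> at multiples of \<open>p\<close> would
  survive there. Taking \<open>p\<close>-th roots of them makes \<open>f\<close> congruent to the
  \<open>p\<close>-th power of a monic polynomial of degree \<open>q\<close>, where
  \<open>s = F.p * q\<close>. Then \<beta> is a root of that polynomial modulo the maximal ideal,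
  against the minimality of \<open>s\<close>.\<close>

lemma fd_unit: "fd \<in> Units (val_ring w)"
proof (rule ccontr)
  assume "fd \<notin> Units (val_ring w)"
  moreover have fd: "fd = ev s (\<lambda>i. of_nat (Suc i) * a (Suc i))" by (simp add: fd_def ev_def)
  have "fd \<in> K.I 0" unfolding fd by (intro ev_ideal F.ideal_multL a_integral F.ideal_of_nat)
  ultimately have "fd \<in> K.I 1" by (simp add: K.unit_iff)
  then have "of_nat (Suc i) * a (Suc i) \<in> F.I 1" if "i < s" for i
    using coeff_ideal[of "\<lambda>i. of_nat (Suc i) * a (Suc i)" 1 i] that fd by simp
  then have ia: "of_nat i * a i \<in> F.I 1" if "0 < i" "i \<le> s" for i
    using that by (cases i) auto
  have av: "a i \<in> F.I 1" if "\<not> F.p dvd i" "i \<le> s" for i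
    using ia[of i] F.unit_mult_iff[OF F.of_nat_unit[OF that(1)], of "a i" 1] that by (cases "i = 0") auto
  have "F.p dvd s"
  proof (rule ccontr)
    assume "\<not> F.p dvd s"
    then have "1 \<in> F.I 1" using av[of s] by (simp add: a_def)
    then show False by (simp add: val_ideal_def)
  qed
  then obtain q where q: "s = F.p * q" by (rule dvdE)
  have q0: "0 < q" "0 < F.p" using s_pos q by auto
  have qs: "q < s" using q q0 prime_gt_1_nat[OF F.p_prime] by simp
  have "\<exists>b. b \<in> F.I 0 \<and> a i - b ^ F.p \<in> F.I 1" for i using F.p_root[OF a_integral] by metis
  then obtain b where b: "\<And>i. b i \<in> F.I 0" "\<And>i. a i - b i ^ F.p \<in> F.I 1" by metis
  \<comment> \<open>The root at \<open>q\<close> is set to 1, as the coefficient of \<open>f\<close>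
    there is 1; this makes the relation of degree \<open>q\<close> monic.\<close>
  define h where "h k = (if k = q then 1 else b (F.p * k))" for k
  have h: "h k \<in> F.I 0" "a (F.p * k) - h k ^ F.p \<in> F.I 1" for k
    using b(1) b(2)[of "F.p * k"] by (auto simp: h_def) (simp add: a_def q)
  define g where "g k = e (h k) * \<beta> ^ k" for k
  have gi: "g k \<in> K.I 0" for k unfolding g_def using h \<beta>_integral by (intro K.ideal_multL) auto
  have 1: "(sum g {..q}) ^ F.p - (\<Sum>k\<le>q. g k ^ F.p) \<in> K.I 1"
    by (rule K.freshman_sum[OF F.p_prime e_p]) (rule gi)
  have "(\<Sum>k\<le>q. e (a (F.p * k)) * \<beta> ^ (F.p * k)) - (\<Sum>k\<le>q. g k ^ F.p) =
      (\<Sum>k\<le>q. e (a (F.p * k) - h k ^ F.p) * \<beta> ^ (F.p * k))"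
    by (simp add: g_def sum_subtractf e_diff e_power algebra_simps power_mult_distrib power_mult[symmetric] mult.commute[of F.p])
  also have "\<dots> \<in> K.I 1" using h(2) \<beta>_integral by (intro K.ideal_sum K.ideal_multR) auto
  finally have 2: "(\<Sum>k\<le>q. e (a (F.p * k)) * \<beta> ^ (F.p * k)) - (\<Sum>k\<le>q. g k ^ F.p) \<in> K.I 1" .
  have "(\<Sum>k\<le>q. e (a (F.p * k)) * \<beta> ^ (F.p * k)) = (\<Sum>i\<in>(\<lambda>k. F.p * k) ` {..q}. e (a i) * \<beta> ^ i)"
    using q0 by (subst sum.reindex) (auto simp: inj_on_def)
  also have "\<dots> = (\<Sum>i\<le>s. e (a i) * \<beta> ^ i) - (\<Sum>i\<in>{..s} - (\<lambda>k. F.p * k) ` {..q}. e (a i) * \<beta> ^ i)"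
    by (subst sum_diff) (auto simp: q)
  also have "\<dots> \<in> K.I 1"
    unfolding minpoly
  proof (intro K.ideal_diff K.ideal_sum K.ideal_multR)
    fix i assume i: "i \<in> {..s} - (\<lambda>k. F.p * k) ` {..q}"
    have "\<not> F.p dvd i"
    proof
      assume "F.p dvd i"
      then obtain k where "i = F.p * k" by (rule dvdE)
      then show False using i q q0 by auto
    qed
    then show "e (a i) \<in> K.I 1" using av i by simp
  qed (auto simp: \<beta>_integral)
  finally have 3: "(\<Sum>k\<le>q. e (a (F.p * k)) * \<beta> ^ (F.p * k)) \<in> K.I 1" .
  have "(sum g {..q}) ^ F.p \<in> K.I 1"
    using K.ideal_cancel[OF 1] K.ideal_cancel[OF 2] 3 by blast
  then have "sum g {..q} \<in> K.I 1" by (rule K.prime_ideal_power[rotated]) (use gi in auto)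
  also have "sum g {..q} = \<beta> ^ q + ev q h"
    by (simp add: lessThan_Suc_atMost[symmetric] g_def ev_def h_def)
  finally have "monic_rel q" unfolding monic_rel_def using h by blast
  then show False using qs unfolding s_def using not_less_Least by blast
qed

text \<open>The functional in Euler's formula: by \<open>Tr_top\<close> it is the trace of
  \<open>x / fd\<close>.\<close>

definition top :: "'k \<Rightarrow> 'f" where "top x = coord (s - 1) x"

lemma top_add: "top (x + y) = top x + top y" by (simp add: top_def coord_add)
lemma top_diff: "top (x - y) = top x - top y" by (simp add: top_def coord_diff)
lemma top_uminus: "top (- x) = - top x" by (simp add: top_def coord_uminus)
lemma top_smult: "top (e c * x) = c * top x" by (simp add: top_def coord_smult)
lemma top_sum: "top (sum f A) = (\<Sum>j\<in>A. top (f j))" by (simp add: top_def coord_sum)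
lemma top_zero [simp]: "top 0 = 0" by (simp add: top_def)
lemma top_ideal: "x \<in> K.I j \<Longrightarrow> top x \<in> F.I j" by (simp add: top_def coord_ideal)
lemma top_power: "j < s \<Longrightarrow> top (\<beta> ^ j) = (if j = s - 1 then 1 else 0)" by (auto simp: top_def coord_power)

text \<open>The coefficient of \<open>X ^ j\<close> in the quotient
  \<open>f / (X - \<beta>)\<close>.\<close>

definition dual :: "nat \<Rightarrow> 'k" where
  "dual j = (\<Sum>i\<in>{Suc j..s}. e (a i) * \<beta> ^ (i - 1 - j))"

lemma dual_integral: "dual j \<in> K.I 0"
  unfolding dual_def using a_integral \<beta>_integral by (intro K.ideal_sum K.ideal_multL) auto

text \<open>Comparison of the coefficients of \<open>X ^ j\<close> in \<open>f\<close> and in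
  \<open>X - \<beta>\<close> times the polynomial with coefficients \<open>dual\<close>.\<close>

lemma dual_step: "j < s \<Longrightarrow> \<beta> * dual j = (if j = 0 then 0 else dual (j - 1)) - e (a j)"
proof -
  assume j: "j < s"
  have "\<beta> * dual j = (\<Sum>i\<in>{Suc j..s}. e (a i) * \<beta> ^ (i - j))"
    unfolding dual_def sum_distrib_left
  proof (intro sum.cong refl)
    fix i assume "i \<in> {Suc j..s}"
    then have "i - j = Suc (i - 1 - j)" by auto
    then show "\<beta> * (e (a i) * \<beta> ^ (i - 1 - j)) = e (a i) * \<beta> ^ (i - j)" by simp
  qed
  also have "\<dots> = (\<Sum>i\<in>{j..s}. e (a i) * \<beta> ^ (i - j)) - e (a j)"
    using j by (subst sum.atLeast_Suc_atMost[of j s]) auto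
  also have "(\<Sum>i\<in>{j..s}. e (a i) * \<beta> ^ (i - j)) = (if j = 0 then 0 else dual (j - 1))"
    using minpoly by (auto simp: dual_def atMost_atLeast0)
  finally show ?thesis .
qed

lemma top_dual: "j < s \<Longrightarrow> top (dual j) = (if j = 0 then 1 else 0)"
proof -
  assume j: "j < s"
  have "top (dual j) = (\<Sum>i\<in>{Suc j..s}. a i * (if i - 1 - j = s - 1 then 1 else 0))"
    unfolding dual_def top_sum
  proof (intro sum.cong refl)
    fix i assume i: "i \<in> {Suc j..s}"
    then have "i - 1 - j < s" by auto
    then show "top (e (a i) * \<beta> ^ (i - 1 - j)) = a i * (if i - 1 - j = s - 1 then 1 else 0)"
      using top_power[of "i - 1 - j"] by (simp add: top_smult)
  qed
  also have "\<dots> = (\<Sum>i\<in>{Suc j..s}. if i = s then (if j = 0 then 1 else 0) else 0)"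
    using j by (intro sum.cong) (auto simp: a_def)
  also have "\<dots> = (if j = 0 then 1 else 0)" using j by (simp add: sum.delta)
  finally show ?thesis .
qed

text \<open>\<open>dual_step\<close> moves one factor \<beta> from the power to the dual element,
  where it lowers the index. So the elements \<open>dual j\<close> form the dual basis for the
  pairing \<open>top (x * y)\<close>.\<close>

lemma top_power_dual: "i < s \<Longrightarrow> j < s \<Longrightarrow> top (\<beta> ^ i * dual j) = (if i = j then 1 else 0)"
proof (induction i arbitrary: j)
  case (Suc i)
  have "top (\<beta> ^ Suc i * dual j) = top (\<beta> ^ i * (\<beta> * dual j))" by (simp add: mult_ac)
  also have "\<dots> = top (\<beta> ^ i * (if j = 0 then 0 else dual (j - 1))) - top (e (a j) * \<beta> ^ i)"
    unfolding dual_step[OF Suc.prems(2)] right_diff_distrib top_diff by (simp add: mult.commute)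
  also have "top (e (a j) * \<beta> ^ i) = 0"
    using Suc.prems top_power[of i] by (auto simp: top_smult)
  also have "top (\<beta> ^ i * (if j = 0 then 0 else dual (j - 1))) = (if Suc i = j then 1 else 0)"
    using Suc.IH[of "j - 1"] Suc.prems by auto
  finally show ?case by simp
qed (auto simp: top_dual)

text \<open>The quotient \<open>f / (X - \<beta>)\<close> evaluated at \<beta> is the derivative of
  \<open>f\<close> there.\<close>

lemma sum_dual: "(\<Sum>j<s. dual j * \<beta> ^ j) = fd"
proof -
  have "(\<Sum>j<s. dual j * \<beta> ^ j) = (\<Sum>j<s. \<Sum>i\<in>{Suc j..s}. e (a i) * \<beta> ^ (i - 1))"
    unfolding dual_def sum_distrib_right
    by (intro sum.cong refl) (simp add: mult.assoc power_add[symmetric])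
  also have "\<dots> = (\<Sum>j<s. \<Sum>i<s. if j \<le> i then e (a (Suc i)) * \<beta> ^ i else 0)"
  proof (rule sum.cong[OF refl])
    fix j assume "j \<in> {..<s}"
    have "(\<Sum>i\<in>{Suc j..s}. e (a i) * \<beta> ^ (i - 1)) = (\<Sum>i\<in>{i\<in>{..<s}. j \<le> i}. e (a (Suc i)) * \<beta> ^ i)"
      by (rule sum.reindex_bij_witness[of _ Suc "\<lambda>i. i - 1"]) auto
    also have "\<dots> = (\<Sum>i<s. if j \<le> i then e (a (Suc i)) * \<beta> ^ i else 0)"
      by (rule sum.inter_filter) simp
    finally show "(\<Sum>i\<in>{Suc j..s}. e (a i) * \<beta> ^ (i - 1)) = (\<Sum>i<s. if j \<le> i then e (a (Suc i)) * \<beta> ^ i else 0)" .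
  qed
  also have "\<dots> = (\<Sum>i<s. \<Sum>j<s. if j \<le> i then e (a (Suc i)) * \<beta> ^ i else 0)" by (rule sum.swap)
  also have "\<dots> = fd"
    unfolding fd_def
  proof (rule sum.cong[OF refl])
    fix i assume i: "i \<in> {..<s}"
    have "(\<Sum>j<s. if j \<le> i then e (a (Suc i)) * \<beta> ^ i else 0) = (\<Sum>j\<in>{j\<in>{..<s}. j \<le> i}. e (a (Suc i)) * \<beta> ^ i)"
      by (rule sum.inter_filter[symmetric]) simp
    also have "{j\<in>{..<s}. j \<le> i} = {..i}" using i by auto
    finally show "(\<Sum>j<s. if j \<le> i then e (a (Suc i)) * \<beta> ^ i else 0) = e (of_nat (Suc i) * a (Suc i)) * \<beta> ^ i"
      by (simp add: e_mult e_of_nat e_add algebra_simps)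
  qed
  finally show ?thesis .
qed

lemma coord_dual: "j < s \<Longrightarrow> coord j y = top (dual j * y)"
proof -
  assume j: "j < s"
  have "top (dual j * y) = top (dual j * ev s (\<lambda>i. coord i y))" by (simp add: coord_ev)
  also have "\<dots> = (\<Sum>i<s. coord i y * top (\<beta> ^ i * dual j))"
    unfolding ev_def sum_distrib_left top_sum
    by (intro sum.cong refl) (simp add: mult.commute[of "dual j"] mult.assoc top_smult)
  also have "\<dots> = (\<Sum>i<s. if i = j then coord i y else 0)"
    using j by (intro sum.cong) (auto simp: top_power_dual)
  also have "\<dots> = coord j y" using j by simp
  finally show ?thesis by simp
qed

definition Tr :: "'k \<Rightarrow> 'f" where
  "Tr x = (\<Sum>i<s. coord i (x * \<beta> ^ i))"

text \<open>Euler's formula: each diagonal coefficient of multiplication by \<open>x\<close> is read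
  off by a dual element, and \<open>sum_dual\<close> adds them up.\<close>

lemma Tr_top: "Tr x = top (fd * x)"
proof -
  have "Tr x = (\<Sum>i<s. top (dual i * \<beta> ^ i * x))"
    unfolding Tr_def
  proof (rule sum.cong[OF refl])
    fix i assume "i \<in> {..<s}"
    then show "coord i (x * \<beta> ^ i) = top (dual i * \<beta> ^ i * x)"
      using coord_dual[of i "x * \<beta> ^ i"] by (simp add: mult_ac)
  qed
  also have "\<dots> = top (\<Sum>i<s. dual i * \<beta> ^ i * x)" by (simp only: top_sum)
  also have "\<dots> = top (fd * x)" by (simp only: sum_distrib_right[symmetric] sum_dual)
  finally show ?thesis .
qed

lemma Tr_add: "Tr (x + y) = Tr x + Tr y" by (simp add: Tr_top distrib_left top_add)
lemma Tr_smult: "Tr (e c * x) = c * Tr x" by (simp add: Tr_top mult.left_commute top_smult)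
lemma Tr_uminus: "Tr (- x) = - Tr x" by (simp add: Tr_top top_uminus)
lemma Tr_diff: "Tr (x - y) = Tr x - Tr y" by (simp add: Tr_top right_diff_distrib top_diff)
lemma Tr_zero [simp]: "Tr 0 = 0" by (simp add: Tr_top)

lemma Tr_ideal: "x \<in> K.I j \<Longrightarrow> Tr x \<in> F.I j"
  unfolding Tr_top using K.unit_integral[OF fd_unit] by (intro top_ideal K.ideal_multL)

text \<open>Tested against the dual basis, \<open>Tr (z * y)\<close> gives the coordinates of
  \<open>fd * z\<close>, and \<open>fd\<close> is a unit.\<close>

lemma Tr_nondeg:
  assumes "\<And>y. y \<in> K.I 0 \<Longrightarrow> Tr (z * y) \<in> F.I j"
  shows "z \<in> K.I j"
proof -
  have "coord i (fd * z) \<in> F.I j" if i: "i < s" for i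
  proof -
    have "coord i (fd * z) = Tr (z * dual i)" using coord_dual[OF i, of "fd * z"] by (simp add: Tr_top mult_ac)
    then show ?thesis using assms[OF dual_integral] by simp
  qed
  then have "fd * z \<in> K.I j" by (rule ideal_coord)
  then show ?thesis by (simp add: K.unit_mult_iff[OF fd_unit])
qed

lemma Tr_represent:
  fixes t :: "nat \<Rightarrow> 'f"
  obtains z where "\<And>y. Tr (z * y) = (\<Sum>i<s. t i * coord i y)"
    "\<And>j. (\<And>i. i < s \<Longrightarrow> t i \<in> F.I j) \<Longrightarrow> z \<in> K.I j"
proof -
  define u where "u = (\<Sum>i<s. e (t i) * dual i)"
  have fd0: "fd \<noteq> 0" using fd_unit by (rule K.unit_nonzero)
  have "Tr (u / fd * y) = (\<Sum>i<s. t i * coord i y)" for y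
  proof -
    have "Tr (u / fd * y) = top (u * y)" using fd0 by (simp add: Tr_top)
    also have "\<dots> = (\<Sum>i<s. t i * top (dual i * y))"
      unfolding u_def sum_distrib_right top_sum by (intro sum.cong refl) (simp add: mult.assoc top_smult)
    also have "\<dots> = (\<Sum>i<s. t i * coord i y)" by (intro sum.cong refl) (simp add: coord_dual[symmetric])
    finally show ?thesis .
  qed
  moreover have "u / fd \<in> K.I j" if "\<And>i. i < s \<Longrightarrow> t i \<in> F.I j" for j
    unfolding u_def using that dual_integral
    by (intro K.unit_divide[OF _ fd_unit] K.ideal_sum K.ideal_multR) auto
  ultimately show thesis using that by blast
qed

end

section \<open>Traces of endomorphisms in coordinates\<close>

lemma abelian_monoid_by_type:
  assumes "\<And>x y. x \<in> carrier N \<Longrightarrow> y \<in> carrier N \<Longrightarrow> x + y \<in> carrier N" "0 \<in> carrier N"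
    and "\<And>x y. x \<oplus>\<^bsub>N\<^esub> y = (x + y :: 'b::comm_monoid_add)" "\<zero>\<^bsub>N\<^esub> = 0"
  shows "abelian_monoid N"
  by (rule abelian_monoidI) (use assms in \<open>auto simp: ac_simps\<close>)

lemma finsum_eq_sum:
  assumes N: "\<And>x y. x \<in> carrier N \<Longrightarrow> y \<in> carrier N \<Longrightarrow> x + y \<in> carrier N" "0 \<in> carrier N"
    and ops: "\<And>x y. x \<oplus>\<^bsub>N\<^esub> y = (x + y :: 'b::comm_monoid_add)" "\<zero>\<^bsub>N\<^esub> = 0"
    and "finite A" "\<And>i. i \<in> A \<Longrightarrow> h i \<in> carrier N"
  shows "finsum N h A = sum h A"
proof -
  interpret abelian_monoid N by (rule abelian_monoid_by_type[OF N ops])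
  show ?thesis using assms(5,6)
  proof (induction A rule: finite_induct)
    case (insert a A)
    then show ?case by (subst finsum_insert) (auto simp: ops Pi_def)
  qed (simp add: ops)
qed

text \<open>Covers both \<open>K\<close> over \<open>F\<close> and the lattice over
  \<open>O\<close>. The coordinates \<kappa> are functions on the whole type, so that their
  linearity is unconditional.\<close>

locale coordinate_module =
  fixes L :: "'f::field ring" and N :: "('f, 'b::ab_group_add) module" (structure)
    and s :: nat and bas :: "nat \<Rightarrow> 'b" and \<kappa> :: "nat \<Rightarrow> 'b \<Rightarrow> 'f"
  assumes N: "\<And>x y. x \<in> carrier N \<Longrightarrow> y \<in> carrier N \<Longrightarrow> x + y \<in> carrier N" "0 \<in> carrier N"
    and N_ops: "\<And>x y. x \<oplus> y = x + y" "\<zero> = 0"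
    and L: "\<And>x y. x \<in> carrier L \<Longrightarrow> y \<in> carrier L \<Longrightarrow> x + y \<in> carrier L" "0 \<in> carrier L"
      "1 \<in> carrier L" "\<And>x y. x \<in> carrier L \<Longrightarrow> y \<in> carrier L \<Longrightarrow> x * y \<in> carrier L"
    and L_ops: "\<And>x y. x \<oplus>\<^bsub>L\<^esub> y = x + y" "\<zero>\<^bsub>L\<^esub> = 0"
    and sm: "\<And>a u. a \<in> carrier L \<Longrightarrow> u \<in> carrier N \<Longrightarrow> a \<odot> u \<in> carrier N"
      "\<And>a b u. (a + b) \<odot> u = a \<odot> u + b \<odot> u" "\<And>a u w. a \<odot> (u + w) = a \<odot> u + a \<odot> w"
      "\<And>a b u. (a * b) \<odot> u = a \<odot> (b \<odot> u)" "\<And>u. 1 \<odot> u = u"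
    and bas: "\<And>i. i < s \<Longrightarrow> bas i \<in> carrier N"
    and \<kappa>: "\<And>i u. i < s \<Longrightarrow> u \<in> carrier N \<Longrightarrow> \<kappa> i u \<in> carrier L"
      "\<And>u. u = (\<Sum>i<s. \<kappa> i u \<odot> bas i)"
      "\<And>i u w. \<kappa> i (u + w) = \<kappa> i u + \<kappa> i w" "\<And>i a u. \<kappa> i (a \<odot> u) = a * \<kappa> i u"
      "\<And>i j. i < s \<Longrightarrow> j < s \<Longrightarrow> \<kappa> i (bas j) = (if i = j then 1 else 0)"
begin

lemma finsum_N: "(\<And>i. i < (n::nat) \<Longrightarrow> h i \<in> carrier N) \<Longrightarrow> (\<Oplus>i\<in>{..<n}. h i) = (\<Sum>i<n. h i)"
  by (rule finsum_eq_sum) (use N N_ops in auto)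

lemma finsum_L: "(\<And>i. i < (n::nat) \<Longrightarrow> h i \<in> carrier L) \<Longrightarrow> (\<Oplus>\<^bsub>L\<^esub>i\<in>{..<n}. h i) = (\<Sum>i<n. h i)"
  by (rule finsum_eq_sum) (use L L_ops in auto)

lemma \<kappa>_zero: "\<kappa> i 0 = 0" using \<kappa>(3)[of i 0 0] by (metis add_cancel_right_right add_0)
lemma \<kappa>_sum: "\<kappa> i (sum h A) = (\<Sum>k\<in>A. \<kappa> i (h k))"
  by (induction A rule: infinite_finite_induct) (simp_all add: \<kappa>_zero \<kappa>(3))
lemma sm_zero: "a \<odot> 0 = 0" "0 \<odot> u = 0"
  using sm(3)[of a 0 0] sm(2)[of 0 0 u] by (metis add_cancel_right_right add_0)+
lemma sm_sum: "a \<odot> (sum h A) = (\<Sum>k\<in>A. a \<odot> h k)"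
  by (induction A rule: infinite_finite_induct) (simp_all add: sm_zero sm)
lemma sum_sm: "(sum h A) \<odot> u = (\<Sum>k\<in>A. h k \<odot> u)"
  by (induction A rule: infinite_finite_induct) (simp_all add: sm_zero sm)
lemma L_sum: "(\<And>i. i \<in> A \<Longrightarrow> h i \<in> carrier L) \<Longrightarrow> sum h A \<in> carrier L"
  by (induction A rule: infinite_finite_induct) (simp_all add: L)

lemma module_basis: "module_basis L N s bas"
  unfolding module_basis_def
proof (intro conjI ballI)
  show "bas \<in> {..<s} \<rightarrow> carrier N" using bas by auto
  fix u assume u: "u \<in> carrier N"
  have fs: "(\<Oplus>i\<in>{..<s}. c i \<odot> bas i) = (\<Sum>i<s. c i \<odot> bas i)" if "c \<in> {..<s} \<rightarrow>\<^sub>E carrier L" for c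
    using that by (intro finsum_N sm bas) auto
  show "\<exists>!c. c \<in> {..<s} \<rightarrow>\<^sub>E carrier L \<and> u = (\<Oplus>i\<in>{..<s}. c i \<odot> bas i)"
  proof (rule ex1I[of _ "\<lambda>i\<in>{..<s}. \<kappa> i u"])
    have c: "(\<lambda>i\<in>{..<s}. \<kappa> i u) \<in> {..<s} \<rightarrow>\<^sub>E carrier L" using \<kappa>(1) u by auto
    show "(\<lambda>i\<in>{..<s}. \<kappa> i u) \<in> {..<s} \<rightarrow>\<^sub>E carrier L \<and>
      u = (\<Oplus>i\<in>{..<s}. (\<lambda>i\<in>{..<s}. \<kappa> i u) i \<odot> bas i)"
      unfolding fs[OF c] using c \<kappa>(2)[of u] by simp
    fix c assume c: "c \<in> {..<s} \<rightarrow>\<^sub>E carrier L \<and> u = (\<Oplus>i\<in>{..<s}. c i \<odot> bas i)"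
    have "\<kappa> j u = c j" if j: "j < s" for j
    proof -
      have "\<kappa> j u = (\<Sum>i<s. c i * (if j = i then 1 else 0))"
        using c fs[of c] j by (simp add: \<kappa>_sum \<kappa>(4,5) cong: if_cong)
      also have "\<dots> = (\<Sum>i<s. if j = i then c i else 0)" by (intro sum.cong) auto
      finally show ?thesis using j by simp
    qed
    then show "c = (\<lambda>i\<in>{..<s}. \<kappa> i u)" using c by (auto simp: PiE_def extensional_def fun_eq_iff)
  qed
qed

text \<open>The definite description ranges over bases of any length \<open>n\<close>. If
  \<open>P\<close> and \<open>Q\<close> are the base change matrices to such a basis, and
  \<open>C\<close> and \<open>?C\<close> the matrices of the endomorphism, then
  \<open>P C = ?C P\<close> and both products of \<open>P\<close> and \<open>Q\<close> are
  identities, so the traces agree.\<close>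

lemma module_trace_eq:
  assumes f: "\<And>u. u \<in> carrier N \<Longrightarrow> f u = g u" and g: "\<And>u. u \<in> carrier N \<Longrightarrow> g u \<in> carrier N"
    "\<And>u w. g (u + w) = g u + g w" "\<And>a u. g (a \<odot> u) = a \<odot> g u"
  shows "module_trace L N f = (\<Sum>i<s. \<kappa> i (g (bas i)))"
  unfolding module_trace_def
proof (rule the_equality)
  let ?C = "\<lambda>i j. \<kappa> i (g (bas j))"
  have C: "?C i j \<in> carrier L" if "i < s" "j < s" for i j using that \<kappa>(1) g bas by auto
  have "f (bas j) = (\<Oplus>i\<in>{..<s}. ?C i j \<odot> bas i)" if j: "j < s" for j
    by (subst finsum_N) (use j C sm bas f \<kappa>(2)[of "g (bas j)"] in auto)
  moreover have "(\<Sum>i<s. \<kappa> i (g (bas i))) = (\<Oplus>\<^bsub>L\<^esub>i\<in>{..<s}. ?C i i)"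
    by (subst finsum_L) (use C in auto)
  ultimately show "\<exists>n b C. module_basis L N n b \<and> (\<forall>i<n. \<forall>j<n. C i j \<in> carrier L) \<and>
     (\<forall>j<n. f (b j) = (\<Oplus>i\<in>{..<n}. C i j \<odot> b i)) \<and>
     (\<Sum>i<s. \<kappa> i (g (bas i))) = (\<Oplus>\<^bsub>L\<^esub>i\<in>{..<n}. C i i)"
    using module_basis C by (intro exI[of _ s] exI[of _ bas] exI[of _ ?C]) auto
next
  let ?C = "\<lambda>i j. \<kappa> i (g (bas j))"
  fix t assume "\<exists>n b C. module_basis L N n b \<and> (\<forall>i<n. \<forall>j<n. C i j \<in> carrier L) \<and>
     (\<forall>j<n. f (b j) = (\<Oplus>i\<in>{..<n}. C i j \<odot> b i)) \<and> t = (\<Oplus>\<^bsub>L\<^esub>i\<in>{..<n}. C i i)"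
  then obtain n b C where *: "module_basis L N n b \<and> (\<forall>i<n. \<forall>j<n. C i j \<in> carrier L) \<and>
     (\<forall>j<n. f (b j) = (\<Oplus>i\<in>{..<n}. C i j \<odot> b i)) \<and> t = (\<Oplus>\<^bsub>L\<^esub>i\<in>{..<n}. C i i)"
    by (elim exE) (rule that, assumption)
  then have b: "module_basis L N n b" and C: "\<And>i j. i < n \<Longrightarrow> j < n \<Longrightarrow> C i j \<in> carrier L"
    and fb: "\<And>j. j < n \<Longrightarrow> f (b j) = (\<Oplus>i\<in>{..<n}. C i j \<odot> b i)" and t: "t = (\<Oplus>\<^bsub>L\<^esub>i\<in>{..<n}. C i i)"
    by auto
  have bc: "b i \<in> carrier N" if "i < n" for i using b that by (auto simp: module_basis_def)
  have ex1: "\<exists>!c. c \<in> {..<n} \<rightarrow>\<^sub>E carrier L \<and> u = (\<Oplus>i\<in>{..<n}. c i \<odot> b i)" if "u \<in> carrier N" for u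
    using b that by (auto simp: module_basis_def)
  have fs: "(\<Oplus>i\<in>{..<n}. c i \<odot> b i) = (\<Sum>i<n. c i \<odot> b i)" if "\<And>i. i < n \<Longrightarrow> c i \<in> carrier L" for c
    using that by (intro finsum_N sm bc) auto
  have uniq: "c i = c' i" if "\<And>i. i < n \<Longrightarrow> c i \<in> carrier L" "\<And>i. i < n \<Longrightarrow> c' i \<in> carrier L" "i < n"
    "(\<Sum>i<n. c i \<odot> b i) = (\<Sum>i<n. c' i \<odot> b i)" "(\<Sum>i<n. c' i \<odot> b i) \<in> carrier N" for c c' i
  proof -
    define PP where "PP x \<longleftrightarrow> x \<in> {..<n} \<rightarrow>\<^sub>E carrier L \<and>
      (\<Sum>i<n. c' i \<odot> b i) = (\<Oplus>i\<in>{..<n}. x i \<odot> b i)" for x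
    have PP1: "\<exists>!x. PP x" unfolding PP_def by (rule ex1[OF that(5)])
    have r: "PP (restrict x {..<n})"
      if "\<And>i. i < n \<Longrightarrow> x i \<in> carrier L" "(\<Sum>i<n. x i \<odot> b i) = (\<Sum>i<n. c' i \<odot> b i)" for x
      unfolding PP_def using that fs[of "restrict x {..<n}"] by auto
    have "PP (restrict c {..<n})" "PP (restrict c' {..<n})" using r[of c] r[of c'] that(1,2,4) by auto
    then have "restrict c {..<n} = restrict c' {..<n}" using PP1 by blast
    then show ?thesis using that(3) by (metis lessThan_iff restrict_apply')
  qed
  have Qex: "\<exists>c. (\<forall>i<n. c i \<in> carrier L) \<and> bas j = (\<Sum>i<n. c i \<odot> b i)" if j: "j < s" for j
  proof -
    obtain c where c: "c \<in> {..<n} \<rightarrow>\<^sub>E carrier L" "bas j = (\<Oplus>i\<in>{..<n}. c i \<odot> b i)"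
      using ex1[OF bas[OF j]] by auto
    then show ?thesis using fs[of c] by (intro exI[of _ c]) auto
  qed
  obtain Q where Q: "\<And>i j. i < n \<Longrightarrow> j < s \<Longrightarrow> Q i j \<in> carrier L"
    "\<And>j. j < s \<Longrightarrow> bas j = (\<Sum>i<n. Q i j \<odot> b i)"
  proof -
    assume that: "\<And>Q. (\<And>i j. i < n \<Longrightarrow> j < s \<Longrightarrow> Q i j \<in> carrier L) \<Longrightarrow>
        (\<And>j. j < s \<Longrightarrow> bas j = (\<Sum>i<n. Q i j \<odot> b i)) \<Longrightarrow> thesis"
    let ?Q = "\<lambda>j. SOME c. (\<forall>i<n. c i \<in> carrier L) \<and> bas j = (\<Sum>i<n. c i \<odot> b i)"
    have "(\<forall>i<n. ?Q j i \<in> carrier L) \<and> bas j = (\<Sum>i<n. ?Q j i \<odot> b i)" if "j < s" for j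
      using Qex[OF that] by (rule someI_ex)
    then show thesis by (intro that[of "\<lambda>i j. ?Q j i"]) auto
  qed
  define P where "P i k = \<kappa> i (b k)" for i k
  have P: "P i k \<in> carrier L" if "i < s" "k < n" for i k using that \<kappa>(1) bc by (simp add: P_def)
  have QP: "(\<Sum>i<s. Q l i * P i k) = (if l = k then 1 else 0)" if l: "l < n" and k: "k < n" for l k
  proof (rule uniq[of "\<lambda>l. \<Sum>i<s. Q l i * P i k" "\<lambda>l. if l = k then 1 else 0"])
    have "(\<Sum>l<n. (\<Sum>i<s. Q l i * P i k) \<odot> b l) = (\<Sum>i<s. P i k \<odot> (\<Sum>l<n. Q l i \<odot> b l))"
      unfolding sum_sm sm_sum by (subst sum.swap) (simp add: sm(4)[symmetric] mult.commute)
    also have "\<dots> = (\<Sum>i<s. \<kappa> i (b k) \<odot> bas i)" by (intro sum.cong) (auto simp: Q(2)[symmetric] P_def)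
    also have "\<dots> = b k" using \<kappa>(2)[of "b k"] by simp
    also have "\<dots> = (\<Sum>l<n. if l = k then b l else 0)" using k by simp
    also have "\<dots> = (\<Sum>l<n. (if l = k then 1 else 0) \<odot> b l)" by (intro sum.cong) (auto simp: sm sm_zero)
    finally show e: "(\<Sum>l<n. (\<Sum>i<s. Q l i * P i k) \<odot> b l) = (\<Sum>l<n. (if l = k then 1 else 0) \<odot> b l)" .
    have "(\<Sum>l<n. (if l = k then 1 else 0) \<odot> b l) = (\<Sum>l<n. if l = k then b l else 0)"
      by (intro sum.cong) (auto simp: sm sm_zero)
    then show "(\<Sum>l<n. (if l = k then 1 else 0) \<odot> b l) \<in> carrier N" using k bc by simp
  qed (use l k Q P L in \<open>auto intro!: L_sum\<close>)
  have PC: "(\<Sum>l<n. P i l * C l j) = (\<Sum>k<s. ?C i k * P k j)" if i: "i < s" and j: "j < n" for i j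
  proof -
    have "f (b j) = (\<Sum>l<n. C l j \<odot> b l)" using fb[OF j] fs[of "\<lambda>l. C l j"] C j by simp
    then have "\<kappa> i (g (b j)) = (\<Sum>l<n. P i l * C l j)"
      using f[OF bc[OF j]] by (simp add: \<kappa>_sum \<kappa>(4) P_def mult.commute)
    moreover have "\<kappa> i (g (b j)) = (\<Sum>k<s. ?C i k * P k j)"
    proof -
      have g0: "g 0 = 0" using g(2)[of 0 0] by (metis add_cancel_right_right add_0)
      have gs: "g (sum h A) = (\<Sum>k\<in>A. g (h k))" for h and A :: "nat set"
        by (induction A rule: infinite_finite_induct) (simp_all add: g0 g(2))
      have "g (b j) = g (\<Sum>k<s. P k j \<odot> bas k)" using \<kappa>(2)[of "b j"] by (simp add: P_def)
      then show ?thesis by (simp add: gs g(3) \<kappa>_sum \<kappa>(4) mult.commute)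
    qed
    ultimately show ?thesis by simp
  qed
  have PQ: "(\<Sum>k<n. P i k * Q k j) = (if i = j then 1 else 0)" if "i < s" "j < s" for i j
  proof -
    have "\<kappa> i (\<Sum>k<n. Q k j \<odot> b k) = (if i = j then 1 else 0)" using \<kappa>(5)[OF that] Q(2)[OF that(2)] by simp
    then show ?thesis by (simp add: \<kappa>_sum \<kappa>(4) P_def mult.commute)
  qed
  \<comment> \<open>The chain runs through the traces of \<open>C\<close>, \<open>Q P C\<close>,
    \<open>Q ?C P\<close>, \<open>?C P Q\<close> and \<open>?C\<close>.\<close>
  have "t = (\<Sum>i<n. C i i)" unfolding t using C by (intro finsum_L) auto
  also have "\<dots> = (\<Sum>k<n. \<Sum>l<n. (if k = l then 1 else 0) * C l k)"
  proof (rule sum.cong[OF refl])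
    fix k assume "k \<in> {..<n}"
    have "(\<Sum>l<n. (if k = l then 1 else 0) * C l k) = (\<Sum>l<n. if k = l then C l k else 0)" by (intro sum.cong) auto
    then show "C k k = (\<Sum>l<n. (if k = l then 1 else 0) * C l k)" using \<open>k \<in> {..<n}\<close> by simp
  qed
  also have "\<dots> = (\<Sum>k<n. \<Sum>l<n. (\<Sum>i<s. Q k i * P i l) * C l k)"
    by (rule sum.cong[OF refl], rule sum.cong[OF refl]) (simp add: QP)
  also have "\<dots> = (\<Sum>k<n. \<Sum>i<s. Q k i * (\<Sum>l<n. P i l * C l k))"
    unfolding sum_distrib_left sum_distrib_right by (rule sum.cong[OF refl], subst sum.swap) (simp add: mult.assoc)
  also have "\<dots> = (\<Sum>k<n. \<Sum>i<s. Q k i * (\<Sum>j<s. ?C i j * P j k))"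
    by (rule sum.cong[OF refl], rule sum.cong[OF refl]) (simp add: PC)
  also have "\<dots> = (\<Sum>i<s. \<Sum>j<s. ?C i j * (\<Sum>k<n. P j k * Q k i))"
  proof -
    have "(\<Sum>k<n. \<Sum>i<s. Q k i * (\<Sum>j<s. ?C i j * P j k)) = (\<Sum>i<s. \<Sum>k<n. \<Sum>j<s. Q k i * (?C i j * P j k))"
      unfolding sum_distrib_left by (rule sum.swap)
    also have "\<dots> = (\<Sum>i<s. \<Sum>j<s. \<Sum>k<n. Q k i * (?C i j * P j k))" by (rule sum.cong[OF refl], rule sum.swap)
    finally show ?thesis by (simp add: sum_distrib_left mult_ac)
  qed
  also have "\<dots> = (\<Sum>i<s. \<Sum>j<s. if j = i then ?C i j else 0)"
    by (rule sum.cong[OF refl], rule sum.cong[OF refl]) (simp add: PQ)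
  also have "\<dots> = (\<Sum>i<s. ?C i i)" by (rule sum.cong[OF refl]) simp
  finally show "t = (\<Sum>i<s. ?C i i)" .
qed

end

context unramified_gen
begin

lemma ext_trace_eq: "ext_trace e x = Tr x"
proof -
  have cr: "a \<odot>\<^bsub>ext_module e\<^esub> u = e a * u" for a u by (simp add: ext_module_def)
  interpret coordinate_module "class_ring :: 'f ring" "ext_module e" s "\<lambda>i. \<beta> ^ i" coord
  proof unfold_locales
    show "u = (\<Sum>i<s. coord i u \<odot>\<^bsub>ext_module e\<^esub> \<beta> ^ i)" for u
      using coord_ev[of u] by (simp add: cr ev_def)
  qed (auto simp: ext_module_def class_ring_simps e_add e_mult distrib_left distrib_right coord_add coord_smult coord_power)
  show ?thesis
    unfolding ext_trace_def Tr_def by (rule module_trace_eq) (auto simp: cr ext_module_def algebra_simps)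
qed

end

section \<open>Endomorphisms of the lattice\<close>

text \<open>Additive endomorphisms acting from the right: \<open>X * Y\<close> means first \<open>X\<close>, then \<open>Y\<close>.\<close>

typedef (overloaded) 'a aend = "{f :: 'a::ab_group_add \<Rightarrow> 'a. \<forall>x y. f (x + y) = f x + f y}"
  morphisms app Aend
  by (rule exI[of _ "\<lambda>x. x"]) simp

setup_lifting type_definition_aend

instantiation aend :: (ab_group_add) ring
begin
lift_definition zero_aend :: "'a aend" is "\<lambda>x. 0" by simp
lift_definition plus_aend :: "'a aend \<Rightarrow> 'a aend \<Rightarrow> 'a aend" is "\<lambda>f g x. f x + g x" by (simp add: algebra_simps)
lift_definition minus_aend :: "'a aend \<Rightarrow> 'a aend \<Rightarrow> 'a aend" is "\<lambda>f g x. f x - g x" by (simp add: algebra_simps)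
lift_definition uminus_aend :: "'a aend \<Rightarrow> 'a aend" is "\<lambda>f x. - f x" by simp
lift_definition times_aend :: "'a aend \<Rightarrow> 'a aend \<Rightarrow> 'a aend" is "\<lambda>f g x. g (f x)" by simp
instance by intro_classes (transfer; auto simp: algebra_simps fun_eq_iff)+
end

instantiation aend :: (ab_group_add) monoid_mult
begin
lift_definition one_aend :: "'a aend" is "\<lambda>x. x" by simp
instance by intro_classes (transfer; auto simp: algebra_simps fun_eq_iff)+
end

lemma app_simps [simp]: "app 0 u = 0" "app (X + Y) u = app X u + app Y u" "app (X - Y) u = app X u - app Y u"
  "app (- X) u = - app X u" "app (X * Y) u = app Y (app X u)" "app 1 u = u"
  by (transfer; simp)+

lemma app_add: "app X (u + w) = app X u + app X w"
  using app[of X] by simp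

lemma app_zero [simp]: "app X 0 = 0"
  using app_add[of X 0 0] by (metis add_cancel_right_right add_0)

lemma app_uminus: "app X (- u) = - app X u"
  using app_add[of X u "- u"] by (simp add: eq_neg_iff_add_eq_0 add.commute)

lemma app_diff: "app X (u - w) = app X u - app X w"
  using app_add[of X u "- w"] by (simp add: app_uminus)

lemma app_sum: "app X (sum h A) = (\<Sum>k\<in>A. app X (h k))"
  by (induction A rule: infinite_finite_induct) (simp_all add: app_add)

lemma aend_eqI: "(\<And>u. app X u = app Y u) \<Longrightarrow> X = Y"
  by (metis app_inject ext)

lemma app_Aend: "(\<And>u w. f (u + w) = f u + f w) \<Longrightarrow> app (Aend f) = f"
  by (rule Aend_inverse) simp

lemma UN_const: "A \<noteq> {} \<Longrightarrow> (\<And>x. x \<in> A \<Longrightarrow> f x = c) \<Longrightarrow> (\<Union>x\<in>A. f x) = c"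
  by auto

text \<open>\<open>tau_O\<close> and \<open>tau_conductor\<close> are the two inclusions in the
  conductor condition on \<tau>. Odd residue characteristic makes 2 a unit, as the halvings in the
  logarithm and in the Lie algebra require.\<close>

locale go_setting = unramified_gen "vF D" "varpi D" "vK D" "emb D" "beta0 D"
  for D :: "('f::field, 'k::field) go_data" +
  assumes p_odd: "odd (residue_char (vF D))"
    and tau_add: "tau D (x + y) = tau D x * tau D y"
    and tau_O: "x \<in> val_ideal (vF D) 0 \<Longrightarrow> tau D x = 1"
    and tau_conductor: "(\<And>y. y \<in> val_ideal (vF D) 0 \<Longrightarrow> tau D (x * y) = 1) \<Longrightarrow> x \<in> val_ideal (vF D) 0"
    and iot_add: "iot D (x' + y') = iot D x' + iot D y'" and iot_mult: "iot D (x' * y') = iot D x' * iot D y'"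
    and iot_e: "iot D (emb D a') = emb D a'" and iot_iot: "iot D (iot D x') = x'"
    and iot_beta: "iot D (beta0 D) = - beta0 D"
    and eps_unit: "eps D \<in> Units (val_ring (vK D))" and iot_eps: "iot D (eps D) = eps D"
    and eta_unit: "eta D \<in> Units (val_ring (vF D))"
begin

declare split_paired_All [simp del] split_paired_Ex [simp del]

abbreviation "IF \<equiv> val_ideal (vF D)"
abbreviation "IK \<equiv> val_ideal (vK D)"
abbreviation "\<e> \<equiv> emb D"
abbreviation "\<b> \<equiv> beta0 D"
abbreviation "\<iota> \<equiv> iot D"
abbreviation "\<omega> \<equiv> varpi D"
abbreviation "UF \<equiv> Units (val_ring (vF D))"
abbreviation "UK \<equiv> Units (val_ring (vK D))"

lemma two_unit: "2 \<in> UF"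
proof -
  have "\<not> F.p dvd 2"
  proof
    assume "F.p dvd 2"
    then have "F.p = 2" using F.p_prime by (simp add: primes_dvd_imp_eq)
    then show False using p_odd by (simp add: F.p_def)
  qed
  then show ?thesis using F.of_nat_unit[of 2] by simp
qed

lemma two_nz: "(2 :: 'f) \<noteq> 0" using two_unit by (rule F.unit_nonzero)
lemma half: "inverse 2 \<in> UF" using two_unit by (rule F.unit_inverse)
lemma e_two: "\<e> 2 = 2" using e_of_nat[of 2] by simp
lemma two_unit_K: "2 \<in> UK" using two_unit e_unit[of 2] by (simp add: e_two)
lemma two_nz_K: "(2 :: 'k) \<noteq> 0" using two_unit_K by (rule K.unit_nonzero)

lemma iot_zero [simp]: "\<iota> 0 = 0" using iot_e[of 0] by simp
lemma iot_one [simp]: "\<iota> 1 = 1" using iot_e[of 1] by simp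
lemma iot_uminus: "\<iota> (- x) = - \<iota> x" using iot_add[of x "- x"] by (simp add: eq_neg_iff_add_eq_0 add.commute)
lemma iot_diff: "\<iota> (x - y) = \<iota> x - \<iota> y" using iot_add[of x "- y"] by (simp add: iot_uminus)
lemma iot_sum: "\<iota> (sum f A) = (\<Sum>i\<in>A. \<iota> (f i))"
  by (induction A rule: infinite_finite_induct) (simp_all add: iot_add)
lemma iot_power: "\<iota> (x ^ n) = \<iota> x ^ n" by (induction n) (simp_all add: iot_mult)
lemma iot_inverse: "\<iota> (inverse x) = inverse (\<iota> x)"
proof (cases "x = 0")
  case False
  then show ?thesis using iot_mult[of x "inverse x"] by (simp add: inverse_unique)
qed simp
lemma iot_divide: "\<iota> (x / y) = \<iota> x / \<iota> y" by (simp add: divide_inverse iot_mult iot_inverse)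

text \<open>Because \<iota> negates \<beta>, it is diagonal with entries plus or minus 1 in the
  power basis. From this follows that it preserves the ideals and the trace.\<close>

lemma coord_iot: "coord i (\<iota> x) = (- 1) ^ i * coord i x"
proof (cases "i < s")
  case True
  have "\<iota> x = \<iota> (ev s (\<lambda>i. coord i x))" by (simp add: coord_ev)
  also have "\<dots> = ev s (\<lambda>i. (- 1) ^ i * coord i x)"
    unfolding ev_def iot_sum
    by (intro sum.cong refl) (simp add: iot_mult iot_e iot_power iot_beta e_mult e_power e_uminus power_minus[of \<b>])
  finally show ?thesis using True by (rule coord_unique)
qed (simp add: coord_ge)

lemma iot_ideal1: "x \<in> IK j \<Longrightarrow> \<iota> x \<in> IK j"
proof (rule ideal_coord)
  fix i assume "x \<in> IK j" "i < s"
  then have "coord i x \<in> IF j" by (intro coord_ideal)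
  moreover have "(- 1) ^ i \<in> IF 0" by (rule F.ideal_power) simp
  ultimately show "coord i (\<iota> x) \<in> IF j" unfolding coord_iot by (intro F.ideal_multL)
qed

lemma iot_ideal [simp]: "\<iota> x \<in> IK j \<longleftrightarrow> x \<in> IK j"
  using iot_ideal1[of x j] iot_ideal1[of "\<iota> x" j] by (auto simp: iot_iot)

lemma Tr_iot: "Tr (\<iota> x) = Tr x"
  unfolding Tr_def
proof (intro sum.cong refl)
  fix i
  have sq: "(- 1) ^ i * (- 1) ^ i = (1 :: 'c::comm_ring_1)" by (rule minus_one_mult_self)
  have "\<iota> (\<e> ((- 1) ^ i) * (x * \<b> ^ i)) = (- 1) ^ i * (\<iota> x * (- \<b>) ^ i)"
    by (simp add: iot_mult iot_uminus iot_power iot_beta e_power e_uminus)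
  also have "\<dots> = ((- 1) ^ i * (- 1) ^ i) * (\<iota> x * \<b> ^ i)"
    by (simp only: power_minus[of \<b>] mult_ac)
  finally have "\<iota> x * \<b> ^ i = \<iota> (\<e> ((- 1) ^ i) * (x * \<b> ^ i))" by (simp only: sq mult_1)
  then have "coord i (\<iota> x * \<b> ^ i) = ((- 1) ^ i * (- 1) ^ i) * coord i (x * \<b> ^ i)"
    by (simp only: coord_iot coord_smult mult.assoc)
  then show "coord i (\<iota> x * \<b> ^ i) = coord i (x * \<b> ^ i)" by (simp only: minus_one_mult_self mult_1)
qed

section \<open>Coordinates and endomorphisms on the ambient space\<close>

definition sc :: "'f \<Rightarrow> 'k \<times> 'f \<Rightarrow> 'k \<times> 'f" where
  "sc c u = (\<e> c * fst u, c * snd u)"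

abbreviation "L \<equiv> sublattice D"

lemma mem_L: "u \<in> L j \<longleftrightarrow> fst u \<in> IK j \<and> snd u \<in> IF j"
  by (cases u) (simp add: sublattice_def)

lemma sc_add: "sc c (u + w) = sc c u + sc c w" "sc (c + c') u = sc c u + sc c' u"
  by (simp_all add: sc_def e_add algebra_simps)
lemma sc_sc: "sc c (sc c' u) = sc (c * c') u" by (simp add: sc_def e_mult algebra_simps)
lemma sc_one [simp]: "sc 1 u = u" by (simp add: sc_def)
lemma sc_zero [simp]: "sc 0 u = 0" "sc c 0 = 0" by (simp_all add: sc_def prod_eq_iff)
lemma sc_uminus: "sc c (- u) = - sc c u" "sc (- c) u = - sc c u" by (simp_all add: sc_def prod_eq_iff e_uminus)
lemma sc_diff: "sc c (u - w) = sc c u - sc c w" "sc (c - c') u = sc c u - sc c' u"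
  by (simp_all add: sc_def prod_eq_iff e_diff algebra_simps)
lemma sc_sum: "sc c (sum h A) = (\<Sum>k\<in>A. sc c (h k))" "sc (sum g A) u = (\<Sum>k\<in>A. sc (g k) u)"
  by (induction A rule: infinite_finite_induct) (simp_all add: sc_add)

lemma L_zero [simp]: "0 \<in> L j" by (simp add: mem_L)
lemma L_add: "u \<in> L j \<Longrightarrow> w \<in> L j \<Longrightarrow> u + w \<in> L j" by (auto simp: mem_L)
lemma L_uminus [simp]: "- u \<in> L j \<longleftrightarrow> u \<in> L j" by (auto simp: mem_L)
lemma L_diff: "u \<in> L j \<Longrightarrow> w \<in> L j \<Longrightarrow> u - w \<in> L j" by (auto simp: mem_L)
lemma L_sum: "(\<And>i. i \<in> A \<Longrightarrow> h i \<in> L j) \<Longrightarrow> sum h A \<in> L j"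
  by (induction A rule: infinite_finite_induct) (auto intro: L_add)
lemma L_sc: "c \<in> IF j \<Longrightarrow> u \<in> L k \<Longrightarrow> sc c u \<in> L (j + k)"
  by (auto simp: mem_L sc_def intro!: K.ideal_mult F.ideal_mult)
lemma L_sc0: "c \<in> IF 0 \<Longrightarrow> u \<in> L k \<Longrightarrow> sc c u \<in> L k"
  using L_sc[of c 0 u k] by simp
lemma L_mono: "u \<in> L j \<Longrightarrow> k \<le> j \<Longrightarrow> u \<in> L k" by (auto simp: mem_L intro: K.ideal_mono F.ideal_mono)
lemma L_shift: "sc (\<omega> ^ j) u \<in> L (j + k) \<longleftrightarrow> u \<in> L k"
  by (simp add: mem_L sc_def e_power K.ideal_shift F.ideal_shift)
lemma L_shift0: "sc (\<omega> ^ j) u \<in> L j \<longleftrightarrow> u \<in> L 0"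
  using L_shift[of j u 0] by simp
lemma L_E:
  assumes "u \<in> L j"
  obtains w where "w \<in> L 0" "u = sc (\<omega> ^ j) w"
proof -
  have "sc (\<omega> ^ j) (sc (inverse (\<omega> ^ j)) u) = u" using F.\<pi> by (simp add: sc_sc)
  then show thesis using that[of "sc (inverse (\<omega> ^ j)) u"] assms L_shift0 by metis
qed
lemma L_cancel: "u - w \<in> L j \<Longrightarrow> u \<in> L j \<longleftrightarrow> w \<in> L j"
  using L_diff[of u j "u - w"] L_add[of "u - w" j w] by auto
text \<open>The indices below \<open>s\<close> belong to the summand \<open>O_K\<close>, the index
  \<open>s\<close> to the summand \<open>O\<close>.\<close>

definition bas :: "nat \<Rightarrow> 'k \<times> 'f" where
  "bas i = (if i < s then (\<b> ^ i, 0) else (0, 1))"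

definition cf :: "nat \<Rightarrow> 'k \<times> 'f \<Rightarrow> 'f" where
  "cf i u = (if i < s then coord i (fst u) else snd u)"

abbreviation "n \<equiv> Suc s"

lemma bas_L: "bas i \<in> L 0" by (simp add: bas_def mem_L \<beta>_integral)
lemma cf_add: "cf i (u + w) = cf i u + cf i w" by (simp add: cf_def coord_add)
lemma cf_sc: "cf i (sc c u) = c * cf i u" by (simp add: cf_def sc_def coord_smult)
lemma cf_diff: "cf i (u - w) = cf i u - cf i w" by (simp add: cf_def coord_diff)
lemma cf_zero [simp]: "cf i 0 = 0" by (simp add: cf_def)
lemma cf_sum: "cf i (sum h A) = (\<Sum>k\<in>A. cf i (h k))"
  by (induction A rule: infinite_finite_induct) (simp_all add: cf_add)
lemma cf_bas: "i < n \<Longrightarrow> j < n \<Longrightarrow> cf i (bas j) = (if i = j then 1 else 0)"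
  by (auto simp: cf_def bas_def coord_power)

lemma expand: "(\<Sum>i<n. sc (cf i u) (bas i)) = u"
proof -
  have "(\<Sum>i<s. sc (cf i u) (bas i)) = (ev s (\<lambda>i. coord i (fst u)), 0)"
    unfolding ev_def by (auto simp: prod_eq_iff fst_sum snd_sum sc_def cf_def bas_def intro!: sum.cong)
  then show ?thesis by (simp add: coord_ev sc_def cf_def bas_def prod_eq_iff)
qed

lemma cf_ideal: "u \<in> L j \<Longrightarrow> cf i u \<in> IF j" by (auto simp: cf_def mem_L coord_ideal)

lemma lattice_simps: "carrier (lattice D) = L 0" "u \<oplus>\<^bsub>lattice D\<^esub> w = u + w" "\<zero>\<^bsub>lattice D\<^esub> = 0"
  "c \<odot>\<^bsub>lattice D\<^esub> u = sc c u"
  by (auto simp: lattice_def sublattice_def F.carrier_val_ring K.carrier_val_ring sc_def split_def zero_prod_def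
      plus_prod_def)

lemma carrier_O: "carrier (O_F D) = IF 0" by (rule F.carrier_val_ring)

sublocale LM: coordinate_module "O_F D" "lattice D" n bas cf
proof unfold_locales
  show "x \<oplus>\<^bsub>O_F D\<^esub> y = x + y" "\<zero>\<^bsub>O_F D\<^esub> = 0" for x y by (simp_all add: val_ring_def)
  show "u = (\<Sum>i<n. cf i u \<odot>\<^bsub>lattice D\<^esub> bas i)" for u using expand[of u] by (simp only: lattice_simps)
  show "x * y \<in> carrier (O_F D)" if "x \<in> carrier (O_F D)" "y \<in> carrier (O_F D)" for x y
    using that by (auto simp: carrier_O intro: F.ideal_multL)
qed (auto simp: lattice_simps carrier_O L_add sc_add sc_sc bas_L cf_add cf_sc cf_bas cf_ideal intro: L_sc0)

text \<open>Endomorphisms of the lattice are represented by linear maps of the ambient space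
  \<open>K \<times> F\<close>. There division by powers of \<omega> is possible, and
  \<open>\<I> j\<close> is \<open>\<omega> ^ j\<close> times \<open>\<E>\<close>.\<close>

definition \<E> :: "('k \<times> 'f) aend set" where
  "\<E> = {X. (\<forall>c u. app X (sc c u) = sc c (app X u)) \<and> (\<forall>u\<in>L 0. app X u \<in> L 0)}"

definition \<I> :: "nat \<Rightarrow> ('k \<times> 'f) aend set" where
  "\<I> j = {X. (\<forall>c u. app X (sc c u) = sc c (app X u)) \<and> (\<forall>u\<in>L 0. app X u \<in> L j)}"

lemma \<E>_0: "\<E> = \<I> 0" by (simp add: \<E>_def \<I>_def)

lift_definition sm :: "'f \<Rightarrow> ('k \<times> 'f) aend \<Rightarrow> ('k \<times> 'f) aend" is "\<lambda>c X u. sc c (X u)"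
  by (simp add: sc_add)

lemma app_sm [simp]: "app (sm c X) u = sc c (app X u)" by transfer simp

lemma sm_simps: "sm c (X + Y) = sm c X + sm c Y" "sm c (X - Y) = sm c X - sm c Y" "sm (c + c') X = sm c X + sm c' X"
  "sm (c - c') X = sm c X - sm c' X" "sm c (sm c' X) = sm (c * c') X" "sm 1 X = X" "sm c 0 = 0" "sm 0 X = 0"
  "sm c (- X) = - sm c X" "sm (- c) X = - sm c X" "X * sm c Y = sm c (X * Y)"
  by (auto intro!: aend_eqI simp: sc_add sc_diff sc_sc sc_uminus)

lemma \<I>D: "X \<in> \<I> j \<Longrightarrow> app X (sc c u) = sc c (app X u)" "X \<in> \<I> j \<Longrightarrow> u \<in> L 0 \<Longrightarrow> app X u \<in> L j"
  by (auto simp: \<I>_def)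
lemma \<E>D: "X \<in> \<E> \<Longrightarrow> app X (sc c u) = sc c (app X u)" "X \<in> \<E> \<Longrightarrow> u \<in> L 0 \<Longrightarrow> app X u \<in> L 0"
  by (auto simp: \<E>_def)
lemma \<I>_mono: "X \<in> \<I> j \<Longrightarrow> k \<le> j \<Longrightarrow> X \<in> \<I> k" by (auto simp: \<I>_def intro: L_mono)
lemma \<I>_\<E>: "X \<in> \<I> j \<Longrightarrow> X \<in> \<E>" unfolding \<E>_0 by (rule \<I>_mono) auto
lemma \<E>_L: "X \<in> \<E> \<Longrightarrow> u \<in> L j \<Longrightarrow> app X u \<in> L j"
proof -
  assume X: "X \<in> \<E>" and u: "u \<in> L j"
  obtain w where w: "w \<in> L 0" "u = sc (\<omega> ^ j) w" using u by (rule L_E)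
  show ?thesis unfolding w(2) \<E>D(1)[OF X] L_shift0 by (rule \<E>D(2)[OF X w(1)])
qed
lemma sm_mult: "X \<in> \<E> \<Longrightarrow> Y \<in> \<E> \<Longrightarrow> sm c X * Y = sm c (X * Y)"
  by (auto intro!: aend_eqI simp: \<E>D)
lemma \<I>_closed: "0 \<in> \<I> j" "X \<in> \<I> j \<Longrightarrow> Y \<in> \<I> j \<Longrightarrow> X + Y \<in> \<I> j" "X \<in> \<I> j \<Longrightarrow> Y \<in> \<I> j \<Longrightarrow> X - Y \<in> \<I> j"
  "X \<in> \<I> j \<Longrightarrow> - X \<in> \<I> j" "c \<in> IF 0 \<Longrightarrow> X \<in> \<I> j \<Longrightarrow> sm c X \<in> \<I> j"
  by (auto simp: \<I>_def L_add L_diff L_sc0 sc_add sc_diff sc_uminus sc_sc mult.commute)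
lemma \<E>_closed: "0 \<in> \<E>" "1 \<in> \<E>" "X \<in> \<E> \<Longrightarrow> Y \<in> \<E> \<Longrightarrow> X + Y \<in> \<E>" "X \<in> \<E> \<Longrightarrow> Y \<in> \<E> \<Longrightarrow> X - Y \<in> \<E>"
  "X \<in> \<E> \<Longrightarrow> Y \<in> \<E> \<Longrightarrow> X * Y \<in> \<E>" "X \<in> \<E> \<Longrightarrow> - X \<in> \<E>" "c \<in> IF 0 \<Longrightarrow> X \<in> \<E> \<Longrightarrow> sm c X \<in> \<E>"
  by (auto simp: \<E>_def L_add L_diff L_sc0 sc_add sc_diff sc_uminus sc_sc mult.commute)
lemma \<I>_mult: "X \<in> \<I> j \<Longrightarrow> Y \<in> \<E> \<Longrightarrow> X * Y \<in> \<I> j" "Y \<in> \<E> \<Longrightarrow> X \<in> \<I> j \<Longrightarrow> Y * X \<in> \<I> j"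
  by (auto simp: \<I>_def \<E>D \<E>_L)
lemma \<I>_shift: "sm (\<omega> ^ j) X \<in> \<I> (j + k) \<longleftrightarrow> X \<in> \<I> k"
proof -
  have "sc (\<omega> ^ j) u = sc (\<omega> ^ j) w \<longleftrightarrow> u = w" for u w
    using F.\<pi> by (auto simp: sc_def prod_eq_iff e_power)
  moreover have "sc (\<omega> ^ j) (sc c u) = sc c (sc (\<omega> ^ j) u)" for c u by (simp add: sc_sc mult.commute)
  ultimately have "(\<forall>c u. sc (\<omega> ^ j) (app X (sc c u)) = sc c (sc (\<omega> ^ j) (app X u))) \<longleftrightarrow>
    (\<forall>c u. app X (sc c u) = sc c (app X u))" by metis
  then show ?thesis by (auto simp: \<I>_def L_shift)
qed
lemma \<I>_shift0: "sm (\<omega> ^ j) X \<in> \<I> j \<longleftrightarrow> X \<in> \<E>"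
  using \<I>_shift[of j X 0] by (simp add: \<E>_0)
lemma \<I>_E:
  assumes "X \<in> \<I> j"
  obtains Y where "Y \<in> \<E>" "X = sm (\<omega> ^ j) Y"
proof -
  have "X = sm (\<omega> ^ j) (sm (inverse (\<omega> ^ j)) X)" using F.\<pi> by (simp add: sm_simps)
  then show thesis using that \<I>_shift0[of j "sm (inverse (\<omega> ^ j)) X"] assms by metis
qed

definition mk :: "(nat \<Rightarrow> 'k \<times> 'f) \<Rightarrow> ('k \<times> 'f) aend" where
  "mk f = Aend (\<lambda>u. \<Sum>i<n. sc (cf i u) (f i))"

lemma app_mk: "app (mk f) u = (\<Sum>i<n. sc (cf i u) (f i))"
  unfolding mk_def by (subst app_Aend) (auto simp: cf_add sc_add sum.distrib simp del: sum.lessThan_Suc)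

lemma mk_E: "(\<And>i. i < n \<Longrightarrow> f i \<in> L j) \<Longrightarrow> mk f \<in> \<I> j"
  unfolding \<I>_def
  by (auto simp: app_mk cf_sc sc_sum sc_sc simp del: sum.lessThan_Suc intro!: L_sum L_sc0 cf_ideal)

lemma linear_expand: "X \<in> \<E> \<Longrightarrow> app X u = (\<Sum>i<n. sc (cf i u) (app X (bas i)))"
proof -
  assume X: "X \<in> \<E>"
  have "app X u = app X (\<Sum>i<n. sc (cf i u) (bas i))" by (simp only: expand)
  then show ?thesis using X by (simp add: app_sum app_add \<E>D)
qed

definition tr :: "('k \<times> 'f) aend \<Rightarrow> 'f" where
  "tr X = (\<Sum>i<n. cf i (app X (bas i)))"

lemma tr_add: "tr (X + Y) = tr X + tr Y" by (simp add: tr_def cf_add sum.distrib)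
lemma tr_diff: "tr (X - Y) = tr X - tr Y" by (simp add: tr_def cf_diff sum_subtractf)
lemma tr_sm: "tr (sm c X) = c * tr X" by (simp add: tr_def cf_sc sum_distrib_left algebra_simps)
lemma tr_ideal: "X \<in> \<I> j \<Longrightarrow> tr X \<in> IF j"
  unfolding tr_def using bas_L by (intro F.ideal_sum cf_ideal) (auto simp: \<I>D)

lemma tr_commute:
  assumes "X \<in> \<E>" "Y \<in> \<E>"
  shows "tr (X * Y) = tr (Y * X)"
proof -
  have *: "tr (X * Y) = (\<Sum>i<n. \<Sum>j<n. cf j (app X (bas i)) * cf i (app Y (bas j)))" if "Y \<in> \<E>" for X Y
    unfolding tr_def
  proof (rule sum.cong[OF refl])
    fix i
    have "cf i (app Y (app X (bas i))) = cf i (\<Sum>j<n. sc (cf j (app X (bas i))) (app Y (bas j)))"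
      by (simp only: linear_expand[OF that, of "app X (bas i)"])
    then show "cf i (app (X * Y) (bas i)) = (\<Sum>j<n. cf j (app X (bas i)) * cf i (app Y (bas j)))"
      by (simp only: cf_sum cf_sc app_simps)
  qed
  have "tr (X * Y) = (\<Sum>j<n. \<Sum>i<n. cf j (app X (bas i)) * cf i (app Y (bas j)))"
    unfolding *[OF assms(2)] by (rule sum.swap)
  also have "\<dots> = tr (Y * X)" unfolding *[OF assms(1)] by (simp add: mult.commute)
  finally show ?thesis .
qed

section \<open>The form, its perfectness and adjoints\<close>

abbreviation "\<F> \<equiv> form D"

lemma form_eq: "\<F> u w = Tr (eps D * fst u * \<iota> (fst w)) + eta D * snd u * snd w"
  by (cases u; cases w) (simp add: ext_trace_eq)

lemma form_add: "\<F> (u + u') w = \<F> u w + \<F> u' w" "\<F> u (w + w') = \<F> u w + \<F> u w'"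
  by (simp_all add: form_eq Tr_add iot_add distrib_left distrib_right)
lemma form_diff: "\<F> (u - u') w = \<F> u w - \<F> u' w" "\<F> u (w - w') = \<F> u w - \<F> u w'"
  by (simp_all add: form_eq Tr_diff iot_diff left_diff_distrib right_diff_distrib)
lemma form_sc: "\<F> (sc c u) w = c * \<F> u w" "\<F> u (sc c w) = c * \<F> u w"
proof -
  have 1: "eps D * fst (sc c u) * \<iota> (fst w) = \<e> c * (eps D * fst u * \<iota> (fst w))" by (simp add: sc_def mult_ac)
  show "\<F> (sc c u) w = c * \<F> u w" unfolding form_eq 1 Tr_smult by (simp add: sc_def distrib_left mult_ac)
  have 2: "eps D * fst u * \<iota> (fst (sc c w)) = \<e> c * (eps D * fst u * \<iota> (fst w))"
    by (simp add: sc_def iot_mult iot_e mult_ac)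
  show "\<F> u (sc c w) = c * \<F> u w" unfolding form_eq 2 Tr_smult by (simp add: sc_def distrib_left mult_ac)
qed
lemma form_zero [simp]: "\<F> 0 w = 0" "\<F> u 0 = 0" by (simp_all add: form_eq)
lemma form_sum: "\<F> (sum h A) w = (\<Sum>k\<in>A. \<F> (h k) w)" "\<F> u (sum h A) = (\<Sum>k\<in>A. \<F> u (h k))"
  by (induction A rule: infinite_finite_induct) (simp_all add: form_add)
lemma form_sym: "\<F> u w = \<F> w u"
proof -
  have "Tr (eps D * fst u * \<iota> (fst w)) = Tr (\<iota> (eps D * fst u * \<iota> (fst w)))" by (simp add: Tr_iot)
  then show ?thesis by (simp add: form_eq iot_mult iot_iot iot_eps mult_ac)
qed
lemma form_ideal: "u \<in> L j \<Longrightarrow> w \<in> L 0 \<Longrightarrow> \<F> u w \<in> IF j"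
  unfolding form_eq mem_L using K.unit_integral[OF eps_unit] F.unit_integral[OF eta_unit]
  by (intro F.ideal_add Tr_ideal F.ideal_multR[of _ j] K.ideal_multR[of _ j] F.ideal_multL[of _ _ j] K.ideal_multL[of _ _ j]) auto
lemma form_ideal': "u \<in> L 0 \<Longrightarrow> w \<in> L j \<Longrightarrow> \<F> u w \<in> IF j"
  using form_ideal[of w j u] by (simp add: form_sym)

text \<open>Perfectness of the form on the lattice: the trace pairing is perfect by
  \<open>Tr_nondeg\<close>, and \<open>eps D\<close> and \<open>eta D\<close> are units.\<close>

lemma form_nondeg:
  assumes "\<And>w. w \<in> L 0 \<Longrightarrow> \<F> u w \<in> IF j"
  shows "u \<in> L j"
proof -
  have "eps D * fst u \<in> IK j"
  proof (rule Tr_nondeg)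
    fix y assume "y \<in> IK 0"
    then show "Tr (eps D * fst u * y) \<in> IF j"
      using assms[of "(\<iota> y, 0)"] by (simp add: form_eq mem_L iot_iot)
  qed
  moreover have "eta D * snd u \<in> IF j" using assms[of "(0, 1)"] by (simp add: form_eq mem_L)
  ultimately show ?thesis by (simp add: mem_L K.unit_mult_iff[OF eps_unit] F.unit_mult_iff[OF eta_unit])
qed

lemma form_nondeg': "(\<And>w. w \<in> L 0 \<Longrightarrow> \<F> w u \<in> IF j) \<Longrightarrow> u \<in> L j"
  by (rule form_nondeg) (simp add: form_sym)

lemma form_represent:
  assumes "\<And>u w. \<phi> (u + w) = \<phi> u + \<phi> w" "\<And>c u. \<phi> (sc c u) = c * \<phi> u"
  obtains w where "\<And>u. \<phi> u = \<F> u w"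
proof -
  obtain z where z: "\<And>y. Tr (z * y) = (\<Sum>i<s. \<phi> (bas i) * coord i y)" using Tr_represent[of "\<lambda>i. \<phi> (bas i)"] by blast
  define w where "w = (\<iota> (z / eps D), \<phi> (bas s) / eta D)"
  have p0: "\<phi> 0 = 0" using assms(2)[of 0 0] by simp
  have ps: "\<phi> (sum h A) = (\<Sum>k\<in>A. \<phi> (h k))" for h and A :: "nat set"
    by (induction A rule: infinite_finite_induct) (simp_all add: p0 assms)
  have "\<phi> u = \<F> u w" for u
  proof -
    have "\<phi> u = \<phi> (\<Sum>i<n. sc (cf i u) (bas i))" by (simp only: expand)
    also have "\<dots> = (\<Sum>i<n. cf i u * \<phi> (bas i))" by (simp only: ps assms(2))
    also have "\<dots> = (\<Sum>i<s. \<phi> (bas i) * coord i (fst u)) + snd u * \<phi> (bas s)"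
      by (simp add: cf_def mult.commute)
    also have "\<dots> = \<F> u w"
      using K.unit_nonzero[OF eps_unit] F.unit_nonzero[OF eta_unit]
      by (simp add: form_eq w_def iot_iot z[symmetric] mult.commute)
    finally show ?thesis .
  qed
  then show thesis using that by blast
qed

lemma form_eq_zero: "(\<And>w. \<F> w u = 0) \<Longrightarrow> u = 0"
proof -
  assume "\<And>w. \<F> w u = 0"
  then have "u \<in> L j" for j by (intro form_nondeg') simp
  then show "u = 0" using K.ideal_all[of "fst u"] F.ideal_all[of "snd u"] by (auto simp: mem_L prod_eq_iff)
qed

text \<open>For fixed \<open>w\<close> the functional \<open>\<F> (app X u) w\<close> of
  \<open>u\<close> is represented by a unique vector, which is therefore linear in \<open>w\<close>.
  Perfectness of the form makes it integral when \<open>w\<close> is.\<close>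

lemma adjoint_exists:
  assumes X: "X \<in> \<E>"
  obtains Y where "Y \<in> \<E>" "\<And>u w. \<F> (app X u) w = \<F> u (app Y w)"
proof -
  have "\<exists>w'. \<forall>u. \<F> (app X u) w = \<F> u w'" for w
    using form_represent[of "\<lambda>u. \<F> (app X u) w"] by (metis X \<E>D(1) app_add form_add(1) form_sc(1))
  then obtain g where g: "\<And>u w. \<F> (app X u) w = \<F> u (g w)" by metis
  have eqI: "a = b" if "\<And>u. \<F> u a = \<F> u b" for a b
    using form_eq_zero[of "a - b"] that by (simp add: form_diff)
  have "g (w + w') = g w + g w'" for w w' by (rule eqI) (simp add: g[symmetric] form_add)
  then have a: "app (Aend g) = g" by (rule app_Aend)
  have "g (sc c w) = sc c (g w)" for c w by (rule eqI) (simp add: g[symmetric] form_sc)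
  moreover have "g w \<in> L 0" if w: "w \<in> L 0" for w
    by (rule form_nondeg') (use w X in \<open>auto simp: g[symmetric] \<E>D intro: form_ideal\<close>)
  ultimately have "Aend g \<in> \<E>" by (simp add: \<E>_def a)
  then show thesis using that[of "Aend g"] a g by simp
qed

end

section \<open>Reduction modulo powers of the prime\<close>

context go_setting
begin

abbreviation "V j \<equiv> res_lattice D j"
abbreviation "RR j \<equiv> res_ring (vF D) j"

definition pp :: "nat \<Rightarrow> 'f \<Rightarrow> 'f set" where
  "pp j c = val_ideal (vF D) j +>\<^bsub>O_F D\<^esub> c"

definition qq :: "nat \<Rightarrow> 'k \<times> 'f \<Rightarrow> ('k \<times> 'f) set" where
  "qq j u = sublattice D j +>\<^bsub>lattice D\<^esub> u"

lemma pp: "pp j c = {x. x - c \<in> IF j}" unfolding pp_def by (rule F.coset_eq)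
lemma pp_eq: "pp j c = pp j c' \<longleftrightarrow> c - c' \<in> IF j" unfolding pp_def by (rule F.coset_eq_iff)

lemma qq: "qq j u = {w. w - u \<in> L j}"
proof -
  have "qq j u = (\<Union>h\<in>L j. {h + u})"
    by (simp add: qq_def a_r_coset_def' lattice_simps)
  also have "\<dots> = {w. w - u \<in> L j}"
  proof (intro equalityI subsetI)
    fix y assume "y \<in> {w. w - u \<in> L j}"
    then show "y \<in> (\<Union>h\<in>L j. {h + u})" by (intro UN_I[of "y - u"]) auto
  qed auto
  finally show ?thesis .
qed

lemma qq_eq: "qq j u = qq j w \<longleftrightarrow> u - w \<in> L j"
proof
  assume *: "qq j u = qq j w"
  have "u \<in> qq j u" by (simp add: qq)
  then have "u \<in> qq j w" by (simp only: *)
  then show "u - w \<in> L j" by (simp add: qq)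
next
  assume *: "u - w \<in> L j"
  have "z - u \<in> L j \<longleftrightarrow> z - w \<in> L j" for z
    using L_cancel[of "z - w" "z - u" j] * by simp
  then show "qq j u = qq j w" by (simp add: qq)
qed

lemma pp_self: "c \<in> pp j c" by (simp add: pp)
lemma qq_self: "u \<in> qq j u" by (simp add: qq)
lemma pp_O: "c \<in> IF 0 \<Longrightarrow> x \<in> pp j c \<Longrightarrow> x \<in> IF 0"
  using F.ideal_cancel[OF F.ideal_mono, of x c j 0] by (simp add: pp)
lemma qq_L: "u \<in> L 0 \<Longrightarrow> x \<in> qq j u \<Longrightarrow> x \<in> L 0"
  using L_cancel[OF L_mono, of x u j 0] by (simp add: qq)

lemma carrier_V: "carrier (V j) = qq j ` L 0"
  by (auto simp: res_lattice_def A_RCOSETS_def' lattice_simps qq_def)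

lemma carrier_VE:
  assumes "A \<in> carrier (V j)"
  obtains u where "u \<in> L 0" "A = qq j u"
  using assms unfolding carrier_V by (rule imageE) (rule that)

lemma carrier_VI: "u \<in> L 0 \<Longrightarrow> qq j u \<in> carrier (V j)"
  unfolding carrier_V by (rule imageI)

lemma carrier_RR: "carrier (RR j) = pp j ` IF 0"
  using F.carrier_res_ring[of j] by (simp add: pp_def)

lemma V_add: "qq j u \<oplus>\<^bsub>V j\<^esub> qq j w = qq j (u + w)"
proof -
  have "qq j u \<oplus>\<^bsub>V j\<^esub> qq j w = (\<Union>h\<in>qq j u. \<Union>k\<in>qq j w. {h + k})"
    by (simp add: res_lattice_def set_add_def' lattice_simps)
  also have "\<dots> = qq j (u + w)"
  proof (intro equalityI subsetI)
    fix y assume "y \<in> (\<Union>h\<in>qq j u. \<Union>k\<in>qq j w. {h + k})"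
    then obtain h k where "h - u \<in> L j" "k - w \<in> L j" "y = h + k" by (auto simp: qq)
    then have "(h - u) + (k - w) \<in> L j" "y = h + k" by (auto intro: L_add)
    then show "y \<in> qq j (u + w)" by (simp add: qq algebra_simps)
  next
    fix y assume "y \<in> qq j (u + w)"
    then have "y - w \<in> qq j u" "y = (y - w) + w" by (simp_all add: qq algebra_simps)
    then show "y \<in> (\<Union>h\<in>qq j u. \<Union>k\<in>qq j w. {h + k})" using qq_self[of w j] by blast
  qed
  finally show ?thesis .
qed

lemma V_smult:
  assumes "c \<in> IF 0" "u \<in> L 0"
  shows "pp j c \<odot>\<^bsub>V j\<^esub> qq j u = qq j (sc c u)"
proof -
  have "pp j c \<odot>\<^bsub>V j\<^esub> qq j u = (\<Union>a\<in>pp j c. \<Union>w\<in>qq j u. qq j (sc a w))"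
    by (simp add: res_lattice_def lattice_simps qq_def)
  also have "\<dots> = qq j (sc c u)"
  proof (intro UN_const)
    fix a w assume a: "a \<in> pp j c" and w: "w \<in> qq j u"
    have "sc a w - sc c u = sc (a - c) w + sc c (w - u)" by (simp add: sc_diff)
    also have "\<dots> \<in> L j"
      using L_sc[of "a - c" j w 0] L_sc0[of c "w - u" j] a w assms qq_L[of u w j] by (intro L_add) (auto simp: pp qq)
    finally show "qq j (sc a w) = qq j (sc c u)" by (simp add: qq_eq)
  qed (use pp_self qq_self in blast)+
  finally show ?thesis .
qed

lemma RR_ops:
  assumes "c \<in> IF 0" "c' \<in> IF 0"
  shows "pp j c \<oplus>\<^bsub>RR j\<^esub> pp j c' = pp j (c + c')" "pp j c \<otimes>\<^bsub>RR j\<^esub> pp j c' = pp j (c * c')"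
    "\<one>\<^bsub>RR j\<^esub> = pp j 1" "\<zero>\<^bsub>RR j\<^esub> = pp j 0"
proof -
  show "\<one>\<^bsub>RR j\<^esub> = pp j 1" by (simp add: res_ring_def FactRing_def pp_def val_ring_def)
  show "\<zero>\<^bsub>RR j\<^esub> = pp j 0" by (simp add: res_ring_def FactRing_def pp)
  have "pp j c \<oplus>\<^bsub>RR j\<^esub> pp j c' = (\<Union>h\<in>pp j c. \<Union>k\<in>pp j c'. {h + k})"
    by (simp add: res_ring_def FactRing_def set_add_def' val_ring_def)
  also have "\<dots> = pp j (c + c')"
  proof (intro equalityI subsetI)
    fix y assume "y \<in> (\<Union>h\<in>pp j c. \<Union>k\<in>pp j c'. {h + k})"
    then obtain h k where "h - c \<in> IF j" "k - c' \<in> IF j" "y = h + k" by (auto simp: pp)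
    then have "(h - c) + (k - c') \<in> IF j" "y = h + k" by auto
    then show "y \<in> pp j (c + c')" by (simp add: pp algebra_simps)
  next
    fix y assume "y \<in> pp j (c + c')"
    then have "y - c' \<in> pp j c" "y = (y - c') + c'" by (simp_all add: pp algebra_simps)
    then show "y \<in> (\<Union>h\<in>pp j c. \<Union>k\<in>pp j c'. {h + k})" using pp_self[of c' j] by blast
  qed
  finally show "pp j c \<oplus>\<^bsub>RR j\<^esub> pp j c' = pp j (c + c')" .
  have "pp j c \<otimes>\<^bsub>RR j\<^esub> pp j c' = (\<Union>h\<in>pp j c. \<Union>k\<in>pp j c'. pp j (h * k))"
    by (simp add: res_ring_def FactRing_def rcoset_mult_def pp_def val_ring_def)
  also have "\<dots> = pp j (c * c')"
  proof (intro UN_const)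
    fix h k assume h: "h \<in> pp j c" and k: "k \<in> pp j c'"
    have "h * k - c * c' = (h - c) * k + c * (k - c')" by (simp add: algebra_simps)
    also have "\<dots> \<in> IF j"
      using h k assms pp_O[of c' k j] F.ideal_multR[of "h - c" j k] F.ideal_multL[of c "k - c'" j]
      by (intro F.ideal_add) (auto simp: pp)
    finally show "pp j (h * k) = pp j (c * c')" by (simp add: pp_eq)
  qed (use pp_self in blast)+
  finally show "pp j c \<otimes>\<^bsub>RR j\<^esub> pp j c' = pp j (c * c')" .
qed

lemma RR_units: "1 \<le> j \<Longrightarrow> Units (RR j) = pp j ` UF"
proof (intro equalityI subsetI)
  fix C assume j: "1 \<le> j" and "C \<in> Units (RR j)"
  then obtain x y where xy: "x \<in> IF 0" "y \<in> IF 0" "C = pp j x" "pp j x \<otimes>\<^bsub>RR j\<^esub> pp j y = \<one>\<^bsub>RR j\<^esub>"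
    by (auto simp: Units_def carrier_RR)
  then have "1 - x * y \<in> IF 1" using j F.ideal_mono[of "x * y - 1" j 1] F.ideal_uminus[of "1 - x * y" 1]
    by (simp add: RR_ops pp_eq)
  then have "x * y \<in> UF" using F.unit_cong[of 1 "x * y"] by simp
  then have "x \<notin> IF 1" using F.ideal_multR[of x 1 y] xy by (auto simp: F.unit_iff)
  then show "C \<in> pp j ` UF" using xy by (auto simp: F.unit_iff)
next
  fix C assume "C \<in> pp j ` UF"
  then obtain x where x: "x \<in> UF" "C = pp j x" by auto
  have i: "inverse x \<in> IF 0" "x \<in> IF 0" using F.unit_integral[OF x(1)] F.unit_integral[OF F.unit_inverse[OF x(1)]] by auto
  have "pp j (inverse x) \<otimes>\<^bsub>RR j\<^esub> pp j x = \<one>\<^bsub>RR j\<^esub>" "pp j x \<otimes>\<^bsub>RR j\<^esub> pp j (inverse x) = \<one>\<^bsub>RR j\<^esub>"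
    using i F.unit_nonzero[OF x(1)] by (simp_all add: RR_ops)
  then show "C \<in> Units (RR j)" unfolding Units_def carrier_RR using x i by auto
qed

lemma res_form:
  assumes "u \<in> L 0" "w \<in> L 0"
  shows "res_form D j (qq j u) (qq j w) = pp j (\<F> u w)"
proof -
  have "res_form D j (qq j u) (qq j w) = (\<Union>u'\<in>qq j u. \<Union>w'\<in>qq j w. pp j (\<F> u' w'))"
    by (simp add: res_form_def pp_def)
  also have "\<dots> = pp j (\<F> u w)"
  proof (intro UN_const)
    fix u' w' assume u': "u' \<in> qq j u" and w': "w' \<in> qq j w"
    have "\<F> u' w' - \<F> u w = \<F> (u' - u) w' + \<F> u (w' - w)" by (simp add: form_diff)
    also have "\<dots> \<in> IF j"
      using u' w' assms qq_L[of w w' j] form_ideal[of "u' - u" j w'] form_ideal'[of u "w' - w" j]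
      by (intro F.ideal_add) (auto simp: qq)
    finally show "pp j (\<F> u' w') = pp j (\<F> u w)" by (simp add: pp_eq)
  qed (use qq_self in blast)+
  finally show ?thesis .
qed

text \<open>\<open>\<Phi>_eq\<close>, \<open>rcomp_\<Phi>\<close> and \<open>module_end_V\<close>
  identify the endomorphisms over \<open>O / \<pp>^j\<close> with \<open>\<E>\<close> modulo
  \<open>\<I> j\<close>, so that computations with cosets become identities in a ring.\<close>

definition \<Phi> :: "nat \<Rightarrow> ('k \<times> 'f) aend \<Rightarrow> ('k \<times> 'f) set \<Rightarrow> ('k \<times> 'f) set" where
  "\<Phi> j X = red_int D j (app X)"

definition lat :: "('k \<times> 'f) aend \<Rightarrow> 'k \<times> 'f \<Rightarrow> 'k \<times> 'f" where
  "lat X = restrict (app X) (L 0)"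

lemma red_int_cong: "(\<And>u. u \<in> L 0 \<Longrightarrow> f u = g u) \<Longrightarrow> red_int D j f = red_int D j g"
  unfolding red_int_def
proof (rule restrict_ext)
  fix C assume *: "\<And>u. u \<in> L 0 \<Longrightarrow> f u = g u" and "C \<in> carrier (V j)"
  then obtain u where u: "u \<in> L 0" "C = qq j u" by (elim carrier_VE)
  show "(\<Union>u\<in>C. L j +>\<^bsub>lattice D\<^esub> f u) = (\<Union>u\<in>C. L j +>\<^bsub>lattice D\<^esub> g u)"
    by (rule SUP_cong) (use u * qq_L in simp_all)
qed

lemma red_int_lat: "red_int D j (lat X) = \<Phi> j X"
  unfolding \<Phi>_def by (rule red_int_cong) (simp add: lat_def)

lemma \<Phi>_qq:
  assumes "X \<in> \<E>" "u \<in> L 0"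
  shows "\<Phi> j X (qq j u) = qq j (app X u)"
proof -
  have "\<Phi> j X (qq j u) = (\<Union>w\<in>qq j u. qq j (app X w))"
    using assms by (simp add: \<Phi>_def red_int_def carrier_V qq_def[symmetric])
  also have "\<dots> = qq j (app X u)"
  proof (intro UN_const)
    fix w assume "w \<in> qq j u"
    then have "app X (w - u) \<in> L j" using \<E>_L[OF assms(1)] by (simp add: qq)
    then show "qq j (app X w) = qq j (app X u)" by (simp add: qq_eq app_diff)
  qed (use qq_self in blast)
  finally show ?thesis .
qed

lemma \<Phi>_ext: "\<Phi> j X \<in> extensional (carrier (V j))"
  by (simp add: \<Phi>_def red_int_def)

lemma extensional_eqI:
  assumes "f \<in> extensional (carrier (V j))" "g \<in> extensional (carrier (V j))"
    "\<And>u. u \<in> L 0 \<Longrightarrow> f (qq j u) = g (qq j u)"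
  shows "f = g"
  using assms by (intro extensionalityI[of f "carrier (V j)" g]) (auto simp: carrier_V)

lemma \<Phi>_eq: "X \<in> \<E> \<Longrightarrow> Y \<in> \<E> \<Longrightarrow> \<Phi> j X = \<Phi> j Y \<longleftrightarrow> X - Y \<in> \<I> j"
proof
  assume X: "X \<in> \<E>" and Y: "Y \<in> \<E>" and e: "\<Phi> j X = \<Phi> j Y"
  have "app (X - Y) u \<in> L j" if u: "u \<in> L 0" for u
    using \<Phi>_qq[OF X u, of j] \<Phi>_qq[OF Y u, of j] e qq_eq[of j "app X u" "app Y u"] by simp
  then show "X - Y \<in> \<I> j" using \<E>_closed(4)[OF X Y] by (simp add: \<I>_def \<E>_def)
next
  assume X: "X \<in> \<E>" and Y: "Y \<in> \<E>" and d: "X - Y \<in> \<I> j"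
  have "app X u - app Y u \<in> L j" if "u \<in> L 0" for u using \<I>D(2)[OF d that] by simp
  then show "\<Phi> j X = \<Phi> j Y" by (intro extensional_eqI[OF \<Phi>_ext \<Phi>_ext]) (simp add: \<Phi>_qq[OF X] \<Phi>_qq[OF Y] qq_eq)
qed

lemma \<Phi>_V: "X \<in> \<E> \<Longrightarrow> \<Phi> j X \<in> carrier (V j) \<rightarrow> carrier (V j)"
  by (auto simp: carrier_V \<Phi>_qq \<E>D)

lemma rcomp_\<Phi>: "X \<in> \<E> \<Longrightarrow> Y \<in> \<E> \<Longrightarrow> rcomp (V j) (\<Phi> j X) (\<Phi> j Y) = \<Phi> j (X * Y)"
  by (rule extensional_eqI)
    (use \<Phi>_ext in \<open>auto simp: rcomp_def compose_def carrier_VI \<Phi>_qq \<E>_closed \<E>D\<close>)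

lemma \<Phi>_one: "\<Phi> j 1 = (\<lambda>u\<in>carrier (V j). u)"
  by (rule extensional_eqI[of _ j]) (use \<Phi>_ext in \<open>auto simp: carrier_VI \<Phi>_qq \<E>_closed\<close>)

text \<open>The images of the basis vectors are lifted and extended linearly by \<open>mk\<close>;
  by linearity the result induces the given map on every coset.\<close>

lemma module_end_V: "module_end (RR j) (V j) = \<Phi> j ` \<E>"
proof (intro equalityI subsetI)
  fix f assume "f \<in> \<Phi> j ` \<E>"
  then obtain X where X: "X \<in> \<E>" "f = \<Phi> j X" by auto
  show "f \<in> module_end (RR j) (V j)"
    unfolding module_end_def LinearCombinations.module_hom_def X(2)
  proof (intro IntI CollectI conjI allI impI \<Phi>_V[OF X(1)] \<Phi>_ext; elim conjE)
    fix A B assume "A \<in> carrier (V j)" "B \<in> carrier (V j)"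
    then obtain u w where "u \<in> L 0" "A = qq j u" "w \<in> L 0" "B = qq j w" by (elim carrier_VE)
    then show "\<Phi> j X (A \<oplus>\<^bsub>V j\<^esub> B) = \<Phi> j X A \<oplus>\<^bsub>V j\<^esub> \<Phi> j X B"
      by (simp add: V_add \<Phi>_qq[OF X(1)] app_add L_add)
  next
    fix C A assume "C \<in> carrier (RR j)" and A: "A \<in> carrier (V j)"
    then obtain c where "c \<in> IF 0" "C = pp j c" by (auto simp: carrier_RR)
    moreover obtain u where "u \<in> L 0" "A = qq j u" using A by (rule carrier_VE)
    ultimately show "\<Phi> j X (C \<odot>\<^bsub>V j\<^esub> A) = C \<odot>\<^bsub>V j\<^esub> \<Phi> j X A"
      by (simp add: V_smult \<Phi>_qq[OF X(1)] \<E>D[OF X(1)] L_sc0)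
  qed
next
  fix f assume f: "f \<in> module_end (RR j) (V j)"
  have fV: "f C \<in> carrier (V j)" if "C \<in> carrier (V j)" for C
    using f that by (auto simp: module_end_def LinearCombinations.module_hom_def)
  have fa: "f (qq j (u + w)) = f (qq j u) \<oplus>\<^bsub>V j\<^esub> f (qq j w)" if "u \<in> L 0" "w \<in> L 0" for u w
    using f that by (auto simp: module_end_def LinearCombinations.module_hom_def carrier_V V_add[symmetric])
  have fs: "f (qq j (sc c u)) = pp j c \<odot>\<^bsub>V j\<^esub> f (qq j u)" if "c \<in> IF 0" "u \<in> L 0" for u c
    using f that by (auto simp: module_end_def LinearCombinations.module_hom_def carrier_V carrier_RR V_smult[symmetric])
  have "\<exists>y. y \<in> L 0 \<and> f (qq j (bas i)) = qq j y" for i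
    using fV[of "qq j (bas i)"] bas_L by (auto simp: carrier_V)
  then obtain y where y: "\<And>i. y i \<in> L 0" "\<And>i. f (qq j (bas i)) = qq j (y i)" by metis
  have f0: "f (qq j 0) = qq j 0"
  proof -
    obtain w where w: "w \<in> L 0" "f (qq j 0) = qq j w" using fV[of "qq j 0"] by (auto simp: carrier_V)
    have "f (qq j (sc 0 0)) = pp j 0 \<odot>\<^bsub>V j\<^esub> qq j w" using fs[of 0 0] w by simp
    then show ?thesis using w by (simp add: V_smult)
  qed
  have part: "f (qq j (\<Sum>i<k. sc (c i) (bas i))) = qq j (\<Sum>i<k. sc (c i) (y i))" if "\<And>i. c i \<in> IF 0" for k :: nat and c
  proof (induction k)
    case (Suc k)
    have "f (qq j (sc (c k) (bas k))) = qq j (sc (c k) (y k))"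
      using fs[OF that bas_L] y V_smult[OF that] by simp
    then show ?case
      using fa[of "\<Sum>i<k. sc (c i) (bas i)" "sc (c k) (bas k)"] Suc that bas_L y
      by (simp add: V_add L_sum L_sc0)
  qed (simp add: f0)
  have E: "mk y \<in> \<E>" using mk_E[of y 0] y by (simp add: \<E>_0)
  have "f = \<Phi> j (mk y)"
  proof (rule extensional_eqI)
    fix u assume u: "u \<in> L 0"
    have "f (qq j u) = f (qq j (\<Sum>i<n. sc (cf i u) (bas i)))" by (simp only: expand)
    also have "\<dots> = qq j (\<Sum>i<n. sc (cf i u) (y i))" by (rule part) (rule cf_ideal[OF u])
    finally show "f (qq j u) = \<Phi> j (mk y) (qq j u)" by (simp only: \<Phi>_qq[OF E u] app_mk)
  qed (use f \<Phi>_ext in \<open>auto simp: module_end_def\<close>)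
  then show "f \<in> \<Phi> j ` \<E>" using E by blast
qed

lemma module_end_lat: "module_end (O_F D) (lattice D) = lat ` \<E>"
proof (intro equalityI subsetI)
  fix f assume "f \<in> lat ` \<E>"
  then obtain X where X: "X \<in> \<E>" "f = lat X" by auto
  then show "f \<in> module_end (O_F D) (lattice D)"
    by (auto simp: module_end_def LinearCombinations.module_hom_def lattice_simps carrier_O lat_def \<E>D app_add L_add L_sc0)
next
  fix f assume f: "f \<in> module_end (O_F D) (lattice D)"
  have fV: "f u \<in> L 0" if "u \<in> L 0" for u
    using f that by (auto simp: module_end_def LinearCombinations.module_hom_def lattice_simps)
  have fa: "f (u + w) = f u + f w" if "u \<in> L 0" "w \<in> L 0" for u w
    using f that by (auto simp: module_end_def LinearCombinations.module_hom_def lattice_simps)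
  have fs: "f (sc c u) = sc c (f u)" if "c \<in> IF 0" "u \<in> L 0" for u c
    using f that by (auto simp: module_end_def LinearCombinations.module_hom_def lattice_simps carrier_O)
  have f0: "f 0 = 0" using fs[of 0 0] by simp
  have part: "f (\<Sum>i<k. sc (c i) (bas i)) = (\<Sum>i<k. sc (c i) (f (bas i)))" if "\<And>i. c i \<in> IF 0" for k :: nat and c
    by (induction k) (use that bas_L in \<open>auto simp: f0 fa fs L_sum L_sc0\<close>)
  have E: "mk (\<lambda>i. f (bas i)) \<in> \<E>" using mk_E[of "\<lambda>i. f (bas i)" 0] fV bas_L by (simp add: \<E>_0)
  have "f = lat (mk (\<lambda>i. f (bas i)))"
  proof (rule extensionalityI)
    fix u assume u: "u \<in> L 0"
    have "f u = f (\<Sum>i<n. sc (cf i u) (bas i))" by (simp only: expand)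
    also have "\<dots> = (\<Sum>i<n. sc (cf i u) (f (bas i)))" by (rule part) (rule cf_ideal[OF u])
    finally show "f u = lat (mk (\<lambda>i. f (bas i))) u" using u by (simp only: lat_def restrict_apply' app_mk)
  qed (use f in \<open>auto simp: module_end_def lattice_simps lat_def\<close>)
  then show "f \<in> lat ` \<E>" using E by blast
qed

text \<open>A lift satisfies the similitude equation only modulo \<open>\<pp>^j\<close>; by
  \<open>GO_mem\<close> such lifts represent the elements of \<open>GO D j\<close> for positive
  \<open>j\<close>.\<close>

definition sim :: "nat \<Rightarrow> ('k \<times> 'f) aend \<Rightarrow> 'f \<Rightarrow> bool" where
  "sim j X \<nu> \<longleftrightarrow> X \<in> \<E> \<and> \<nu> \<in> UF \<and> (\<forall>u\<in>L 0. \<forall>w\<in>L 0. \<F> (app X u) (app X w) - \<nu> * \<F> u w \<in> IF j)"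

definition lie :: "nat \<Rightarrow> ('k \<times> 'f) aend \<Rightarrow> 'f \<Rightarrow> bool" where
  "lie j X \<nu> \<longleftrightarrow> X \<in> \<E> \<and> \<nu> \<in> IF 0 \<and>
    (\<forall>u\<in>L 0. \<forall>w\<in>L 0. \<F> (app X u) w + \<F> u (app X w) - \<nu> * \<F> u w \<in> IF j)"

text \<open>A residue modulo \<open>\<pp>^(j+1)\<close> is determined by its residue modulo
  \<open>\<pp>^j\<close> and one further digit in the residue field.\<close>

lemma finite_RR: "finite (carrier (RR j))"
proof (induction j)
  case 0
  have "pp 0 x = pp 0 0" if "x \<in> IF 0" for x using that by (simp only: pp_eq diff_0_right)
  then have "pp 0 ` IF 0 \<subseteq> {pp 0 0}" by blast
  then show ?case unfolding carrier_RR by (rule finite_subset) simp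
next
  case (Suc j)
  let ?f = "\<lambda>(C, E). pp (Suc j) ((SOME x. x \<in> IF 0 \<and> C = pp j x) + \<omega> ^ j * (SOME x. x \<in> IF 0 \<and> E = pp 1 x))"
  have "pp (Suc j) x \<in> ?f ` (carrier (RR j) \<times> carrier (RR 1))" if x: "x \<in> IF 0" for x
  proof -
    define y where "y = (SOME y. y \<in> IF 0 \<and> pp j x = pp j y)"
    have y: "y \<in> IF 0 \<and> pp j x = pp j y" unfolding y_def by (rule someI[of _ x]) (use x in simp)
    then obtain z where z: "z \<in> IF 0" "x - y = \<omega> ^ j * z" by (auto simp: pp_eq elim: F.idealE)
    define t where "t = (SOME t. t \<in> IF 0 \<and> pp 1 z = pp 1 t)"
    have t: "t \<in> IF 0 \<and> pp 1 z = pp 1 t" unfolding t_def by (rule someI[of _ z]) (use z in simp)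
    have "x - (y + \<omega> ^ j * t) = \<omega> ^ j * (z - t)" using z by (simp add: algebra_simps)
    also have "\<dots> \<in> IF (j + 1)" using t by (simp only: F.ideal_shift pp_eq)
    finally have "pp (Suc j) x = ?f (pp j x, pp 1 z)" by (simp add: pp_eq y_def t_def)
    then show ?thesis using x z by (intro image_eqI[of _ _ "(pp j x, pp 1 z)"]) (auto simp: carrier_RR)
  qed
  then have "carrier (RR (Suc j)) \<subseteq> ?f ` (carrier (RR j) \<times> carrier (RR 1))" by (auto simp: carrier_RR)
  moreover have "finite (carrier (RR 1))" by (rule F.finite_residue)
  ultimately show ?case using Suc by (meson finite_SigmaI finite_imageI finite_subset)
qed

lemma finite_V: "finite (carrier (V j))"
proof -
  let ?f = "\<lambda>c. qq j (\<Sum>i<n. sc (SOME x. x \<in> IF 0 \<and> c i = pp j x) (bas i))"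
  have "qq j u \<in> ?f ` ({..<n} \<rightarrow>\<^sub>E carrier (RR j))" if u: "u \<in> L 0" for u
  proof -
    let ?x = "\<lambda>i. SOME x. x \<in> IF 0 \<and> pp j (cf i u) = pp j x"
    have x: "?x i \<in> IF 0 \<and> pp j (cf i u) = pp j (?x i)" for i
      by (rule someI[of _ "cf i u"]) (use cf_ideal[OF u] in simp)
    define c where "c = (\<lambda>i\<in>{..<n}. pp j (cf i u))"
    have "u - (\<Sum>i<n. sc (?x i) (bas i)) = (\<Sum>i<n. sc (cf i u - ?x i) (bas i))"
      unfolding sc_diff sum_subtractf expand by simp
    also have "\<dots> \<in> L j"
    proof (rule L_sum)
      fix i
      have "cf i u - ?x i \<in> IF j" using x[of i] by (simp only: pp_eq)
      then show "sc (cf i u - ?x i) (bas i) \<in> L j" using L_sc[of _ j "bas i" 0] bas_L by simp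
    qed
    finally have "qq j u = qq j (\<Sum>i<n. sc (?x i) (bas i))" by (simp only: qq_eq)
    also have "(\<Sum>i<n. sc (?x i) (bas i)) = (\<Sum>i<n. sc (SOME x. x \<in> IF 0 \<and> c i = pp j x) (bas i))"
      by (rule sum.cong[OF refl]) (simp add: c_def)
    finally show ?thesis using cf_ideal[OF u] by (intro image_eqI[of _ _ c]) (auto simp: c_def carrier_RR)
  qed
  then have "carrier (V j) \<subseteq> ?f ` ({..<n} \<rightarrow>\<^sub>E carrier (RR j))" by (auto simp: carrier_V)
  then show ?thesis by (rule finite_subset) (intro finite_imageI finite_PiE finite_RR finite_lessThan)
qed

text \<open>Bijectivity is the point: a vector whose image vanishes modulo \<open>\<pp>^j\<close> is
  orthogonal to the lattice there, hence zero by nondegeneracy, and an injective map of a finite set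
  to itself is bijective.\<close>

lemma GO_mem:
  assumes j: "1 \<le> j" and X: "X \<in> \<E>"
  shows "\<Phi> j X \<in> carrier (GO D j) \<longleftrightarrow> (\<exists>\<nu>. sim j X \<nu>)"
proof
  assume "\<Phi> j X \<in> carrier (GO D j)"
  then obtain C where C: "C \<in> Units (RR j)" "\<And>u w. u \<in> carrier (V j) \<Longrightarrow> w \<in> carrier (V j) \<Longrightarrow>
      res_form D j (\<Phi> j X u) (\<Phi> j X w) = C \<otimes>\<^bsub>RR j\<^esub> res_form D j u w"
    by (auto simp: GO_def similitude_group_def)
  obtain \<nu> where \<nu>: "\<nu> \<in> UF" "C = pp j \<nu>" using C(1) RR_units[OF j] by auto
  have "\<F> (app X u) (app X w) - \<nu> * \<F> u w \<in> IF j" if "u \<in> L 0" "w \<in> L 0" for u w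
  proof -
    have "res_form D j (\<Phi> j X (qq j u)) (\<Phi> j X (qq j w)) = pp j \<nu> \<otimes>\<^bsub>RR j\<^esub> res_form D j (qq j u) (qq j w)"
      using C(2)[of "qq j u" "qq j w"] that by (simp add: carrier_V \<nu>)
    then show ?thesis
      using that F.unit_integral[OF \<nu>(1)] form_ideal[OF that] \<E>D(2)[OF X]
      by (simp add: \<Phi>_qq[OF X] res_form RR_ops pp_eq)
  qed
  then show "\<exists>\<nu>. sim j X \<nu>" using \<nu> X by (auto simp: sim_def)
next
  assume "\<exists>\<nu>. sim j X \<nu>"
  then obtain \<nu> where \<nu>: "\<nu> \<in> UF" "\<And>u w. u \<in> L 0 \<Longrightarrow> w \<in> L 0 \<Longrightarrow> \<F> (app X u) (app X w) - \<nu> * \<F> u w \<in> IF j"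
    by (auto simp: sim_def)
  have "inj_on (\<Phi> j X) (carrier (V j))"
  proof (rule inj_onI)
    fix A B assume AB: "A \<in> carrier (V j)" "B \<in> carrier (V j)" and e: "\<Phi> j X A = \<Phi> j X B"
    obtain u w where uw: "u \<in> L 0" "A = qq j u" "w \<in> L 0" "B = qq j w" using AB by (elim carrier_VE)
    have d: "app X (u - w) \<in> L j" "u - w \<in> L 0" using e uw L_diff by (auto simp: \<Phi>_qq[OF X] qq_eq app_diff)
    have "u - w \<in> L j"
    proof (rule form_nondeg)
      fix z assume z: "z \<in> L 0"
      have "\<F> (app X (u - w)) (app X z) \<in> IF j" using d(1) \<E>D(2)[OF X z] by (rule form_ideal)
      then have "\<nu> * \<F> (u - w) z \<in> IF j" using F.ideal_cancel[OF \<nu>(2)[OF d(2) z]] by simp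
      then show "\<F> (u - w) z \<in> IF j" by (simp only: F.unit_mult_iff[OF \<nu>(1)])
    qed
    then show "A = B" by (simp add: uw qq_eq)
  qed
  then have "bij_betw (\<Phi> j X) (carrier (V j)) (carrier (V j))"
    using endo_inj_surj[OF finite_V] \<Phi>_V[OF X] by (simp add: bij_betw_def image_subset_iff Pi_iff)
  moreover have "\<Phi> j X \<in> module_end (RR j) (V j)" using X module_end_V by auto
  moreover have "pp j \<nu> \<in> Units (RR j)" using RR_units[OF j] \<nu> by auto
  moreover have "res_form D j (\<Phi> j X A) (\<Phi> j X B) = pp j \<nu> \<otimes>\<^bsub>RR j\<^esub> res_form D j A B"
    if "A \<in> carrier (V j)" "B \<in> carrier (V j)" for A B
  proof -
    from that obtain u w where uw: "u \<in> L 0" "A = qq j u" "w \<in> L 0" "B = qq j w" by (elim carrier_VE)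
    then show ?thesis
      using \<nu>(2)[OF uw(1,3)] F.unit_integral[OF \<nu>(1)] form_ideal[OF uw(1,3)] \<E>D(2)[OF X]
      by (simp add: \<Phi>_qq[OF X] res_form RR_ops pp_eq)
  qed
  ultimately show "\<Phi> j X \<in> carrier (GO D j)" unfolding GO_def similitude_group_def by auto
qed

lemma GO_E:
  assumes "1 \<le> j" "g \<in> carrier (GO D j)"
  obtains X \<nu> where "X \<in> \<E>" "sim j X \<nu>" "g = \<Phi> j X"
proof -
  have "g \<in> module_end (RR j) (V j)" using assms by (auto simp: GO_def similitude_group_def)
  then obtain X where X: "X \<in> \<E>" "g = \<Phi> j X" using module_end_V by auto
  then show thesis using that GO_mem[OF assms(1) X(1)] assms(2) by blast
qed

lemma GO_mult: "g \<otimes>\<^bsub>GO D j\<^esub> h = rcomp (V j) g h" and GO_one: "\<one>\<^bsub>GO D j\<^esub> = \<Phi> j 1"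
  by (simp_all add: GO_def similitude_group_def \<Phi>_one)

lemma sim_mult:
  assumes X: "sim j X \<nu>" and Y: "sim j Y \<nu>'"
  shows "sim j (X * Y) (\<nu> * \<nu>')"
proof -
  have E: "X \<in> \<E>" "Y \<in> \<E>" "\<nu> \<in> UF" "\<nu>' \<in> UF" using X Y by (auto simp: sim_def)
  have "\<F> (app Y (app X u)) (app Y (app X w)) - \<nu> * \<nu>' * \<F> u w \<in> IF j" if uw: "u \<in> L 0" "w \<in> L 0" for u w
  proof -
    have "\<F> (app Y (app X u)) (app Y (app X w)) - \<nu>' * \<F> (app X u) (app X w) \<in> IF j"
      using Y uw E by (auto simp: sim_def \<E>D)
    moreover have "\<nu>' * (\<F> (app X u) (app X w) - \<nu> * \<F> u w) \<in> IF j"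
      using X uw F.unit_integral[OF E(4)] by (intro F.ideal_multL) (auto simp: sim_def)
    ultimately have "(\<F> (app Y (app X u)) (app Y (app X w)) - \<nu>' * \<F> (app X u) (app X w)) +
        \<nu>' * (\<F> (app X u) (app X w) - \<nu> * \<F> u w) \<in> IF j" by (rule F.ideal_add)
    then show ?thesis by (simp add: algebra_simps)
  qed
  then show ?thesis using E by (auto simp: sim_def \<E>_closed F.unit_mult)
qed

lemma sim_one: "sim j 1 1" by (auto simp: sim_def \<E>_closed)

text \<open>The inverse of a similitude is its adjoint divided by the multiplier. One product is the
  identity by nondegeneracy, the other because \<open>X\<close> is surjective modulo
  \<open>\<pp>^j\<close>.\<close>

lemma GO_inverse:
  assumes j: "1 \<le> j" and X: "sim j X \<nu>"
  obtains Y where "sim j Y (inverse \<nu>)" "X * Y - 1 \<in> \<I> j" "Y * X - 1 \<in> \<I> j"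
proof -
  have E: "X \<in> \<E>" and \<nu>: "\<nu> \<in> UF" using X by (auto simp: sim_def)
  obtain X' where X': "X' \<in> \<E>" "\<And>u w. \<F> (app X u) w = \<F> u (app X' w)" using adjoint_exists[OF E] by blast
  define Y where "Y = sm (inverse \<nu>) X'"
  have i: "inverse \<nu> \<in> UF" "inverse \<nu> \<in> IF 0" using F.unit_inverse[OF \<nu>] F.unit_integral[OF F.unit_inverse[OF \<nu>]] by auto
  have \<nu>0: "\<nu> \<noteq> 0" using F.unit_nonzero[OF \<nu>] .
  have YE: "Y \<in> \<E>" using X' i by (simp add: Y_def \<E>_closed)
  have XY: "app (X * Y) w - w \<in> L j" if w: "w \<in> L 0" for w
  proof (rule form_nondeg')
    fix u assume u: "u \<in> L 0"
    have "\<F> u (app (X * Y) w - w) = inverse \<nu> * (\<F> (app X u) (app X w) - \<nu> * \<F> u w)"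
      using \<nu>0 by (simp add: Y_def form_diff form_sc X'(2)[symmetric] algebra_simps)
    also have "\<dots> \<in> IF j" using X u w i by (intro F.ideal_multL) (auto simp: sim_def)
    finally show "\<F> u (app (X * Y) w - w) \<in> IF j" .
  qed
  then have 1: "X * Y - 1 \<in> \<I> j" using YE E by (auto simp: \<I>_def \<E>D sc_diff)
  have gX: "\<Phi> j X \<in> carrier (GO D j)" using GO_mem[OF j E] X by auto
  have YX: "app (Y * X) w - w \<in> L j" if w: "w \<in> L 0" for w
  proof -
    have "qq j w \<in> \<Phi> j X ` carrier (V j)"
      using gX w by (auto simp: GO_def similitude_group_def bij_betw_def carrier_V)
    then obtain u where u: "u \<in> L 0" "qq j w = qq j (app X u)" by (auto simp: carrier_V \<Phi>_qq[OF E])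
    have a: "w - app X u \<in> L j" using u by (simp only: qq_eq)
    then have "app (Y * X) (w - app X u) \<in> L j" using YE E by (intro \<E>_L \<E>_closed) auto
    moreover have "app X (app (X * Y) u - u) \<in> L j" using XY[OF u(1)] E by (intro \<E>_L) auto
    ultimately have "app (Y * X) (w - app X u) + app X (app (X * Y) u - u) \<in> L j" by (rule L_add)
    then have "app (Y * X) (w - app X u) + app X (app (X * Y) u - u) - (w - app X u) \<in> L j"
      using a by (rule L_diff)
    then show ?thesis by (simp add: app_diff)
  qed
  then have 2: "Y * X - 1 \<in> \<I> j" using YE E by (auto simp: \<I>_def \<E>D sc_diff)
  have "\<F> (app Y u) (app Y w) - inverse \<nu> * \<F> u w \<in> IF j" if uw: "u \<in> L 0" "w \<in> L 0" for u w
  proof -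
    have Yuw: "app Y u \<in> L 0" "app Y w \<in> L 0" using YE uw by (auto simp: \<E>D)
    have 1: "\<F> (app X (app Y u)) (app X (app Y w)) - \<nu> * \<F> (app Y u) (app Y w) \<in> IF j"
      using X Yuw by (auto simp: sim_def)
    have 2: "\<F> (app X (app Y u)) (app X (app Y w)) - \<F> u w =
        \<F> (app (Y * X) u - u) (app (Y * X) w) + \<F> u (app (Y * X) w - w)" by (simp add: form_diff)
    have "\<F> (app (Y * X) u - u) (app (Y * X) w) + \<F> u (app (Y * X) w - w) \<in> IF j"
      using YX uw YE E by (intro F.ideal_add form_ideal form_ideal') (auto simp: \<E>D)
    then have "\<F> (app X (app Y u)) (app X (app Y w)) - \<F> u w \<in> IF j" by (simp only: 2)
    from F.ideal_multL[OF i(2) F.ideal_diff[OF this 1]]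
    have "inverse \<nu> * ((\<F> (app X (app Y u)) (app X (app Y w)) - \<F> u w) -
        (\<F> (app X (app Y u)) (app X (app Y w)) - \<nu> * \<F> (app Y u) (app Y w))) \<in> IF j" .
    moreover have "inverse \<nu> * ((\<F> (app X (app Y u)) (app X (app Y w)) - \<F> u w) -
        (\<F> (app X (app Y u)) (app X (app Y w)) - \<nu> * \<F> (app Y u) (app Y w))) =
        \<F> (app Y u) (app Y w) - inverse \<nu> * \<F> u w"
      using \<nu>0 by (simp add: field_simps)
    ultimately show ?thesis by simp
  qed
  then have "sim j Y (inverse \<nu>)" using YE i by (simp add: sim_def)
  then show thesis using that 1 2 by blast
qed

lemma GO_group:
  assumes j: "1 \<le> j"
  shows "group (GO D j)"
proof (rule groupI)
  fix x y assume xy: "x \<in> carrier (GO D j)" "y \<in> carrier (GO D j)"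
  obtain X \<nu> where X: "X \<in> \<E>" "sim j X \<nu>" "x = \<Phi> j X" using GO_E[OF j xy(1)] by blast
  obtain Y \<mu> where Y: "Y \<in> \<E>" "sim j Y \<mu>" "y = \<Phi> j Y" using GO_E[OF j xy(2)] by blast
  show "x \<otimes>\<^bsub>GO D j\<^esub> y \<in> carrier (GO D j)"
    using X Y sim_mult[OF X(2) Y(2)] GO_mem[OF j \<E>_closed(5)[OF X(1) Y(1)]]
    by (auto simp: GO_mult rcomp_\<Phi>)
next
  show "\<one>\<^bsub>GO D j\<^esub> \<in> carrier (GO D j)" using GO_mem[OF j \<E>_closed(2)] sim_one by (auto simp: GO_one)
next
  fix x y z assume xyz: "x \<in> carrier (GO D j)" "y \<in> carrier (GO D j)" "z \<in> carrier (GO D j)"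
  obtain X where X: "X \<in> \<E>" "x = \<Phi> j X" using GO_E[OF j xyz(1)] by blast
  obtain Y where Y: "Y \<in> \<E>" "y = \<Phi> j Y" using GO_E[OF j xyz(2)] by blast
  obtain Z where Z: "Z \<in> \<E>" "z = \<Phi> j Z" using GO_E[OF j xyz(3)] by blast
  show "x \<otimes>\<^bsub>GO D j\<^esub> y \<otimes>\<^bsub>GO D j\<^esub> z = x \<otimes>\<^bsub>GO D j\<^esub> (y \<otimes>\<^bsub>GO D j\<^esub> z)"
    using X Y Z by (simp add: GO_mult rcomp_\<Phi> \<E>_closed mult.assoc)
next
  fix x assume x: "x \<in> carrier (GO D j)"
  obtain X \<nu> where X: "X \<in> \<E>" "sim j X \<nu>" "x = \<Phi> j X" using GO_E[OF j x] by blast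
  show "\<one>\<^bsub>GO D j\<^esub> \<otimes>\<^bsub>GO D j\<^esub> x = x" using X by (simp add: GO_mult GO_one rcomp_\<Phi> \<E>_closed)
  obtain Y where Y: "sim j Y (inverse \<nu>)" "X * Y - 1 \<in> \<I> j" "Y * X - 1 \<in> \<I> j"
    using GO_inverse[OF j X(2)] by blast
  have YE: "Y \<in> \<E>" using Y by (simp add: sim_def)
  have "\<Phi> j Y \<in> carrier (GO D j)" using GO_mem[OF j YE] Y by auto
  moreover have "\<Phi> j Y \<otimes>\<^bsub>GO D j\<^esub> x = \<one>\<^bsub>GO D j\<^esub>"
    using X YE Y(3) by (simp add: GO_mult GO_one rcomp_\<Phi> \<Phi>_eq \<E>_closed)
  ultimately show "\<exists>y\<in>carrier (GO D j). y \<otimes>\<^bsub>GO D j\<^esub> x = \<one>\<^bsub>GO D j\<^esub>" by blast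
qed

lemma finite_GO: "finite (carrier (GO D j))"
proof -
  have "carrier (GO D j) \<subseteq> carrier (V j) \<rightarrow>\<^sub>E carrier (V j)"
    by (auto simp: GO_def similitude_group_def module_end_def LinearCombinations.module_hom_def PiE_def)
  then show ?thesis by (rule finite_subset) (intro finite_PiE finite_V)
qed

lemma GO_inv:
  assumes "1 \<le> j" "sim j X \<nu>" "Y \<in> \<E>" "Y * X - 1 \<in> \<I> j"
  shows "inv\<^bsub>GO D j\<^esub> (\<Phi> j X) = \<Phi> j Y"
proof -
  interpret group "GO D j" by (rule GO_group[OF assms(1)])
  have X: "X \<in> \<E>" using assms by (simp add: sim_def)
  obtain Z where Z: "sim j Z (inverse \<nu>)" "X * Z - 1 \<in> \<I> j" using GO_inverse[OF assms(1,2)] by blast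
  have ZE: "Z \<in> \<E>" using Z by (simp add: sim_def)
  have "Y * (X * Z - 1) - (Y * X - 1) * Z \<in> \<I> j"
    using \<I>_mult(2)[OF assms(3) Z(2)] \<I>_mult(1)[OF assms(4) ZE] by (rule \<I>_closed)
  then have "Z - Y \<in> \<I> j" by (simp add: algebra_simps)
  then have e: "\<Phi> j Z = \<Phi> j Y" using \<Phi>_eq[OF ZE assms(3)] by simp
  have gX: "\<Phi> j X \<in> carrier (GO D j)" using GO_mem[OF assms(1) X] assms by auto
  have gZ: "\<Phi> j Z \<in> carrier (GO D j)" using GO_mem[OF assms(1) ZE] Z by auto
  have "\<Phi> j Z \<otimes>\<^bsub>GO D j\<^esub> \<Phi> j X = \<one>\<^bsub>GO D j\<^esub>"
    unfolding e using X assms by (simp add: GO_mult GO_one rcomp_\<Phi> \<Phi>_eq \<E>_closed)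
  then show ?thesis using inv_equality[of "\<Phi> j Z" "\<Phi> j X"] gX gZ e by simp
qed

lemma red_\<Phi>:
  assumes X: "X \<in> \<E>" and j: "j \<le> r"
  shows "red D r j (\<Phi> r X) = \<Phi> j X"
proof (rule extensional_eqI)
  show "red D r j (\<Phi> r X) \<in> extensional (carrier (V j))" by (simp add: red_def)
  fix u assume u: "u \<in> L 0"
  have "red D r j (\<Phi> r X) (qq j u) = (\<Union>E\<in>{E \<in> carrier (V r). E \<subseteq> qq j u}. L j <+>\<^bsub>lattice D\<^esub> \<Phi> r X E)"
    using u by (simp add: red_def carrier_V)
  also have "\<dots> = qq j (app X u)"
  proof (rule UN_const)
    have "qq r u \<subseteq> qq j u" using j by (auto simp: qq intro: L_mono)
    then show "{E \<in> carrier (V r). E \<subseteq> qq j u} \<noteq> {}" using u by (auto simp: carrier_V)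
    fix E assume "E \<in> {E \<in> carrier (V r). E \<subseteq> qq j u}"
    then have "E \<in> carrier (V r)" and Eu: "E \<subseteq> qq j u" by auto
    then obtain w where w: "w \<in> L 0" "E = qq r w" by (elim carrier_VE)
    then have w3: "w \<in> qq j u" using Eu qq_self[of w r] by blast
    have "L j <+>\<^bsub>lattice D\<^esub> \<Phi> r X E = (\<Union>h\<in>L j. \<Union>k\<in>qq r (app X w). {h + k})"
      by (simp add: w \<Phi>_qq[OF X] set_add_def' lattice_simps)
    also have "\<dots> = qq j (app X w)"
    proof (intro equalityI subsetI)
      fix y assume "y \<in> (\<Union>h\<in>L j. \<Union>k\<in>qq r (app X w). {h + k})"
      then obtain h k where hk: "h \<in> L j" "k - app X w \<in> L r" "y = h + k" by (auto simp: qq)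
      then have "h + (k - app X w) \<in> L j" using j by (intro L_add) (auto intro: L_mono)
      then show "y \<in> qq j (app X w)" using hk by (simp add: qq algebra_simps)
    next
      fix y assume "y \<in> qq j (app X w)"
      then show "y \<in> (\<Union>h\<in>L j. \<Union>k\<in>qq r (app X w). {h + k})"
        using qq_self[of "app X w" r] by (intro UN_I[of "y - app X w"] UN_I[of "app X w"]) (auto simp: qq)
    qed
    also have "\<dots> = qq j (app X u)" using w3 \<E>_L[OF X, of "w - u" j] by (simp add: qq_eq app_diff) (simp add: qq)
    finally show "L j <+>\<^bsub>lattice D\<^esub> \<Phi> r X E = qq j (app X u)" .
  qed
  finally show "red D r j (\<Phi> r X) (qq j u) = \<Phi> j X (qq j u)" by (simp add: \<Phi>_qq[OF X u])
qed (rule \<Phi>_ext)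

lemma go_int_eq: "go_int D = lat ` {X. \<exists>\<nu>. X \<in> \<E> \<and> \<nu> \<in> IF 0 \<and>
    (\<forall>u\<in>L 0. \<forall>w\<in>L 0. \<F> (app X u) w + \<F> u (app X w) = \<nu> * \<F> u w)}"
proof -
  have *: "(\<F> (lat X u) w \<oplus>\<^bsub>O_F D\<^esub> \<F> u (lat X w) = \<nu> \<otimes>\<^bsub>O_F D\<^esub> \<F> u w) \<longleftrightarrow>
    \<F> (app X u) w + \<F> u (app X w) = \<nu> * \<F> u w" if "u \<in> L 0" "w \<in> L 0" for X u w \<nu>
    using that by (simp add: lat_def val_ring_def)
  show ?thesis
  proof (intro equalityI subsetI)
    fix f assume "f \<in> go_int D"
    then obtain X \<nu> where X: "X \<in> \<E>" "f = lat X" "\<nu> \<in> IF 0"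
      "\<And>u w. u \<in> L 0 \<Longrightarrow> w \<in> L 0 \<Longrightarrow> \<F> (f u) w \<oplus>\<^bsub>O_F D\<^esub> \<F> u (f w) = \<nu> \<otimes>\<^bsub>O_F D\<^esub> \<F> u w"
      unfolding go_int_def similitude_lie_def module_end_lat lattice_simps carrier_O by blast
    then have "\<forall>u\<in>L 0. \<forall>w\<in>L 0. \<F> (app X u) w + \<F> u (app X w) = \<nu> * \<F> u w" using * by blast
    then show "f \<in> lat ` {X. \<exists>\<nu>. X \<in> \<E> \<and> \<nu> \<in> IF 0 \<and>
      (\<forall>u\<in>L 0. \<forall>w\<in>L 0. \<F> (app X u) w + \<F> u (app X w) = \<nu> * \<F> u w)}" using X by blast
  next
    fix f assume "f \<in> lat ` {X. \<exists>\<nu>. X \<in> \<E> \<and> \<nu> \<in> IF 0 \<and>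
      (\<forall>u\<in>L 0. \<forall>w\<in>L 0. \<F> (app X u) w + \<F> u (app X w) = \<nu> * \<F> u w)}"
    then obtain X \<nu> where X: "X \<in> \<E>" "f = lat X" "\<nu> \<in> IF 0"
      "\<forall>u\<in>L 0. \<forall>w\<in>L 0. \<F> (app X u) w + \<F> u (app X w) = \<nu> * \<F> u w" by blast
    then have "\<forall>u\<in>L 0. \<forall>w\<in>L 0. \<F> (f u) w \<oplus>\<^bsub>O_F D\<^esub> \<F> u (f w) = \<nu> \<otimes>\<^bsub>O_F D\<^esub> \<F> u w" using * by blast
    then show "f \<in> go_int D"
      unfolding go_int_def similitude_lie_def module_end_lat lattice_simps carrier_O using X by blast
  qed
qed

lemma go_res_eq: "go_res D j = \<Phi> j ` {X. \<exists>\<nu>. lie j X \<nu>}"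
proof -
  have *: "(res_form D j (\<Phi> j X (qq j u)) (qq j w) \<oplus>\<^bsub>RR j\<^esub> res_form D j (qq j u) (\<Phi> j X (qq j w)) =
      pp j \<nu> \<otimes>\<^bsub>RR j\<^esub> res_form D j (qq j u) (qq j w)) \<longleftrightarrow>
    \<F> (app X u) w + \<F> u (app X w) - \<nu> * \<F> u w \<in> IF j"
    if "X \<in> \<E>" "u \<in> L 0" "w \<in> L 0" "\<nu> \<in> IF 0" for X u w \<nu>
    using that by (simp add: \<Phi>_qq res_form \<E>D RR_ops form_ideal pp_eq del: form.simps)
  show ?thesis
  proof (intro equalityI subsetI)
    fix f assume "f \<in> go_res D j"
    then obtain X C where X: "X \<in> \<E>" "f = \<Phi> j X" and C: "C \<in> carrier (RR j)"
      "\<And>A B. A \<in> carrier (V j) \<Longrightarrow> B \<in> carrier (V j) \<Longrightarrow>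
        res_form D j (f A) B \<oplus>\<^bsub>RR j\<^esub> res_form D j A (f B) = C \<otimes>\<^bsub>RR j\<^esub> res_form D j A B"
      unfolding go_res_def similitude_lie_def module_end_V by blast
    obtain \<nu> where \<nu>: "\<nu> \<in> IF 0" "C = pp j \<nu>" using C(1) by (auto simp: carrier_RR)
    have "lie j X \<nu>" unfolding lie_def
      using X \<nu> C(2) *[OF X(1) _ _ \<nu>(1)] by (auto simp: carrier_V simp del: form.simps)
    then show "f \<in> \<Phi> j ` {X. \<exists>\<nu>. lie j X \<nu>}" using X by auto
  next
    fix f assume "f \<in> \<Phi> j ` {X. \<exists>\<nu>. lie j X \<nu>}"
    then obtain X \<nu> where X: "lie j X \<nu>" "f = \<Phi> j X" by auto
    then have E: "X \<in> \<E>" "\<nu> \<in> IF 0" by (auto simp: lie_def)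
    have "res_form D j (f A) B \<oplus>\<^bsub>RR j\<^esub> res_form D j A (f B) = pp j \<nu> \<otimes>\<^bsub>RR j\<^esub> res_form D j A B"
      if AB: "A \<in> carrier (V j)" "B \<in> carrier (V j)" for A B
    proof -
      obtain u w where "u \<in> L 0" "w \<in> L 0" "A = qq j u" "B = qq j w" using AB by (auto simp: carrier_V)
      then show ?thesis using *[OF E(1) _ _ E(2)] X by (auto simp: lie_def simp del: form.simps)
    qed
    then show "f \<in> go_res D j"
      unfolding go_res_def similitude_lie_def module_end_V using X E by (auto simp: carrier_RR)
  qed
qed

lemma trace_form_eq:
  assumes "X \<in> \<E>" "Y \<in> \<E>"
  shows "trace_form D (lat X) (lat Y) = tr (X * Y)"
  unfolding trace_form_def tr_def
  by (rule LM.module_trace_eq)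
    (use assms in \<open>auto simp: rcomp_def compose_def lat_def lattice_simps \<E>D app_add\<close>)

lemma lat_ops: "X \<in> \<E> \<Longrightarrow> one_plus D j (lat X) = lat (1 + sm (\<omega> ^ j) X)"
  "X \<in> \<E> \<Longrightarrow> Y \<in> \<E> \<Longrightarrow> rcomp (lattice D) (lat X) (lat Y) = lat (X * Y)"
  by (auto simp: one_plus_def rcomp_def compose_def lat_def lattice_simps \<E>D fun_eq_iff)

end

section \<open>Centralizers and skew endomorphisms\<close>

context go_setting
begin

declare form.simps [simp del]

text \<open>Newton's iteration with the derivative frozen at its value 2 at the starting point 1.
  Each step improves the error by at least one power of the prime; all iterates are fixed by
  \<iota>, hence so is the limit.\<close>

lemma sqrt_one_unit:
  assumes j: "1 \<le> j" and u: "u - 1 \<in> IK j" "\<iota> u = u"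
  obtains \<delta> where "\<delta> - 1 \<in> IK j" "\<delta> * \<delta> = u" "\<iota> \<delta> = \<delta>"
proof -
  define d where "d = rec_nat (1 :: 'k) (\<lambda>_ x. x - (x * x - u) / 2)"
  have d: "d 0 = 1" "d (Suc k) = d k - (d k * d k - u) / 2" for k by (simp_all add: d_def)
  have inv: "d k - 1 \<in> IK j \<and> d k * d k - u \<in> IK (j + k) \<and> \<iota> (d k) = d k" for k
  proof (induction k)
    case 0
    have "- (u - 1) \<in> IK j" using u(1) by (simp only: K.ideal_uminus)
    then show ?case by (simp add: d)
  next
    case (Suc k)
    define t where "t = d k * d k - u"
    have t: "t \<in> IK (j + k)" using Suc by (simp add: t_def)
    have t2: "t / 2 \<in> IK (j + k)" using t two_unit_K by (rule K.unit_divide)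
    have 1: "d (Suc k) - 1 = (d k - 1) - t / 2" by (simp add: d t_def)
    have "t / 2 \<in> IK j" using t2 by (rule K.ideal_mono) simp
    then have "d (Suc k) - 1 \<in> IK j" unfolding 1 by (rule K.ideal_diff[rotated]) (use Suc in blast)
    moreover have "d (Suc k) * d (Suc k) - u \<in> IK (j + Suc k)"
    proof -
      define y where "y = t / 2"
      have ds: "d (Suc k) = d k - y" by (simp add: d t_def y_def)
      have "d (Suc k) * d (Suc k) - u = t - 2 * y * d k + y * y"
        unfolding ds t_def by (simp add: algebra_simps)
      then have "d (Suc k) * d (Suc k) - u = t - 2 * (t / 2) * d k + (t / 2) * (t / 2)" by (simp only: y_def)
      \<comment> \<open>The linear terms cancel up to \<open>t * (d k - 1)\<close>; this and the
        square of \<open>t / 2\<close> lie one level deeper because \<open>j\<close> is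
        positive.\<close>
      also have "\<dots> = t * - (d k - 1) + (t / 2) * (t / 2)" using two_nz_K by (simp add: algebra_simps)
      also have "\<dots> \<in> IK (j + Suc k)"
      proof (rule K.ideal_add)
        have "- (d k - 1) \<in> IK j" unfolding K.ideal_uminus using Suc by simp
        from K.ideal_mult[OF t this] show "t * - (d k - 1) \<in> IK (j + Suc k)" by (rule K.ideal_mono) (use j in simp)
        from K.ideal_mult[OF t2 t2] show "t / 2 * (t / 2) \<in> IK (j + Suc k)" by (rule K.ideal_mono) (use j in simp)
      qed
      finally show ?thesis .
    qed
    moreover have "\<iota> 2 = 2" using iot_e[of 2] by (simp add: e_two)
    then have "\<iota> (d (Suc k)) = d (Suc k)" using Suc u(2) by (simp add: d iot_diff iot_divide iot_mult)
    ultimately show ?case by blast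
  qed
  have inc: "- ((d k * d k - u) / 2) \<in> IK k" for k
    unfolding K.ideal_uminus using inv[of k] two_unit_K by (intro K.unit_divide) (auto intro: K.ideal_mono)
  have "\<exists>y. y \<in> IK 0 \<and> - ((d k * d k - u) / 2) = \<e> \<omega> ^ k * y" for k using K.idealE[OF inc[of k]] by metis
  then obtain y where y: "\<And>k. y k \<in> IK 0" "\<And>k. - ((d k * d k - u) / 2) = \<e> \<omega> ^ k * y k" by metis
  obtain Y where Y: "\<And>n. Y - (\<Sum>k<n. \<e> \<omega> ^ k * y k) \<in> IK n" using K_series[of y] y(1) by blast
  have dn: "d k = 1 + (\<Sum>i<k. \<e> \<omega> ^ i * y i)" for k
    by (induction k) (simp_all add: d y(2)[symmetric])
  define \<delta> where "\<delta> = 1 + Y"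
  have \<delta>: "\<delta> - d k \<in> IK k" for k using Y[of k] by (simp add: \<delta>_def dn)
  have "(\<delta> - d j) + (d j - 1) \<in> IK j" using \<delta>[of j] inv[of j] by (intro K.ideal_add) auto
  then have 1: "\<delta> - 1 \<in> IK j" by simp
  have di: "d k \<in> IK 0" for k
    using inv[of k] K.ideal_add[of "d k - 1" 0 1] K.ideal_mono[of "d k - 1" j 0] by simp
  have \<delta>i: "\<delta> \<in> IK 0" using K.ideal_add[of "\<delta> - 1" 0 1] K.ideal_mono[OF 1, of 0] by simp
  have "\<delta> * \<delta> - u \<in> IK k" for k
  proof -
    have "\<delta> * \<delta> - u = (\<delta> - d k) * (\<delta> + d k) + (d k * d k - u)" by (simp add: algebra_simps)
    also have "\<dots> \<in> IK k"
      by (rule K.ideal_add, rule K.ideal_multR[OF \<delta> K.ideal_add[OF \<delta>i di]])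
        (use inv[of k] in \<open>auto intro: K.ideal_mono\<close>)
    finally show ?thesis .
  qed
  then have 2: "\<delta> * \<delta> = u" using K.ideal_all[of "\<delta> * \<delta> - u"] by simp
  have "\<iota> \<delta> - \<delta> \<in> IK k" for k
  proof -
    have "\<iota> \<delta> - \<delta> = \<iota> (\<delta> - d k) - (\<delta> - d k)" using inv[of k] by (simp add: iot_diff)
    also have "\<dots> \<in> IK k" by (rule K.ideal_diff) (simp_all only: iot_ideal \<delta>)
    finally show ?thesis .
  qed
  then have 3: "\<iota> \<delta> = \<delta>" using K.ideal_all[of "\<iota> \<delta> - \<delta>"] by simp
  show thesis using that 1 2 3 by blast
qed

text \<open>Multiply \<gamma> by a square root \<delta> of
  \<open>\<e> (c ^ 2) / (\<gamma> * \<iota> \<gamma>)\<close>. This quotient is fixed by \<iota> and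
  congruent to 1, so \<delta> can be chosen fixed by \<iota>, and then it multiplies the norm by its
  square.\<close>

lemma norm_lift:
  assumes j: "1 \<le> j" and \<gamma>: "\<gamma> \<in> IK 0" and c: "c \<in> UF" and n: "\<gamma> * \<iota> \<gamma> - \<e> (c ^ 2) \<in> IK j"
  obtains \<gamma>' where "\<gamma>' - \<gamma> \<in> IK j" "\<gamma>' * \<iota> \<gamma>' = \<e> (c ^ 2)" "\<gamma>' \<in> UK"
proof -
  define N where "N = \<gamma> * \<iota> \<gamma>"
  have ec: "\<e> (c ^ 2) \<in> UK" using F.unit_mult[OF c c] by (simp add: power2_eq_square)
  have "N - \<e> (c ^ 2) \<in> IK 1" using n j by (auto simp: N_def intro: K.ideal_mono)
  then have "\<e> (c ^ 2) - N \<in> IK 1" using K.ideal_uminus[of "N - \<e> (c ^ 2)" 1] by simp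
  then have NU: "N \<in> UK" using K.unit_cong[OF ec] by simp
  then have N0: "N \<noteq> 0" by (rule K.unit_nonzero)
  have \<iota>N: "\<iota> N = N" by (simp add: N_def iot_mult iot_iot mult.commute)
  define u where "u = \<e> (c ^ 2) / N"
  have "u - 1 = - ((N - \<e> (c ^ 2)) / N)" using N0 by (simp add: u_def field_simps)
  also have "\<dots> \<in> IK j" unfolding K.ideal_uminus using n NU by (intro K.unit_divide) (simp_all add: N_def)
  finally have u: "u - 1 \<in> IK j" .
  have "\<iota> u = u" by (simp add: u_def iot_divide iot_e \<iota>N)
  then obtain \<delta> where \<delta>: "\<delta> - 1 \<in> IK j" "\<delta> * \<delta> = u" "\<iota> \<delta> = \<delta>" using sqrt_one_unit[OF j u] by blast
  have n': "(\<gamma> * \<delta>) * \<iota> (\<gamma> * \<delta>) = \<e> (c ^ 2)"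
  proof -
    have "(\<gamma> * \<delta>) * \<iota> (\<gamma> * \<delta>) = N * (\<delta> * \<delta>)" by (simp add: iot_mult \<delta>(3) N_def mult_ac)
    then show ?thesis using N0 by (simp add: \<delta>(2) u_def)
  qed
  have "\<gamma> * \<delta> - \<gamma> = \<gamma> * (\<delta> - 1)" by (simp add: algebra_simps)
  then have d: "\<gamma> * \<delta> - \<gamma> \<in> IK j" using K.ideal_multL[OF \<gamma> \<delta>(1)] by simp
  have i: "\<gamma> * \<delta> \<in> IK 0" using K.ideal_add[OF K.ideal_mono[OF d, of 0] \<gamma>] by simp
  have "\<gamma> * \<delta> \<in> UK"
  proof (rule ccontr)
    assume "\<gamma> * \<delta> \<notin> UK"
    then have "\<gamma> * \<delta> \<in> IK 1" using i by (simp add: K.unit_iff)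
    then have "\<e> (c ^ 2) \<in> IK 1" unfolding n'[symmetric] by (rule K.ideal_multR) (use i in \<open>simp only: iot_ideal\<close>)
    then show False using ec by (simp add: K.unit_iff)
  qed
  then show thesis using that n' d by blast
qed

section \<open>Block-diagonal endomorphisms and the commutant of \<beta>\<close>

definition dg :: "'k \<Rightarrow> 'f \<Rightarrow> ('k \<times> 'f) aend" where
  "dg \<gamma> c = Aend (\<lambda>u. (fst u * \<gamma>, snd u * c))"

lemma app_dg [simp]: "app (dg \<gamma> c) u = (fst u * \<gamma>, snd u * c)"
  unfolding dg_def by (subst app_Aend) (auto simp: algebra_simps)

lemma dg_E: "\<gamma> \<in> IK j \<Longrightarrow> c \<in> IF j \<Longrightarrow> dg \<gamma> c \<in> \<I> j"
  unfolding \<I>_def by (auto simp: sc_def mem_L intro!: K.ideal_multL F.ideal_multL)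

lemma dg_E0: "\<gamma> \<in> IK 0 \<Longrightarrow> c \<in> IF 0 \<Longrightarrow> dg \<gamma> c \<in> \<E>"
  unfolding \<E>_0 by (rule dg_E)

lemma dg_E_iff: "dg \<gamma> c \<in> \<I> j \<longleftrightarrow> \<gamma> \<in> IK j \<and> c \<in> IF j"
proof
  assume "dg \<gamma> c \<in> \<I> j"
  from \<I>D(2)[OF this, of "(1, 1)"] show "\<gamma> \<in> IK j \<and> c \<in> IF j" by (simp add: mem_L)
qed (auto intro: dg_E)

lemma dg_mult: "dg \<gamma> c * dg \<gamma>' c' = dg (\<gamma> * \<gamma>') (c * c')"
  by (rule aend_eqI) (simp add: mult.assoc)
lemma dg_one: "dg 1 1 = 1" by (rule aend_eqI) simp
lemma dg_diff: "dg \<gamma> c - dg \<gamma>' c' = dg (\<gamma> - \<gamma>') (c - c')"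
  by (rule aend_eqI) (simp add: algebra_simps)
lemma dg_sm: "sm x (dg \<gamma> c) = dg (\<e> x * \<gamma>) (x * c)"
  by (rule aend_eqI) (simp add: sc_def mult_ac)

lemma lat_dg: "lat (dg \<gamma> c) = diag D \<gamma> c"
  unfolding lat_def diag_def lattice_simps by (intro restrict_ext) auto

abbreviation "bt \<equiv> dg \<b> 0"

lemma bt_E: "bt \<in> \<E>" using \<beta>_integral[of 1] by (intro dg_E0) simp_all

lemma lat_bt: "lat bt = beta D"
  unfolding lat_def beta_def lattice_simps by (intro restrict_ext) auto

lemma form_bt: "\<F> (app bt u) w = - \<F> u (app bt w)"
proof -
  have 1: "eps D * fst (app bt u) * \<iota> (fst w) = eps D * (fst u * \<b>) * \<iota> (fst w)" by simp
  have 2: "eps D * fst u * \<iota> (fst (app bt w)) = - (eps D * (fst u * \<b>) * \<iota> (fst w))"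
    by (simp add: iot_mult iot_beta mult_ac)
  show ?thesis unfolding form_eq 1 2 Tr_uminus by simp
qed

lemma tr_dg_bt: "tr (dg x y * bt) = Tr (\<b> * x)"
proof -
  have "tr (dg x y * bt) = (\<Sum>i<s. coord i (\<b> ^ i * x * \<b>)) + 0"
    unfolding tr_def sum.lessThan_Suc by (simp add: cf_def bas_def)
  also have "\<dots> = Tr (\<b> * x)" by (simp add: Tr_def mult_ac)
  finally show ?thesis .
qed

lemma \<I>_bas:
  assumes Z: "Z \<in> \<E>" "\<And>i. i < n \<Longrightarrow> app Z (bas i) \<in> L j"
  shows "Z \<in> \<I> j"
  unfolding \<I>_def
proof (intro CollectI conjI ballI allI)
  show "app Z (sc c u) = sc c (app Z u)" for c u using \<E>D(1)[OF Z(1)] .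
  fix u assume u: "u \<in> L 0"
  show "app Z u \<in> L j"
    unfolding linear_expand[OF Z(1), of u] using Z(2) cf_ideal[OF u] by (intro L_sum L_sc0) auto
qed

text \<open>Modulo \<open>\<pp>^j\<close>, commuting with \<beta> forces the block on
  \<open>O_K\<close> to be multiplication by the image \<gamma> of 1. The mixed blocks vanish
  because \<beta> acts as a unit on one summand and as zero on the other.\<close>

lemma commutant:
  assumes X: "X \<in> \<E>" and C: "X * bt - bt * X \<in> \<I> j"
  obtains \<gamma> c where "\<gamma> \<in> IK 0" "c \<in> IF 0" "X - dg \<gamma> c \<in> \<I> j"
proof -
  define \<gamma> where "\<gamma> = fst (app X (1, 0))"
  define c where "c = snd (app X (0, 1))"
  have i: "\<gamma> \<in> IK 0" "c \<in> IF 0"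
    using \<E>D(2)[OF X, of "(1, 0)"] \<E>D(2)[OF X, of "(0, 1)"] by (simp_all add: mem_L \<gamma>_def c_def)
  have Cx: "fst (app X (x, 0)) * \<b> - fst (app X (x * \<b>, 0)) \<in> IK j" "snd (app X (x * \<b>, 0)) \<in> IF j" if "x \<in> IK 0" for x
    using \<I>D(2)[OF C, of "(x, 0)"] that by (simp_all add: mem_L)
  have C0: "fst (app X (0, 1)) \<in> IK j"
  proof -
    have "app X (0, 0) = 0" using app_zero[of X] by (simp add: zero_prod_def)
    then have "\<b> * fst (app X (0, 1)) \<in> IK j"
      using \<I>D(2)[OF C, of "(0, 1)"] by (simp add: mem_L mult.commute)
    then show ?thesis by (simp only: K.unit_mult_iff[OF \<beta>_unit])
  qed
  have b0: "\<b> \<noteq> 0" using K.unit_nonzero[OF \<beta>_unit] .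
  have bi: "inverse \<b> \<in> IK 0" using K.unit_integral[OF K.unit_inverse[OF \<beta>_unit]] .
  \<comment> \<open>Every integral \<open>x\<close> is \<beta> times an integral element, so the
    bound on multiples of \<beta> covers it.\<close>
  have S: "snd (app X (x, 0)) \<in> IF j" if "x \<in> IK 0" for x
    using Cx(2)[of "x * inverse \<b>"] K.ideal_multL[OF that bi] b0 by (simp add: mult.assoc)
  have P: "fst (app X (\<b> ^ k, 0)) - \<b> ^ k * \<gamma> \<in> IK j" for k
  proof (induction k)
    case (Suc k)
    have "\<b> * (fst (app X (\<b> ^ k, 0)) - \<b> ^ k * \<gamma>) \<in> IK j" using Suc \<beta>_integral[of 1] by (intro K.ideal_multL) simp_all
    from K.ideal_diff[OF this Cx(1)[OF \<beta>_integral[of k]]]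
    show ?case by (simp add: algebra_simps)
  qed (simp add: \<gamma>_def)
  have "X - dg \<gamma> c \<in> \<I> j"
  proof (rule \<I>_bas)
    show "X - dg \<gamma> c \<in> \<E>" using X i by (intro \<E>_closed dg_E0)
    fix k assume "k < n"
    show "app (X - dg \<gamma> c) (bas k) \<in> L j"
      using P[of k] S[OF \<beta>_integral[of k]] C0 by (auto simp: bas_def mem_L c_def)
  qed
  then show thesis using that i by blast
qed

lemma form_dg: "\<F> (app (dg \<gamma> c) u) (app (dg \<gamma> c) w) - \<nu> * \<F> u w =
  Tr (eps D * fst u * (\<gamma> * \<iota> \<gamma> - \<e> \<nu>) * \<iota> (fst w)) + (c * c - \<nu>) * (eta D * snd u * snd w)"
proof -
  have "eps D * fst u * (\<gamma> * \<iota> \<gamma> - \<e> \<nu>) * \<iota> (fst w) =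
    eps D * (fst u * \<gamma>) * \<iota> (fst w * \<gamma>) - \<e> \<nu> * (eps D * fst u * \<iota> (fst w))"
    by (simp add: iot_mult algebra_simps)
  then have "Tr (eps D * fst u * (\<gamma> * \<iota> \<gamma> - \<e> \<nu>) * \<iota> (fst w)) =
    Tr (eps D * (fst u * \<gamma>) * \<iota> (fst w * \<gamma>)) - \<nu> * Tr (eps D * fst u * \<iota> (fst w))"
    by (simp only: Tr_diff Tr_smult)
  then show ?thesis unfolding form_eq by (simp add: algebra_simps)
qed

lemma sim_dg:
  assumes "\<gamma> \<in> IK 0" "c \<in> UF" "\<gamma> * \<iota> \<gamma> - \<e> (c ^ 2) \<in> IK j"
  shows "sim j (dg \<gamma> c) (c ^ 2)"
  unfolding sim_def
proof (intro conjI ballI)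
  show "dg \<gamma> c \<in> \<E>" using assms F.unit_integral by (intro dg_E0) auto
  show "c ^ 2 \<in> UF" using F.unit_mult[OF assms(2,2)] by (simp add: power2_eq_square)
  fix u w assume uw: "u \<in> L 0" "w \<in> L 0"
  have "Tr (eps D * fst u * (\<gamma> * \<iota> \<gamma> - \<e> (c ^ 2)) * \<iota> (fst w)) \<in> IF j"
    using assms uw K.unit_integral[OF eps_unit]
    by (intro Tr_ideal K.ideal_multR[of _ j] K.ideal_multL[of _ _ j]) (auto simp: mem_L intro: K.ideal_multL)
  then show "\<F> (app (dg \<gamma> c) u) (app (dg \<gamma> c) w) - c ^ 2 * \<F> u w \<in> IF j"
    unfolding form_dg by (simp add: power2_eq_square)
qed

lemma form_cong:
  assumes "u - u' \<in> L j" "w - w' \<in> L j" "u \<in> L 0" "w' \<in> L 0"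
  shows "\<F> u w - \<F> u' w' \<in> IF j"
proof -
  have "\<F> u w - \<F> u' w' = \<F> u (w - w') + \<F> (u - u') w'" by (simp add: form_diff)
  then show ?thesis using form_ideal'[OF assms(3,2)] form_ideal[OF assms(1,4)] by auto
qed

lemma sim_cong:
  assumes "sim j X \<nu>" "Y \<in> \<E>" "X - Y \<in> \<I> j"
  shows "sim j Y \<nu>"
proof -
  have X: "X \<in> \<E>" using assms by (simp add: sim_def)
  have "\<F> (app Y u) (app Y w) - \<nu> * \<F> u w \<in> IF j" if "u \<in> L 0" "w \<in> L 0" for u w
  proof -
    have d: "app X u - app Y u \<in> L j" "app X w - app Y w \<in> L j" using \<I>D(2)[OF assms(3)] that by auto
    have 1: "\<F> (app X u) (app X w) - \<F> (app Y u) (app Y w) \<in> IF j"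
      using d that \<E>D(2)[OF X] \<E>D(2)[OF assms(2)] by (intro form_cong) auto
    have 2: "\<F> (app X u) (app X w) - \<nu> * \<F> u w \<in> IF j" using assms(1) that by (simp add: sim_def)
    from F.ideal_diff[OF 2 1] show ?thesis by simp
  qed
  then show ?thesis using assms by (simp add: sim_def)
qed

text \<open>The similitude equation on the two summands makes \<open>c * c\<close> and
  \<open>\<gamma> * \<iota> \<gamma>\<close> congruent to the multiplier. Then
  \<open>norm_lift\<close> changes \<gamma> within its class until the norm equation is exact, which
  yields an element centralizing \<beta> at every level.\<close>

lemma sim_centralizer:
  assumes j: "1 \<le> j" and X: "sim j X \<nu>" and C: "X * bt - bt * X \<in> \<I> j"
  obtains \<gamma> c where "\<gamma> \<in> UK" "c \<in> UF" "\<gamma> * \<iota> \<gamma> = \<e> (c ^ 2)" "X - dg \<gamma> c \<in> \<I> j"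
proof -
  have XE: "X \<in> \<E>" and \<nu>: "\<nu> \<in> UF" using X by (auto simp: sim_def)
  obtain \<gamma> c where \<gamma>: "\<gamma> \<in> IK 0" "c \<in> IF 0" "X - dg \<gamma> c \<in> \<I> j" using commutant[OF XE C] by blast
  have dE: "dg \<gamma> c \<in> \<E>" using \<gamma> by (intro dg_E0)
  have S: "\<F> (app (dg \<gamma> c) u) (app (dg \<gamma> c) w) - \<nu> * \<F> u w \<in> IF j" if "u \<in> L 0" "w \<in> L 0" for u w
    using sim_cong[OF X dE \<gamma>(3)] that by (simp add: sim_def)
  have "eta D * (c * c - \<nu>) \<in> IF j"
    using S[of "(0, 1)" "(0, 1)"] unfolding form_dg by (simp add: mem_L mult.commute)
  then have c1: "c * c - \<nu> \<in> IF j" by (simp only: F.unit_mult_iff[OF eta_unit])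
  have "eps D * (\<gamma> * \<iota> \<gamma> - \<e> \<nu>) \<in> IK j"
  proof (rule Tr_nondeg)
    fix y assume "y \<in> IK 0"
    then show "Tr (eps D * (\<gamma> * \<iota> \<gamma> - \<e> \<nu>) * y) \<in> IF j"
      using S[of "(1, 0)" "(\<iota> y, 0)"] unfolding form_dg by (simp add: mem_L iot_iot)
  qed
  then have n1: "\<gamma> * \<iota> \<gamma> - \<e> \<nu> \<in> IK j" by (simp only: K.unit_mult_iff[OF eps_unit])
  have "\<nu> - c * c \<in> IF 1" using F.ideal_mono[OF c1 j] F.ideal_uminus[of "c * c - \<nu>" 1] by simp
  then have "c * c \<in> UF" by (rule F.unit_cong[OF \<nu>])
  then have cU: "c \<in> UF" using \<gamma>(2) F.ideal_multR[of c 1 c] by (auto simp: F.unit_iff)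
  have "\<gamma> * \<iota> \<gamma> - \<e> (c ^ 2) = (\<gamma> * \<iota> \<gamma> - \<e> \<nu>) - \<e> (c * c - \<nu>)" by (simp add: e_diff power2_eq_square)
  also have "\<dots> \<in> IK j" by (rule K.ideal_diff[OF n1]) (simp add: c1)
  finally obtain \<gamma>' where \<gamma>': "\<gamma>' - \<gamma> \<in> IK j" "\<gamma>' * \<iota> \<gamma>' = \<e> (c ^ 2)" "\<gamma>' \<in> UK"
    using norm_lift[OF j \<gamma>(1) cU] by blast
  have "X - dg \<gamma>' c = (X - dg \<gamma> c) - (dg \<gamma>' c - dg \<gamma> c)" by simp
  also have "\<dots> \<in> \<I> j" unfolding dg_diff by (rule \<I>_closed(3)[OF \<gamma>(3)]) (use \<gamma>'(1) in \<open>simp add: dg_E\<close>)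
  finally show thesis using that \<gamma>' cU by blast
qed

section \<open>Skew endomorphisms and the Lie algebra\<close>

definition skew :: "nat \<Rightarrow> ('k \<times> 'f) aend \<Rightarrow> bool" where
  "skew j C \<longleftrightarrow> C \<in> \<E> \<and> (\<forall>u\<in>L 0. \<forall>w\<in>L 0. \<F> (app C u) w + \<F> u (app C w) \<in> IF j)"

text \<open>The Lie algebra of the isometry group, with exact equations. Its elements serve to test
  \<open>skew\<close> endomorphisms, for which the equations hold only modulo
  \<open>\<pp>^j\<close>.\<close>

definition so :: "('k \<times> 'f) aend set" where
  "so = {Y \<in> \<E>. \<forall>u w. \<F> (app Y u) w + \<F> u (app Y w) = 0}"

lemma so_E: "Y \<in> so \<Longrightarrow> Y \<in> \<E>" and so_form: "Y \<in> so \<Longrightarrow> \<F> (app Y u) w = - \<F> u (app Y w)"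
  by (simp_all add: so_def add_eq_0_iff2)

lemma so_sm: "Y \<in> so \<Longrightarrow> c \<in> IF 0 \<Longrightarrow> sm c Y \<in> so"
  by (simp add: so_def \<E>_closed form_sc flip: distrib_left)

text \<open>The test element is the skew map \<open>sc (\<F> u x) z - sc (\<F> u z) x\<close> of
  rank at most two. The trace of its product with \<open>C\<close> is
  \<open>\<F> (app C z) x - \<F> (app C x) z\<close>, which for skew \<open>C\<close> is
  \<open>- 2\<close> times \<open>\<F> (app C x) z\<close> modulo \<open>\<pp>^j\<close>, and 2 is a
  unit.\<close>

lemma so_nondeg:
  assumes C: "skew j C" and t: "\<And>Y. Y \<in> so \<Longrightarrow> tr (Y * C) \<in> IF j"
  shows "C \<in> \<I> j"
proof -
  have CE: "C \<in> \<E>" using C by (simp add: skew_def)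
  have "app C x \<in> L j" if x: "x \<in> L 0" for x
  proof (rule form_nondeg)
    fix z assume z: "z \<in> L 0"
    define Y where "Y = Aend (\<lambda>u. sc (\<F> u x) z - sc (\<F> u z) x)"
    have Y: "app Y u = sc (\<F> u x) z - sc (\<F> u z) x" for u
      unfolding Y_def by (subst app_Aend) (simp_all add: form_add sc_add)
    have YE: "Y \<in> \<E>" unfolding \<E>_def
      by (auto simp: Y form_sc sc_diff sc_sc form_ideal x z intro!: L_diff L_sc0)
    have "Y \<in> so" using YE by (simp add: so_def Y form_diff form_sc form_sym[of _ x] form_sym[of _ z] algebra_simps)
    then have 1: "tr (Y * C) \<in> IF j" by (rule t)
    have e: "(\<Sum>i<n. \<F> (bas i) a * cf i v) = \<F> v a" for a v
    proof -
      have "\<F> v a = \<F> (\<Sum>i<n. sc (cf i v) (bas i)) a" by (simp only: expand)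
      then show ?thesis by (simp only: form_sum form_sc mult.commute)
    qed
    have "tr (Y * C) = (\<Sum>i<n. \<F> (bas i) x * cf i (app C z)) - (\<Sum>i<n. \<F> (bas i) z * cf i (app C x))"
      unfolding tr_def sum_subtractf[symmetric]
      by (rule sum.cong[OF refl]) (simp add: Y app_diff \<E>D[OF CE] cf_diff cf_sc)
    then have 2: "tr (Y * C) = \<F> (app C z) x - \<F> (app C x) z" by (simp only: e)
    have 3: "\<F> (app C z) x + \<F> z (app C x) \<in> IF j" using C x z by (simp add: skew_def)
    have "2 * \<F> (app C x) z = (\<F> (app C z) x + \<F> z (app C x)) - tr (Y * C)"
      unfolding 2 by (simp add: form_sym[of z])
    also have "\<dots> \<in> IF j" using 3 1 by (rule F.ideal_diff)
    finally show "\<F> (app C x) z \<in> IF j" by (simp only: F.unit_mult_iff[OF two_unit])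
  qed
  then show ?thesis using CE by (simp add: \<I>_def \<E>_def)
qed

lemma tau_one [simp]: "tau D 0 = 1" by (rule tau_O) simp
lemma tau_nz: "tau D x \<noteq> 0" using tau_add[of x "- x"] by auto

text \<open>Replacing \<open>Y\<close> by its integral multiples turns triviality of \<tau> into
  integrality, by the conductor condition.\<close>

lemma so_nondeg_tau:
  assumes C: "skew j C" and t: "\<And>Y. Y \<in> so \<Longrightarrow> tau D (tr (Y * C) / \<omega> ^ j) = 1"
  shows "C \<in> \<I> j"
proof (rule so_nondeg[OF C])
  have CE: "C \<in> \<E>" using C by (simp add: skew_def)
  fix Y assume Y: "Y \<in> so"
  have "tr (Y * C) / \<omega> ^ j \<in> IF 0"
  proof (rule tau_conductor)
    fix y assume y: "y \<in> IF 0"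
    have "tr (sm y Y * C) / \<omega> ^ j = tr (Y * C) / \<omega> ^ j * y"
      by (simp add: sm_mult[OF so_E[OF Y] CE] tr_sm mult.commute)
    with t[OF so_sm[OF Y y]] show "tau D (tr (Y * C) / \<omega> ^ j * y) = 1" by (simp only:)
  qed
  then show "tr (Y * C) \<in> IF j" using F.ideal_shift0[of j "tr (Y * C) / \<omega> ^ j"] F.\<pi> by simp
qed

text \<open>Half of the defect \<open>\<mu> - X - X'\<close> is added to \<open>X\<close>, where
  \<open>X'\<close> is the adjoint. The defect is self-adjoint and lies in \<open>\<I> j\<close>, so
  the correction makes the equation exact without changing the class.\<close>

lemma lie_lift:
  assumes X: "lie j X \<mu>"
  obtains Y where "Y \<in> \<E>" "Y - X \<in> \<I> j" "\<And>u w. \<F> (app Y u) w + \<F> u (app Y w) = \<mu> * \<F> u w"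
proof -
  have XE: "X \<in> \<E>" and \<mu>: "\<mu> \<in> IF 0" using X by (auto simp: lie_def)
  obtain X' where X': "X' \<in> \<E>" "\<And>u w. \<F> (app X u) w = \<F> u (app X' w)" using adjoint_exists[OF XE] by blast
  have X'2: "\<F> (app X' u) w = \<F> u (app X w)" for u w using X'(2)[of w u] by (simp add: form_sym)
  define Z where "Z = sm \<mu> 1 - X - X'"
  have ZE: "Z \<in> \<E>" using XE X' \<mu> by (simp add: Z_def \<E>_closed)
  have "Z \<in> \<I> j"
  proof -
    have "app Z w \<in> L j" if w: "w \<in> L 0" for w
    proof (rule form_nondeg')
      fix u assume u: "u \<in> L 0"
      have "\<F> u (app Z w) = - (\<F> (app X u) w + \<F> u (app X w) - \<mu> * \<F> u w)"
        by (simp add: Z_def form_diff form_sc X'(2))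
      also have "\<dots> \<in> IF j" unfolding F.ideal_uminus using X u w by (simp add: lie_def)
      finally show "\<F> u (app Z w) \<in> IF j" .
    qed
    then show ?thesis using ZE by (simp add: \<I>_def \<E>_def)
  qed
  then have hZ: "sm (inverse 2) Z \<in> \<I> j" by (intro \<I>_closed F.unit_integral half)
  define Y where "Y = X + sm (inverse 2) Z"
  have "\<F> (app Y u) w + \<F> u (app Y w) = \<mu> * \<F> u w" for u w
  proof -
    define z where "z = \<mu> * \<F> u w - \<F> u (app X' w) - \<F> u (app X w)"
    have "inverse 2 * z + inverse 2 * z = (2 * inverse 2) * z" by (simp only: mult_2 distrib_right)
    then have h: "inverse 2 * z + inverse 2 * z = z" using two_nz by simp
    have e: "\<F> (app Y u) w = \<F> u (app X' w) + inverse 2 * z" "\<F> u (app Y w) = \<F> u (app X w) + inverse 2 * z"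
      by (simp_all add: Y_def Z_def form_add form_diff form_sc X'(2) X'2 z_def algebra_simps)
    have "\<F> (app Y u) w + \<F> u (app Y w) = \<F> u (app X' w) + \<F> u (app X w) + (inverse 2 * z + inverse 2 * z)"
      unfolding e by (simp only: ac_simps)
    also have "\<dots> = \<mu> * \<F> u w" unfolding h by (simp add: z_def)
    finally show ?thesis .
  qed
  then show thesis using that[of Y] XE ZE hZ half by (simp add: Y_def \<E>_closed F.unit_integral)
qed

lemma \<I>_mult2: "X \<in> \<I> i \<Longrightarrow> Y \<in> \<I> j \<Longrightarrow> X * Y \<in> \<I> (i + j)"
proof -
  assume X: "X \<in> \<I> i" and Y: "Y \<in> \<I> j"
  obtain X' where X': "X' \<in> \<E>" "X = sm (\<omega> ^ i) X'" using X by (rule \<I>_E)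
  have "X * Y = sm (\<omega> ^ i) (X' * Y)" unfolding X'(2) by (rule sm_mult[OF X'(1) \<I>_\<E>[OF Y]])
  then show ?thesis using \<I>_shift[of i "X' * Y" j] \<I>_mult(2)[OF X'(1) Y] by simp
qed

text \<open>In the similitude equation for \<open>1 + A\<close> the only quadratic term is
  \<open>\<F> (app A u) (app A w)\<close>, and it lies in \<open>IF (2 * i)\<close>.\<close>

lemma sim_lie:
  assumes X: "sim r X \<nu>" and A: "X - 1 \<in> \<I> i" and k: "k \<le> r" "k \<le> 2 * i"
  shows "lie k (X - 1) (\<nu> - 1)"
  unfolding lie_def
proof (intro conjI ballI)
  show "X - 1 \<in> \<E>" using A by (rule \<I>_\<E>)
  show "\<nu> - 1 \<in> IF 0" using X F.unit_integral by (auto simp: sim_def)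
  fix u w assume uw: "u \<in> L 0" "w \<in> L 0"
  define a where "a = app (X - 1) u"
  define b where "b = app (X - 1) w"
  have ab: "a \<in> L i" "b \<in> L i" using \<I>D(2)[OF A] uw by (simp_all only: a_def b_def)
  obtain a' where a': "a' \<in> L 0" "a = sc (\<omega> ^ i) a'" using ab(1) by (rule L_E)
  have "\<F> a b = \<omega> ^ i * \<F> a' b" unfolding a'(2) by (simp only: form_sc)
  then have "\<F> a b \<in> IF (i + i)" using form_ideal'[OF a'(1) ab(2)] F.ideal_shift[of i "\<F> a' b" i] by simp
  then have 1: "\<F> a b \<in> IF k" by (rule F.ideal_mono) (use k in simp)
  have 2: "\<F> (u + a) (w + b) - \<nu> * \<F> u w \<in> IF k"
    using X uw k(1) by (auto simp: sim_def a_def b_def intro: F.ideal_mono)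
  have "\<F> a w + \<F> u b - (\<nu> - 1) * \<F> u w = (\<F> (u + a) (w + b) - \<nu> * \<F> u w) - \<F> a b"
    by (simp add: form_add algebra_simps)
  also have "\<dots> \<in> IF k" using 2 1 by (rule F.ideal_diff)
  finally show "\<F> (app (X - 1) u) w + \<F> u (app (X - 1) w) - (\<nu> - 1) * \<F> u w \<in> IF k"
    by (simp only: a_def b_def)
qed

text \<open>Evaluation at \<open>(0, 1)\<close>, where the form takes the unit value
  \<open>eta D\<close>, isolates the multiplier.\<close>

lemma lie_multiplier:
  assumes "lie k A \<mu>" "A \<in> \<I> i" "i \<le> k"
  shows "\<mu> \<in> IF i"
proof -
  let ?u = "(0, 1) :: 'k \<times> 'f"
  have u: "?u \<in> L 0" by (simp add: mem_L)
  have 1: "\<F> (app A ?u) ?u + \<F> ?u (app A ?u) \<in> IF i"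
    using form_ideal[OF \<I>D(2)[OF assms(2) u] u] form_ideal'[OF u \<I>D(2)[OF assms(2) u]] by (rule F.ideal_add)
  have "\<F> (app A ?u) ?u + \<F> ?u (app A ?u) - \<mu> * \<F> ?u ?u \<in> IF k" using assms(1) u by (simp add: lie_def)
  from F.ideal_diff[OF 1 F.ideal_mono[OF this assms(3)]]
  have "\<mu> * \<F> ?u ?u \<in> IF i" by simp
  then have "eta D * \<mu> \<in> IF i" unfolding form_eq by (simp add: mult.commute)
  then show ?thesis by (simp only: F.unit_mult_iff[OF eta_unit])
qed

text \<open>The multiplier contributes two terms, which cancel because \<beta> is skew.\<close>

lemma lie_skew:
  assumes A: "lie k A \<mu>"
  shows "skew k (A * bt - bt * A)"
  unfolding skew_def
proof (intro conjI ballI)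
  have AE: "A \<in> \<E>" using A by (simp add: lie_def)
  then show "A * bt - bt * A \<in> \<E>" using bt_E by (intro \<E>_closed)
  fix u w assume uw: "u \<in> L 0" "w \<in> L 0"
  have b: "app bt u \<in> L 0" "app bt w \<in> L 0" using \<E>D(2)[OF bt_E] uw by auto
  define P where "P = \<F> (app A (app bt u)) w + \<F> (app bt u) (app A w) - \<mu> * \<F> (app bt u) w"
  define Q where "Q = \<F> (app A u) (app bt w) + \<F> u (app A (app bt w)) - \<mu> * \<F> u (app bt w)"
  have PQ: "P \<in> IF k" "Q \<in> IF k" using A uw b by (simp_all only: P_def Q_def lie_def)
  have f: "\<F> (app bt u) w = - \<F> u (app bt w)" "\<F> (app bt (app A u)) w = - \<F> (app A u) (app bt w)"
    "\<F> u (app bt (app A w)) = - \<F> (app bt u) (app A w)"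
    using form_bt[of u w] form_bt[of "app A u" w] form_bt[of u "app A w"] by simp_all
  have "\<F> (app (A * bt - bt * A) u) w + \<F> u (app (A * bt - bt * A) w) =
    \<F> (app bt (app A u)) w - \<F> (app A (app bt u)) w + \<F> u (app bt (app A w)) - \<F> u (app A (app bt w))"
    by (simp only: app_simps form_diff) simp
  also have "\<dots> = - (P + Q)" unfolding P_def Q_def f by (simp add: algebra_simps del: app_dg)
  also have "\<dots> \<in> IF k" unfolding F.ideal_uminus using PQ by (rule F.ideal_add)
  finally show "\<F> (app (A * bt - bt * A) u) w + \<F> u (app (A * bt - bt * A) w) \<in> IF k" .
qed

end

section \<open>Congruence subgroups of GO\<close>

text \<open>The inequalities cover both parities at once. \<open>l \<le> 2 * l'\<close> puts
  commutators of level \<open>l'\<close> into level \<open>l\<close>; together with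
  \<open>r = l + l'\<close> it gives \<open>r \<le> 3 * l'\<close>, so that triple products of level
  \<open>l'\<close> vanish modulo \<open>\<pp>^r\<close>.\<close>

locale go_level = go_setting D for D :: "('f::field, 'k::field) go_data" +
  fixes r l l' :: nat
  assumes level: "r = l + l'" "l' \<le> l" "l \<le> 2 * l'" "1 \<le> l'"
begin

lemma r1: "1 \<le> r" using level by simp
lemma rl: "r \<le> 3 * l'" "l \<le> r" "l' \<le> r" "r \<le> 2 * l" using level by simp_all

abbreviation "G \<equiv> GO D r"
abbreviation gmult (infixl "\<star>" 70) where "g \<star> h \<equiv> g \<otimes>\<^bsub>G\<^esub> h"
abbreviation "iv g \<equiv> inv\<^bsub>G\<^esub> g"
sublocale G: group "GO D r" by (rule GO_group[OF r1])

lemma \<Phi>_G: "sim r X \<nu> \<Longrightarrow> \<Phi> r X \<in> carrier G"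
  using GO_mem[OF r1] by (auto simp: sim_def)
lemma sim_E: "sim r X \<nu> \<Longrightarrow> X \<in> \<E>" by (simp add: sim_def)
lemma \<Phi>_mult: "X \<in> \<E> \<Longrightarrow> Y \<in> \<E> \<Longrightarrow> \<Phi> r X \<star> \<Phi> r Y = \<Phi> r (X * Y)"
  by (simp add: GO_mult rcomp_\<Phi>)

lemma G_rep:
  assumes "g \<in> carrier G"
  obtains X \<nu> X' where "g = \<Phi> r X" "iv g = \<Phi> r X'" "sim r X \<nu>" "sim r X' (inverse \<nu>)"
    "X * X' - 1 \<in> \<I> r" "X' * X - 1 \<in> \<I> r" "X \<in> \<E>" "X' \<in> \<E>"
proof -
  obtain X \<nu> where X: "X \<in> \<E>" "sim r X \<nu>" "g = \<Phi> r X" using GO_E[OF r1 assms] by blast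
  obtain X' where X': "sim r X' (inverse \<nu>)" "X * X' - 1 \<in> \<I> r" "X' * X - 1 \<in> \<I> r"
    using GO_inverse[OF r1 X(2)] by blast
  have "iv g = \<Phi> r X'" unfolding X(3) by (rule GO_inv[OF r1 X(2) sim_E[OF X'(1)] X'(3)])
  then show thesis using that X X' sim_E[OF X'(1)] by blast
qed

lemma \<I>_trans: "X - Y \<in> \<I> j \<Longrightarrow> Y \<in> \<I> j \<Longrightarrow> X \<in> \<I> j"
  using \<I>_closed(2)[of "X - Y" j Y] by simp

subsection \<open>Congruence subgroups and centralizers\<close>

abbreviation "Kc j \<equiv> congr_subgroup D r j"

lemma K_iff: "j \<le> r \<Longrightarrow> X \<in> \<E> \<Longrightarrow> \<Phi> r X \<in> Kc j \<longleftrightarrow> \<Phi> r X \<in> carrier G \<and> X - 1 \<in> \<I> j"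
  by (simp add: congr_subgroup_def red_\<Phi> GO_one \<Phi>_eq \<E>_closed)

lemma K_G: "k \<in> Kc j \<Longrightarrow> k \<in> carrier G" by (simp add: congr_subgroup_def)

lemma inverse_congr:
  assumes "X' * X - 1 \<in> \<I> r" "X - 1 \<in> \<I> j" "X' \<in> \<E>" "j \<le> r"
  shows "X' - 1 \<in> \<I> j"
proof -
  have e: "X' - 1 = (X' * X - 1) - X' * (X - 1)" by (simp add: algebra_simps)
  show ?thesis unfolding e by (rule \<I>_closed(3)[OF \<I>_mono[OF assms(1,4)] \<I>_mult(2)[OF assms(3,2)]])
qed

lemma conj_congr:
  assumes "X * X' - 1 \<in> \<I> r" "Y - 1 \<in> \<I> j" "X \<in> \<E>" "X' \<in> \<E>" "j \<le> r"
  shows "X * Y * X' - 1 \<in> \<I> j"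
proof -
  have e: "X * Y * X' - 1 = X * (Y - 1) * X' + (X * X' - 1)" by (simp add: algebra_simps)
  show ?thesis unfolding e
    by (rule \<I>_closed(2)[OF \<I>_mult(1)[OF \<I>_mult(2)[OF assms(3,2)] assms(4)] \<I>_mono[OF assms(1,5)]])
qed

lemma K_subgroup: "j \<le> r \<Longrightarrow> subgroup (Kc j) G"
proof (rule G.subgroupI)
  assume j: "j \<le> r"
  show "Kc j \<subseteq> carrier G" using K_G by blast
  have "\<Phi> r 1 \<in> Kc j" using j \<Phi>_G[OF sim_one] by (simp add: K_iff \<E>_closed \<I>_closed)
  then show "Kc j \<noteq> {}" by blast
  fix a assume a: "a \<in> Kc j"
  obtain X X' where X: "a = \<Phi> r X" "iv a = \<Phi> r X'" "X' * X - 1 \<in> \<I> r" "X \<in> \<E>" "X' \<in> \<E>"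
    using G_rep[OF K_G[OF a]] by metis
  have "X - 1 \<in> \<I> j" using a X j by (simp add: K_iff)
  then show "iv a \<in> Kc j"
    using inverse_congr[OF X(3) _ X(5) j] G.inv_closed[OF K_G[OF a]] X j by (simp add: K_iff)
  fix b assume b: "b \<in> Kc j"
  obtain Y where Y: "b = \<Phi> r Y" "Y \<in> \<E>" using G_rep[OF K_G[OF b]] by metis
  have e: "X * Y - 1 = (X - 1) * Y + (Y - 1)" by (simp add: algebra_simps)
  have "Y - 1 \<in> \<I> j" using b Y j by (simp add: K_iff)
  then have "X * Y - 1 \<in> \<I> j" unfolding e by (rule \<I>_closed(2)[OF \<I>_mult(1)[OF \<open>X - 1 \<in> \<I> j\<close> Y(2)]])
  then show "a \<star> b \<in> Kc j" using G.m_closed[OF K_G[OF a] K_G[OF b]] X Y j by (simp add: \<Phi>_mult K_iff \<E>_closed)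
qed

lemma K_normal:
  assumes j: "j \<le> r" and g: "g \<in> carrier G" and k: "k \<in> Kc j"
  shows "g \<star> k \<star> iv g \<in> Kc j"
proof -
  obtain X X' where X: "g = \<Phi> r X" "iv g = \<Phi> r X'" "X * X' - 1 \<in> \<I> r" "X \<in> \<E>" "X' \<in> \<E>"
    using G_rep[OF g] by metis
  obtain Y where Y: "k = \<Phi> r Y" "Y \<in> \<E>" using G_rep[OF K_G[OF k]] by metis
  have "Y - 1 \<in> \<I> j" using k Y j by (simp add: K_iff)
  then have "X * Y * X' - 1 \<in> \<I> j" using conj_congr[OF X(3) _ X(4,5) j] by blast
  moreover have "g \<star> k \<star> iv g = \<Phi> r (X * Y * X')" using X Y by (simp add: \<Phi>_mult \<E>_closed)
  moreover have "g \<star> k \<star> iv g \<in> carrier G" using g K_G[OF k] by simp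
  ultimately show ?thesis using X Y j by (simp add: K_iff \<E>_closed)
qed

lemma K_normal':
  assumes "j \<le> r" "g \<in> carrier G" "k \<in> Kc j"
  shows "iv g \<star> k \<star> g \<in> Kc j"
  using K_normal[OF assms(1) G.inv_closed[OF assms(2)] assms(3)] assms(2) by simp

lemma K_mono: "j \<le> k \<Longrightarrow> k \<le> r \<Longrightarrow> Kc k \<subseteq> Kc j"
proof
  fix x assume j: "j \<le> k" "k \<le> r" and x: "x \<in> Kc k"
  obtain X where X: "x = \<Phi> r X" "X \<in> \<E>" using G_rep[OF K_G[OF x]] by metis
  show "x \<in> Kc j" using x j unfolding X(1) by (auto simp: K_iff X(2) intro: \<I>_mono)
qed

definition cm :: "('k \<times> 'f) aend \<Rightarrow> ('k \<times> 'f) aend" where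
  "cm X = X * bt - bt * X"

lemma cm_E: "X \<in> \<I> j \<Longrightarrow> cm X \<in> \<I> j"
  unfolding cm_def using bt_E by (intro \<I>_closed \<I>_mult)
lemma cm_add: "cm (X + Y) = cm X + cm Y" and cm_diff: "cm (X - Y) = cm X - cm Y" and cm_one: "cm 1 = 0"
  by (simp_all add: cm_def algebra_simps)
lemma cm_mult: "cm (X * Y) = X * cm Y + cm X * Y" by (simp add: cm_def algebra_simps)
lemma cm_dg: "cm (dg \<gamma> c) = 0" by (simp add: cm_def dg_mult mult.commute)

text \<open>For \<open>j = r\<close> this is \<open>G_beta D r\<close>, for \<open>j = l'\<close> it
  is the stabilizer of \<psi>, and for \<open>j = l\<close> it cuts out the subgroup
  \<open>Zs\<close> of \<open>Kc l'\<close>.\<close>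

definition Cent :: "nat \<Rightarrow> ('f, 'k) res_map set" where
  "Cent j = {g \<in> carrier G. \<exists>X\<in>\<E>. g = \<Phi> r X \<and> cm X \<in> \<I> j}"

lemma Cent_iff: "j \<le> r \<Longrightarrow> X \<in> \<E> \<Longrightarrow> \<Phi> r X \<in> Cent j \<longleftrightarrow> \<Phi> r X \<in> carrier G \<and> cm X \<in> \<I> j"
proof
  assume j: "j \<le> r" and X: "X \<in> \<E>" and "\<Phi> r X \<in> Cent j"
  then obtain Y where Y: "Y \<in> \<E>" "\<Phi> r X = \<Phi> r Y" "cm Y \<in> \<I> j" "\<Phi> r X \<in> carrier G" by (auto simp: Cent_def)
  have "X - Y \<in> \<I> r" using Y \<Phi>_eq[OF X Y(1)] by simp
  from \<I>_mono[OF cm_E[OF this] j] show "\<Phi> r X \<in> carrier G \<and> cm X \<in> \<I> j"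
    using \<I>_trans[of "cm X" "cm Y" j] Y by (simp add: cm_diff)
qed (auto simp: Cent_def)

lemma Cent_G: "g \<in> Cent j \<Longrightarrow> g \<in> carrier G" by (simp add: Cent_def)

lemma Cent_subgroup: "j \<le> r \<Longrightarrow> subgroup (Cent j) G"
proof (rule G.subgroupI)
  assume j: "j \<le> r"
  show "Cent j \<subseteq> carrier G" using Cent_G by blast
  have "\<Phi> r 1 \<in> Cent j" using j \<Phi>_G[OF sim_one] by (simp add: Cent_iff \<E>_closed \<I>_closed cm_one)
  then show "Cent j \<noteq> {}" by blast
  fix a assume a: "a \<in> Cent j"
  obtain X X' where X: "a = \<Phi> r X" "iv a = \<Phi> r X'" "X * X' - 1 \<in> \<I> r" "X' * X - 1 \<in> \<I> r" "X \<in> \<E>" "X' \<in> \<E>"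
    using G_rep[OF Cent_G[OF a]] by metis
  have cX: "cm X \<in> \<I> j" using a X j by (simp add: Cent_iff)
  have cX': "cm X' \<in> \<E>" using cm_E[of X' 0] X by (simp add: \<E>_0)
  \<comment> \<open>\<open>cm\<close> is a derivation, so applying it to \<open>X' * X\<close> gives
    the commutator of the inverse.\<close>
  have "cm (X' * X - 1) \<in> \<I> j" by (rule \<I>_mono[OF cm_E[OF X(4)] j])
  then have "cm X' * X \<in> \<I> j"
    using \<I>_closed(3)[OF _ \<I>_mult(2)[OF X(6) cX], of "cm (X' * X - 1)"] by (simp add: cm_diff cm_one cm_mult)
  from \<I>_closed(3)[OF \<I>_mult(1)[OF this X(6)] \<I>_mult(2)[OF cX' \<I>_mono[OF X(3) j]]]
  have "cm X' \<in> \<I> j" by (simp add: algebra_simps)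
  then show "iv a \<in> Cent j" using G.inv_closed[OF Cent_G[OF a]] X j by (simp add: Cent_iff)
  fix b assume b: "b \<in> Cent j"
  obtain Y where Y: "b = \<Phi> r Y" "Y \<in> \<E>" using G_rep[OF Cent_G[OF b]] by metis
  have "cm Y \<in> \<I> j" using b Y j by (simp add: Cent_iff)
  then have "cm (X * Y) \<in> \<I> j" using cX X Y by (simp add: cm_mult \<I>_closed \<I>_mult)
  then show "a \<star> b \<in> Cent j" using G.m_closed[OF Cent_G[OF a] Cent_G[OF b]] X Y j by (simp add: \<Phi>_mult Cent_iff \<E>_closed)
qed

lemma G_beta_eq: "G_beta D r = Cent r"
proof -
  have *: "rcomp (V r) (\<Phi> r X) (red_int D r (beta D)) = rcomp (V r) (red_int D r (beta D)) (\<Phi> r X) \<longleftrightarrow> cm X \<in> \<I> r"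
    if "X \<in> \<E>" for X
    using that bt_E by (simp add: lat_bt[symmetric] red_int_lat rcomp_\<Phi> \<Phi>_eq \<E>_closed cm_def)
  show ?thesis
  proof (intro equalityI subsetI)
    fix g assume g: "g \<in> G_beta D r"
    then have gG: "g \<in> carrier G" by (simp add: G_beta_def)
    obtain X where X: "g = \<Phi> r X" "X \<in> \<E>" using G_rep[OF gG] by metis
    show "g \<in> Cent r" using g gG * X by (simp add: G_beta_def Cent_iff)
  next
    fix g assume g: "g \<in> Cent r"
    obtain X where X: "g = \<Phi> r X" "X \<in> \<E>" using G_rep[OF Cent_G[OF g]] by metis
    show "g \<in> G_beta D r" using g * X by (simp add: G_beta_def Cent_iff)
  qed
qed

lemma stabilizer_eq: "stabilizer_beta D r l' = Cent l'"
proof -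
  have *: "red D r l' (rcomp (V r) (rcomp (V r) g (red_int D r (beta D))) (iv g)) = red_int D l' (beta D) \<longleftrightarrow>
    cm X \<in> \<I> l'"
    if X: "g = \<Phi> r X" "iv g = \<Phi> r X'" "X * X' - 1 \<in> \<I> r" "X' * X - 1 \<in> \<I> r" "X \<in> \<E>" "X' \<in> \<E>" for g X X'
  proof -
    have "red D r l' (rcomp (V r) (rcomp (V r) g (red_int D r (beta D))) (iv g)) = \<Phi> l' (X * bt * X')"
      using X bt_E by (simp add: lat_bt[symmetric] red_int_lat rcomp_\<Phi> \<E>_closed red_\<Phi> rl)
    moreover have "red_int D l' (beta D) = \<Phi> l' bt" by (simp add: lat_bt[symmetric] red_int_lat)
    moreover have "X * bt * X' - bt \<in> \<I> l' \<longleftrightarrow> cm X \<in> \<I> l'"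
    proof
      assume "X * bt * X' - bt \<in> \<I> l'"
      from \<I>_closed(3)[OF \<I>_mult(1)[OF this X(5)] \<I>_mult(2)[OF \<E>_closed(5)[OF X(5) bt_E] \<I>_mono[OF X(4) rl(3)]]]
      show "cm X \<in> \<I> l'" by (simp add: cm_def algebra_simps)
    next
      assume "cm X \<in> \<I> l'"
      from \<I>_closed(2)[OF \<I>_mult(1)[OF this X(6)] \<I>_mult(2)[OF bt_E \<I>_mono[OF X(3) rl(3)]]]
      show "X * bt * X' - bt \<in> \<I> l'" by (simp add: cm_def algebra_simps)
    qed
    ultimately show ?thesis using X bt_E by (simp add: \<Phi>_eq \<E>_closed)
  qed
  show ?thesis
  proof (intro equalityI subsetI)
    fix g assume g: "g \<in> stabilizer_beta D r l'"
    then have gG: "g \<in> carrier G" by (simp add: stabilizer_beta_def)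
    obtain X \<nu> X' where X: "g = \<Phi> r X" "iv g = \<Phi> r X'" "sim r X \<nu>" "sim r X' (inverse \<nu>)"
      "X * X' - 1 \<in> \<I> r" "X' * X - 1 \<in> \<I> r" "X \<in> \<E>" "X' \<in> \<E>" using G_rep[OF gG] .
    show "g \<in> Cent l'" using g gG *[OF X(1,2,5-8)] X rl(3) by (simp add: stabilizer_beta_def Cent_iff)
  next
    fix g assume g: "g \<in> Cent l'"
    obtain X \<nu> X' where X: "g = \<Phi> r X" "iv g = \<Phi> r X'" "sim r X \<nu>" "sim r X' (inverse \<nu>)"
      "X * X' - 1 \<in> \<I> r" "X' * X - 1 \<in> \<I> r" "X \<in> \<E>" "X' \<in> \<E>" using G_rep[OF Cent_G[OF g]] .
    show "g \<in> stabilizer_beta D r l'" using g *[OF X(1,2,5-8)] X rl(3) by (simp add: stabilizer_beta_def Cent_iff)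
  qed
qed

lemma Cent_mono: "j \<le> k \<Longrightarrow> Cent k \<subseteq> Cent j"
  unfolding Cent_def using \<I>_mono by blast

lemma K_Cent: "j \<le> r \<Longrightarrow> Kc j \<subseteq> Cent j"
proof
  fix x assume j: "j \<le> r" and x: "x \<in> Kc j"
  obtain X where X: "x = \<Phi> r X" "X \<in> \<E>" using G_rep[OF K_G[OF x]] by metis
  have "cm (X - 1) \<in> \<I> j" using x j X by (intro cm_E) (simp add: K_iff)
  then show "x \<in> Cent j" using x j X K_G by (simp add: Cent_iff cm_diff cm_one)
qed

lemma dg_Cent:
  assumes "\<gamma> \<in> UK" "c \<in> UF" "\<gamma> * \<iota> \<gamma> - \<e> (c ^ 2) \<in> IK r"
  shows "\<Phi> r (dg \<gamma> c) \<in> Cent r"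
  using \<Phi>_G[OF sim_dg[OF K.unit_integral[OF assms(1)] assms(2,3)]] assms
  by (subst Cent_iff) (auto simp: cm_dg \<I>_closed intro!: dg_E0 K.unit_integral F.unit_integral)

lemma Cent_E:
  assumes j: "1 \<le> j" "j \<le> r" and g: "g \<in> Cent j"
  obtains X \<gamma> c where "X \<in> \<E>" "g = \<Phi> r X" "\<gamma> \<in> UK" "c \<in> UF" "\<gamma> * \<iota> \<gamma> = \<e> (c ^ 2)" "X - dg \<gamma> c \<in> \<I> j"
proof -
  obtain X \<nu> where X: "g = \<Phi> r X" "sim r X \<nu>" "X \<in> \<E>" using G_rep[OF Cent_G[OF g]] by metis
  have "sim j X \<nu>" using X(2) j by (auto simp: sim_def intro: F.ideal_mono)
  moreover have "X * bt - bt * X \<in> \<I> j" using g X j by (simp add: Cent_iff cm_def)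
  ultimately show thesis using sim_centralizer[OF j(1)] that X by metis
qed

lemma Cent_r_E:
  assumes g: "g \<in> Cent r"
  obtains \<gamma> c where "g = \<Phi> r (dg \<gamma> c)" "\<gamma> \<in> UK" "c \<in> UF" "\<gamma> * \<iota> \<gamma> = \<e> (c ^ 2)"
proof -
  obtain X \<gamma> c where X: "X \<in> \<E>" "g = \<Phi> r X" "\<gamma> \<in> UK" "c \<in> UF" "\<gamma> * \<iota> \<gamma> = \<e> (c ^ 2)" "X - dg \<gamma> c \<in> \<I> r"
    using Cent_E[OF r1 order_refl g] by blast
  have "dg \<gamma> c \<in> \<E>" using X K.unit_integral F.unit_integral by (intro dg_E0) auto
  then have "g = \<Phi> r (dg \<gamma> c)" using X by (simp add: \<Phi>_eq)
  then show thesis using that X by blast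
qed

lemma Cent_r_comm: "g \<in> Cent r \<Longrightarrow> h \<in> Cent r \<Longrightarrow> g \<star> h = h \<star> g"
proof -
  assume g: "g \<in> Cent r" and h: "h \<in> Cent r"
  obtain \<gamma> c where 1: "g = \<Phi> r (dg \<gamma> c)" "\<gamma> \<in> UK" "c \<in> UF" using Cent_r_E[OF g] by metis
  obtain \<gamma>' c' where 2: "h = \<Phi> r (dg \<gamma>' c')" "\<gamma>' \<in> UK" "c' \<in> UF" using Cent_r_E[OF h] by metis
  have "dg \<gamma> c \<in> \<E>" "dg \<gamma>' c' \<in> \<E>" using 1 2 K.unit_integral F.unit_integral by (auto intro!: dg_E0)
  then show ?thesis using 1 2 by (simp add: \<Phi>_mult dg_mult mult.commute)
qed

text \<open>Modulo \<open>\<pp>^l'\<close> the element is block-diagonal with an exact norm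
  equation, so this diagonal element lies in \<open>Cent r\<close>; dividing by it leaves an element
  of \<open>Kc l'\<close>.\<close>

lemma Cent_prod:
  assumes h: "h \<in> Cent l'"
  shows "\<exists>g\<in>Cent r. \<exists>x\<in>Kc l'. h = g \<star> x"
proof -
  obtain X \<gamma> c where X: "X \<in> \<E>" "h = \<Phi> r X" "\<gamma> \<in> UK" "c \<in> UF" "\<gamma> * \<iota> \<gamma> = \<e> (c ^ 2)" "X - dg \<gamma> c \<in> \<I> l'"
    using Cent_E[OF level(4) rl(3) h] by blast
  define g where "g = \<Phi> r (dg \<gamma> c)"
  have g: "g \<in> Cent r" unfolding g_def by (rule dg_Cent) (use X in simp_all)
  have dE: "dg \<gamma> c \<in> \<E>" using X K.unit_integral F.unit_integral by (intro dg_E0) auto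
  obtain Y Y' where Y: "g = \<Phi> r Y" "iv g = \<Phi> r Y'" "Y' * Y - 1 \<in> \<I> r" "Y \<in> \<E>" "Y' \<in> \<E>"
    using G_rep[OF Cent_G[OF g]] by metis
  have YD: "Y - dg \<gamma> c \<in> \<I> r" using \<Phi>_eq[OF Y(4) dE, of r] Y(1) g_def by simp
  define x where "x = iv g \<star> h"
  have gG: "g \<in> carrier G" "h \<in> carrier G" using Cent_G g h by auto
  have e: "Y' * X - 1 = Y' * ((X - dg \<gamma> c) - (Y - dg \<gamma> c)) + (Y' * Y - 1)" by (simp add: algebra_simps)
  have "(X - dg \<gamma> c) - (Y - dg \<gamma> c) \<in> \<I> l'" by (rule \<I>_closed(3)[OF X(6) \<I>_mono[OF YD rl(3)]])
  then have "Y' * X - 1 \<in> \<I> l'" unfolding e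
    by (rule \<I>_closed(2)[OF \<I>_mult(2)[OF Y(5)] \<I>_mono[OF Y(3) rl(3)]])
  moreover have "x = \<Phi> r (Y' * X)" using X Y by (simp add: x_def \<Phi>_mult)
  moreover have "x \<in> carrier G" using gG by (simp add: x_def)
  ultimately have "x \<in> Kc l'" using X Y rl(3) by (simp add: K_iff \<E>_closed)
  moreover have "h = g \<star> x" using gG by (simp add: x_def G.m_assoc[symmetric])
  ultimately show ?thesis using g by blast
qed

subsection \<open>The logarithmic character\<close>

definition T :: "('k \<times> 'f) aend \<Rightarrow> complex" where
  "T Z = tau D (tr Z / \<omega> ^ r)"

lemma T_add: "T (X + Y) = T X * T Y" by (simp add: T_def tr_add add_divide_distrib tau_add)
lemma T_one: "Z \<in> \<I> r \<Longrightarrow> T Z = 1"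
  unfolding T_def using tr_ideal[of Z r] F.ideal_shift0[of r "tr Z / \<omega> ^ r"] F.\<pi> by (intro tau_O) simp
lemma T_nz: "T Z \<noteq> 0" by (simp add: T_def tau_nz)
lemma T_cong: "X - Y \<in> \<I> r \<Longrightarrow> T X = T Y"
  using T_add[of "X - Y" Y] T_one[of "X - Y"] by simp
lemma T_comm: "X \<in> \<E> \<Longrightarrow> Y \<in> \<E> \<Longrightarrow> T (X * Y) = T (Y * X)"
  by (simp add: T_def tr_commute)
lemma T_uminus: "T (- X) * T X = 1"
  using T_add[of "- X" X] T_one[of 0] by (simp add: \<I>_closed)

definition hf :: "('k \<times> 'f) aend \<Rightarrow> ('k \<times> 'f) aend" where
  "hf X = sm (inverse 2) X"

lemma hf_simps: "hf (X + Y) = hf X + hf Y" "hf (X - Y) = hf X - hf Y" "hf (- X) = - hf X" "X * hf Y = hf (X * Y)"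
  by (simp_all only: hf_def sm_simps)

lemma hf_mult: "X \<in> \<E> \<Longrightarrow> Y \<in> \<E> \<Longrightarrow> hf X * Y = hf (X * Y)"
  by (simp only: hf_def sm_mult)

lemma hf_add: "hf X + hf X = X"
proof -
  have "hf X + hf X = sm (inverse 2 + inverse 2) X" by (simp only: sm_simps hf_def)
  also have "inverse 2 + inverse 2 = (1 :: 'f)" using two_nz by (metis mult_2 right_inverse)
  finally show ?thesis by (simp only: sm_simps)
qed

lemma hf_E: "X \<in> \<I> j \<Longrightarrow> hf X \<in> \<I> j"
  unfolding hf_def using half by (intro \<I>_closed F.unit_integral)

text \<open>The truncated logarithm of \<open>1 + A\<close>; its cubic term vanishes modulo \<open>\<pp>\<^sup>r\<close> because \<open>r \<le> 3 * l'\<close>.  It makes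
  \<open>\<psi>\<close> and the quadratic formula for \<open>psi_beta_rho\<close> instances of one function.\<close>

definition lg :: "('k \<times> 'f) aend \<Rightarrow> ('k \<times> 'f) aend" where
  "lg A = A - hf (A * A)"

lemma lg_cong:
  assumes "A - B \<in> \<I> r" "A \<in> \<E>" "B \<in> \<E>"
  shows "lg A - lg B \<in> \<I> r"
proof -
  have "lg A - lg B = (A - B) - hf (A * (A - B) + (A - B) * B)" by (simp add: lg_def algebra_simps hf_simps)
  then show ?thesis using assms by (simp add: \<I>_closed hf_E \<I>_mult)
qed

definition psf :: "('k \<times> 'f) aend \<Rightarrow> complex" where
  "psf X = T (lg (X - 1) * bt)"

lemma psf_cong: "X - Y \<in> \<I> r \<Longrightarrow> X \<in> \<E> \<Longrightarrow> Y \<in> \<E> \<Longrightarrow> psf X = psf Y"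
  unfolding psf_def
proof (rule T_cong)
  assume *: "X - Y \<in> \<I> r" "X \<in> \<E>" "Y \<in> \<E>"
  then have "lg (X - 1) - lg (Y - 1) \<in> \<I> r" by (intro lg_cong) (simp_all add: \<E>_closed)
  from \<I>_mult(1)[OF this bt_E] show "lg (X - 1) * bt - lg (Y - 1) * bt \<in> \<I> r" by (simp add: algebra_simps)
qed

lemma psf_nz: "psf X \<noteq> 0" by (simp add: psf_def T_nz)

text \<open>The defect of multiplicativity of \<open>psf\<close>: half a commutator, paired with
  \<beta>.\<close>

definition cc :: "('k \<times> 'f) aend \<Rightarrow> ('k \<times> 'f) aend \<Rightarrow> complex" where
  "cc A B = T (hf (A * B - B * A) * bt)"

lemma cube: "A \<in> \<I> l' \<Longrightarrow> B \<in> \<I> l' \<Longrightarrow> C \<in> \<I> l' \<Longrightarrow> A * (B * C) \<in> \<I> r"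
  using \<I>_mult2[of A l' "B * C" "l' + l'"] \<I>_mult2[of B l' C l'] rl(1)
  by (auto intro: \<I>_mono)

text \<open>The Baker-Campbell-Hausdorff formula to second order; the remaining terms
  \<open>R\<close> contain at least three factors of level \<open>l'\<close>.\<close>

lemma lg_mult:
  assumes A: "A \<in> \<I> l'" and B: "B \<in> \<I> l'"
  shows "lg (A + B + A * B) - (lg A + lg B + hf (A * B - B * A)) \<in> \<I> r"
proof -
  define R where "R = A * (A * B) + B * (A * B) + A * (B * A) + A * (B * B) + A * (B * (A * B))"
  have AB: "A * B \<in> \<I> l'" by (rule \<I>_mult(1)[OF A \<I>_\<E>[OF B]])
  have R: "R \<in> \<I> r" unfolding R_def using A B AB cube by (intro \<I>_closed) auto
  have "(A + B + A * B) * (A + B + A * B) = A * A + B * B + A * B + B * A + R"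
    by (simp add: R_def algebra_simps)
  then have "lg (A + B + A * B) - (lg A + lg B + hf (A * B - B * A)) = A * B - (hf (A * B) + hf (A * B)) - hf R"
    by (simp add: lg_def hf_simps algebra_simps)
  also have "\<dots> = - hf R" by (simp add: hf_add)
  finally show ?thesis using R by (simp add: \<I>_closed hf_E)
qed

lemma psf_mult:
  assumes X: "X - 1 \<in> \<I> l'" and Y: "Y - 1 \<in> \<I> l'"
  shows "psf (X * Y) = psf X * psf Y * cc (X - 1) (Y - 1)"
proof -
  let ?A = "X - 1" and ?B = "Y - 1"
  have e: "X * Y - 1 = ?A + ?B + ?A * ?B" by (simp add: algebra_simps)
  from \<I>_mult(1)[OF lg_mult[OF X Y] bt_E]
  have "lg (X * Y - 1) * bt - (lg ?A * bt + lg ?B * bt + hf (?A * ?B - ?B * ?A) * bt) \<in> \<I> r"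
    unfolding e by (simp only: left_diff_distrib distrib_right)
  then have "T (lg (X * Y - 1) * bt) = T (lg ?A * bt + lg ?B * bt + hf (?A * ?B - ?B * ?A) * bt)" by (rule T_cong)
  then show ?thesis by (simp only: psf_def cc_def T_add)
qed

text \<open>Cyclicity of the trace replaces the commutator of \<open>A\<close> and \<open>B\<close>
  by that of \<open>B\<close> and \<beta>.\<close>

lemma T_commutator:
  assumes "A \<in> \<E>" "B \<in> \<E>"
  shows "T ((A * B - B * A) * bt) = T (A * cm B)" and "cc A B = T (hf (A * cm B))"
proof -
  have "tr ((A * B - B * A) * bt) = tr (A * (B * bt)) - tr (B * (A * bt))" by (simp add: left_diff_distrib tr_diff mult.assoc)
  also have "tr (B * (A * bt)) = tr (A * (bt * B))" using tr_commute[of B "A * bt"] assms bt_E by (simp add: \<E>_closed mult.assoc)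
  finally have e: "tr ((A * B - B * A) * bt) = tr (A * cm B)" by (simp add: cm_def right_diff_distrib tr_diff)
  then show "T ((A * B - B * A) * bt) = T (A * cm B)" by (simp add: T_def)
  have "hf (A * B - B * A) * bt = hf ((A * B - B * A) * bt)" using assms bt_E by (intro hf_mult \<E>_closed)
  then show "cc A B = T (hf (A * cm B))" unfolding cc_def by (simp only: T_def hf_def tr_sm e)
qed

text \<open>By \<open>T_commutator\<close> the value depends on \<open>A * cm B\<close>, whose level
  is \<open>l' + l = r\<close>.\<close>

lemma cc_trivial:
  assumes A: "A \<in> \<I> l'" and B: "B \<in> \<E>" "cm B \<in> \<I> l"
  shows "cc A B = 1" "cc B A = 1"
proof -
  have "A * cm B \<in> \<I> r" using \<I>_mult2[OF A B(2)] level(1) by (simp add: add.commute)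
  then show 1: "cc A B = 1" unfolding T_commutator(2)[OF \<I>_\<E>[OF A] B(1)] by (intro T_one hf_E)
  have "hf (B * A - A * B) * bt = - (hf (A * B - B * A) * bt)" by (simp add: hf_simps algebra_simps)
  then have "cc B A * cc A B = 1" unfolding cc_def by (simp only: T_uminus)
  then show "cc B A = 1" using 1 by simp
qed

definition ps :: "('f, 'k) res_map \<Rightarrow> complex" where
  "ps k = (THE z. \<exists>X\<in>\<E>. k = \<Phi> r X \<and> z = psf X)"

lemma ps_\<Phi>: "X \<in> \<E> \<Longrightarrow> ps (\<Phi> r X) = psf X"
  unfolding ps_def
proof (rule the_equality)
  fix z assume X: "X \<in> \<E>" and "\<exists>Y\<in>\<E>. \<Phi> r X = \<Phi> r Y \<and> z = psf Y"
  then obtain Y where Y: "Y \<in> \<E>" "\<Phi> r X = \<Phi> r Y" "z = psf Y" by blast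
  then have "X - Y \<in> \<I> r" using \<Phi>_eq[OF X Y(1)] by simp
  then show "z = psf X" using psf_cong[of X Y] X Y by simp
qed auto

lemma ps_nz: "k \<in> carrier G \<Longrightarrow> ps k \<noteq> 0"
  using G_rep[of k] ps_\<Phi> psf_nz by metis

text \<open>The radical of the commutator pairing on \<open>Kc l'\<close>: \<open>cc_trivial\<close>
  gives one inclusion and \<open>nondeg_Zs\<close> the other.\<close>

definition Zs :: "('f, 'k) res_map set" where
  "Zs = Kc l' \<inter> Cent l"

lemma Zs_subgroup: "subgroup Zs G"
  unfolding Zs_def using K_subgroup Cent_subgroup rl by (intro G.subgroups_Inter_pair) auto

lemma Zs_E:
  assumes "z \<in> Zs"
  obtains X where "X \<in> \<E>" "z = \<Phi> r X" "X - 1 \<in> \<I> l'" "cm (X - 1) \<in> \<I> l"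
proof -
  have z: "z \<in> Kc l'" "z \<in> Cent l" using assms by (simp_all add: Zs_def)
  obtain X where X: "z = \<Phi> r X" "X \<in> \<E>" using G_rep[OF K_G[OF z(1)]] by metis
  show thesis using that[of X] X z rl by (simp add: K_iff Cent_iff cm_diff cm_one)
qed

lemma Kl_Zs: "Kc l \<subseteq> Zs"
  unfolding Zs_def using K_mono[of l' l] K_Cent[of l] rl level by auto

lemma K_E:
  assumes "j \<le> r" "k \<in> Kc j"
  obtains X \<nu> where "X \<in> \<E>" "k = \<Phi> r X" "X - 1 \<in> \<I> j" "sim r X \<nu>"
proof -
  obtain X \<nu> where X: "k = \<Phi> r X" "X \<in> \<E>" "sim r X \<nu>" using G_rep[OF K_G[OF assms(2)]] by metis
  then show thesis using that[of X] assms by (simp add: K_iff)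
qed

lemma ps_mult_Z:
  assumes y: "y \<in> Kc l'" and z: "z \<in> Zs"
  shows "ps (y \<star> z) = ps y * ps z" "ps (z \<star> y) = ps z * ps y"
proof -
  obtain Y where Y: "Y \<in> \<E>" "y = \<Phi> r Y" "Y - 1 \<in> \<I> l'" using K_E[OF rl(3) y] by metis
  obtain Z where Z: "Z \<in> \<E>" "z = \<Phi> r Z" "Z - 1 \<in> \<I> l'" "cm (Z - 1) \<in> \<I> l" using Zs_E[OF z] by metis
  have c: "cc (Y - 1) (Z - 1) = 1" "cc (Z - 1) (Y - 1) = 1" using cc_trivial[OF Y(3) \<I>_\<E>[OF Z(3)] Z(4)] by auto
  show "ps (y \<star> z) = ps y * ps z" "ps (z \<star> y) = ps z * ps y"
    using Y Z c psf_mult[OF Y(3) Z(3)] psf_mult[OF Z(3) Y(3)] by (simp_all add: \<Phi>_mult ps_\<Phi> \<E>_closed)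
qed

lemma Zs_norm:
  assumes y: "y \<in> Kc l'" and z: "z \<in> Zs"
  shows "y \<star> z \<star> iv y \<in> Zs"
proof -
  have yG: "y \<in> carrier G" and zK: "z \<in> Kc l'" using y z K_G by (auto simp: Zs_def)
  obtain Y Y' where Y: "y = \<Phi> r Y" "iv y = \<Phi> r Y'" "Y * Y' - 1 \<in> \<I> r" "Y' * Y - 1 \<in> \<I> r" "Y \<in> \<E>" "Y' \<in> \<E>"
    using G_rep[OF yG] by metis
  obtain Z where Z: "Z \<in> \<E>" "z = \<Phi> r Z" "Z - 1 \<in> \<I> l'" "cm (Z - 1) \<in> \<I> l" using Zs_E[OF z] by metis
  have B: "Y - 1 \<in> \<I> l'" using y Y rl by (simp add: K_iff)
  have B': "Y' - 1 \<in> \<I> l'" by (rule inverse_congr[OF Y(4) B Y(6) rl(3)])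
  \<comment> \<open>The change under conjugation consists of products of two factors of level
    \<open>l'\<close>, which lie in level \<open>l\<close> because
    \<open>l \<le> 2 * l'\<close>.\<close>
  define S where "S = (Y - 1) * (Z - 1) * Y' + (Z - 1) * (Y' - 1)"
  have S: "S \<in> \<I> l"
  proof -
    have "S \<in> \<I> (l' + l')" unfolding S_def 
      by (rule \<I>_closed(2)[OF \<I>_mult(1)[OF \<I>_mult2[OF B Z(3)] Y(6)] \<I>_mult2[OF Z(3) B']])
    then show ?thesis by (rule \<I>_mono) (use level in simp)
  qed
  have e: "Y * Z * Y' = (Y * Y' - 1) + 1 + (Z - 1) + S" by (simp add: S_def algebra_simps)
  have "cm (Y * Z * Y') \<in> \<I> l"
    unfolding e cm_add cm_one using Z(4) cm_E[OF S] \<I>_mono[OF cm_E[OF Y(3)] rl(2)] by (intro \<I>_closed)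
  moreover have "y \<star> z \<star> iv y = \<Phi> r (Y * Z * Y')" using Y Z by (simp add: \<Phi>_mult \<E>_closed)
  moreover have "y \<star> z \<star> iv y \<in> carrier G" using yG K_G[OF zK] by simp
  ultimately show ?thesis using K_normal[OF rl(3) yG zK] Y Z rl by (simp add: Zs_def Cent_iff \<E>_closed)
qed

lemma ps_conj_Z:
  assumes y: "y \<in> Kc l'" and z: "z \<in> Zs"
  shows "ps (y \<star> z \<star> iv y) = ps z"
proof -
  let ?z = "y \<star> z \<star> iv y"
  have g: "y \<in> carrier G" "z \<in> carrier G" using y z K_G by (auto simp: Zs_def)
  have "?z \<star> y = y \<star> z" using g by (simp add: G.m_assoc)
  then have "ps ?z * ps y = ps z * ps y"
    using ps_mult_Z(2)[OF y Zs_norm[OF y z]] ps_mult_Z(1)[OF y z] mult.commute[of "ps y" "ps z"] by metis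
  then show ?thesis using ps_nz[OF g(1)] mult_right_cancel by blast
qed

text \<open>Up to the factor \<open>Y' * X'\<close> and terms of level \<open>r\<close>, the
  difference from 1 is the ring commutator of \<open>Y - 1\<close> and \<open>X - 1\<close>.\<close>

lemma commutator_Zs:
  assumes x: "x \<in> Kc l'" and y: "y \<in> Kc l'"
  obtains W where "W \<in> \<E>" "y \<star> x \<star> iv y \<star> iv x = \<Phi> r W" "W - 1 \<in> \<I> (2 * l')"
    "y \<star> x \<star> iv y \<star> iv x \<in> Kc l"
proof -
  have yG: "y \<in> carrier G" and xG: "x \<in> carrier G" using x y K_G by auto
  obtain Y Y' where Y: "y = \<Phi> r Y" "iv y = \<Phi> r Y'" "Y * Y' - 1 \<in> \<I> r" "Y \<in> \<E>" "Y' \<in> \<E>"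
    using G_rep[OF yG] by metis
  obtain X X' where X: "x = \<Phi> r X" "iv x = \<Phi> r X'" "X * X' - 1 \<in> \<I> r" "X \<in> \<E>" "X' \<in> \<E>"
    using G_rep[OF xG] by metis
  have B: "Y - 1 \<in> \<I> l'" "X - 1 \<in> \<I> l'" using x y X Y rl by (simp_all add: K_iff)
  let ?r = "min r (2 * l')"
  have e: "Y * X * Y' * X' - 1 = ((Y - 1) * (X - 1) - (X - 1) * (Y - 1)) * (Y' * X') + (X * (Y * Y' - 1) * X' + (X * X' - 1))"
    by (simp add: algebra_simps)
  have 1: "((Y - 1) * (X - 1) - (X - 1) * (Y - 1)) * (Y' * X') \<in> \<I> (l' + l')"

    by (rule \<I>_mult(1)[OF \<I>_closed(3)[OF \<I>_mult2[OF B] \<I>_mult2[OF B(2,1)]] \<E>_closed(5)[OF Y(5) X(5)]])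
  have 2: "X * (Y * Y' - 1) * X' + (X * X' - 1) \<in> \<I> r"
    by (rule \<I>_closed(2)[OF \<I>_mult(1)[OF \<I>_mult(2)[OF X(4) Y(3)] X(5)] X(3)])
  have "2 * l' \<le> r" using level by simp
  then have W: "Y * X * Y' * X' - 1 \<in> \<I> (2 * l')"
    unfolding e using \<I>_closed(2)[OF 1 \<I>_mono[OF 2, of "l' + l'"]] by (simp add: mult_2)
  have f: "y \<star> x \<star> iv y \<star> iv x = \<Phi> r (Y * X * Y' * X')"
    using X Y by (simp add: \<Phi>_mult \<E>_closed)
  moreover have "y \<star> x \<star> iv y \<star> iv x \<in> carrier G" using xG yG by simp
  ultimately have "y \<star> x \<star> iv y \<star> iv x \<in> Kc l"
    using \<I>_mono[OF W level(3)] X Y rl by (simp add: K_iff \<E>_closed)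
  then show thesis using that[of "Y * X * Y' * X'"] f W X Y by (simp add: \<E>_closed)
qed

text \<open>The correction \<open>cc\<close> enters the values at the two products of
  \<open>\<Phi> r X\<close> and \<open>\<Phi> r Y\<close> with opposite signs, so in their quotient
  the two halves add up to the full commutator.\<close>

lemma ps_commutator:
  assumes x: "\<Phi> r X \<in> Kc l'" "X \<in> \<E>" and y: "\<Phi> r Y \<in> Kc l'" "Y \<in> \<E>"
  shows "ps (\<Phi> r Y \<star> \<Phi> r X \<star> iv (\<Phi> r Y) \<star> iv (\<Phi> r X)) = T ((Y - 1) * cm X)"
proof -
  let ?x = "\<Phi> r X" and ?y = "\<Phi> r Y"
  let ?k = "?y \<star> ?x \<star> iv ?y \<star> iv ?x"
  have G: "?x \<in> carrier G" "?y \<in> carrier G" using x y K_G by auto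
  have k: "?k \<in> Zs" using commutator_Zs[OF x(1) y(1)] Kl_Zs by blast
  have xy: "?x \<star> ?y \<in> Kc l'" using x y subgroup.m_closed[OF K_subgroup[OF rl(3)]] by blast
  have e: "?y \<star> ?x = ?k \<star> (?x \<star> ?y)" 
  proof -
    have "iv ?x \<star> (?x \<star> ?y) = ?y" using G by (simp add: G.m_assoc[symmetric])
    then show ?thesis using G by (simp add: G.m_assoc)
  qed
  have A: "X - 1 \<in> \<I> l'" "Y - 1 \<in> \<I> l'" using x y rl by (simp_all add: K_iff)
  have "ps (?y \<star> ?x) = ps ?k * ps (?x \<star> ?y)" by (rule trans[OF arg_cong[OF e, of ps] ps_mult_Z(2)[OF xy k]])
  then have 1: "psf Y * psf X * cc (Y - 1) (X - 1) = ps ?k * (psf X * psf Y * cc (X - 1) (Y - 1))"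
    using x y psf_mult[OF A] psf_mult[OF A(2,1)] by (simp add: \<Phi>_mult ps_\<Phi> \<E>_closed)
  let ?Q = "hf ((Y - 1) * (X - 1) - (X - 1) * (Y - 1)) * bt"
  have "hf ((X - 1) * (Y - 1) - (Y - 1) * (X - 1)) * bt = - ?Q" by (simp add: hf_simps algebra_simps)
  then have 2: "cc (X - 1) (Y - 1) * cc (Y - 1) (X - 1) = 1" unfolding cc_def by (simp only: T_uminus)
  have "psf Y * psf X * cc (Y - 1) (X - 1) * cc (Y - 1) (X - 1) =
      ps ?k * (psf X * psf Y * cc (X - 1) (Y - 1)) * cc (Y - 1) (X - 1)" unfolding 1 by simp
  also have "\<dots> = ps ?k * (psf X * psf Y) * (cc (X - 1) (Y - 1) * cc (Y - 1) (X - 1))" by (simp only: mult_ac)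
  finally have "(psf X * psf Y) * (cc (Y - 1) (X - 1) * cc (Y - 1) (X - 1)) = (psf X * psf Y) * ps ?k"
    unfolding 2 by (simp add: mult_ac)
  then have "ps ?k = cc (Y - 1) (X - 1) * cc (Y - 1) (X - 1)" using psf_nz by simp
  also have "\<dots> = T (?Q + ?Q)" by (simp only: cc_def T_add)
  also have "?Q + ?Q = ((Y - 1) * (X - 1) - (X - 1) * (Y - 1)) * bt" by (simp only: distrib_right[symmetric] hf_add)
  also have "T \<dots> = T ((Y - 1) * cm (X - 1))" using A by (intro T_commutator) (auto intro: \<I>_\<E>)
  finally show ?thesis by (simp add: cm_diff cm_one)
qed

lemma so_T:
  assumes "i + j = r" "Y \<in> so" "C \<in> \<E>"
  shows "T (sm (\<omega> ^ i) Y * C) = tau D (tr (Y * C) / \<omega> ^ j)"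
proof -
  have "sm (\<omega> ^ i) Y * C = sm (\<omega> ^ i) (Y * C)" by (rule sm_mult[OF so_E[OF assms(2)] assms(3)])
  then have "T (sm (\<omega> ^ i) Y * C) = tau D (\<omega> ^ i * tr (Y * C) / \<omega> ^ r)" by (simp only: T_def tr_sm)
  also have "\<omega> ^ r = \<omega> ^ i * \<omega> ^ j" unfolding assms(1)[symmetric] by (rule power_add)
  finally show ?thesis using F.\<pi> by simp
qed

text \<open>Truncated exponentials supply enough elements of \<open>K\<^bsub>l'\<^esub>\<close> for the nondegeneracy of the commutator pairing.\<close>

lemma exp_so:
  assumes Y: "Y \<in> so"
  defines "P \<equiv> sm (\<omega> ^ l') Y"
  shows "sim r (1 + P + hf (P * P)) 1" "P \<in> \<I> l'" "P \<in> so"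
proof -
  have wI: "\<omega> ^ l' \<in> IF 0" using F.\<pi>_power_mem by (rule F.ideal_mono) simp
  show Ps: "P \<in> so" unfolding P_def by (rule so_sm[OF Y wI])
  show Pl: "P \<in> \<I> l'" unfolding P_def using so_E[OF Y] by (simp add: \<I>_shift0)
  have PE: "P \<in> \<E>" using so_E[OF Ps] .
  define Q where "Q = P * P"
  have QE: "Q \<in> \<E>" unfolding Q_def using PE by (intro \<E>_closed)
  have hI: "inverse 2 \<in> IF 0" using F.unit_integral[OF half] .
  have QQ: "Q * Q \<in> \<I> r" unfolding Q_def mult.assoc using Pl PE by (intro cube) (auto intro: \<I>_mult)
  have adjQ: "\<F> (app Q u) w = \<F> u (app Q w)" for u w by (simp add: Q_def so_form[OF Ps])
  \<comment> \<open>As \<open>P\<close> is skew, the adjoint of its truncated exponential is the one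
    of \<open>- P\<close>, and the product of both is \<open>1 + P^4 / 4\<close>.\<close>
  have F: "\<F> (app (1 + P + hf Q) u) (app (1 + P + hf Q) w) - 1 * \<F> u w = inverse 2 * inverse 2 * \<F> u (app (Q * Q) w)" for u w
  proof -
    have 1: "\<F> (app (1 + P + hf Q) u) v = \<F> u v - \<F> u (app P v) + inverse 2 * \<F> u (app Q v)" for v
      by (simp only: form_add form_sc so_form[OF Ps] adjQ hf_def app_sm app_simps) simp
    have h: "inverse 2 * x + inverse 2 * x = x" for x :: 'f
      using two_nz by (metis mult.left_neutral distrib_right mult_2 right_inverse)
    have h2: "inverse 2 * x + (inverse 2 * x + z) = x + z" for x z :: 'f by (simp only: add.assoc[symmetric] h)
    have 2: "app P (app Q w) = app Q (app P w)" by (simp add: Q_def)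
    have 3: "app P (app P w) = app Q w" by (simp add: Q_def)
    show ?thesis
      unfolding 1 
      by (simp only: app_add form_add form_sc \<E>D(1)[OF PE] \<E>D(1)[OF QE] 2 3 app_simps hf_def app_sm)
        (simp only: algebra_simps h2 mult_1_left)
  qed
  have "1 + P + hf Q \<in> \<E>" unfolding hf_def using PE QE hI by (intro \<E>_closed)
  moreover have "\<F> (app (1 + P + hf Q) u) (app (1 + P + hf Q) w) - 1 * \<F> u w \<in> IF r" if "u \<in> L 0" "w \<in> L 0" for u w
    unfolding F using form_ideal'[OF that(1) \<I>D(2)[OF QQ that(2)]] hI by (intro F.ideal_multL) auto
  ultimately show "sim r (1 + P + hf (P * P)) 1" by (simp add: sim_def Q_def)
qed

text \<open>Were the pairing of \<open>x\<close> with all of \<open>Kc l'\<close> trivial, truncated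
  exponentials would show \<open>cm X\<close> to be orthogonal to every skew endomorphism. Since
  \<open>cm X\<close> is itself skew modulo \<open>\<pp>^l\<close>, it would vanish there, and
  \<open>x\<close> would lie in \<open>Zs\<close>.\<close>

lemma nondeg_Zs:
  assumes x: "x \<in> Kc l'" "x \<notin> Zs"
  shows "\<exists>y\<in>Kc l'. ps (y \<star> x \<star> iv y \<star> iv x) \<noteq> 1"
proof (rule ccontr)
  assume neg: "\<not> ?thesis"
  obtain X \<nu> where X: "X \<in> \<E>" "x = \<Phi> r X" "X - 1 \<in> \<I> l'" "sim r X \<nu>" using K_E[OF rl(3) x(1)] by metis
  have "lie l (X - 1) (\<nu> - 1)" using sim_lie[OF X(4,3) rl(2) level(3)] .
  from lie_skew[OF this] have sk: "skew l (cm X)" using cm_diff[of X 1] by (simp add: cm_one cm_def[symmetric])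
  have cX: "cm X \<in> \<I> l'" using cm_E[OF X(3)] by (simp add: cm_diff cm_one)
  have "cm X \<in> \<I> l"
  proof (rule so_nondeg_tau[OF sk])
    fix Y assume Y: "Y \<in> so"
    define P where "P = sm (\<omega> ^ l') Y"
    note E = exp_so[OF Y, folded P_def]
    define y where "y = 1 + P + hf (P * P)"
    have yE: "y \<in> \<E>" using E(1) by (simp add: sim_def y_def)
    have "y - 1 \<in> \<I> l'" unfolding y_def using E(2) by (simp add: \<I>_closed hf_E \<I>_mult \<I>_\<E>)
    then have yK: "\<Phi> r y \<in> Kc l'" using \<Phi>_G[OF E(1)] yE rl by (simp add: K_iff y_def)
    have "T ((y - 1) * cm X) = 1" using neg yK ps_commutator[OF _ X(1) yK yE] x X by auto
    \<comment> \<open>The quadratic term of the exponential contributes only a product of three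
      factors of level \<open>l'\<close>.\<close>
    moreover have "(y - 1) * cm X - P * cm X \<in> \<I> r"
    proof -
      have "(y - 1) * cm X - P * cm X = hf (P * P) * cm X" by (simp add: y_def algebra_simps)
      also have "\<dots> = hf (P * (P * cm X))"
        using so_E[OF E(3)] cX by (simp add: hf_mult \<E>_closed \<I>_\<E> mult.assoc)
      finally show ?thesis using cube[OF E(2) E(2) cX] by (simp add: hf_E)
    qed
    ultimately have "T (P * cm X) = 1" using T_cong by metis
    then show "tau D (tr (Y * cm X) / \<omega> ^ l) = 1"
      using so_T[of l' l Y "cm X"] Y cX level by (simp add: P_def \<I>_\<E> add.commute)
  qed
  then have "x \<in> Cent l" using X x K_G rl by (simp add: Cent_iff)
  then show False using x by (simp add: Zs_def)
qed

subsection \<open>The character psi beta\<close>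

text \<open>At level \<open>l\<close> the quadratic term of the logarithm has level
  \<open>2 * l\<close>, which is at least \<open>r\<close>.\<close>

lemma ps_l:
  assumes "C \<in> \<I> l"
  shows "psf (1 + C) = T (C * bt)"
proof -
  have "C * C \<in> \<I> r" using \<I>_mult2[OF assms assms] by (rule \<I>_mono) (use rl in simp)
  then have "lg (1 + C - 1) * bt - C * bt \<in> \<I> r"
    using \<I>_mult(1)[OF hf_E bt_E, of "C * C" r] \<I>_closed(4)[of "hf (C * C) * bt" r] by (simp add: lg_def algebra_simps)
  then show ?thesis unfolding psf_def by (rule T_cong)
qed

lemma lie_divide:
  assumes "lie (i + j) (sm (\<omega> ^ i) A) M" "A \<in> \<E>"
  obtains \<mu> where "lie j A \<mu>" "M = \<omega> ^ i * \<mu>"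
proof -
  have "M \<in> IF i" using lie_multiplier[OF assms(1), of i] assms(2) by (simp add: \<I>_shift0)
  then obtain \<mu> where \<mu>: "\<mu> \<in> IF 0" "M = \<omega> ^ i * \<mu>" by (rule F.idealE)
  have "lie j A \<mu>"
    unfolding lie_def
  proof (intro conjI ballI assms(2) \<mu>(1))
    fix u w assume "u \<in> L 0" "w \<in> L 0"
    then have "\<F> (app (sm (\<omega> ^ i) A) u) w + \<F> u (app (sm (\<omega> ^ i) A) w) - M * \<F> u w \<in> IF (i + j)"
      using assms(1) by (simp add: lie_def)
    then have "\<omega> ^ i * (\<F> (app A u) w + \<F> u (app A w) - \<mu> * \<F> u w) \<in> IF (i + j)"
      unfolding \<mu>(2) by (simp add: form_sc algebra_simps)
    then show "\<F> (app A u) w + \<F> u (app A w) - \<mu> * \<F> u w \<in> IF j" by (simp only: F.ideal_shift)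
  qed
  then show thesis using that \<mu>(2) by blast
qed

text \<open>The definition of \<open>psi_beta\<close> asks for an exact element of the Lie algebra.
  The similitude equation makes \<open>X - 1\<close> divided by \<open>\<omega> ^ l\<close> a Lie
  algebra element modulo \<open>\<pp>^l'\<close>, and \<open>lie_lift\<close> makes it exact; after
  multiplication by \<open>\<omega> ^ l\<close> the change has level \<open>r\<close>.\<close>

lemma psi_beta_eq:
  assumes k: "k \<in> Kc l"
  shows "psi_beta D r l l' k = ps k"
  unfolding psi_beta_def
proof (rule the_equality)
  have val: "tau D (trace_form D (lat Y) (beta D) / \<omega> ^ l') = psf (1 + sm (\<omega> ^ l) Y)" if Y: "Y \<in> \<E>" for Y
  proof -
    have "psf (1 + sm (\<omega> ^ l) Y) = T (sm (\<omega> ^ l) Y * bt)" using Y by (intro ps_l) (simp add: \<I>_shift0)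
    also have "\<dots> = tau D (tr (Y * bt) / \<omega> ^ l')"

    proof -
      have "T (sm (\<omega> ^ l) Y * bt) = tau D (\<omega> ^ l * tr (Y * bt) / \<omega> ^ r)" by (simp only: T_def tr_sm sm_mult[OF Y bt_E])
      also have "\<omega> ^ r = \<omega> ^ l * \<omega> ^ l'" unfolding level(1) by (rule power_add)
      finally show ?thesis using F.\<pi> by simp
    qed
    finally show ?thesis using Y bt_E by (simp add: lat_bt[symmetric] trace_form_eq)
  qed
  have one: "red_int D r (one_plus D l (lat Y)) = \<Phi> r (1 + sm (\<omega> ^ l) Y)" if "Y \<in> \<E>" for Y
    using that by (simp add: lat_ops red_int_lat)
  have E: "1 + sm (\<omega> ^ l) Y \<in> \<E>" if "Y \<in> \<E>" for Y
    using that F.ideal_mono[OF F.\<pi>_power_mem[of l], of 0] by (intro \<E>_closed) auto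
  {
    fix z assume "\<exists>X\<in>go_int D. k = red_int D r (one_plus D l X) \<and> z = tau D (trace_form D X (beta D) / \<omega> ^ l')"
    then obtain Y where Y: "Y \<in> \<E>" "k = red_int D r (one_plus D l (lat Y))" "z = tau D (trace_form D (lat Y) (beta D) / \<omega> ^ l')"
      unfolding go_int_eq by blast
    then show "z = ps k" using one[OF Y(1)] val[OF Y(1)] ps_\<Phi>[OF E[OF Y(1)]] by simp
  }
  obtain X \<nu> where X: "X \<in> \<E>" "k = \<Phi> r X" "X - 1 \<in> \<I> l" "sim r X \<nu>" using K_E[OF rl(2) k] by metis
  obtain A where A: "A \<in> \<E>" "X - 1 = sm (\<omega> ^ l) A" using \<I>_E[OF X(3)] by metis
  have li: "lie r (X - 1) (\<nu> - 1)" using sim_lie[OF X(4,3) order_refl rl(4)] .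
  obtain \<mu> where \<mu>: "lie l' A \<mu>" using lie_divide[of l l' A] li A level(1) by metis
  then obtain Y where Y: "Y \<in> \<E>" "Y - A \<in> \<I> l'" "\<And>u w. \<F> (app Y u) w + \<F> u (app Y w) = \<mu> * \<F> u w"
    using lie_lift by blast
  have "X - (1 + sm (\<omega> ^ l) Y) = - sm (\<omega> ^ l) (Y - A)" using A(2) by (simp add: sm_simps algebra_simps)
  also have "\<dots> \<in> \<I> r"
  proof -
    have "sm (\<omega> ^ l) (Y - A) \<in> \<I> (l + l')" using Y(2) by (simp only: \<I>_shift)
    then show ?thesis unfolding level(1) by (rule \<I>_closed(4))
  qed
  finally have "k = \<Phi> r (1 + sm (\<omega> ^ l) Y)" unfolding X(2) using \<Phi>_eq[OF X(1) E[OF Y(1)]] by simp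
  moreover have "\<mu> \<in> IF 0" using \<mu> by (simp add: lie_def)
  with Y have "lat Y \<in> go_int D" unfolding go_int_eq by blast
  ultimately show "\<exists>X\<in>go_int D. k = red_int D r (one_plus D l X) \<and> ps k = tau D (trace_form D X (beta D) / \<omega> ^ l')"
    using one[OF Y(1)] val[OF Y(1)] ps_\<Phi>[OF E[OF Y(1)]] by (intro bexI[of _ "lat Y"]) auto
qed

text \<open>A similitude multiplies both terms of the skew equation by its multiplier, so a
  conjugate of \<beta> is again skew.\<close>

lemma skew_conj:
  assumes X: "sim r X \<nu>" "X' \<in> \<E>" "X' * X - 1 \<in> \<I> r"
  shows "skew r (X' * bt * X - bt)"
  unfolding skew_def
proof (intro conjI ballI)
  have XE: "X \<in> \<E>" using X by (simp add: sim_def)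
  show "X' * bt * X - bt \<in> \<E>" using XE X(2) bt_E by (intro \<E>_closed)
  fix u w assume uw: "u \<in> L 0" "w \<in> L 0"
  let ?u = "app X' u" and ?w = "app X' w"
  have u': "?u \<in> L 0" "?w \<in> L 0" using uw \<E>D(2)[OF X(2)] by auto
  have b: "app bt ?u \<in> L 0" "app bt ?w \<in> L 0" using u' \<E>D(2)[OF bt_E] by auto
  have xb: "app X (app bt ?u) \<in> L 0" "app X (app bt ?w) \<in> L 0" using b \<E>D(2)[OF XE] by auto
  have d: "app X ?u - u \<in> L r" "app X ?w - w \<in> L r" using \<I>D(2)[OF X(3)] uw by auto
  have 1: "\<F> (app X (app bt ?u)) (app X ?w) - \<nu> * \<F> (app bt ?u) ?w \<in> IF r"
    and 2: "\<F> (app X ?u) (app X (app bt ?w)) - \<nu> * \<F> ?u (app bt ?w) \<in> IF r"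
    using X(1) u' b by (simp_all only: sim_def)
  have 3: "\<F> (app X (app bt ?u)) (app X ?w - w) \<in> IF r" "\<F> (app X ?u - u) (app X (app bt ?w)) \<in> IF r"
    using form_ideal'[OF xb(1) d(2)] form_ideal[OF d(1) xb(2)] .
  have f1: "\<F> (app bt ?u) ?w = - \<F> ?u (app bt ?w)" and f2: "\<F> (app bt u) w = - \<F> u (app bt w)" by (rule form_bt)+
  have "\<F> (app (X' * bt * X - bt) u) w + \<F> u (app (X' * bt * X - bt) w) =
    \<F> (app X (app bt ?u)) w - \<F> (app bt u) w + (\<F> u (app X (app bt ?w)) - \<F> u (app bt w))"
    by (simp only: app_simps form_diff)
  also have "\<dots> = (\<F> (app X (app bt ?u)) (app X ?w) - \<nu> * \<F> (app bt ?u) ?w)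
      + (\<F> (app X ?u) (app X (app bt ?w)) - \<nu> * \<F> ?u (app bt ?w))
      - (\<F> (app X (app bt ?u)) (app X ?w - w) + \<F> (app X ?u - u) (app X (app bt ?w)))"
    unfolding form_diff f1 f2 by (simp add: algebra_simps del: app_dg)
  also have "\<dots> \<in> IF r" by (rule F.ideal_diff[OF F.ideal_add[OF 1 2] F.ideal_add[OF 3]])
  finally show "\<F> (app (X' * bt * X - bt) u) w + \<F> u (app (X' * bt * X - bt) w) \<in> IF r" .
qed

text \<open>Conjugation by \<open>g\<close> changes \<open>ps\<close> at \<open>1 + C\<close> by the
  factor \<open>T (C * W)\<close>, where \<open>W\<close> is the difference between a conjugate of
  \<beta> and \<beta>. If all these factors are 1, then \<open>W\<close>, being skew, vanishes
  modulo \<open>\<pp>^l'\<close> by nondegeneracy.\<close>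

lemma stabilizer_ps: "g \<in> Cent l' \<longleftrightarrow> g \<in> carrier G \<and> (\<forall>k\<in>Kc l. ps (g \<star> k \<star> iv g) = ps k)"
proof (cases "g \<in> carrier G")
  case gG: True
  obtain X \<nu> X' where X: "g = \<Phi> r X" "iv g = \<Phi> r X'" "sim r X \<nu>" "sim r X' (inverse \<nu>)"
      "X * X' - 1 \<in> \<I> r" "X' * X - 1 \<in> \<I> r" "X \<in> \<E>" "X' \<in> \<E>" using G_rep[OF gG] .
  define W where "W = X' * bt * X - bt"
  have WE: "W \<in> \<E>" unfolding W_def using X bt_E by (intro \<E>_closed)
  have conj: "ps (g \<star> \<Phi> r (1 + C) \<star> iv g) = ps (\<Phi> r (1 + C)) * T (C * W)" if C: "C \<in> \<I> l" for C
  proof -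
    have CE: "C \<in> \<E>" using C by (rule \<I>_\<E>)
    have XC: "X * C * X' \<in> \<I> l" using C X by (intro \<I>_mult)
    have "g \<star> \<Phi> r (1 + C) \<star> iv g = \<Phi> r (X * (1 + C) * X')"
      using X CE by (simp add: \<Phi>_mult \<E>_closed)
    also have "\<dots> = \<Phi> r (1 + X * C * X')"
    proof -
      have e: "X * (1 + C) * X' - (1 + X * C * X') = X * X' - 1" by (simp add: algebra_simps)
      have "X * (1 + C) * X' \<in> \<E>" "1 + X * C * X' \<in> \<E>" using X CE by (simp_all add: \<E>_closed)
      from \<Phi>_eq[OF this] show ?thesis unfolding e using X(5) by blast
    qed
    finally have "ps (g \<star> \<Phi> r (1 + C) \<star> iv g) = T (X * C * X' * bt)"
      using X CE ps_l[OF XC] by (simp add: ps_\<Phi> \<E>_closed)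
    also have "\<dots> = T (C * (X' * bt * X))"
      using T_comm[of X "C * X' * bt"] X CE bt_E by (simp add: \<E>_closed mult.assoc)
    also have "\<dots> = T (C * bt + C * W)" by (simp add: W_def algebra_simps)
    finally show ?thesis using CE ps_l[OF C] by (simp add: T_add ps_\<Phi> \<E>_closed)
  qed
  show ?thesis
  proof
    assume g: "g \<in> Cent l'"
    have "cm X \<in> \<I> l'" using g X rl by (simp add: Cent_iff)
    from \<I>_closed(3)[OF \<I>_mult(1)[OF \<I>_mono[OF X(6) rl(3)] bt_E] \<I>_mult(2)[OF X(8) this]]
    have W: "W \<in> \<I> l'" by (simp add: W_def cm_def algebra_simps)
    have "ps (g \<star> k \<star> iv g) = ps k" if k: "k \<in> Kc l" for k
    proof -
      obtain Y where Y: "k = \<Phi> r Y" "Y - 1 \<in> \<I> l" using K_E[OF rl(2) k] by metis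
      have "T ((Y - 1) * W) = 1" using \<I>_mult2[OF Y(2) W] level(1) by (intro T_one) simp
      then show ?thesis using conj[OF Y(2)] Y by simp
    qed
    then show "g \<in> carrier G \<and> (\<forall>k\<in>Kc l. ps (g \<star> k \<star> iv g) = ps k)" using gG by blast
  next
    assume inv: "g \<in> carrier G \<and> (\<forall>k\<in>Kc l. ps (g \<star> k \<star> iv g) = ps k)"
    have "skew r W" unfolding W_def by (rule skew_conj[OF X(3,8,6)])
    then have sk: "skew l' W" using rl(3) by (auto simp: skew_def intro: F.ideal_mono)
    have W: "W \<in> \<I> l'"
    proof (rule so_nondeg_tau[OF sk])
      fix Y assume Y: "Y \<in> so"
      \<comment> \<open>Since \<open>C\<close> is skew and its square has level \<open>r\<close>,
        \<open>1 + C\<close> is an isometry modulo \<open>\<pp>^r\<close>.\<close>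
      define C where "C = sm (\<omega> ^ l) Y"
      have wI: "\<omega> ^ l \<in> IF 0" using F.\<pi>_power_mem by (rule F.ideal_mono) simp
      have Cs: "C \<in> so" unfolding C_def by (rule so_sm[OF Y wI])
      have C: "C \<in> \<I> l" unfolding C_def using so_E[OF Y] by (simp add: \<I>_shift0)
      have "C * C \<in> \<I> r" using \<I>_mult2[OF C C] by (rule \<I>_mono) (use rl in simp)
      then have "\<F> (app (1 + C) u) (app (1 + C) w) - 1 * \<F> u w \<in> IF r" if "u \<in> L 0" "w \<in> L 0" for u w
      proof -
        have "\<F> (app (1 + C) u) (app (1 + C) w) - 1 * \<F> u w = - \<F> u (app (C * C) w)"
          by (simp add: form_add so_form[OF Cs] app_add)
        also have "\<dots> \<in> IF r" unfolding F.ideal_uminus using form_ideal'[OF that(1) \<I>D(2)[OF \<open>C * C \<in> \<I> r\<close> that(2)]] .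
        finally show ?thesis .
      qed
      then have "sim r (1 + C) 1" using so_E[OF Cs] by (simp add: sim_def \<E>_closed)
      then have "\<Phi> r (1 + C) \<in> Kc l" using \<Phi>_G C rl so_E[OF Cs] by (simp add: K_iff \<E>_closed)
      then have "ps (\<Phi> r (1 + C)) * T (C * W) = ps (\<Phi> r (1 + C))" using inv conj[OF C] by simp
      then have "T (C * W) = 1" using ps_nz[OF K_G[OF \<open>\<Phi> r (1 + C) \<in> Kc l\<close>]] by simp
      then show "tau D (tr (Y * W) / \<omega> ^ l') = 1" using so_T[of l l' Y W] Y WE level(1) by (simp add: C_def)
    qed
    from \<I>_closed(3)[OF \<I>_mult(1)[OF \<I>_mono[OF X(5) rl(3)] \<E>_closed(5)[OF bt_E X(7)]] \<I>_mult(2)[OF X(7) W]]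
    have "cm X \<in> \<I> l'" by (simp add: W_def cm_def algebra_simps)
    then show "g \<in> Cent l'" using gG X rl by (simp add: Cent_iff)
  qed
qed (auto simp: Cent_def)

end

context go_level
begin

subsection \<open>The characters theta\<close>

abbreviation "\<Theta> \<equiv> theta_set D r l l'"
abbreviation "\<chi> \<equiv> theta_on_G_beta D r"

lemma fiber_iff: "(\<gamma>, c) \<in> carrier (U_fiber D r) \<longleftrightarrow>
    \<gamma> \<in> UK \<and> c \<in> UF \<and> (\<exists>u\<in>UF. \<gamma> * \<iota> \<gamma> = \<e> u \<and> u - c ^ 2 \<in> IF r)"
proof -
  have *: "\<e> u - \<e> (c ^ 2) \<in> \<e> ` IF r \<longleftrightarrow> u - c ^ 2 \<in> IF r" for u
    unfolding e_diff[symmetric] by (auto simp: e_inj)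
  have "(\<gamma>, c) \<in> carrier (U_fiber D r) \<longleftrightarrow>
      \<gamma> \<in> UK \<and> c \<in> UF \<and> (\<exists>u\<in>UF. \<gamma> * \<iota> \<gamma> = \<e> u) \<and> \<gamma> * \<iota> \<gamma> - \<e> (c ^ 2) \<in> \<e> ` IF r"
    by (auto simp: U_fiber_def U_KF_def)
  then show ?thesis using * by metis
qed

lemma fiber_exact: "\<gamma> \<in> UK \<Longrightarrow> c \<in> UF \<Longrightarrow> \<gamma> * \<iota> \<gamma> = \<e> (c ^ 2) \<Longrightarrow> (\<gamma>, c) \<in> carrier (U_fiber D r)"
  unfolding fiber_iff using F.unit_mult by (intro conjI bexI[of _ "c ^ 2"]) (auto simp: power2_eq_square)

lemma fiber_Cent:
  assumes "(\<gamma>, c) \<in> carrier (U_fiber D r)"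
  shows "\<Phi> r (dg \<gamma> c) \<in> Cent r" "dg \<gamma> c \<in> \<E>"
proof -
  obtain u where u: "\<gamma> \<in> UK" "c \<in> UF" "\<gamma> * \<iota> \<gamma> = \<e> u" "u - c ^ 2 \<in> IF r" using assms by (auto simp: fiber_iff)
  show "\<Phi> r (dg \<gamma> c) \<in> Cent r" using u by (intro dg_Cent) (simp_all only: e_diff[symmetric] e_ideal)
  show "dg \<gamma> c \<in> \<E>" using u K.unit_integral F.unit_integral by (intro dg_E0) auto
qed

lemma fiber_mult:
  assumes "(\<gamma>, c) \<in> carrier (U_fiber D r)" "(\<gamma>', c') \<in> carrier (U_fiber D r)"
  shows "(\<gamma> * \<gamma>', c * c') \<in> carrier (U_fiber D r)"
proof -
  obtain u where u: "\<gamma> \<in> UK" "c \<in> UF" "u \<in> UF" "\<gamma> * \<iota> \<gamma> = \<e> u" "u - c ^ 2 \<in> IF r" using assms(1) by (auto simp: fiber_iff)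
  obtain u' where u': "\<gamma>' \<in> UK" "c' \<in> UF" "u' \<in> UF" "\<gamma>' * \<iota> \<gamma>' = \<e> u'" "u' - c' ^ 2 \<in> IF r"
    using assms(2) by (auto simp: fiber_iff)
  have "\<gamma> * \<gamma>' * \<iota> (\<gamma> * \<gamma>') = (\<gamma> * \<iota> \<gamma>) * (\<gamma>' * \<iota> \<gamma>')" by (simp add: iot_mult)
  then have e: "\<gamma> * \<gamma>' * \<iota> (\<gamma> * \<gamma>') = \<e> (u * u')" unfolding u(4) u'(4) by (simp add: e_mult)
  have "u * u' - (c * c') ^ 2 = u * (u' - c' ^ 2) + (u - c ^ 2) * c' ^ 2" by (simp add: algebra_simps)
  also have "\<dots> \<in> IF r"
    using u u' F.unit_integral by (intro F.ideal_add F.ideal_multL[OF _ u'(5)] F.ideal_multR[OF u(5)] F.ideal_power) auto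
  finally show ?thesis
    unfolding fiber_iff using u u' e F.unit_mult K.unit_mult by (intro conjI bexI[of _ "u * u'"]) auto
qed

lemma theta_set_iff: "\<theta> \<in> \<Theta> \<longleftrightarrow> \<theta> \<in> char_set (U_fiber D r) \<and>
    (\<forall>\<gamma> a \<delta> b. (\<gamma>, a) \<in> carrier (U_fiber D r) \<longrightarrow> (\<delta>, b) \<in> carrier (U_fiber D r) \<longrightarrow>
      \<gamma> - \<delta> \<in> IK r \<longrightarrow> a - b \<in> IF r \<longrightarrow> \<theta> (\<gamma>, a) = \<theta> (\<delta>, b)) \<and>
    (\<forall>x\<in>IK 0. \<forall>y\<in>IF 0. (1 + \<e> \<omega> ^ l * x, 1 + \<omega> ^ l * y) \<in> carrier (U_fiber D r) \<longrightarrow>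
      \<theta> (1 + \<e> \<omega> ^ l * x, 1 + \<omega> ^ l * y) = tau D (Tr (\<b> * x) / \<omega> ^ l'))"
  unfolding theta_set_def carrier_O K.carrier_val_ring ext_trace_eq by (rule mem_Collect_eq)

lemma \<chi>_eq:
  assumes \<theta>: "\<theta> \<in> \<Theta>" and c: "(\<gamma>, c) \<in> carrier (U_fiber D r)"
  shows "\<chi> \<theta> (\<Phi> r (dg \<gamma> c)) = \<theta> (\<gamma>, c)"
  unfolding theta_on_G_beta_def
proof (rule the_equality)
  fix z assume "\<exists>(\<gamma>', c')\<in>carrier (U_fiber D r). \<Phi> r (dg \<gamma> c) = red_int D r (diag D \<gamma>' c') \<and> z = \<theta> (\<gamma>', c')"
  then obtain \<gamma>' c' where *: "(\<gamma>', c') \<in> carrier (U_fiber D r)" "\<Phi> r (dg \<gamma> c) = \<Phi> r (dg \<gamma>' c')" "z = \<theta> (\<gamma>', c')"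
    by (auto simp: lat_dg[symmetric] red_int_lat)
  then have "dg (\<gamma> - \<gamma>') (c - c') \<in> \<I> r"
    using \<Phi>_eq[OF fiber_Cent(2)[OF c] fiber_Cent(2)[OF *(1)]] by (simp add: dg_diff)
  then have "\<gamma> - \<gamma>' \<in> IK r" "c - c' \<in> IF r" by (simp_all add: dg_E_iff)
  then show "z = \<theta> (\<gamma>, c)" using c * \<theta> unfolding theta_set_iff by metis
next
  show "\<exists>(\<gamma>', c')\<in>carrier (U_fiber D r). \<Phi> r (dg \<gamma> c) = red_int D r (diag D \<gamma>' c') \<and> \<theta> (\<gamma>, c) = \<theta> (\<gamma>', c')"
    by (rule bexI[OF _ c]) (simp add: lat_dg[symmetric] red_int_lat)
qed

lemma \<chi>_mult:
  assumes \<theta>: "\<theta> \<in> \<Theta>" and g: "g \<in> Cent r" and h: "h \<in> Cent r"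
  shows "\<chi> \<theta> (g \<star> h) = \<chi> \<theta> g * \<chi> \<theta> h"
proof -
  obtain \<gamma> c where 1: "g = \<Phi> r (dg \<gamma> c)" "(\<gamma>, c) \<in> carrier (U_fiber D r)" using Cent_r_E[OF g] fiber_exact by metis
  obtain \<gamma>' c' where 2: "h = \<Phi> r (dg \<gamma>' c')" "(\<gamma>', c') \<in> carrier (U_fiber D r)" using Cent_r_E[OF h] fiber_exact by metis
  have "\<theta> ((\<gamma>, c) \<otimes>\<^bsub>U_fiber D r\<^esub> (\<gamma>', c')) = \<theta> (\<gamma>, c) * \<theta> (\<gamma>', c')"
    using \<theta> 1 2 by (intro char_setD(2)) (simp_all only: theta_set_iff)
  then have "\<theta> (\<gamma> * \<gamma>', c * c') = \<theta> (\<gamma>, c) * \<theta> (\<gamma>', c')" by (simp add: U_fiber_def)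
  then show ?thesis
    unfolding 1 2 using 1 2 \<theta> fiber_Cent fiber_mult by (simp add: \<Phi>_mult dg_mult \<chi>_eq)
qed

lemma psf_dg:
  assumes "x \<in> IK 0" "y \<in> IF 0"
  shows "psf (dg (1 + \<e> \<omega> ^ l * x) (1 + \<omega> ^ l * y)) = tau D (Tr (\<b> * x) / \<omega> ^ l')"
    and "dg (1 + \<e> \<omega> ^ l * x) (1 + \<omega> ^ l * y) - 1 \<in> \<I> l"
proof -
  have e: "dg (1 + \<e> \<omega> ^ l * x) (1 + \<omega> ^ l * y) = 1 + sm (\<omega> ^ l) (dg x y)"
    using dg_diff[of "1 + \<e> \<omega> ^ l * x" "1 + \<omega> ^ l * y" 1 1] by (simp add: dg_one dg_sm e_power diff_eq_eq add.commute)
  have S: "sm (\<omega> ^ l) (dg x y) \<in> \<I> l" using assms by (simp add: \<I>_shift0 dg_E0)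
  then show "dg (1 + \<e> \<omega> ^ l * x) (1 + \<omega> ^ l * y) - 1 \<in> \<I> l" unfolding e by simp
  have "T (sm (\<omega> ^ l) (dg x y) * bt) = tau D (\<omega> ^ l * Tr (\<b> * x) / \<omega> ^ r)"
    by (simp only: T_def tr_sm sm_mult[OF dg_E0[OF assms] bt_E] tr_dg_bt)
  also have "\<omega> ^ r = \<omega> ^ l * \<omega> ^ l'" unfolding level(1) by (rule power_add)
  finally show "psf (dg (1 + \<e> \<omega> ^ l * x) (1 + \<omega> ^ l * y)) = tau D (Tr (\<b> * x) / \<omega> ^ l')"
    unfolding e ps_l[OF S] using F.\<pi> by simp
qed

lemma \<chi>_Kl:
  assumes \<theta>: "\<theta> \<in> \<Theta>" and k: "k \<in> Cent r" "k \<in> Kc l"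
  shows "\<chi> \<theta> k = ps k"
proof -
  obtain \<gamma> c where c: "k = \<Phi> r (dg \<gamma> c)" "(\<gamma>, c) \<in> carrier (U_fiber D r)" using Cent_r_E[OF k(1)] fiber_exact by metis
  have "dg \<gamma> c - dg 1 1 \<in> \<I> l" using k(2) c fiber_Cent(2) rl(2) by (simp add: K_iff dg_one)
  then have i: "\<gamma> - 1 \<in> IK l" "c - 1 \<in> IF l" by (simp_all add: dg_diff dg_E_iff)
  obtain x where x: "x \<in> IK 0" "\<gamma> - 1 = \<e> \<omega> ^ l * x" using i(1) by (rule K.idealE)
  obtain y where y: "y \<in> IF 0" "c - 1 = \<omega> ^ l * y" using i(2) by (rule F.idealE)
  have gc: "\<gamma> = 1 + \<e> \<omega> ^ l * x" "c = 1 + \<omega> ^ l * y" using x y by (simp_all add: diff_eq_eq add.commute)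
  have "\<theta> (\<gamma>, c) = tau D (Tr (\<b> * x) / \<omega> ^ l')"
    using \<theta> c(2) x(1) y(1) unfolding gc theta_set_iff by blast
  then show ?thesis using psf_dg(1)[OF x(1) y(1)] ps_\<Phi>[OF fiber_Cent(2)[OF c(2)]] \<chi>_eq[OF \<theta> c(2)] unfolding gc c(1) by simp
qed

lemma psf_one: "psf 1 = 1"
  using ps_l[of 0] T_one[of 0] by (simp add: \<I>_closed)

lemma ps_one: "ps \<one>\<^bsub>G\<^esub> = 1"
  using psf_one ps_\<Phi>[of 1] by (simp add: GO_one \<E>_closed)

text \<open>\<theta> is \<chi>0 read on pairs. That it does not vanish follows from multiplicativity
  and the value 1 at the unit, which comes from \<open>ps\<close>.\<close>

lemma theta_exists:
  assumes mult: "\<And>g h. g \<in> Cent r \<Longrightarrow> h \<in> Cent r \<Longrightarrow> \<chi>0 (g \<star> h) = \<chi>0 g * \<chi>0 h"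
    and ps: "\<And>k. k \<in> Cent r \<Longrightarrow> k \<in> Kc l \<Longrightarrow> \<chi>0 k = ps k"
  shows "\<exists>\<theta>\<in>\<Theta>. \<forall>g\<in>Cent r. \<chi> \<theta> g = \<chi>0 g"
proof
  define \<theta> where "\<theta> = restrict (\<lambda>(\<gamma>, c). \<chi>0 (\<Phi> r (dg \<gamma> c))) (carrier (U_fiber D r))"
  have \<theta>: "\<theta> (\<gamma>, c) = \<chi>0 (\<Phi> r (dg \<gamma> c))" if "(\<gamma>, c) \<in> carrier (U_fiber D r)" for \<gamma> c
    using that by (simp add: \<theta>_def)
  interpret C: subgroup "Cent r" G by (rule Cent_subgroup) simp
  interpret K: subgroup "Kc l" G by (rule K_subgroup[OF rl(2)])
  have nz: "\<chi>0 g \<noteq> 0" if "g \<in> Cent r" for g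
    using mult[OF that C.m_inv_closed[OF that]] ps[OF C.one_closed K.one_closed] ps_one C.mem_carrier[OF that] by auto
  have "\<theta> \<in> char_set (U_fiber D r)"
  proof (rule char_setI)
    fix x assume x: "x \<in> carrier (U_fiber D r)"
    obtain \<gamma> c where xc: "x = (\<gamma>, c)" by (cases x)
    show "\<theta> x \<noteq> 0" using x fiber_Cent(1)[of \<gamma> c] nz unfolding xc by (simp add: \<theta>)
    fix y assume y: "y \<in> carrier (U_fiber D r)"
    obtain \<gamma>' c' where yc: "y = (\<gamma>', c')" by (cases y)
    have "x \<otimes>\<^bsub>U_fiber D r\<^esub> y = (\<gamma> * \<gamma>', c * c')" by (simp add: xc yc U_fiber_def)
    then show "\<theta> (x \<otimes>\<^bsub>U_fiber D r\<^esub> y) = \<theta> x * \<theta> y"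
      using x y fiber_mult[of \<gamma> c \<gamma>' c'] fiber_Cent[of \<gamma> c] fiber_Cent[of \<gamma>' c'] mult[of "\<Phi> r (dg \<gamma> c)" "\<Phi> r (dg \<gamma>' c')"]
      unfolding xc yc by (simp add: \<theta> \<Phi>_mult dg_mult)
  qed (simp add: \<theta>_def)
  moreover have "\<theta> (\<gamma>, a) = \<theta> (\<delta>, b)"
    if "(\<gamma>, a) \<in> carrier (U_fiber D r)" "(\<delta>, b) \<in> carrier (U_fiber D r)" "\<gamma> - \<delta> \<in> IK r" "a - b \<in> IF r" for \<gamma> a \<delta> b
  proof -
    have "\<Phi> r (dg \<gamma> a) = \<Phi> r (dg \<delta> b)"
      using \<Phi>_eq[OF fiber_Cent(2)[OF that(1)] fiber_Cent(2)[OF that(2)]] that(3,4) by (simp add: dg_diff dg_E)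
    then show ?thesis using that by (simp add: \<theta>)
  qed
  moreover have "\<theta> (1 + \<e> \<omega> ^ l * x, 1 + \<omega> ^ l * y) = tau D (Tr (\<b> * x) / \<omega> ^ l')"
    if xy: "x \<in> IK 0" "y \<in> IF 0" and c: "(1 + \<e> \<omega> ^ l * x, 1 + \<omega> ^ l * y) \<in> carrier (U_fiber D r)" for x y
  proof -
    let ?d = "dg (1 + \<e> \<omega> ^ l * x) (1 + \<omega> ^ l * y)"
    have "\<Phi> r ?d \<in> Kc l" using K_iff[OF rl(2) fiber_Cent(2)[OF c]] psf_dg(2)[OF xy] fiber_Cent(1)[OF c] Cent_G by blast
    then have "\<chi>0 (\<Phi> r ?d) = psf ?d" using ps[OF fiber_Cent(1)[OF c]] ps_\<Phi>[OF fiber_Cent(2)[OF c]] by simp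
    then show ?thesis unfolding \<theta>[OF c] psf_dg(1)[OF xy] .
  qed
  ultimately show "\<theta> \<in> \<Theta>"
    unfolding theta_set_iff by blast
  then show "\<forall>g\<in>Cent r. \<chi> \<theta> g = \<chi>0 g"
    using Cent_r_E fiber_exact \<chi>_eq \<theta> by metis
qed

lemma \<chi>_inj:
  assumes \<theta>: "\<theta> \<in> \<Theta>" "\<theta>' \<in> \<Theta>" and eq: "\<And>g. g \<in> Cent r \<Longrightarrow> \<chi> \<theta> g = \<chi> \<theta>' g"
  shows "\<theta> = \<theta>'"
proof (rule char_set_eqI)
  show "\<theta> \<in> char_set (U_fiber D r)" "\<theta>' \<in> char_set (U_fiber D r)" using \<theta> by (simp_all only: theta_set_iff)
  fix x assume "x \<in> carrier (U_fiber D r)"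
  then show "\<theta> x = \<theta>' x" using eq[OF fiber_Cent(1)] \<chi>_eq[OF \<theta>(1)] \<chi>_eq[OF \<theta>(2)] by (cases x) simp
qed

lemma clifford_level: "clifford G (Kc l) (Cent l') (psi_beta D r l l')"
proof (intro clifford.intro clifford_axioms.intro G.group_axioms)
  show "finite (carrier G)" by (rule finite_GO)
  show "subgroup (Kc l) G" by (rule K_subgroup[OF rl(2)])
  show "x \<star> n \<star> iv x \<in> Kc l" if "x \<in> carrier G" "n \<in> Kc l" for x n
    by (rule K_normal[OF rl(2) that])
  show "subgroup (Cent l') G" by (rule Cent_subgroup[OF rl(3)])
  show "Kc l \<subseteq> Cent l'" using K_Cent[OF rl(2)] Cent_mono[OF level(2)] by blast
  show "g \<in> Cent l' \<longleftrightarrow> g \<in> carrier G \<and> (\<forall>n\<in>Kc l. psi_beta D r l l' (g \<star> n \<star> iv g) = psi_beta D r l l' n)" for g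
    unfolding stabilizer_ps using K_normal[OF rl(2)] by (metis psi_beta_eq)
qed

lemma A_Zs: "Cent r \<inter> Kc l' \<subseteq> Zs"
  using Cent_mono[OF rl(2)] by (auto simp: Zs_def)

lemma Zs_carrier: "z \<in> Zs \<Longrightarrow> z \<in> carrier G" and Zs_K: "z \<in> Zs \<Longrightarrow> z \<in> Kc l'"
  using K_G by (auto simp: Zs_def)

subsection \<open>Even level\<close>

text \<open>The Heisenberg setting degenerates: \<open>N1\<close>, \<open>Z\<close> and
  \<open>N\<close> coincide, \<pi> is the one-dimensional representation \<open>ps\<close>,
  \<open>U\<close> is trivial, and there is only one extension. Nondegeneracy is vacuous.\<close>

theorem even_bij:
  assumes ev: "l' = l"
  shows "bij_betw (\<lambda>\<theta>. induced_class G (Cent l) 1 (sigma_even D r l l \<theta>)) \<Theta> (Irr_over G (Kc l) (psi_beta D r l l))"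
proof -
  interpret cl: clifford G "Kc l" "Cent l" "psi_beta D r l l" using clifford_level unfolding ev .
  interpret A: subgroup "Cent r" G by (rule Cent_subgroup) simp
  interpret N: subgroup "Kc l" G by (rule K_subgroup[OF rl(2)])
  have kk: "Kc l' = Kc l" using ev by simp
  have Z: "Zs = Kc l" using K_Cent[OF rl(2)] kk Zs_def by blast
  have psi: "psi_beta D r l l k = ps k" if "k \<in> Kc l" for k using psi_beta_eq[OF that] unfolding ev .
  have mult: "ps (x \<star> y) = ps x * ps y" if "x \<in> Kc l" "y \<in> Kc l" for x y
    using ps_mult_Z(1)[of x y] that unfolding Z kk by blast
  let ?\<pi> = "\<lambda>(p :: unit) k. ps k \<cdot>\<^sub>m 1\<^sub>m 1 :: complex mat"
  let ?U = "\<lambda>(p :: unit) (k :: ('f, 'k) res_map). 1\<^sub>m 1 :: complex mat"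
  let ?one = "\<lambda>\<theta> :: 'k \<times> 'f \<Rightarrow> complex. ()"
  interpret hc: heisenberg_clifford G "Kc l" "Cent l" "psi_beta D r l l" "Kc l" "Kc l" "Cent r" UNIV "\<lambda>_. 1" ?\<pi> ?U "\<lambda>_. ps"
    \<Theta> \<chi> ?one "sigma_even D r l l"
  proof (intro heisenberg_clifford.intro heisenberg_clifford_axioms.intro cl.clifford_axioms)
    show "subgroup (Kc l) G" "subgroup (Kc l) G" "subgroup (Cent r) G"
      by (rule N.subgroup_axioms A.subgroup_axioms)+
    show "Kc l \<subseteq> Kc l" "Kc l \<subseteq> Kc l" "Kc l \<subseteq> Cent l" "Cent r \<subseteq> Cent l"
      using K_Cent[OF rl(2)] Cent_mono[OF rl(2)] by auto
    show "g \<star> h = h \<star> g" if "g \<in> Cent r" "h \<in> Cent r" for g h by (rule Cent_r_comm[OF that])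
    show "\<exists>g\<in>Cent r. \<exists>x\<in>Kc l. h = g \<star> x" if "h \<in> Cent l" for h using Cent_prod that unfolding ev by blast
    show "iv g \<star> x \<star> g \<in> Kc l" if "g \<in> Cent r" "x \<in> Kc l" for g x
      by (rule K_normal'[OF rl(2) Cent_G[OF that(1)] that(2)])
    show "y \<star> z \<star> iv y \<in> Kc l" if "y \<in> Kc l" "z \<in> Kc l" for y z using that by simp
    show "rep_on G (Kc l) 1 (?\<pi> p)" for p :: unit
      unfolding rep_on_def
    proof (intro conjI ballI)
      show "?\<pi> p x \<in> carrier_mat 1 1" for x by simp
      show "?\<pi> p (x \<star> y) = ?\<pi> p x * ?\<pi> p y" if "x \<in> Kc l" "y \<in> Kc l" for x y
        unfolding mult[OF that] using scalar_mat_mult[of "?\<pi> p y" 1 "ps x"] by (simp only: smult_smult_times smult_carrier_mat one_carrier_mat)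
      show "?\<pi> p \<one>\<^bsub>G\<^esub> = 1\<^sub>m 1" by (auto simp only: ps_one intro!: eq_matI) simp_all
    qed
    show "irr_on (Kc l) 1 (?\<pi> p)" for p :: unit by (rule irr_on_1)
    show "contains_char (Kc l) 1 (?\<pi> p) ps" for p :: unit
      unfolding contains_char_def by (intro bexI[of _ "unit_vec 1 0"]) (auto simp: scalar_mat_vec)
    show "ps (y \<star> z \<star> iv y) = ps z" if "y \<in> Kc l" "z \<in> Kc l" for y z
      using ps_conj_Z[of y z] that unfolding Z kk by blast
    show "ps n = psi_beta D r l l n" if "n \<in> Kc l" for n using psi[OF that] by simp
    show "rep_on G (Cent r) 1 (?U p)" for p :: unit by (auto simp: rep_on_def)
    show "?\<pi> p (iv g \<star> x \<star> g) = ?U p (iv g) * ?\<pi> p x * ?U p g" if "g \<in> Cent r" "x \<in> Kc l" for p :: unit and g x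
    proof -
      have "iv g \<in> Cent l'" using Cent_mono[OF rl(3)] A.m_inv_closed[OF that(1)] by blast
      then have "ps (iv g \<star> x \<star> iv (iv g)) = ps x" using that(2) unfolding stabilizer_ps by blast
      then show ?thesis using Cent_G[OF that(1)] by simp
    qed
    show "\<exists>p\<in>UNIV. contains_char (Kc l) D' R ps" if "contains_char (Kc l) D' R (psi_beta D r l l)" for D' R
      using that psi unfolding contains_char_def by auto
    show "\<chi> t (g \<star> h) = \<chi> t g * \<chi> t h" if "t \<in> \<Theta>" "g \<in> Cent r" "h \<in> Cent r" for t g h by (rule \<chi>_mult[OF that])
    show "\<chi> t k = ps k" if "t \<in> \<Theta>" "k \<in> Cent r \<inter> Kc l" for t k using \<chi>_Kl that by blast
    show "\<exists>t\<in>\<Theta>. ?one t = p \<and> (\<forall>g\<in>Cent r. \<chi> t g = \<chi>0 g)"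
      if "\<And>g h. g \<in> Cent r \<Longrightarrow> h \<in> Cent r \<Longrightarrow> \<chi>0 (g \<star> h) = \<chi>0 g * \<chi>0 h"
        "\<And>k. k \<in> Cent r \<inter> Kc l \<Longrightarrow> \<chi>0 k = ps k" for p :: unit and \<chi>0
      using theta_exists[of \<chi>0] that by auto
    show "t = t'" if "t \<in> \<Theta>" "t' \<in> \<Theta>" "\<And>g. g \<in> Cent r \<Longrightarrow> \<chi> t g = \<chi> t' g" for t t' by (rule \<chi>_inj[OF that])
    show "sigma_even D r l l t (g \<star> x) = \<chi> t g \<cdot>\<^sub>m (?U (?one t) g * ?\<pi> (?one t) x)"
      if t: "t \<in> \<Theta>" and gx: "g \<in> Cent r" "x \<in> Kc l" for t g x
    proof -
      have "sigma_even D r l l t (g \<star> x) = (\<chi> t g * psi_beta D r l l x) \<cdot>\<^sub>m 1\<^sub>m 1"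
        unfolding sigma_even_def G_beta_eq
      proof (rule G.the_factorization[OF A.subgroup_axioms N.subgroup_axioms _ gx])
        fix g k x assume g: "g \<in> Cent r" and k: "k \<in> Cent r \<inter> Kc l" and x: "x \<in> Kc l"
        have "\<chi> t (g \<star> k) = \<chi> t g * ps k" using \<chi>_mult[OF t g] \<chi>_Kl[OF t] k by simp
        then show "(\<chi> t (g \<star> k) * psi_beta D r l l x) \<cdot>\<^sub>m 1\<^sub>m 1 = (\<chi> t g * psi_beta D r l l (k \<star> x)) \<cdot>\<^sub>m 1\<^sub>m 1"
          using k x by (simp add: psi mult mult.assoc)
      qed
      then show ?thesis using gx by (simp add: psi smult_smult_times)
    qed
  qed (auto)
  show ?thesis using hc.heisenberg_clifford_bij .
qed

end

subsection \<open>Odd level\<close>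

locale go_odd = go_level +
  assumes odd_level: "l = Suc l'"
begin

lemma l_l': "l = l' + 1" "l - 1 = l'" using odd_level by simp_all

text \<open>Inverse of the map from \<open>Y\<close> to \<open>1 + sm (\<omega> ^ l') Y\<close>; the
  division takes place in the ambient space.\<close>

definition yb :: "('b \<times> 'a) aend \<Rightarrow> ('b \<times> 'a) aend" where
  "yb X = sm (inverse (\<omega> ^ l')) (X - 1)"

lemma sm_yb: "sm (\<omega> ^ l') (yb X) = X - 1" "sm (\<omega> ^ l') (yb X - yb X') = X - X'"
proof -
  show *: "sm (\<omega> ^ l') (yb X) = X - 1" for X
    by (simp only: yb_def sm_simps right_inverse[OF F.\<pi>_power_nz])
  show "sm (\<omega> ^ l') (yb X - yb X') = X - X'" by (simp only: sm_simps(2) *) simp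
qed

lemma yb_one_plus: "yb (1 + sm (\<omega> ^ l') Y) = Y"
proof -
  have "yb (1 + sm (\<omega> ^ l') Y) = sm (inverse (\<omega> ^ l')) (sm (\<omega> ^ l') Y)" by (simp only: yb_def add_diff_cancel_left')
  also have "\<dots> = Y" by (simp only: sm_simps left_inverse[OF F.\<pi>_power_nz])
  finally show ?thesis .
qed

lemma yb_E: "X - 1 \<in> \<I> l' \<longleftrightarrow> yb X \<in> \<E>"
  using \<I>_shift0[of l' "yb X"] by (simp only: sm_yb)

lemma yb_cong: "X - X' \<in> \<I> l \<longleftrightarrow> yb X - yb X' \<in> \<I> 1"
  using \<I>_shift[of l' "yb X - yb X'" 1] by (simp only: sm_yb l_l'(1))

text \<open>A homomorphism from \<open>Kc l'\<close> to the additive group of endomorphisms over the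
  residue field, with kernel \<open>Kc l\<close>. It identifies \<open>Zs\<close> modulo
  \<open>Kc l\<close> with the residual centralizer \<open>lie_beta_res D\<close>.\<close>

definition yv :: "('a, 'b) res_map \<Rightarrow> ('a, 'b) res_map" where
  "yv k = (THE y. \<exists>X\<in>\<E>. X - 1 \<in> \<I> l' \<and> k = \<Phi> r X \<and> y = \<Phi> 1 (yb X))"

lemma yv_\<Phi>:
  assumes X: "X \<in> \<E>" "X - 1 \<in> \<I> l'"
  shows "yv (\<Phi> r X) = \<Phi> 1 (yb X)"
  unfolding yv_def
proof (rule the_equality)
  fix y assume "\<exists>X'\<in>\<E>. X' - 1 \<in> \<I> l' \<and> \<Phi> r X = \<Phi> r X' \<and> y = \<Phi> 1 (yb X')"
  then obtain X' where X': "X' \<in> \<E>" "X' - 1 \<in> \<I> l'" "\<Phi> r X = \<Phi> r X'" "y = \<Phi> 1 (yb X')" by blast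
  have "X - X' \<in> \<I> l" using \<I>_mono[OF _ rl(2)] \<Phi>_eq[OF X(1) X'(1)] X'(3) by blast
  then have "yb X - yb X' \<in> \<I> 1" by (simp only: yb_cong)
  then show "y = \<Phi> 1 (yb X)" using \<Phi>_eq X X' yb_E by metis
qed (use X in blast)

lemma lie_beta_add_simps: "carrier (lie_beta_add D) = lie_beta_res D"
  "Y \<in> \<E> \<Longrightarrow> Y' \<in> \<E> \<Longrightarrow> \<Phi> 1 Y \<otimes>\<^bsub>lie_beta_add D\<^esub> \<Phi> 1 Y' = \<Phi> 1 (Y + Y')"
proof -
  show "carrier (lie_beta_add D) = lie_beta_res D" by (simp add: lie_beta_add_def)
  assume Y: "Y \<in> \<E>" "Y' \<in> \<E>"
  show "\<Phi> 1 Y \<otimes>\<^bsub>lie_beta_add D\<^esub> \<Phi> 1 Y' = \<Phi> 1 (Y + Y')"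
  proof (rule extensional_eqI)
    show "\<Phi> 1 Y \<otimes>\<^bsub>lie_beta_add D\<^esub> \<Phi> 1 Y' \<in> extensional (carrier (V 1))" by (simp add: lie_beta_add_def)
    show "\<Phi> 1 (Y + Y') \<in> extensional (carrier (V 1))" by (rule \<Phi>_ext)
    show "(\<Phi> 1 Y \<otimes>\<^bsub>lie_beta_add D\<^esub> \<Phi> 1 Y') (qq 1 u) = \<Phi> 1 (Y + Y') (qq 1 u)" if "u \<in> L 0" for u
      using that Y carrier_VI[OF that, of 1] by (simp add: lie_beta_add_def \<Phi>_qq V_add \<E>_closed)
  qed
qed

lemma yv_mult:
  assumes k: "k \<in> Kc l'" "k' \<in> Kc l'"
  shows "yv (k \<star> k') = yv k \<otimes>\<^bsub>lie_beta_add D\<^esub> yv k'"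
proof -
  obtain X where X: "X \<in> \<E>" "k = \<Phi> r X" "X - 1 \<in> \<I> l'" using K_E[OF rl(3) k(1)] by metis
  obtain X' where X': "X' \<in> \<E>" "k' = \<Phi> r X'" "X' - 1 \<in> \<I> l'" using K_E[OF rl(3) k(2)] by metis
  have XX: "X * X' \<in> \<E>" using X X' by (intro \<E>_closed)
  have e: "X * X' - 1 = (X - 1) + (X' - 1) + (X - 1) * (X' - 1)" by (simp add: algebra_simps)
  have XX1: "X * X' - 1 \<in> \<I> l'"
    unfolding e by (rule \<I>_closed(2)[OF \<I>_closed(2)[OF X(3) X'(3)] \<I>_mult(1)[OF X(3) \<I>_\<E>[OF X'(3)]]])
  have "sm (\<omega> ^ l') (yb (X * X') - (yb X + yb X')) = (X * X' - 1) - ((X - 1) + (X' - 1))"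
    by (simp only: sm_simps(1,2) sm_yb(1))
  also have "\<dots> = (X - 1) * (X' - 1)" unfolding e by simp
  also have "\<dots> \<in> \<I> (l' + 1)" by (rule \<I>_mono[OF \<I>_mult2[OF X(3) X'(3)]]) (use level in simp)
  finally have "yb (X * X') - (yb X + yb X') \<in> \<I> 1" by (simp only: \<I>_shift)
  moreover have y: "yb X \<in> \<E>" "yb X' \<in> \<E>" "yb (X * X') \<in> \<E>" using X(3) X'(3) XX1 by (simp_all only: yb_E)
  ultimately have "\<Phi> 1 (yb (X * X')) = \<Phi> 1 (yb X + yb X')" using \<Phi>_eq[OF y(3) \<E>_closed(3)[OF y(1,2)]] by blast
  then show ?thesis
    using X X' XX XX1 y by (simp only: \<Phi>_mult yv_\<Phi> lie_beta_add_simps)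
qed

lemma yv_eq_iff:
  assumes k: "k \<in> Kc l'" "k' \<in> Kc l'"
  shows "yv k = yv k' \<longleftrightarrow> k \<star> iv k' \<in> Kc l"
proof -
  obtain X where X: "X \<in> \<E>" "k = \<Phi> r X" "X - 1 \<in> \<I> l'" using K_E[OF rl(3) k(1)] by metis
  obtain X' X'' where X': "k' = \<Phi> r X'" "iv k' = \<Phi> r X''" "X' * X'' - 1 \<in> \<I> r" "X'' * X' - 1 \<in> \<I> r" "X' \<in> \<E>" "X'' \<in> \<E>"
    using G_rep[OF K_G[OF k(2)]] by metis
  have X'1: "X' - 1 \<in> \<I> l'" using k(2) X' rl by (simp add: K_iff)
  have "yv k = yv k' \<longleftrightarrow> X - X' \<in> \<I> l"
    using X X' X'1 \<Phi>_eq[of "yb X" "yb X'" 1] yb_E by (simp only: yv_\<Phi> yb_cong)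
  also have "\<dots> \<longleftrightarrow> X * X'' - 1 \<in> \<I> l"
  proof
    assume "X - X' \<in> \<I> l"
    moreover have e: "X * X'' - 1 = (X - X') * X'' + (X' * X'' - 1)" by (simp add: algebra_simps)
    ultimately show "X * X'' - 1 \<in> \<I> l"
      unfolding e using \<I>_closed(2)[OF \<I>_mult(1)[OF _ X'(6)] \<I>_mono[OF X'(3) rl(2)]] by blast
  next
    assume "X * X'' - 1 \<in> \<I> l"
    moreover have e: "X - X' = (X * X'' - 1) * X' - X * (X'' * X' - 1)" by (simp add: algebra_simps)
    ultimately show "X - X' \<in> \<I> l"
      unfolding e using \<I>_closed(3)[OF \<I>_mult(1)[OF _ X'(5)] \<I>_mult(2)[OF X(1) \<I>_mono[OF X'(4) rl(2)]]] by blast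
  qed
  also have "\<dots> \<longleftrightarrow> \<Phi> r (X * X'') \<in> Kc l"
  proof -
    have "\<Phi> r (X * X'') \<in> carrier G"
      using G.m_closed[OF K_G[OF k(1)] G.inv_closed[OF K_G[OF k(2)]]] X X' by (simp add: \<Phi>_mult)
    then show ?thesis using K_iff[OF rl(2) \<E>_closed(5)[OF X(1) X'(6)]] by blast
  qed
  also have "\<Phi> r (X * X'') = k \<star> iv k'" using X X' by (simp add: \<Phi>_mult)
  finally show ?thesis .
qed

lemma lie_cong: "lie j X \<mu> \<Longrightarrow> Y \<in> \<E> \<Longrightarrow> X - Y \<in> \<I> j \<Longrightarrow> lie j Y \<mu>"
  unfolding lie_def
proof (elim conjE, intro conjI ballI)
  fix u w assume *: "X - Y \<in> \<I> j" "\<forall>u\<in>L 0. \<forall>w\<in>L 0. \<F> (app X u) w + \<F> u (app X w) - \<mu> * \<F> u w \<in> IF j"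
    and uw: "u \<in> L 0" "w \<in> L 0"
  have "\<F> (app (X - Y) u) w \<in> IF j" "\<F> u (app (X - Y) w) \<in> IF j"
    using form_ideal[OF \<I>D(2)[OF *(1) uw(1)] uw(2)] form_ideal'[OF uw(1) \<I>D(2)[OF *(1) uw(2)]] .
  from F.ideal_diff[OF _ F.ideal_add[OF this], of "\<F> (app X u) w + \<F> u (app X w) - \<mu> * \<F> u w"]
  have "\<F> (app X u) w + \<F> u (app X w) - \<mu> * \<F> u w - (\<F> (app (X - Y) u) w + \<F> u (app (X - Y) w)) \<in> IF j"
    using * uw by blast
  then show "\<F> (app Y u) w + \<F> u (app Y w) - \<mu> * \<F> u w \<in> IF j" by (simp add: form_diff algebra_simps)
qed

lemma lie_beta_res_iff:
  assumes Y: "Y \<in> \<E>"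
  shows "\<Phi> 1 Y \<in> lie_beta_res D \<longleftrightarrow> (\<exists>\<mu>. lie 1 Y \<mu>) \<and> cm Y \<in> \<I> 1"
proof -
  have "\<Phi> 1 Y \<in> go_res D 1 \<longleftrightarrow> (\<exists>\<mu>. lie 1 Y \<mu>)"
  proof
    assume "\<Phi> 1 Y \<in> go_res D 1"
    then obtain X \<mu> where X: "\<Phi> 1 Y = \<Phi> 1 X" "lie 1 X \<mu>" unfolding go_res_eq by blast
    have XE: "X \<in> \<E>" using X by (simp add: lie_def)
    have "X - Y \<in> \<I> 1" using \<Phi>_eq[OF XE Y, of 1] X(1) by metis
    then show "\<exists>\<mu>. lie 1 Y \<mu>" using lie_cong[OF X(2) Y] by blast
  qed (auto simp: go_res_eq)
  moreover have "rcomp (V 1) (\<Phi> 1 Y) (red_int D 1 (beta D)) = rcomp (V 1) (red_int D 1 (beta D)) (\<Phi> 1 Y) \<longleftrightarrow> cm Y \<in> \<I> 1"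
    using Y bt_E by (simp add: lat_bt[symmetric] red_int_lat rcomp_\<Phi> \<Phi>_eq \<E>_closed cm_def)
  ultimately show ?thesis by (simp add: lie_beta_res_def)
qed

lemma cm_yb: "X \<in> \<E> \<Longrightarrow> X - 1 \<in> \<I> l' \<Longrightarrow> cm X \<in> \<I> l \<longleftrightarrow> cm (yb X) \<in> \<I> 1"
proof -
  assume X: "X \<in> \<E>" "X - 1 \<in> \<I> l'"
  have y: "yb X \<in> \<E>" using X(2) by (simp only: yb_E)
  have "sm (\<omega> ^ l') (cm (yb X)) = cm (sm (\<omega> ^ l') (yb X))"
    by (simp only: cm_def sm_simps(2) sm_mult[OF y bt_E] sm_simps(11))
  also have "\<dots> = cm X" by (simp only: sm_yb cm_diff cm_one) simp
  finally have "sm (\<omega> ^ l') (cm (yb X)) = cm X" .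
  then show ?thesis using \<I>_shift[of l' "cm (yb X)" 1] by (simp only: l_l'(1))
qed

text \<open>The similitude equation already makes \<open>yb X\<close> a Lie algebra element modulo
  \<pp>, so both sides express commutation with \<beta>.\<close>

lemma Zs_iff:
  assumes k: "\<Phi> r X \<in> Kc l'" and X: "X \<in> \<E>" "X - 1 \<in> \<I> l'"
  shows "\<Phi> r X \<in> Zs \<longleftrightarrow> \<Phi> 1 (yb X) \<in> lie_beta_res D"
proof -
  obtain X1 \<nu> where X1: "X1 \<in> \<E>" "\<Phi> r X = \<Phi> r X1" "sim r X1 \<nu>" using K_E[OF rl(3) k] by metis
  have "X1 - X \<in> \<I> r" using \<Phi>_eq[OF X1(1) X(1), of r] X1(2) by simp
  then have sX: "sim r X \<nu>" by (rule sim_cong[OF X1(3) X(1)])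
  have "lie l (X - 1) (\<nu> - 1)" using sim_lie[OF sX X(2) rl(2) level(3)] .
  then have "lie (l' + 1) (sm (\<omega> ^ l') (yb X)) (\<nu> - 1)" by (simp only: sm_yb l_l'(1))
  moreover have y: "yb X \<in> \<E>" using X(2) by (simp only: yb_E)
  ultimately obtain \<mu> where "lie 1 (yb X) \<mu>" using lie_divide by metis
  then show ?thesis
    using k K_G[OF k] unfolding Zs_def lie_beta_res_iff[OF y] cm_yb[OF X, symmetric] by (auto simp: Cent_iff[OF rl(2) X(1)])
qed

lemma red_one_plus: "Y \<in> \<E> \<Longrightarrow> red_int D r (one_plus D (l - 1) (lat Y)) = \<Phi> r (1 + sm (\<omega> ^ l') Y)"
  unfolding l_l'(2) by (simp add: lat_ops red_int_lat)

lemma one_plus_E: "Y \<in> \<E> \<Longrightarrow> 1 + sm (\<omega> ^ l') Y \<in> \<E>" "Y \<in> \<E> \<Longrightarrow> 1 + sm (\<omega> ^ l') Y - 1 \<in> \<I> l'"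
proof -
  assume Y: "Y \<in> \<E>"
  have S: "sm (\<omega> ^ l') Y \<in> \<I> l'" using Y by (simp add: \<I>_shift0)
  then show "1 + sm (\<omega> ^ l') Y - 1 \<in> \<I> l'" by simp
  show "1 + sm (\<omega> ^ l') Y \<in> \<E>" by (rule \<E>_closed(3)[OF \<E>_closed(2) \<I>_\<E>[OF S]])
qed

lemma Zs_rep:
  assumes "k \<in> Kc l'"
  obtains Y where "Y \<in> \<E>" "k = \<Phi> r (1 + sm (\<omega> ^ l') Y)" "yv k = \<Phi> 1 Y"
proof -
  obtain X where X: "X \<in> \<E>" "k = \<Phi> r X" "X - 1 \<in> \<I> l'" using K_E[OF rl(3) assms] by metis
  have "X = 1 + sm (\<omega> ^ l') (yb X)" by (simp only: sm_yb) simp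
  then show thesis using that[of "yb X"] X yv_\<Phi>[OF X(1,3)] yb_E by metis
qed

lemma Zs_yv: "k \<in> Zs \<longleftrightarrow> k \<in> Kc l' \<and> yv k \<in> lie_beta_res D"
proof (cases "k \<in> Kc l'")
  case True
  obtain X where X: "X \<in> \<E>" "k = \<Phi> r X" "X - 1 \<in> \<I> l'" using K_E[OF rl(3) True] by metis
  then show ?thesis using Zs_iff[of X] True yv_\<Phi>[OF X(1,3)] by simp
qed (simp add: Zs_def)

lemma Z_beta_eq: "Z_beta D r l = Zs"
proof -
  have *: "(\<exists>X\<in>module_end (O_F D) (lattice D). k = red_int D r (one_plus D (l - 1) X) \<and> red_int D 1 X \<in> lie_beta_res D)
    \<longleftrightarrow> yv k \<in> lie_beta_res D" if k: "k \<in> Kc l'" for k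
  proof
    assume "\<exists>X\<in>module_end (O_F D) (lattice D). k = red_int D r (one_plus D (l - 1) X) \<and> red_int D 1 X \<in> lie_beta_res D"
    then obtain Y where Y: "Y \<in> \<E>" "k = \<Phi> r (1 + sm (\<omega> ^ l') Y)" "\<Phi> 1 Y \<in> lie_beta_res D"
      unfolding module_end_lat using red_one_plus red_int_lat by auto
    then show "yv k \<in> lie_beta_res D" using yv_\<Phi>[OF one_plus_E[OF Y(1)]] yb_one_plus by simp
  next
    assume y: "yv k \<in> lie_beta_res D"
    obtain Y where Y: "Y \<in> \<E>" "k = \<Phi> r (1 + sm (\<omega> ^ l') Y)" "yv k = \<Phi> 1 Y" using Zs_rep[OF k] .
    show "\<exists>X\<in>module_end (O_F D) (lattice D). k = red_int D r (one_plus D (l - 1) X) \<and> red_int D 1 X \<in> lie_beta_res D"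
      unfolding module_end_lat using Y y red_one_plus[OF Y(1)] by (intro bexI[of _ "lat Y"]) (auto simp: red_int_lat)
  qed
  have "Z_beta D r l = {k \<in> Kc l'. \<exists>X\<in>module_end (O_F D) (lattice D).
      k = red_int D r (one_plus D (l - 1) X) \<and> red_int D 1 X \<in> lie_beta_res D}" unfolding Z_beta_def l_l'(2) ..
  then show ?thesis using * Zs_yv by blast
qed

text \<open>The exponents come from \<open>r = 2 * l' + 1\<close>: the linear term is divided by
  \<open>\<omega>^(r - l') = \<omega>^l\<close>, the quadratic one by
  \<open>\<omega>^(r - 2 * l') = \<omega>\<close>.\<close>

lemma psf_one_plus:
  assumes Y: "Y \<in> \<E>"
  shows "psf (1 + sm (\<omega> ^ l') Y) = tau D (tr (Y * bt) / \<omega> ^ l - tr (Y * Y * bt) / (2 * \<omega>))"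
proof -
  let ?w = "\<omega> ^ l'"
  have "lg (sm ?w Y) = sm ?w Y - sm (inverse 2 * (?w * ?w)) (Y * Y)"
    by (simp only: lg_def hf_def sm_simps sm_mult[OF Y Y])
  then have "tr (lg (sm ?w Y) * bt) = ?w * tr (Y * bt) - inverse 2 * (?w * ?w) * tr (Y * Y * bt)"
    by (simp only: left_diff_distrib sm_mult[OF Y bt_E] sm_mult[OF \<E>_closed(5)[OF Y Y] bt_E] tr_diff tr_sm)
  then have "psf (1 + sm ?w Y) = tau D ((?w * tr (Y * bt) - inverse 2 * (?w * ?w) * tr (Y * Y * bt)) / \<omega> ^ r)"
    by (simp only: psf_def T_def add_diff_cancel_left')
  also have "\<omega> ^ r = ?w * ?w * \<omega>" "\<omega> ^ l = ?w * \<omega>" unfolding level(1) l_l'(1) by (simp_all add: power_add)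
  then have "(?w * tr (Y * bt) - inverse 2 * (?w * ?w) * tr (Y * Y * bt)) / \<omega> ^ r =
      tr (Y * bt) / \<omega> ^ l - tr (Y * Y * bt) / (2 * \<omega>)"
    using F.\<pi> two_nz F.\<pi>_power_nz[of l'] by (simp add: field_simps)
  finally show ?thesis .
qed

lemma psi_beta_rho_eq:
  assumes k: "k \<in> Zs"
  shows "psi_beta_rho D r l \<rho> k = ps k * \<rho> (yv k)"
  unfolding psi_beta_rho_def
proof (rule the_equality)
  have val: "tau D (trace_form D (lat Y) (beta D) / \<omega> ^ l - trace_form D (rcomp (lattice D) (lat Y) (lat Y)) (beta D) / (2 * \<omega>))
      * \<rho> (red_int D 1 (lat Y)) = ps k * \<rho> (yv k)"
    if Y: "Y \<in> \<E>" "k = \<Phi> r (1 + sm (\<omega> ^ l') Y)" for Y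
  proof -
    have "trace_form D (lat Y) (beta D) = tr (Y * bt)" "trace_form D (rcomp (lattice D) (lat Y) (lat Y)) (beta D) = tr (Y * Y * bt)"
      using Y bt_E by (simp_all add: lat_bt[symmetric] lat_ops trace_form_eq \<E>_closed)
    moreover have "yv k = \<Phi> 1 Y" unfolding Y(2) yv_\<Phi>[OF one_plus_E[OF Y(1)]] yb_one_plus ..
    moreover have "ps k = tau D (tr (Y * bt) / \<omega> ^ l - tr (Y * Y * bt) / (2 * \<omega>))"
      unfolding Y(2) ps_\<Phi>[OF one_plus_E(1)[OF Y(1)]] psf_one_plus[OF Y(1)] ..
    ultimately show ?thesis by (simp only: red_int_lat)
  qed
  {
    fix z assume "\<exists>X\<in>module_end (O_F D) (lattice D). k = red_int D r (one_plus D (l - 1) X) \<and> red_int D 1 X \<in> lie_beta_res D \<and>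
      z = tau D (trace_form D X (beta D) / \<omega> ^ l - trace_form D (rcomp (lattice D) X X) (beta D) / (2 * \<omega>)) * \<rho> (red_int D 1 X)"
    then obtain Y where Y: "Y \<in> \<E>" "k = red_int D r (one_plus D (l - 1) (lat Y))"
      "z = tau D (trace_form D (lat Y) (beta D) / \<omega> ^ l - trace_form D (rcomp (lattice D) (lat Y) (lat Y)) (beta D) / (2 * \<omega>))
        * \<rho> (red_int D 1 (lat Y))" unfolding module_end_lat by blast
    then show "z = ps k * \<rho> (yv k)" using val[OF Y(1)] red_one_plus[OF Y(1)] by simp
  }
  have kK: "k \<in> Kc l'" and ky: "yv k \<in> lie_beta_res D" using k unfolding Zs_yv by auto
  obtain Y where Y: "Y \<in> \<E>" "k = \<Phi> r (1 + sm (\<omega> ^ l') Y)" "yv k = \<Phi> 1 Y" using Zs_rep[OF kK] .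
  show "\<exists>X\<in>module_end (O_F D) (lattice D). k = red_int D r (one_plus D (l - 1) X) \<and> red_int D 1 X \<in> lie_beta_res D \<and>
      ps k * \<rho> (yv k) = tau D (trace_form D X (beta D) / \<omega> ^ l - trace_form D (rcomp (lattice D) X X) (beta D) / (2 * \<omega>)) * \<rho> (red_int D 1 X)"
    unfolding module_end_lat using Y ky val[OF Y(1,2)] red_one_plus[OF Y(1)] by (intro bexI[of _ "lat Y"]) (auto simp: red_int_lat)
qed

text \<open>For a residual Lie algebra element \<open>Y\<close> that centralizes \<beta>, the lift
  \<open>1 + sm (\<omega> ^ l') Y\<close> is a similitude centralizing \<beta> modulo
  \<open>\<pp>^l\<close>. By \<open>sim_centralizer\<close> it is congruent there to an element of
  \<open>Cent r\<close>, and \<open>yv\<close> depends only on the class modulo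
  \<open>\<pp>^l\<close>.\<close>

lemma yv_surj:
  assumes y: "y \<in> lie_beta_res D"
  shows "\<exists>k\<in>Cent r \<inter> Kc l'. yv k = y"
proof -
  have "y \<in> go_res D 1" using y by (simp add: lie_beta_res_def)
  then obtain Y \<mu> where Y: "y = \<Phi> 1 Y" "lie 1 Y \<mu>" unfolding go_res_eq by blast
  have YE: "Y \<in> \<E>" and \<mu>: "\<mu> \<in> IF 0" using Y by (auto simp: lie_def)
  have cY: "cm Y \<in> \<I> 1" using y lie_beta_res_iff[OF YE] Y(1) by simp
  let ?w = "\<omega> ^ l'"
  define X where "X = 1 + sm ?w Y"
  have XE: "X \<in> \<E>" "X - 1 \<in> \<I> l'" unfolding X_def using one_plus_E[OF YE] by auto
  have yX: "yb X = Y" unfolding X_def by (rule yb_one_plus)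
  have w1: "?w * c \<in> IF 1" if "c \<in> IF 0" for c
    by (rule F.ideal_mono[of _ l']) (use that level(4) in \<open>simp_all add: F.ideal_shift0\<close>)
  have "sim l X (1 + ?w * \<mu>)"
    unfolding sim_def
  proof (intro conjI ballI XE)
    have "1 - (1 + ?w * \<mu>) \<in> IF 1" using w1[OF \<mu>] by simp
    then show "1 + ?w * \<mu> \<in> UF" by (rule F.unit_cong[OF F.unit_one])
    fix u w assume uw: "u \<in> L 0" "w \<in> L 0"
    have "\<F> (app X u) (app X w) - (1 + ?w * \<mu>) * \<F> u w =
      ?w * (\<F> (app Y u) w + \<F> u (app Y w) - \<mu> * \<F> u w + ?w * \<F> (app Y u) (app Y w))"
      by (simp add: X_def form_add form_sc algebra_simps)
    also have "\<dots> \<in> IF (l' + 1)"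
    proof -
      have "\<F> (app Y u) (app Y w) \<in> IF 0" using \<E>D(2)[OF YE] uw by (intro form_ideal)
      then have "?w * \<F> (app Y u) (app Y w) \<in> IF 1" by (rule w1)
      moreover have "\<F> (app Y u) w + \<F> u (app Y w) - \<mu> * \<F> u w \<in> IF 1" using Y(2) uw by (simp add: lie_def)
      ultimately show ?thesis unfolding F.ideal_shift by (rule F.ideal_add[rotated])
    qed
    finally show "\<F> (app X u) (app X w) - (1 + ?w * \<mu>) * \<F> u w \<in> IF l" unfolding l_l'(1) .
  qed
  moreover have "X * bt - bt * X \<in> \<I> l" using cm_yb[OF XE] cY unfolding yX cm_def by blast
  moreover have "1 \<le> l" using level by simp
  ultimately obtain \<gamma> c where \<gamma>: "\<gamma> \<in> UK" "c \<in> UF" "\<gamma> * \<iota> \<gamma> = \<e> (c ^ 2)" "X - dg \<gamma> c \<in> \<I> l"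
    using sim_centralizer by metis
  have k: "\<Phi> r (dg \<gamma> c) \<in> Cent r" "dg \<gamma> c \<in> \<E>" using fiber_Cent[OF fiber_exact[OF \<gamma>(1-3)]] .
  have e: "dg \<gamma> c - 1 = (X - 1) - (X - dg \<gamma> c)" by simp
  have d1: "dg \<gamma> c - 1 \<in> \<I> l'" unfolding e by (rule \<I>_closed(3)[OF XE(2) \<I>_mono[OF \<gamma>(4) level(2)]])
  have "\<Phi> r (dg \<gamma> c) \<in> Kc l'" using K_iff[OF rl(3) k(2)] d1 Cent_G[OF k(1)] by blast
  moreover have "yv (\<Phi> r (dg \<gamma> c)) = y"
  proof -
    have "yb X - yb (dg \<gamma> c) \<in> \<I> 1" using \<gamma>(4) by (simp only: yb_cong)
    then have "\<Phi> 1 (yb X) = \<Phi> 1 (yb (dg \<gamma> c))" using \<Phi>_eq yb_E XE(2) d1 by blast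
    then show ?thesis unfolding yv_\<Phi>[OF k(2) d1] Y(1) yX by simp
  qed
  ultimately show ?thesis using k(1) by blast
qed

end

context go_odd
begin

text \<open>The quotient of \<chi>0 by \<open>ps\<close> is multiplicative on \<open>B\<close> and
  trivial on \<open>Kc l\<close>, so it descends along \<open>yv\<close>. With \<open>B\<close> the
  intersection of \<open>Cent r\<close> and \<open>Kc l'\<close> this attaches \<rho> to \<theta>;
  with \<open>B = Zs\<close> it classifies the extensions of \<psi>.\<close>

lemma rho_exists:
  assumes B: "subgroup B G" "B \<subseteq> Zs" and surj: "\<And>y. y \<in> lie_beta_res D \<Longrightarrow> \<exists>k\<in>B. yv k = y"
    and mult: "\<And>g h. g \<in> B \<Longrightarrow> h \<in> B \<Longrightarrow> \<chi>0 (g \<star> h) = \<chi>0 g * \<chi>0 h"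
    and ps: "\<And>k. k \<in> B \<Longrightarrow> k \<in> Kc l \<Longrightarrow> \<chi>0 k = ps k"
  obtains \<rho> where "\<rho> \<in> char_set (lie_beta_add D)" "\<And>k. k \<in> B \<Longrightarrow> \<chi>0 k = psi_beta_rho D r l \<rho> k"
proof -
  interpret B: subgroup B G by (rule B)
  have BK: "k \<in> Kc l'" if "k \<in> B" for k using that B(2) by (auto simp: Zs_def)
  define f where "f k = \<chi>0 k / ps k" for k
  have f_mult: "f (g \<star> h) = f g * f h" if "g \<in> B" "h \<in> B" for g h
    using mult[OF that] ps_mult_Z(1)[OF BK[OF that(1)], of h] that B(2) by (auto simp: f_def)
  have f_l: "f k = 1" if "k \<in> B" "k \<in> Kc l" for k
    using ps[OF that] ps_nz[OF K_G[OF that(2)]] by (simp add: f_def)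
  have "\<one>\<^bsub>G\<^esub> \<in> Kc l" using subgroup.one_closed[OF K_subgroup[OF rl(2)]] .
  then have f_nz: "f k \<noteq> 0" if "k \<in> B" for k
    using f_mult[OF that B.m_inv_closed[OF that]] f_l[OF B.one_closed] B.mem_carrier[OF that] by auto
  have f_cong: "f k = f k'" if "k \<in> B" "k' \<in> B" "yv k = yv k'" for k k'
  proof -
    have kk: "k \<star> iv k' \<in> B" using that by simp
    have "k \<star> iv k' \<in> Kc l" using yv_eq_iff[OF BK[OF that(1)] BK[OF that(2)]] that(3) by blast
    then have "f (k \<star> iv k') = 1" by (rule f_l[OF kk])
    moreover have "k = (k \<star> iv k') \<star> k'" using that B.mem_carrier by (simp add: G.m_assoc)
    ultimately show ?thesis using f_mult[OF kk that(2)] by simp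
  qed
  define \<rho> where "\<rho> = restrict (\<lambda>y. f (SOME k. k \<in> B \<and> yv k = y)) (lie_beta_res D)"
  have lb: "yv k \<in> lie_beta_res D" if "k \<in> B" for k using that B(2) by (auto simp: Zs_yv)
  have \<rho>: "\<rho> (yv k) = f k" if k: "k \<in> B" for k
  proof -
    have "(SOME k'. k' \<in> B \<and> yv k' = yv k) \<in> B \<and> yv (SOME k'. k' \<in> B \<and> yv k' = yv k) = yv k"
      by (rule someI[of _ k]) (use k in simp)
    then have "f (SOME k'. k' \<in> B \<and> yv k' = yv k) = f k" using f_cong k by blast
    then show ?thesis using lb[OF k] by (simp only: \<rho>_def restrict_apply if_True)
  qed
  have "\<rho> \<in> char_set (lie_beta_add D)"
  proof (rule char_setI)
    fix y assume y: "y \<in> carrier (lie_beta_add D)"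
    obtain k where k: "k \<in> B" "yv k = y" using surj y by (auto simp: lie_beta_add_simps)
    show "\<rho> y \<noteq> 0" using \<rho>[OF k(1)] f_nz[OF k(1)] k(2) by simp
    fix y' assume y': "y' \<in> carrier (lie_beta_add D)"
    obtain k' where k': "k' \<in> B" "yv k' = y'" using surj y' by (auto simp: lie_beta_add_simps)
    have "y \<otimes>\<^bsub>lie_beta_add D\<^esub> y' = yv (k \<star> k')" using yv_mult[OF BK[OF k(1)] BK[OF k'(1)]] k k' by simp
    then show "\<rho> (y \<otimes>\<^bsub>lie_beta_add D\<^esub> y') = \<rho> y * \<rho> y'"
      using \<rho> k k' f_mult by (metis B.m_closed)
  qed (simp add: \<rho>_def lie_beta_add_simps)
  moreover have "\<chi>0 k = psi_beta_rho D r l \<rho> k" if k: "k \<in> B" for k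
  proof -
    have "k \<in> Zs" using k B(2) by blast
    then show ?thesis using \<rho>[OF k] ps_nz[OF B.mem_carrier[OF k]] by (simp add: psi_beta_rho_eq f_def)
  qed
  ultimately show thesis using that by blast
qed

lemma rho_unique:
  assumes B: "B \<subseteq> Zs" and surj: "\<And>y. y \<in> lie_beta_res D \<Longrightarrow> \<exists>k\<in>B. yv k = y"
    and \<rho>: "\<rho> \<in> char_set (lie_beta_add D)" "\<rho>' \<in> char_set (lie_beta_add D)"
    and eq: "\<And>k. k \<in> B \<Longrightarrow> psi_beta_rho D r l \<rho> k = psi_beta_rho D r l \<rho>' k"
  shows "\<rho> = \<rho>'"
proof (rule char_set_eqI[OF \<rho>])
  fix y assume "y \<in> carrier (lie_beta_add D)"
  then obtain k where k: "k \<in> B" "yv k = y" using surj by (auto simp: lie_beta_add_simps)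
  have z: "k \<in> Zs" using k(1) B by blast
  have "ps k * \<rho> y = ps k * \<rho>' y" using eq[OF k(1)] k(2) z by (simp add: psi_beta_rho_eq)
  then show "\<rho> y = \<rho>' y" using ps_nz[OF Zs_carrier[OF z]] by simp
qed

lemma Zs_surj: "y \<in> lie_beta_res D \<Longrightarrow> \<exists>k\<in>Zs. yv k = y"
  using yv_surj A_Zs by blast

text \<open>For \<open>k\<close> in \<open>Kc l\<close> the element \<open>yv k\<close> is its own
  double in an additive group, so its value under \<rho> is a nonzero idempotent number, namely
  1.\<close>

lemma rho_Kl:
  assumes \<rho>: "\<rho> \<in> char_set (lie_beta_add D)" and k: "k \<in> Kc l"
  shows "psi_beta_rho D r l \<rho> k = ps k"
proof -
  have kZ: "k \<in> Zs" using k Kl_Zs by blast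
  interpret K: subgroup "Kc l" G by (rule K_subgroup[OF rl(2)])
  have kk: "k \<star> k \<in> Zs" "k \<star> k \<in> Kc l'" using k Kl_Zs Zs_K by blast+
  have "yv (k \<star> k) = yv k"
    using yv_eq_iff[OF kk(2) Zs_K[OF kZ]] k K.mem_carrier[OF k] by (simp add: G.m_assoc)
  then have "\<rho> (yv k) = \<rho> (yv k) * \<rho> (yv k)"
    using yv_mult[OF Zs_K[OF kZ] Zs_K[OF kZ]] char_setD(2)[OF \<rho>, of "yv k" "yv k"] kZ by (simp add: Zs_yv lie_beta_add_simps)
  moreover have "\<rho> (yv k) \<noteq> 0" using char_setD(1)[OF \<rho>, of "yv k"] kZ by (simp add: Zs_yv lie_beta_add_simps)
  ultimately show ?thesis using kZ by (simp add: psi_beta_rho_eq)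
qed

lemma rho_of:
  assumes \<theta>: "\<theta> \<in> \<Theta>"
  shows "rho_of D r l \<theta> \<in> char_set (lie_beta_add D)"
    "k \<in> Cent r \<inter> Kc l' \<Longrightarrow> \<chi> \<theta> k = psi_beta_rho D r l (rho_of D r l \<theta>) k"
    "\<rho> \<in> char_set (lie_beta_add D) \<Longrightarrow> (\<And>k. k \<in> Cent r \<inter> Kc l' \<Longrightarrow> \<chi> \<theta> k = psi_beta_rho D r l \<rho> k) \<Longrightarrow>
      rho_of D r l \<theta> = \<rho>"
proof -
  let ?B = "Cent r \<inter> Kc l'"
  let ?P = "\<lambda>\<rho>. \<rho> \<in> char_set (lie_beta_add D) \<and> (\<forall>k\<in>?B. \<chi> \<theta> k = psi_beta_rho D r l \<rho> k)"
  have B: "subgroup ?B G" using Cent_subgroup[of r] K_subgroup[OF rl(3)] by (intro G.subgroups_Inter_pair) auto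
  have ex: "\<exists>\<rho>. ?P \<rho>"
    using rho_exists[OF B A_Zs yv_surj, of "\<chi> \<theta>"] \<chi>_mult[OF \<theta>] \<chi>_Kl[OF \<theta>] by (metis IntD1)
  have un: "\<rho> = \<rho>'" if "?P \<rho>" "?P \<rho>'" for \<rho> \<rho>'
    using that by (intro rho_unique[OF A_Zs yv_surj]) auto
  have d: "rho_of D r l \<theta> = (THE \<rho>. ?P \<rho>)" unfolding rho_of_def G_beta_eq l_l'(2) ..
  obtain \<rho>0 where \<rho>0: "?P \<rho>0" using ex by blast
  have the: "rho_of D r l \<theta> = \<rho>" if "?P \<rho>" for \<rho>
    unfolding d by (rule the_equality[where P = ?P, OF that]) (rule un[OF _ that])
  show "rho_of D r l \<theta> \<in> char_set (lie_beta_add D)" using the[OF \<rho>0] \<rho>0 by blast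
  show "k \<in> ?B \<Longrightarrow> \<chi> \<theta> k = psi_beta_rho D r l (rho_of D r l \<theta>) k" using the[OF \<rho>0] \<rho>0 by blast
  show "\<rho> \<in> char_set (lie_beta_add D) \<Longrightarrow> (\<And>k. k \<in> ?B \<Longrightarrow> \<chi> \<theta> k = psi_beta_rho D r l \<rho> k) \<Longrightarrow> rho_of D r l \<theta> = \<rho>"
    using the by blast
qed

text \<open>The commutator of \<open>y\<close> and \<open>z\<close> lies in \<open>Kc l\<close>, so
  conjugation does not change \<open>yv z\<close>.\<close>

lemma rho_conj:
  assumes y: "y \<in> Kc l'" and z: "z \<in> Zs"
  shows "psi_beta_rho D r l \<rho> (y \<star> z \<star> iv y) = psi_beta_rho D r l \<rho> z"
proof -
  let ?z = "y \<star> z \<star> iv y"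
  have zZ: "?z \<in> Zs" by (rule Zs_norm[OF y z])
  have "?z \<star> iv z \<in> Kc l" using commutator_Zs[OF Zs_K[OF z] y] by blast
  then have "yv ?z = yv z" using yv_eq_iff[OF Zs_K[OF zZ] Zs_K[OF z]] by blast
  then show ?thesis using ps_conj_Z[OF y z] zZ z by (simp add: psi_beta_rho_eq)
qed

text \<open>Commutators of \<open>Zs\<close> have value 1 under \<open>ps\<close>, so
  \<open>eigenchar_extension\<close> provides a common eigenvector of \<open>Zs\<close>;
  \<open>rho_exists\<close> with \<open>B = Zs\<close> identifies its eigenvalues.\<close>

lemma rho_complete:
  assumes R: "rep_on G (carrier G) D' R" and cont: "contains_char (Kc l) D' R (psi_beta D r l l')"
  shows "\<exists>\<rho>\<in>char_set (lie_beta_add D). contains_char Zs D' R (psi_beta_rho D r l \<rho>)"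
proof -
  interpret Z: subgroup Zs G by (rule Zs_subgroup)
  have ps: "contains_char (Kc l) D' R ps" using cont psi_beta_eq unfolding contains_char_def by auto
  obtain lam where lam: "contains_char Zs D' R lam" "\<And>z w. z \<in> Zs \<Longrightarrow> w \<in> Zs \<Longrightarrow> lam (z \<star> w) = lam z * lam w"
    "\<And>n. n \<in> Kc l \<Longrightarrow> lam n = ps n"
  proof (rule G.eigenchar_extension[OF finite_GO K_subgroup[OF rl(2)] Zs_subgroup Kl_Zs _ _ R ps])
    fix z n assume z: "z \<in> Zs" and n: "n \<in> Kc l"
    have i: "iv z \<in> Zs" using z by simp
    have "iv (iv z) = z" using Zs_carrier[OF z] by simp
    then show "iv z \<star> n \<star> z \<in> Kc l \<and> ps (iv z \<star> n \<star> z) = ps n"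
      using K_normal'[OF rl(2) Zs_carrier[OF z] n] ps_conj_Z[OF Zs_K[OF i], of n] n Kl_Zs by auto
  next
    fix z w assume z: "z \<in> Zs" and w: "w \<in> Zs"
    let ?c = "z \<star> w \<star> iv z"
    have "ps (?c \<star> iv w) = ps ?c * ps (iv w)"
      using z w by (intro ps_mult_Z(1)[OF Zs_K]) auto
    also have "\<dots> = ps (w \<star> iv w)"
      unfolding ps_conj_Z[OF Zs_K[OF z] w] using w by (intro ps_mult_Z(1)[OF Zs_K, symmetric]) auto
    also have "\<dots> = 1" by (simp only: G.r_inv[OF Zs_carrier[OF w]] ps_one)
    finally have "ps (?c \<star> iv w) = 1" .
    moreover have "?c \<star> iv w \<in> Kc l" by (rule commutator_Zs[OF Zs_K[OF w] Zs_K[OF z]])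
    ultimately show "?c \<star> iv w \<in> Kc l \<and> ps (?c \<star> iv w) = 1" by (rule conjI[rotated])
  qed blast
  obtain \<rho> where \<rho>: "\<rho> \<in> char_set (lie_beta_add D)" "\<And>k. k \<in> Zs \<Longrightarrow> lam k = psi_beta_rho D r l \<rho> k"
    by (rule rho_exists[OF Zs_subgroup order_refl Zs_surj, of lam]) (use lam(2,3) in blast)+
  have "contains_char Zs D' R (psi_beta_rho D r l \<rho>)" using lam(1) \<rho>(2) unfolding contains_char_def by auto
  then show ?thesis using \<rho>(1) by blast
qed

text \<open>Elements of \<open>Cent r\<close> in \<open>Kc l'\<close> lie in \<open>Zs\<close>,
  where \<pi> is scalar; \<open>U\<close> is trivial on them and \<theta> agrees there with
  \<open>psi_beta_rho\<close>. Hence \<open>sigma_odd\<close> does not depend on the factorization,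
  and \<open>nondeg_Zs\<close> provides the nondegenerate pairing.\<close>

theorem odd_bij:
  assumes choice: "odd_choice D r l d \<pi> U"
  shows "bij_betw (\<lambda>\<theta>. induced_class G (Cent l') (d (rho_of D r l \<theta>)) (sigma_odd D r l \<pi> U \<theta>)) \<Theta>
    (Irr_over G (Kc l) (psi_beta D r l l'))"
proof -
  let ?P = "char_set (lie_beta_add D)"
  interpret cl: clifford G "Kc l" "Cent l'" "psi_beta D r l l'" by (rule clifford_level)
  interpret A: subgroup "Cent r" G by (rule Cent_subgroup) simp
  interpret N1: subgroup "Kc l'" G by (rule K_subgroup[OF rl(3)])
  note ch = choice[unfolded odd_choice_def G_beta_eq l_l'(2) Z_beta_eq irreducible_rep_iff[OF G.group_axioms N1.subgroup_axioms]
      hom_GL_iff[OF G.group_axioms A.subgroup_axioms], rule_format]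
  have \<pi>: "rep_on G (Kc l') (d \<rho>) (\<pi> \<rho>)" "irr_on (Kc l') (d \<rho>) (\<pi> \<rho>)"
    "contains_char Zs (d \<rho>) (\<pi> \<rho>) (psi_beta_rho D r l \<rho>)" "rep_on G (Cent r) (d \<rho>) (U \<rho>)" if "\<rho> \<in> ?P" for \<rho>
    using ch[OF that] by blast+
  have Z1: "Zs \<subseteq> Kc l'" using Zs_K by blast
  have \<pi>Z: "\<pi> \<rho> z = psi_beta_rho D r l \<rho> z \<cdot>\<^sub>m 1\<^sub>m (d \<rho>)" if \<rho>: "\<rho> \<in> ?P" and z: "z \<in> Zs" for \<rho> z
    by (rule G.irreducible_scalar[where \<psi> = "psi_beta_rho D r l \<rho>" and Z = Zs and z = z,
        OF N1.subgroup_axioms Zs_subgroup Z1 \<pi>(1-3)[OF \<rho>] Zs_norm rho_conj z])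
  interpret hc: heisenberg_clifford G "Kc l" "Cent l'" "psi_beta D r l l'" "Kc l'" Zs "Cent r" ?P d \<pi> U "psi_beta_rho D r l"
    \<Theta> \<chi> "rho_of D r l" "sigma_odd D r l \<pi> U"
  proof (intro heisenberg_clifford.intro heisenberg_clifford_axioms.intro cl.clifford_axioms)
    show "subgroup (Kc l') G" "subgroup Zs G" "subgroup (Cent r) G"
      by (rule N1.subgroup_axioms Zs_subgroup A.subgroup_axioms)+
    show "Kc l \<subseteq> Zs" "Zs \<subseteq> Kc l'" "Kc l' \<subseteq> Cent l'" "Cent r \<subseteq> Cent l'"
      by (rule Kl_Zs Z1 K_Cent[OF rl(3)] Cent_mono[OF rl(3)])+
    show "g \<star> h = h \<star> g" if "g \<in> Cent r" "h \<in> Cent r" for g h by (rule Cent_r_comm[OF that])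
    show "\<exists>g\<in>Cent r. \<exists>x\<in>Kc l'. h = g \<star> x" if "h \<in> Cent l'" for h by (rule Cent_prod[OF that])
    show "Cent r \<inter> Kc l' \<subseteq> Zs" by (rule A_Zs)
    show "iv g \<star> x \<star> g \<in> Kc l'" if "g \<in> Cent r" "x \<in> Kc l'" for g x
      by (rule K_normal'[OF rl(3) Cent_G[OF that(1)] that(2)])
    show "y \<star> z \<star> iv y \<in> Zs" if "y \<in> Kc l'" "z \<in> Zs" for y z by (rule Zs_norm[OF that])
    show "rep_on G (Kc l') (d \<rho>) (\<pi> \<rho>)" "irr_on (Kc l') (d \<rho>) (\<pi> \<rho>)"
      "contains_char Zs (d \<rho>) (\<pi> \<rho>) (psi_beta_rho D r l \<rho>)" "rep_on G (Cent r) (d \<rho>) (U \<rho>)" if "\<rho> \<in> ?P" for \<rho>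
      using \<pi>[OF that] by auto
    show "psi_beta_rho D r l \<rho> (y \<star> z \<star> iv y) = psi_beta_rho D r l \<rho> z"
      if "y \<in> Kc l'" "z \<in> Zs" for \<rho> y z by (rule rho_conj[OF that])
    show "psi_beta_rho D r l \<rho> n = psi_beta D r l l' n" if "\<rho> \<in> ?P" "n \<in> Kc l" for \<rho> n
      using rho_Kl[OF that] psi_beta_eq[OF that(2)] by simp
    show "\<pi> \<rho> (iv g \<star> x \<star> g) = U \<rho> (iv g) * \<pi> \<rho> x * U \<rho> g"
      if "\<rho> \<in> ?P" "g \<in> Cent r" "x \<in> Kc l'" for \<rho> g x using ch[OF that(1)] that(2,3) by blast
    show "U \<rho> g = 1\<^sub>m (d \<rho>)" if "\<rho> \<in> ?P" "g \<in> Cent r \<inter> Kc l'" for \<rho> g using ch[OF that(1)] that(2) by blast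
    show "\<exists>y\<in>Kc l'. y \<star> x \<star> iv y \<star> iv x \<in> Zs \<and>
        psi_beta_rho D r l \<rho> (y \<star> x \<star> iv y \<star> iv x) \<noteq> 1"
      if \<rho>: "\<rho> \<in> ?P" and x: "x \<in> Kc l'" "x \<notin> Zs" for \<rho> x
    proof -
      obtain y where y: "y \<in> Kc l'" "ps (y \<star> x \<star> iv y \<star> iv x) \<noteq> 1" using nondeg_Zs[OF x] by blast
      have "y \<star> x \<star> iv y \<star> iv x \<in> Kc l" using commutator_Zs[OF x(1) y(1)] by blast
      then show ?thesis using y rho_Kl[OF \<rho>] Kl_Zs by (intro bexI[of _ y]) auto
    qed
    show "\<rho> = \<rho>'" if "\<rho> \<in> ?P" "\<rho>' \<in> ?P" "\<And>z. z \<in> Zs \<Longrightarrow> psi_beta_rho D r l \<rho> z = psi_beta_rho D r l \<rho>' z" for \<rho> \<rho>'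
      by (rule rho_unique[OF order_refl Zs_surj that])
    show "\<exists>\<rho>\<in>?P. contains_char Zs D' R (psi_beta_rho D r l \<rho>)"
      if "rep_on G (carrier G) D' R" "contains_char (Kc l) D' R (psi_beta D r l l')" for D' R by (rule rho_complete[OF that])
    show "rho_of D r l t \<in> ?P" if "t \<in> \<Theta>" for t by (rule rho_of(1)[OF that])
    show "\<chi> t (g \<star> h) = \<chi> t g * \<chi> t h" if "t \<in> \<Theta>" "g \<in> Cent r" "h \<in> Cent r" for t g h by (rule \<chi>_mult[OF that])
    show "\<chi> t k = psi_beta_rho D r l (rho_of D r l t) k" if "t \<in> \<Theta>" "k \<in> Cent r \<inter> Kc l'" for t k by (rule rho_of(2)[OF that])
    show "\<exists>t\<in>\<Theta>. rho_of D r l t = \<rho> \<and> (\<forall>g\<in>Cent r. \<chi> t g = \<chi>0 g)"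
      if \<rho>: "\<rho> \<in> ?P" and mult: "\<And>g h. g \<in> Cent r \<Longrightarrow> h \<in> Cent r \<Longrightarrow> \<chi>0 (g \<star> h) = \<chi>0 g * \<chi>0 h"
        and \<chi>0: "\<And>k. k \<in> Cent r \<inter> Kc l' \<Longrightarrow> \<chi>0 k = psi_beta_rho D r l \<rho> k" for \<rho> \<chi>0
    proof -
      have "\<chi>0 k = ps k" if k: "k \<in> Cent r" "k \<in> Kc l" for k
        using \<chi>0[of k] rho_Kl[OF \<rho> k(2)] k Kl_Zs Z1 by auto
      then obtain \<theta> where \<theta>: "\<theta> \<in> \<Theta>" "\<forall>g\<in>Cent r. \<chi> \<theta> g = \<chi>0 g" using theta_exists[of \<chi>0] mult by blast
      have "rho_of D r l \<theta> = \<rho>" using rho_of(3)[OF \<theta>(1) \<rho>] \<chi>0 \<theta>(2) by simp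
      then show ?thesis using \<theta> by blast
    qed
    show "t = t'" if "t \<in> \<Theta>" "t' \<in> \<Theta>" "\<And>g. g \<in> Cent r \<Longrightarrow> \<chi> t g = \<chi> t' g" for t t' by (rule \<chi>_inj[OF that])
    show "sigma_odd D r l \<pi> U t (g \<star> x) = \<chi> t g \<cdot>\<^sub>m (U (rho_of D r l t) g * \<pi> (rho_of D r l t) x)"
      if t: "t \<in> \<Theta>" and gx: "g \<in> Cent r" "x \<in> Kc l'" for t g x
      unfolding sigma_odd_def G_beta_eq l_l'(2)
    proof (rule G.the_factorization[OF A.subgroup_axioms N1.subgroup_axioms _ gx])
      fix g k x assume g: "g \<in> Cent r" and k: "k \<in> Cent r \<inter> Kc l'" and x: "x \<in> Kc l'"
      let ?\<rho> = "rho_of D r l t"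
      note \<rho> = rho_of(1)[OF t]
      have kA: "k \<in> Cent r" and kN: "k \<in> Kc l'" and kZ: "k \<in> Zs" using k A_Zs by auto
      have Ug: "U ?\<rho> g \<in> carrier_mat (d ?\<rho>) (d ?\<rho>)" by (rule rep_on_closed[OF \<pi>(4)[OF \<rho>] g])
      have \<pi>x: "\<pi> ?\<rho> x \<in> carrier_mat (d ?\<rho>) (d ?\<rho>)" by (rule rep_on_closed[OF \<pi>(1)[OF \<rho>] x])
      have "U ?\<rho> k = 1\<^sub>m (d ?\<rho>)" using ch[OF \<rho>] k by blast
      then have "U ?\<rho> (g \<star> k) = U ?\<rho> g" using rep_on_mult[OF \<pi>(4)[OF \<rho>] g kA] Ug by simp
      moreover have "\<chi> t (g \<star> k) = \<chi> t g * \<chi> t k" by (rule \<chi>_mult[OF t g kA])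
      moreover have "\<pi> ?\<rho> (k \<star> x) = \<chi> t k \<cdot>\<^sub>m \<pi> ?\<rho> x"
        using rep_on_mult[OF \<pi>(1)[OF \<rho>] kN x] \<pi>Z[OF \<rho> kZ] rho_of(2)[OF t k] scalar_mat_mult[OF \<pi>x] by simp
      ultimately show "\<chi> t (g \<star> k) \<cdot>\<^sub>m (U ?\<rho> (g \<star> k) * \<pi> ?\<rho> x) = \<chi> t g \<cdot>\<^sub>m (U ?\<rho> g * \<pi> ?\<rho> (k \<star> x))"
        using mult_smult_distrib[OF Ug \<pi>x] by (simp add: smult_smult_times)
    qed
  qed
  show ?thesis using hc.heisenberg_clifford_bij .
qed

end

theorem proposition5p3p5:
  fixes D :: "('f::field, 'k::field) go_data"
    and m r l l' :: nat
    and d :: "(('f, 'k) res_map \<Rightarrow> complex) \<Rightarrow> nat"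
    and \<pi> U :: "(('f, 'k) res_map \<Rightarrow> complex) \<Rightarrow> ('f, 'k) res_map \<Rightarrow> complex mat"
  assumes "nonarch_local_field (vF D)"
    and "odd (residue_char (vF D))"
    and "\<not> residue_char (vF D) dvd 2 * m + 1"
    and "varpi D \<noteq> 0" and "vF D (varpi D) = 1"
    and "unitary_char (vF D) (tau D)"
    and "{x. \<forall>y \<in> carrier (O_F D). tau D (x * y) = 1} = carrier (O_F D)"
    and "m \<ge> 1"
    and "unramified_ext (vF D) (vK D) (emb D) (2 * m)"
    and "iot D \<in> galois_set (emb D)" and "iot D \<noteq> id" and "iot D \<circ> iot D = id"
    and "eps D \<in> Units (O_K D)" and "iot D (eps D) = eps D"
    and "eta D \<in> Units (O_F D)"
    and "beta0 D \<in> Units (O_K D)"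
    and "carrier (O_K D) =
      {poly (map_poly (emb D) p) (beta0 D) | p. \<forall>i. coeff p i \<in> carrier (O_F D)}"
    and "iot D (beta0 D) = - beta0 D"
    and "r \<ge> 2"
    and "r = 2 * l \<and> l' = l \<or> r = 2 * l - 1 \<and> l' = l - 1"
    and "r = 2 * l - 1 \<longrightarrow> odd_choice D r l d \<pi> U"
  shows "bij_betw (Ind_sigma D r l l' d \<pi> U) (theta_set D r l l')
    (Irr_over (GO D r) (congr_subgroup D r l) (psi_beta D r l l'))"
proof -
  interpret F: nonarch_local_field "vF D" by fact
  have hom: "emb D 1 = 1" "\<And>a b. emb D (a + b) = emb D a + emb D b" "\<And>a b. emb D (a * b) = emb D a * emb D b"
    and K: "discrete_valuation (vK D)" and val: "\<And>x. x \<noteq> 0 \<Longrightarrow> vK D (emb D x) = vF D x"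
    using assms(9) by (auto simp: unramified_ext_def field_ext_of_degree_def)
  have tau: "tau D (x + y) = tau D x * tau D y" for x y using assms(6) by (auto simp: unitary_char_def)
  have O: "carrier (O_F D) = val_ideal (vF D) 0" by (rule F.carrier_val_ring)
  have iot: "iot D (x + y) = iot D x + iot D y" "iot D (x * y) = iot D x * iot D y" "iot D (emb D c) = emb D c" for x y c
    using assms(10) by (auto simp: galois_set_def)
  interpret go_setting D
  proof (intro go_setting.intro unramified_gen.intro unramified_gen_axioms.intro go_setting_axioms.intro
      complete_uniformized.intro uniformized.intro uniformized_axioms.intro F.discrete_valuation_axioms
      F.nonarch_local_field_axioms K hom val tau iot)
    show "tau D x = 1" if "x \<in> val_ideal (vF D) 0" for x
    proof -
      have "1 \<in> carrier (O_F D)" by (simp add: O)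
      moreover have "\<forall>y\<in>carrier (O_F D). tau D (x * y) = 1" using assms(7) that unfolding O by blast
      ultimately show ?thesis by (metis mult.right_neutral)
    qed
    show "x \<in> val_ideal (vF D) 0" if "\<And>y. y \<in> val_ideal (vF D) 0 \<Longrightarrow> tau D (x * y) = 1" for x
      using assms(7) that unfolding O by blast
    show "iot D (iot D x) = x" for x using assms(12) by (metis comp_apply id_apply)
  qed (use assms in blast)+
  show ?thesis
  proof (cases "r = 2 * l \<and> l' = l")
    case True
    interpret go_level D r l l' by unfold_locales (use True assms(19) in auto)
    have "Ind_sigma D r l l' d \<pi> U = (\<lambda>\<theta>. induced_class G (Cent l) 1 (sigma_even D r l l \<theta>))"
      using stabilizer_eq True by (intro ext) (simp add: Ind_sigma_def)
    then show ?thesis using even_bij True by simp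
  next
    case False
    \<comment> \<open>With truncated subtraction \<open>2 * l - 1 = 2 * l\<close> would mean
      \<open>l = 0\<close>, which \<open>r \<ge> 2\<close> excludes; so \<open>Ind_sigma\<close>
      takes its odd branch.\<close>
    then have o: "r = 2 * l - 1" "l' = l - 1" "r \<noteq> 2 * l" using assms(19,20) by auto
    interpret go_odd D r l l' by unfold_locales (use o assms(19) in auto)
    have "Ind_sigma D r l l' d \<pi> U =
        (\<lambda>\<theta>. induced_class G (Cent l') (d (rho_of D r l \<theta>)) (sigma_odd D r l \<pi> U \<theta>))"
      using stabilizer_eq o(3) by (auto simp: Ind_sigma_def)
    then show ?thesis using odd_bij assms(21) o(1) by simp
  qed
qed

end
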